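(* Let $f\in \mathbb{K}[x,y]$ be a primitive and squarefree polynomial, let $d_y=\deg_y f$, and let $F\in\mathbb{K}[x][Y_0,Y_1]$ be the homogeneous form of degree $d_y$ in $Y=(Y_0:Y_1)$ associated to $f$. Then $f$ has constant discriminant $\Delta_y(f)$ if and only if $F\equiv H$ for some homogeneous form $H\in \mathbb{K}[Y]$. Otherwise, we have the inequality \[ \deg_x \Delta_y(f)\ge \Big\lceil \frac{d_y-1}{2} \Big\rceil \] and the equality holds if and only if one of the following conditions holds: \begin{enumerate} \item $d_y=4$ and $F\equiv Y_0Y_1(Y_0^2+(\mu x+\lambda)Y_0Y_1+ Y_1^2)$, for some $\mu,\lambda\in \mathbb{K}$ with $\mu\ne 0$. \item $d_y=4$ and $F\equiv Y_1(H(Y)+xY_1^3)$, for some cubic form $H\in \mathbb{K}[Y]$. \item $d_y$ is odd and $F\equiv Y_1 H(Y_0^2+xY_1^2,Y_1^2)$ for some form $H\in \mathbb{K}[Y]$. \item $d_y$ is even and $F\equiv H(Y_0^2+xY_1^2,Y_1^2)$ for some form $H\in \mathbb{K}[Y]$. \end{enumerate}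
   Context: $\mathbb{K}$ is an algebraically closed field of characteristic zero. $\Delta_y(f)\in\mathbb{K}[x]$ is the discriminant of $f$ with respect to $y$ (the discriminant of a polynomial of degree at most $1$ in $y$ is $1$). A polynomial is primitive if it has no nonconstant factor in $\mathbb{K}[x]$. The homogeneous form associated to $f$ is $F(Y_0,Y_1)=Y_1^{d_y}f(x,Y_0/Y_1)$. $\mathbb{K}[Y]=\mathbb{K}[Y_0,Y_1]$, and a form is a homogeneous polynomial. The group $G=GL_2(\mathbb{K}[x])$ acts on homogeneous forms in $Y=(Y_0:Y_1)$ with coefficients in $\mathbb{K}[x]$ by \[ \begin{pmatrix} a & b \\ c & d \end{pmatrix}(F)=F(aY_0+b Y_1,cY_0+dY_1), \] and $F\equiv H$ means that $F=\sigma(H)$ for some $\sigma\in G$. *)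

theory Defs
  imports
    "Subresultants.Resultant_Prelim"
    "HOL-Computational_Algebra.Squarefree"
begin

text \<open>
  \<^verbatim>\<open>K[x,y]\<close> is \<^typ>\<open>'a poly poly\<close>: the outer variable is \<open>y\<close>, the coefficient ring
  \<^typ>\<open>'a poly\<close> is \<^verbatim>\<open>K[x]\<close>.  Hence \<^const>\<open>degree\<close> of such an \<open>f\<close> is its degree in \<open>y\<close>.
\<close>

definition primitive_in_y :: "'a::field poly poly \<Rightarrow> bool" where
  "primitive_in_y f \<longleftrightarrow> (\<forall>c. [:c:] dvd f \<longrightarrow> degree c = 0)"

text \<open>
  The leading coefficient divides the resultant exactly in characteristic zero.  The case
  \<open>degree f = 1\<close> of the general formula also gives 1.
\<close>

definition discriminant :: "'r::idom_divide poly \<Rightarrow> 'r" where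
  "discriminant f =
     (if degree f \<le> 1 then 1
      else (- 1) ^ (degree f * (degree f - 1) div 2) *
           (resultant f (pderiv f) div lead_coeff f))"

text \<open>
  The ring \<^verbatim>\<open>R[Y0,Y1]\<close> is also represented by iterated univariate polynomials, with outer
  variable \<open>Y0\<close> and inner variable \<open>Y1\<close>: the coefficient of \<^verbatim>\<open>Y0^i Y1^j\<close> in \<open>F\<close> is
  \<open>coeff (coeff F i) j\<close>.  The synonym keeps it apart from \<^verbatim>\<open>K[x,y]\<close>.
\<close>

type_synonym 'r binary_poly = "'r poly poly"

definition Y0 :: "'r::comm_ring_1 binary_poly" where
  "Y0 = [:0, 1:]"

definition Y1 :: "'r::comm_ring_1 binary_poly" where
  "Y1 = [:[:0, 1:]:]"

definition Const :: "'r::comm_ring_1 \<Rightarrow> 'r binary_poly" where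
  "Const c = [:[:c:]:]"

definition homogeneous :: "nat \<Rightarrow> 'r::comm_ring_1 binary_poly \<Rightarrow> bool" where
  "homogeneous n F \<longleftrightarrow> (\<forall>i j. coeff (coeff F i) j \<noteq> 0 \<longrightarrow> i + j = n)"

definition is_form :: "'r::comm_ring_1 binary_poly \<Rightarrow> bool" where
  "is_form F \<longleftrightarrow> (\<exists>n. homogeneous n F)"

text \<open>The substitution \<^verbatim>\<open>F(P,Q)\<close>.\<close>

definition subst2 ::
  "'r::comm_ring_1 binary_poly \<Rightarrow> 'r binary_poly \<Rightarrow> 'r binary_poly \<Rightarrow> 'r binary_poly" where
  "subst2 F P Q =
     (\<Sum>i\<le>degree F. \<Sum>j\<le>degree (coeff F i). Const (coeff (coeff F i) j) * P ^ i * Q ^ j)"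

text \<open>The inclusion of \<^verbatim>\<open>K[Y0,Y1]\<close> in \<^verbatim>\<open>K[x][Y0,Y1]\<close>.\<close>

definition lift_form :: "'a::field binary_poly \<Rightarrow> 'a poly binary_poly" where
  "lift_form H = map_poly (map_poly (\<lambda>c. [:c:])) H"

text \<open>\<^verbatim>\<open>Y1^d f(Y0/Y1)\<close> with \<open>d = degree f\<close>.\<close>

definition homogenize :: "'r::comm_ring_1 poly \<Rightarrow> 'r binary_poly" where
  "homogenize f = (\<Sum>i\<le>degree f. Const (coeff f i) * Y0 ^ i * Y1 ^ (degree f - i))"

definition GL2 :: "'r::comm_ring_1 mat set" where
  "GL2 = {A \<in> carrier_mat 2 2. invertible_mat A}"

definition GL2_act :: "'r::comm_ring_1 mat \<Rightarrow> 'r binary_poly \<Rightarrow> 'r binary_poly" where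
  "GL2_act A F =
     subst2 F (Const (A $$ (0,0)) * Y0 + Const (A $$ (0,1)) * Y1)
              (Const (A $$ (1,0)) * Y0 + Const (A $$ (1,1)) * Y1)"

definition GL2_equiv :: "'r::comm_ring_1 binary_poly \<Rightarrow> 'r binary_poly \<Rightarrow> bool" where
  "GL2_equiv F H \<longleftrightarrow> (\<exists>A\<in>GL2. F = GL2_act A H)"

end

theory Submission
  imports
    Defs
    "HOL-Computational_Algebra.Formal_Laurent_Series"
    "HOL-Computational_Algebra.Polynomial_Factorial"
    "Subresultants.Subresultant"
begin

text \<open>
  The proof works at the place \<open>x = \<infinity>\<close>.  Substituting \<open>x = t\<^sup>-\<^sup>N\<close> for a suitable \<open>N\<close> splits \<open>f\<close> into linear
  factors in \<open>y\<close> over the Laurent series in \<open>t\<close> (\<open>emb_splits_exists\<close>), and squarefreeness makes the roots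
  distinct.  Resultants become products over the roots, so that the degree of the discriminant is additive:
  if \<open>f\<close> is the product of primitive irreducible \<open>g\<^sub>i\<close>, then the degree of the discriminant of \<open>f\<close> is the sum of
  the \<open>discdeg g\<^sub>i\<close> and of the degrees of all resultants of ordered pairs of factors (\<open>discdeg_prod\<close>).

  The heart of the argument is the inequality \<open>discdeg g \<ge> m - 1\<close> for irreducible \<open>g\<close> of degree \<open>m \<ge> 2\<close>
  (\<open>irreducible_discdeg_ge\<close>).  It takes the place of the Riemann-Hurwitz formula and is proved by a lattice
  argument.  Let \<open>y\<^sub>1, \<dots>, y\<^sub>m\<close> be the roots of \<open>g\<close>.  The tuples \<open>z = (z\<^sub>1, \<dots>, z\<^sub>m)\<close> of Laurent series for
  which multiplication by \<open>z\<close> preserves the module of all \<open>(P(y\<^sub>1), \<dots>, P(y\<^sub>m))\<close>, \<open>P\<close> a polynomial of degree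
  less than \<open>m\<close>, form a ring.  It has a family of \<open>m\<close> members whose determinant squared is essentially the
  discriminant.  Traces of members are polynomials in \<open>x\<close>, hence Laurent series in \<open>t\<^sup>-\<^sup>N\<close> without terms of
  positive degree.  Reduce the family so that the sum of the pole orders \<open>v\<^sub>k\<close> is minimal; then the vectors of
  leading coefficients are independent, and \<open>N\<close> times \<open>discdeg g\<close> is twice the sum of the \<open>v\<^sub>k\<close>.  The Gram
  matrix of the leading vectors is invertible, so some permutation \<open>p\<close> pairs \<open>k\<close> with \<open>p k\<close> such that the trace
  of the product has a nonzero leading coefficient, which forces \<open>N\<close> to divide \<open>v\<^sub>k + v\<^sub>p\<^sub>k\<close>.  A member without
  poles is constant because \<open>g\<close> is irreducible, so at most one \<open>v\<^sub>k\<close> vanishes, and the bound follows.  Linear forms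
  with constant resultants among each other and with \<open>g\<close> have quotients in the same ring; their poles lie on
  different branches, and this gives the sharper bound of \<open>irreducible_discdeg_ge_omitted\<close>.

  Summing these bounds over the factors gives the inequality of the theorem and leaves few configurations in
  which twice the degree of the discriminant is positive and at most \<open>deg\<^sub>y f\<close> (\<open>classification\<close>): quadratics with linear
  discriminant and constant resultants, possibly with one linear factor; such a system with one additional cubic; or two linear factors
  and one quadratic.  Each is brought to a normal form by a change of basis of the module of linear forms
  \<open>a y + b\<close> (\<open>extremal_normal_form\<close>).  A quadratic with linear discriminant is reduced to \<open>p\<^sup>2 + x q\<^sup>2\<close> by division with remainder, as for
  integral quadratic forms; parity of degrees then shows that every other factor is a constant combination of
  \<open>p\<^sup>2 + x q\<^sup>2\<close> and \<open>q\<^sup>2\<close>, or a multiple of \<open>q\<close>.  A cubic is depressed to \<open>p\<^sup>3 + u p q\<^sup>2 + v q\<^sup>3\<close>, and a small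
  discriminant \<open>4 u\<^sup>3 + 27 v\<^sup>2\<close> forces \<open>u\<close> to be constant by an argument of Davenport (\<open>davenport_cubic\<close>).

  Conversely, discriminants and resultants are invariant under a change of basis up to constants, so the discriminants
  of the normal forms can be read off from short factorisations.  Finally \<open>GL2_equiv_homogenize_iff\<close>
  translates equivalence of binary forms into the evaluation of a form at a basis of linear forms.
\<close>

section \<open>Polynomials as Laurent series at infinity\<close>

text \<open>
  The substitution \<open>x = t\<^sup>-\<^sup>N\<close>: a Laurent series in \<open>t\<close> describes behaviour at \<open>x = \<infinity>\<close>, and \<open>N\<close> is the
  ramification index needed for fractional exponents.  Pole orders in \<open>t\<close> are \<open>N\<close> times degrees in \<open>x\<close>.
\<close>
definition emb :: "nat \<Rightarrow> 'a::field poly \<Rightarrow> 'a fls" where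
  "emb N p = poly (map_poly fls_const p) (fls_X_inv ^ N)"

lemma fls_const_hom: "comm_ring_hom (fls_const :: 'a::field \<Rightarrow> 'a fls)"
  by standard (auto simp: fls_const_nonzero fls_plus_const fls_const_mult_const)

lemma emb_altdef: "emb N p = (\<Sum>i\<le>degree p. fls_const (coeff p i) * fls_X_inv ^ (N * i))"
  unfolding emb_def poly_altdef
  by (simp add: coeff_map_poly power_mult degree_map_poly fls_const_nonzero)

lemma fls_X_inv_power_nth: "fls_nth (fls_X_inv ^ n :: 'a::field fls) k = (if k = - int n then 1 else 0)"
  by (simp add: fls_X_inv_power_conv_shift_1)

lemma fls_sum_nth: "fls_nth (sum f A) k = (\<Sum>i\<in>A. fls_nth (f i) k)"
  for f :: "'b \<Rightarrow> 'a::comm_monoid_add fls"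
  by (induction A rule: infinite_finite_induct) auto

text \<open>
  The image consists of Laurent polynomials in \<open>t\<^sup>-\<^sup>N\<close>; both the sign and the divisibility of the exponents
  are used later to constrain traces.
\<close>
lemma emb_nth:
  assumes "N > 0"
  shows "fls_nth (emb N p) k = (if k \<le> 0 \<and> int N dvd k then coeff p (nat (- k div int N)) else 0)"
proof -
  have "fls_nth (emb N p) k = (\<Sum>i\<le>degree p. coeff p i * (if k = - int (N * i) then 1 else 0))"
    by (simp add: emb_altdef fls_X_inv_power_nth fls_sum_nth del: of_nat_mult)
  also have "\<dots> = (if k \<le> 0 \<and> int N dvd k then coeff p (nat (- k div int N)) else 0)"
  proof (cases "k \<le> 0 \<and> int N dvd k")
    case True
    define j where "j = nat (- k div int N)"
    obtain i where i: "k = int N * i" using True by blast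
    have "i \<le> 0" using True assms by (simp add: i mult_le_0_iff)
    hence k: "k = - int (N * j)"
      using assms by (simp add: j_def i flip: mult_minus_right)
    have "(\<Sum>i\<le>degree p. coeff p i * (if k = - int (N * i) then 1 else 0))
        = (\<Sum>i\<le>degree p. if i = j then coeff p j else 0)"
      using assms by (intro sum.cong) (auto simp: k)
    also have "\<dots> = coeff p j" by (auto simp: coeff_eq_0)
    finally show ?thesis using True by (simp add: j_def)
  next
    case False
    hence "k \<noteq> - int (N * i)" for i by auto
    thus ?thesis unfolding if_not_P[OF False] by (intro sum.neutral) (simp del: of_nat_mult)
  qed
  finally show ?thesis .
qed

lemma emb_0 [simp]: "emb N 0 = 0" by (simp add: emb_def)

lemma emb_const [simp]: "emb N [:c:] = fls_const c" by (cases "c = 0") (simp_all add: emb_altdef)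

lemma emb_hom: "comm_ring_hom (emb N :: 'a::field poly \<Rightarrow> 'a fls)"
proof -
  interpret c: comm_ring_hom "fls_const :: 'a \<Rightarrow> 'a fls" by (rule fls_const_hom)
  interpret m: map_poly_comm_ring_hom "fls_const :: 'a \<Rightarrow> 'a fls" ..
  show ?thesis
    by standard (simp_all add: emb_def m.hom_add m.hom_mult)
qed

lemma emb_subdegree:
  assumes "N > 0" "p \<noteq> 0"
  shows "fls_subdegree (emb N p) = - int (N * degree p)"
proof (rule fls_subdegree_eqI)
  show "fls_nth (emb N p) (- int (N * degree p)) \<noteq> 0"
    using assms by (simp add: emb_nth)
next
  fix k assume k: "k < - int (N * degree p)"
  show "fls_nth (emb N p) k = 0"
  proof (cases "k \<le> 0 \<and> int N dvd k")
    case True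
    then obtain j where j: "k = int N * j" by auto
    have "j < - int (degree p)" using k assms j
      by (metis mult_less_cancel_left_pos mult_minus_right of_nat_0_less_iff of_nat_mult)
    hence "coeff p (nat (- j)) = 0" by (intro coeff_eq_0) simp
    thus ?thesis using assms by (simp add: emb_nth j flip: mult_minus_right)
  qed (use assms in \<open>auto simp: emb_nth\<close>)
qed

lemma emb_eq_0_iff: "N > 0 \<Longrightarrow> emb N p = 0 \<longleftrightarrow> p = 0"
proof
  assume "N > 0" "emb N p = 0"
  show "p = 0"
  proof (rule poly_eqI)
    fix n
    have "fls_nth (emb N p) (- int (N * n)) = coeff p n"
      using \<open>N > 0\<close> by (simp add: emb_nth)
    thus "coeff p n = coeff 0 n" using \<open>emb N p = 0\<close> by simp
  qed
qed auto

lemma emb_inj_hom: "N > 0 \<Longrightarrow> inj_comm_ring_hom (emb N :: 'a::field poly \<Rightarrow> 'a fls)"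
proof -
  assume N: "N > 0"
  interpret comm_ring_hom "emb N :: 'a poly \<Rightarrow> 'a fls" by (rule emb_hom)
  show ?thesis
    by standard (use N in \<open>auto simp: emb_eq_0_iff\<close>)
qed

lemma emb_compose_power:
  assumes "n > 0"
  shows "fls_compose_power (emb N p) n = emb (N * n) p"
proof -
  have s: "fls_compose_power (sum f A) n = (\<Sum>i\<in>A. fls_compose_power (f i) n)" for f :: "nat \<Rightarrow> 'a fls" and A
    by (induction A rule: infinite_finite_induct) auto
  have x: "fls_compose_power (fls_X_inv :: 'a fls) n = fls_X_inv ^ n"
    using assms by (simp add: fls_X_inv_power_conv_shift_1)
  show ?thesis using assms
    by (simp add: emb_altdef s x mult_ac flip: power_mult)
qed

lemma fls_nth_mult_leading: "fls_subdegree f \<ge> a \<Longrightarrow> fls_subdegree g \<ge> b \<Longrightarrow>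
  fls_nth (f * g) (a + b) = fls_nth f a * fls_nth g b" for f g :: "'a::field fls" and a b :: int
proof -
  assume a: "fls_subdegree f \<ge> a" "fls_subdegree g \<ge> b"
  show ?thesis
  proof (cases "fls_subdegree f = a \<and> fls_subdegree g = b")
    case True thus ?thesis by auto
  next
    case False
    hence "fls_subdegree f + fls_subdegree g > a + b" using a by auto
    hence "fls_nth (f * g) (a + b) = 0" by (intro fls_times_nth_eq0)
    moreover have "fls_nth f a = 0 \<or> fls_nth g b = 0" using False a by auto
    ultimately show ?thesis by auto
  qed
qed

section \<open>Hensel lifting over Laurent series\<close>

lemma poly_bezout:
  fixes r s :: "'a::field poly"
  assumes "coprime r s"
  shows "\<exists>a b. a * r + b * s = 1"
proof -
  define I where "I = {a * r + b * s | a b. True}"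
  have "r \<noteq> 0 \<or> s \<noteq> 0" using assms by auto
  moreover have "r \<in> I" "s \<in> I"
    unfolding I_def by (auto intro: exI[of _ 1] exI[of _ 0])
  ultimately have "\<exists>d. d \<in> I \<and> d \<noteq> 0" by blast
  then obtain d where d: "d \<in> I" "d \<noteq> 0" and min: "\<And>e. e \<in> I \<Longrightarrow> e \<noteq> 0 \<Longrightarrow> degree d \<le> degree e"
    using ex_has_least_nat[of "\<lambda>d. d \<in> I \<and> d \<noteq> 0" _ degree] by blast
  have dvd: "d dvd e" if "e \<in> I" for e
  proof -
    from d that obtain a b a' b' where "d = a * r + b * s" "e = a' * r + b' * s"
      unfolding I_def by blast
    hence "e - (e div d) * d = (a' - (e div d) * a) * r + (b' - (e div d) * b) * s"
      by (simp add: algebra_simps)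
    hence "e mod d \<in> I" unfolding I_def by (auto simp: minus_div_mult_eq_mod)
    hence "e mod d = 0" using min degree_mod_less'[OF d(2), of e] by fastforce
    thus ?thesis by auto
  qed
  have "is_unit d" using dvd[OF \<open>r \<in> I\<close>] dvd[OF \<open>s \<in> I\<close>] assms by (simp add: coprime_def)
  then obtain e where "1 = d * e" unfolding dvd_def by blast
  moreover from d obtain a b where "d = a * r + b * s" unfolding I_def by blast
  ultimately have "(e * a) * r + (e * b) * s = 1" by (metis (no_types) mult.assoc mult.commute distrib_left)
  thus ?thesis by blast
qed

text \<open>
  The Bezout identity is multiplied by \<open>e\<close> and reduced modulo \<open>g\<close>; the bound on the degree of \<open>e\<close> then
  bounds the other cofactor.
\<close>
lemma coprime_split:
  fixes g h e :: "'a::field poly"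
  assumes "coprime g h" "degree g > 0" "degree h > 0" "degree e < degree g + degree h"
  shows "\<exists>u v. degree u < degree g \<and> degree v < degree h \<and> g * v + h * u = e"
proof -
  obtain a b where ab: "a * g + b * h = 1" using poly_bezout[OF assms(1)] by blast
  have g0: "g \<noteq> 0" and h0: "h \<noteq> 0" using assms by auto
  define u where "u = (b * e) mod g"
  define v where "v = a * e + h * ((b * e) div g)"
  have eq: "g * v + h * u = e"
  proof -
    have "g * v + h * u = a * g * e + h * ((b * e) div g * g + (b * e) mod g)"
      by (simp only: u_def v_def algebra_simps)
    also have "\<dots> = a * g * e + h * (b * e)" by (simp only: div_mult_mod_eq)
    also have "\<dots> = (a * g + b * h) * e" by (simp only: algebra_simps)
    finally show ?thesis by (simp add: ab)
  qed
  have du: "degree u < degree g"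
    using degree_mod_less'[OF g0, of "b * e"] assms(2) by (cases "u = 0") (auto simp: u_def)
  have "degree v < degree h"
  proof (rule ccontr)
    assume n: "\<not> degree v < degree h"
    hence "v \<noteq> 0" using assms(3) by auto
    hence "degree (g * v) = degree g + degree v" using g0 by (simp add: degree_mult_eq)
    moreover have "degree (h * u) < degree g + degree h"
      using degree_mult_le[of h u] du by linarith
    ultimately have "degree (g * v + h * u) = degree g + degree v"
      using n by (subst degree_add_eq_left) auto
    thus False using eq assms(4) n by simp
  qed
  thus ?thesis using du eq by blast
qed

text \<open>
  Factorisation of a power series \<open>\<Sum> f\<^sub>n t\<^sup>n\<close> with polynomial coefficients.  Each step solves the linear
  equation \<open>g\<^sub>0 h\<^sub>n + h\<^sub>0 g\<^sub>n = \<dots>\<close> whose right-hand side involves earlier coefficients only.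
\<close>
lemma hensel_sequence:
  fixes f :: "nat \<Rightarrow> 'a::field poly"
  assumes f0: "f 0 = g0 * h0" and cop: "coprime g0 h0"
    and deg: "degree g0 > 0" "degree h0 > 0"
    and fn: "\<And>n. n > 0 \<Longrightarrow> degree (f n) < degree g0 + degree h0"
  shows "\<exists>g h. g 0 = g0 \<and> h 0 = h0 \<and> (\<forall>n>0. degree (g n) < degree g0 \<and> degree (h n) < degree h0)
           \<and> (\<forall>n. f n = (\<Sum>i\<le>n. g i * h (n - i)))"
proof -
  \<comment> \<open>\<open>s\<close> holds the pairs \<open>(g\<^sub>i, h\<^sub>i)\<close> found so far and \<open>r\<close> is the next pair\<close>
  define Q where "Q s n r \<longleftrightarrow> (if n = 0 then r = (g0, h0) else
      degree (fst r) < degree g0 \<and> degree (snd r) < degree h0 \<and>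
      g0 * snd r + h0 * fst r = f n - (\<Sum>i\<in>{0<..<n}. fst (s i) * snd (s (n - i))))"
    for s :: "nat \<Rightarrow> 'a poly \<times> 'a poly" and n r
  have "\<exists>s. \<forall>n. Q s n (s n)"
  proof (rule dependent_wellorder_choice)
    fix r :: "'a poly \<times> 'a poly" and s s' :: "nat \<Rightarrow> 'a poly \<times> 'a poly" and n
    assume "\<And>k. k < n \<Longrightarrow> s k = s' k"
    thus "Q s n r = Q s' n r" unfolding Q_def by (auto intro!: sum.cong)
  next
    fix n :: nat and s
    assume IH: "\<And>k. k < n \<Longrightarrow> Q s k (s k)"
    show "\<exists>r. Q s n r"
    proof (cases "n = 0")
      case False
      have "degree (f n - (\<Sum>i\<in>{0<..<n}. fst (s i) * snd (s (n - i)))) < degree g0 + degree h0"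
      proof (rule degree_diff_less)
        show "degree (\<Sum>i\<in>{0<..<n}. fst (s i) * snd (s (n - i))) < degree g0 + degree h0"
        proof (rule degree_sum_less)
          fix i assume i: "i \<in> {0<..<n}"
          have "degree (fst (s i)) < degree g0" "degree (snd (s (n - i))) < degree h0"
            using IH[of i] IH[of "n - i"] i by (auto simp: Q_def)
          thus "degree (fst (s i) * snd (s (n - i))) < degree g0 + degree h0"
            using degree_mult_le[of "fst (s i)" "snd (s (n - i))"] by linarith
        qed (use deg in auto)
      qed (use fn False in auto)
      from coprime_split[OF cop deg this] show ?thesis
        using False by (auto simp: Q_def)
    qed (auto simp: Q_def)
  qed
  then obtain s where s: "\<And>n. Q s n (s n)" by blast
  define g where "g n = fst (s n)" for n
  define h where "h n = snd (s n)" for n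
  have g0: "g 0 = g0" "h 0 = h0" using s[of 0] by (auto simp: Q_def g_def h_def)
  have "f n = (\<Sum>i\<le>n. g i * h (n - i))" for n
  proof (cases "n = 0")
    case True thus ?thesis by (simp add: g0 f0)
  next
    case False
    have "{..n} = insert 0 (insert n {0<..<n})" using False by auto
    hence "(\<Sum>i\<le>n. g i * h (n - i)) = g0 * h n + (g n * h0 + (\<Sum>i\<in>{0<..<n}. g i * h (n - i)))"
      using False by (simp add: g0)
    also have "\<dots> = f n" using s[of n] False by (simp add: Q_def g_def h_def algebra_simps)
    finally show ?thesis by simp
  qed
  moreover have "\<forall>n>0. degree (g n) < degree g0 \<and> degree (h n) < degree h0"
    using s by (auto simp: Q_def g_def h_def)
  ultimately show ?thesis using g0 by blast
qed

text \<open>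
  Exchanges the two variables: from a power series in \<open>t\<close> with coefficients in \<open>K[y]\<close> of degree at most
  \<open>d\<close> to a polynomial in \<open>y\<close> over the Laurent series.
\<close>
definition series_poly :: "nat \<Rightarrow> (nat \<Rightarrow> 'a::field poly) \<Rightarrow> 'a fls poly" where
  "series_poly d g = (\<Sum>i\<le>d. monom (fps_to_fls (Abs_fps (\<lambda>n. coeff (g n) i))) i)"

lemma coeff_series_poly:
  assumes "\<And>n. degree (g n) \<le> d"
  shows "coeff (series_poly d g) i = fps_to_fls (Abs_fps (\<lambda>n. coeff (g n) i))"
proof (cases "i \<le> d")
  case True thus ?thesis by (simp add: series_poly_def coeff_sum)
next
  case False
  hence "coeff (g n) i = 0" for n using assms[of n] by (intro coeff_eq_0) simp
  hence "Abs_fps (\<lambda>n. coeff (g n) i) = 0" by (simp add: fps_eq_iff)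
  thus ?thesis using False by (auto simp: series_poly_def coeff_sum)
qed

lemma fps_to_fls_sum: "fps_to_fls (sum f A) = (\<Sum>i\<in>A. fps_to_fls (f i))"
  for f :: "'b \<Rightarrow> 'a::field fps"
  by (induction A rule: infinite_finite_induct) auto

text \<open>
  Hensel's lemma for monic polynomials over the power series ring: a coprime factorisation modulo \<open>t\<close> lifts.
\<close>
lemma hensel_fls:
  fixes P :: "'a::field fls poly"
  assumes monic: "lead_coeff P = 1" and int: "\<And>i. fls_subdegree (coeff P i) \<ge> 0"
    and fac: "map_poly (\<lambda>s. fls_nth s 0) P = g0 * h0" and cop: "coprime g0 h0"
    and deg: "degree g0 > 0" "degree h0 > 0" and lc: "lead_coeff g0 = 1" "lead_coeff h0 = 1"
  shows "\<exists>G H. P = G * H \<and> lead_coeff G = 1 \<and> lead_coeff H = 1 \<and>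
           degree G = degree g0 \<and> degree H = degree h0"
proof -
  define f where "f n = map_poly (\<lambda>s. fls_nth s (int n)) P" for n
  have cf: "coeff (f n) i = fls_nth (coeff P i) (int n)" for n i
    by (simp add: f_def coeff_map_poly)
  have f0: "f 0 = g0 * h0" using fac by (simp add: f_def)
  have dP: "degree P = degree g0 + degree h0"
  proof -
    have "degree (f 0) = degree P" unfolding f_def using monic by (intro degree_map_poly) auto
    thus ?thesis using f0 deg by (subst (asm) f0, subst (asm) degree_mult_eq) auto
  qed
  have "degree (f n) < degree g0 + degree h0" if "n > 0" for n
  proof -
    have "degree (f n) \<le> degree P" by (simp add: f_def degree_map_poly_le)
    moreover have "coeff (f n) (degree P) = 0" using that by (simp add: cf monic)
    ultimately show ?thesis using dP deg
      by (metis add_gr_0 degree_0 le_neq_implies_less leading_coeff_0_iff)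
  qed
  from hensel_sequence[where f = f, OF f0 cop deg this]
  obtain g h where gh0: "g 0 = g0" "h 0 = h0"
    and dgh: "\<And>n. n > 0 \<Longrightarrow> degree (g n) < degree g0 \<and> degree (h n) < degree h0"
    and conv: "\<And>n. f n = (\<Sum>i\<le>n. g i * h (n - i))" by metis
  define G where "G = series_poly (degree g0) g"
  define H where "H = series_poly (degree h0) h"
  have dg: "degree (g n) \<le> degree g0" and dh: "degree (h n) \<le> degree h0" for n
    using dgh[of n] gh0 by (cases "n = 0"; force)+
  note cG = coeff_series_poly[of g, OF dg, folded G_def] and cH = coeff_series_poly[of h, OF dh, folded H_def]
  have "P = G * H"
  proof (rule poly_eqI)
    fix k
    have "coeff P k = fps_to_fls (Abs_fps (\<lambda>n. coeff (f n) k))"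
    proof (rule fls_eqI)
      fix n show "fls_nth (coeff P k) n = fls_nth (fps_to_fls (Abs_fps (\<lambda>n. coeff (f n) k))) n"
        using int[of k] by (cases "n \<ge> 0") (auto simp: cf)
    qed
    also have "Abs_fps (\<lambda>n. coeff (f n) k) = (\<Sum>i\<le>k. Abs_fps (\<lambda>n. coeff (g n) i) * Abs_fps (\<lambda>n. coeff (h n) (k - i)))"
    proof (rule fps_ext)
      fix n
      have "coeff (f n) k = (\<Sum>j\<le>n. \<Sum>i\<le>k. coeff (g j) i * coeff (h (n - j)) (k - i))"
        by (simp add: conv coeff_sum coeff_mult)
      also have "\<dots> = (\<Sum>i\<le>k. \<Sum>j\<le>n. coeff (g j) i * coeff (h (n - j)) (k - i))"
        by (rule sum.swap)
      finally show "fps_nth (Abs_fps (\<lambda>n. coeff (f n) k)) n = fps_nth (\<Sum>i\<le>k. Abs_fps (\<lambda>n. coeff (g n) i) * Abs_fps (\<lambda>n. coeff (h n) (k - i))) n"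
        by (simp add: fps_sum_nth fps_mult_nth atLeast0AtMost)
    qed
    also have "fps_to_fls \<dots> = (\<Sum>i\<le>k. coeff G i * coeff H (k - i))"
      by (simp add: fps_to_fls_sum fls_times_fps_to_fls cG cH)
    finally show "coeff P k = coeff (G * H) k" by (simp add: coeff_mult)
  qed
  moreover have "degree G = degree g0 \<and> lead_coeff G = 1"
  proof -
    have "Abs_fps (\<lambda>n. coeff (g n) (degree g0)) = 1"
    proof (rule fps_ext)
      fix n show "fps_nth (Abs_fps (\<lambda>n. coeff (g n) (degree g0))) n = fps_nth 1 n"
        using dgh[of n] lc gh0 by (cases "n = 0") (auto simp: coeff_eq_0)
    qed
    hence "coeff G (degree g0) = 1" by (simp add: cG)
    moreover have "degree G \<le> degree g0"
      unfolding G_def series_poly_def by (intro degree_sum_le) (auto intro: order.trans[OF degree_monom_le])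
    ultimately show ?thesis by (metis le_antisym le_degree zero_neq_one)
  qed
  moreover have "degree H = degree h0 \<and> lead_coeff H = 1"
  proof -
    have "Abs_fps (\<lambda>n. coeff (h n) (degree h0)) = 1"
    proof (rule fps_ext)
      fix n show "fps_nth (Abs_fps (\<lambda>n. coeff (h n) (degree h0))) n = fps_nth 1 n"
        using dgh[of n] lc gh0 by (cases "n = 0") (auto simp: coeff_eq_0)
    qed
    hence "coeff H (degree h0) = 1" by (simp add: cH)
    moreover have "degree H \<le> degree h0"
      unfolding H_def series_poly_def by (intro degree_sum_le) (auto intro: order.trans[OF degree_monom_le])
    ultimately show ?thesis by (metis le_antisym le_degree zero_neq_one)
  qed
  ultimately show ?thesis by blast
qed

section \<open>Puiseux expansions at infinity\<close>

definition splits :: "'a::field poly \<Rightarrow> bool" where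
  "splits P \<longleftrightarrow> (\<exists>c rs. P = smult c (\<Prod>r\<leftarrow>rs. [:- r, 1:]))"

lemma splits_mult: "splits P \<Longrightarrow> splits Q \<Longrightarrow> splits (P * Q)"
proof -
  assume "splits P" "splits Q"
  then obtain c rs d ss where "P = smult c (\<Prod>r\<leftarrow>rs. [:- r, 1:])" "Q = smult d (\<Prod>r\<leftarrow>ss. [:- r, 1:])"
    unfolding splits_def by blast
  hence "P * Q = smult (c * d) (\<Prod>r\<leftarrow>rs @ ss. [:- r, 1:])" by (simp add: mult.commute)
  thus ?thesis unfolding splits_def by blast
qed

lemma splits_smult: "splits P \<Longrightarrow> splits (smult c P)"
  unfolding splits_def by (metis smult_smult)

lemma splits_linear: "degree P \<le> 1 \<Longrightarrow> splits P"
proof -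
  assume "degree P \<le> 1"
  then obtain a b where P: "P = [:b, a:]" using degree1_coeffs by (metis One_nat_def le_0_eq le_SucE degree_eq_zeroE pCons_0_0)
  show ?thesis
  proof (cases "a = 0")
    case True
    hence "P = smult b (\<Prod>r\<leftarrow>[]. [:- r, 1:])" by (simp add: P)
    thus ?thesis unfolding splits_def by blast
  next
    case False
    hence "P = smult a (\<Prod>r\<leftarrow>[- b / a]. [:- r, 1:])" by (simp add: P)
    thus ?thesis unfolding splits_def by blast
  qed
qed

lemma splits_pcompose:
  fixes a b :: "'a::field"
  assumes "splits P"
  shows "splits (pcompose P [:b, a:])"
proof -
  obtain c rs where P: "P = smult c (\<Prod>r\<leftarrow>rs. [:- r, 1:])" using assms unfolding splits_def by blast
  have "splits (pcompose (\<Prod>r\<leftarrow>rs. [:- r, 1:]) [:b, a:])"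
  proof (induction rs)
    case Nil show ?case by (simp add: splits_linear)
  next
    case (Cons r rs)
    have "splits (pcompose [:- r, 1:] [:b, a:])" by (rule splits_linear) (simp add: pcompose_pCons)
    thus ?case using Cons by (simp add: pcompose_mult splits_mult del: pcompose_pCons mult_pCons_left)
  qed
  thus ?thesis by (simp add: P pcompose_smult splits_smult)
qed

lemma splits_pcompose_iff:
  fixes a b :: "'a::field"
  assumes "a \<noteq> 0"
  shows "splits (pcompose P [:b, a:]) \<longleftrightarrow> splits P"
proof
  assume "splits (pcompose P [:b, a:])"
  hence "splits (pcompose (pcompose P [:b, a:]) [:- b / a, 1 / a:])" by (rule splits_pcompose)
  moreover have "pcompose [:b, a:] [:- b / a, 1 / a:] = [:0, 1:]" using assms by (simp add: pcompose_pCons)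
  ultimately show "splits P" by (metis pcompose_assoc pcompose_idR)
qed (rule splits_pcompose)

lemma fls_compose_power_eq_0_iff: "n > 0 \<Longrightarrow> fls_compose_power s n = 0 \<longleftrightarrow> s = 0" for s :: "'a::field fls"
proof
  assume n: "n > 0" "fls_compose_power s n = 0"
  show "s = 0"
  proof (rule fls_eqI)
    fix k
    have "fls_nth (fls_compose_power s n) (int n * k) = fls_nth s k" using n(1) by (simp add: fls_nth_compose_power)
    thus "fls_nth s k = fls_nth 0 k" using n(2) by simp
  qed
qed simp

lemma fls_compose_power_hom: "n > 0 \<Longrightarrow> inj_comm_ring_hom (\<lambda>s :: 'a::field fls. fls_compose_power s n)"
  by standard (auto simp: fls_compose_power_eq_0_iff)

lemma splits_map_poly_hom:
  assumes "inj_comm_ring_hom h" "splits P"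
  shows "splits (map_poly h P)"
proof -
  interpret inj_comm_ring_hom h by fact
  interpret m: map_poly_inj_comm_ring_hom h ..
  obtain c rs where P: "P = smult c (\<Prod>r\<leftarrow>rs. [:- r, 1:])" using assms unfolding splits_def by blast
  have "map_poly h (\<Prod>r\<leftarrow>rs. [:- r, 1:]) = (\<Prod>r\<leftarrow>map h rs. [:- r, 1:])"
    by (induction rs) (simp_all add: m.hom_mult hom_uminus del: mult_pCons_left)
  hence "map_poly h P = smult (h c) (\<Prod>r\<leftarrow>map h rs. [:- r, 1:])" by (simp add: P map_poly_smult hom_mult)
  thus ?thesis unfolding splits_def by blast
qed

text \<open>
  The ramification \<open>t \<mapsto> t\<^sup>n\<close> on coefficients.
\<close>
abbreviation ram :: "nat \<Rightarrow> 'a::field fls poly \<Rightarrow> 'a fls poly" where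
  "ram n \<equiv> map_poly (\<lambda>s. fls_compose_power s n)"

lemma ram_ram: "m > 0 \<Longrightarrow> n > 0 \<Longrightarrow> ram m (ram n P) = ram (n * m) P"
proof -
  assume "m > 0" "n > 0"
  hence "fls_compose_power (fls_compose_power s n) m = fls_compose_power s (n * m)" for s :: "'a fls"
    by (intro fls_eqI) (auto simp: fls_nth_compose_power  div_mult2_eq zdiv_zmult2_eq elim!: dvdE)
  thus ?thesis by (simp add: map_poly_map_poly o_def)
qed

lemma ram_splits_mono: "n > 0 \<Longrightarrow> splits P \<Longrightarrow> splits (ram n P)"
  by (rule splits_map_poly_hom[OF fls_compose_power_hom])

lemma ram_smult: "n > 0 \<Longrightarrow> ram n (smult c P) = smult (fls_compose_power c n) (ram n P)"
  for P :: "'a::field fls poly"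
  by (intro poly_eqI) (simp add: coeff_map_poly)

lemma ram_pcompose_linear:
  fixes P :: "'a::field fls poly"
  assumes "n > 0"
  shows "ram n (pcompose P [:a, b:]) = pcompose (ram n P) [:fls_compose_power a n, fls_compose_power b n:]"
proof -
  interpret inj_comm_ring_hom "\<lambda>s :: 'a fls. fls_compose_power s n"
    by (rule fls_compose_power_hom[OF assms])
  show ?thesis by (subst map_poly_pcompose) (simp_all add: map_poly_pCons_hom)
qed

lemma fls_shift_one_mult: "fls_shift a 1 * f = fls_shift a (f :: 'a::field fls)"
  using fls_shifted_times_simps(2)[of a 1 f] by simp

lemma fls_shift_one_power: "fls_shift a (1 :: 'a::field fls) ^ i = fls_shift (a * int i) 1"
  by (induction i) (simp_all add: fls_shift_one_mult distrib_left add.commute)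

lemma fls_subdegree_compose_power:
  assumes "n > 0" "s \<noteq> 0"
  shows "fls_subdegree (fls_compose_power s n) = int n * fls_subdegree s"
proof (rule fls_subdegree_eqI)
  show "fls_nth (fls_compose_power s n) (int n * fls_subdegree s) \<noteq> 0"
    using assms by (simp add: fls_nth_compose_power)
next
  fix k assume "k < int n * fls_subdegree s"
  thus "fls_nth (fls_compose_power s n) k = 0" using assms
    by (auto simp: fls_nth_compose_power elim!: dvdE)
qed

text \<open>
  The two top coefficients under a translation; a suitable \<open>b\<close> removes the second one.
\<close>
lemma coeff_pcompose_shift:
  fixes p :: "'b::comm_ring_1 poly"
  assumes "degree p \<le> Suc n"
  shows "coeff (pcompose p [:b, 1:]) (Suc n) = coeff p (Suc n) \<and>
         coeff (pcompose p [:b, 1:]) n = coeff p n + of_nat (Suc n) * b * coeff p (Suc n)"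
  using assms
proof (induction p arbitrary: n)
  case 0 thus ?case by simp
next
  case (pCons a p)
  have dp: "degree p \<le> n" using pCons.prems by (cases "p = 0") auto
  have c: "coeff (pcompose p [:b, 1:]) (Suc n) = 0"
    using degree_pcompose_le[of p "[:b, 1:]"] dp by (intro coeff_eq_0) (simp split: if_splits)
  show ?case
  proof (cases n)
    case 0
    then obtain c where "p = [:c:]" using dp by (auto elim: degree_eq_zeroE)
    thus ?thesis by (simp add: pcompose_pCons 0 algebra_simps)
  next
    case (Suc k)
    show ?thesis using pCons.IH[of k] dp c by (simp add: pcompose_pCons Suc algebra_simps)
  qed
qed

text \<open>
  A polynomial with a single root \<open>x\<close> is \<open>c (Y - x)\<^sup>m\<close>; in characteristic zero its second coefficient
  vanishes only for \<open>x = 0\<close>, and then all lower coefficients do.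
\<close>
lemma two_distinct_roots:
  fixes p :: "'a::{alg_closed_field, field_char_0} poly"
  assumes m: "degree p = m" "m \<ge> 2" "coeff p (m - 1) = 0" and i: "i < m" "coeff p i \<noteq> 0"
  shows "\<exists>x y. poly p x = 0 \<and> poly p y = 0 \<and> x \<noteq> y"
proof -
  have p0: "p \<noteq> 0" using i by auto
  obtain x where x: "poly p x = 0" using alg_closed_imp_poly_has_root[of p] m by auto
  obtain h where h: "p = [:- x, 1:] ^ order x p * h" using order_1[of x p] by (auto elim: dvdE)
  have h0: "h \<noteq> 0" using p0 h by auto
  have hx: "poly h x \<noteq> 0"
  proof
    assume "poly h x = 0"
    hence "[:- x, 1:] dvd h" by (simp add: poly_eq_0_iff_dvd)
    then obtain k where k: "h = [:- x, 1:] * k" by (elim dvdE)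
    have "[:- x, 1:] ^ order x p * h = [:- x, 1:] ^ Suc (order x p) * k"
      by (simp only: k power_Suc2 mult.assoc)
    from h[THEN trans, OF this] have "p = [:- x, 1:] ^ Suc (order x p) * k" .
    hence "[:- x, 1:] ^ Suc (order x p) dvd p" by (rule dvdI)
    thus False using order_2[OF p0] by blast
  qed
  show ?thesis
  proof (cases "degree h = 0")
    case False
    then obtain y where "poly h y = 0" using alg_closed_imp_poly_has_root[of h] by auto
    moreover have "poly p y = poly ([:- x, 1:] ^ order x p * h) y" by (rule arg_cong[OF h])
    ultimately have "poly p y = 0" "y \<noteq> x" using hx by auto
    thus ?thesis using x by blast
  next
    case True
    then obtain c where c: "h = [:c:]" by (auto elim: degree_eq_zeroE)
    have pm: "p = smult c (pcompose (monom 1 m) [:- x, 1:])"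
    proof -
      have "degree p = degree ([:- x, 1:] ^ order x p * h)" using h by simp
      also have "\<dots> = order x p" using h0 by (subst degree_mult_eq) (simp_all add: degree_power_eq True)
      finally have "degree p = order x p" .
      hence "order x p = m" using m by simp
      moreover have "pcompose (monom 1 m) [:- x, 1:] = [:- x, 1:] ^ m"
      proof (induction m)
        case (Suc m)
        have "monom 1 (Suc m) = [:0, 1:] * monom (1::'a) m" by (simp add: monom_Suc)
        thus ?case using Suc by (simp only: pcompose_mult) (simp add: pcompose_pCons)
      qed (simp add: pcompose_1)
      ultimately have "p = pcompose (monom 1 m) [:- x, 1:] * [:c:]" using h c by metis
      also have "\<dots> = smult c (pcompose (monom 1 m) [:- x, 1:])" by (simp only: mult_pCons_right mult_zero_right pCons_0_0 add_0_right)
      finally show ?thesis .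
    qed
    have "c \<noteq> 0" using h0 c by simp
    have "coeff p (m - 1) = c * (of_nat m * (- x))"
    proof -
      have "m \<noteq> m - Suc 0" using m(2) by linarith
      thus ?thesis
        using coeff_pcompose_shift[of "monom 1 m" "m - 1" "- x"] m(2) by (simp add: pm degree_monom_eq)
    qed
    hence x0: "x = 0" using m \<open>c \<noteq> 0\<close> by simp
    have "p = smult c (monom 1 m)" unfolding pm x0 minus_zero pcompose_idR ..
    hence "coeff p i = 0" using i(1) by simp
    thus ?thesis using i(2) by simp
  qed
qed

lemma two_roots_imp_coprime_factors:
  fixes p :: "'a::{alg_closed_field, field_char_0} poly"
  assumes "lead_coeff p = 1" "poly p x = 0" "poly p y = 0" "x \<noteq> y"
  obtains g h where "p = g * h" "coprime g h" "degree g > 0" "degree h > 0" "lead_coeff g = 1" "lead_coeff h = 1"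
proof -
  have "degree p > 1"
  proof (rule ccontr)
    assume "\<not> degree p > 1"
    have p0: "p \<noteq> 0" using assms(1) by auto
    have "{x, y} \<subseteq> {z. poly p z = 0}" using assms by auto
    hence "card {x, y} \<le> card {z. poly p z = 0}" by (intro card_mono poly_roots_finite p0)
    also have "\<dots> \<le> degree p" by (intro card_poly_roots_bound p0)
    finally show False using assms(4) \<open>\<not> degree p > 1\<close> by simp
  qed
  from alg_closed_imp_poly_splits_coprime[OF this assms(2-4)] obtain r s
    where rs: "degree r > 0" "degree s > 0" "coprime r s" "p = r * s" .
  define c where "c = lead_coeff r"
  have c0: "c \<noteq> 0" using rs(1) by (auto simp: c_def)
  have l: "c * lead_coeff s = 1" using assms(1) rs(4) by (simp add: c_def lead_coeff_mult)
  show thesis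
  proof (rule that[of "smult (1 / c) r" "smult c s"])
    show "coprime (smult (1 / c) r) (smult c s)"
      using rs(3) c0 by (simp add: coprime_def smult_dvd_iff dvd_smult_iff)
  qed (use rs c0 l in \<open>auto simp: c_def\<close>)
qed

text \<open>
  The theorem of Newton and Puiseux, by induction on the degree.  After a translation the second
  coefficient vanishes; dividing out the smallest slope of the Newton polygon makes the reduction modulo \<open>t\<close> a
  polynomial with two distinct roots, so that Hensel's lemma applies.
\<close>
lemma ram_splits_exists:
  fixes P :: "'a::{alg_closed_field, field_char_0} fls poly"
  assumes "lead_coeff P = 1"
  shows "\<exists>n>0. splits (ram n P)"
  using assms
proof (induction "degree P" arbitrary: P rule: less_induct)
  case less
  show ?case
  proof (cases "degree P \<le> 1")
    case True
    thus ?thesis by (intro exI[of _ 1]) (auto intro!: splits_linear simp: degree_map_poly_le[THEN order.trans])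
  next
    case False
    define m where "m = degree P"
    have m2: "m \<ge> 2" using False by (simp add: m_def)
    define b where "b = - coeff P (m - 1) / of_nat m"
    define P1 where "P1 = pcompose P [:b, 1:]"
    have dP1: "degree P1 = m" by (simp add: P1_def m_def)
    have lcP1: "coeff P1 m = 1"
      using lead_coeff_comp[of "[:b, 1:]" P] less.prems dP1 by (simp add: P1_def)
    have P1m: "coeff P1 (m - 1) = 0"
      using coeff_pcompose_shift[of P "m - 1" b] m2 less.prems by (simp add: P1_def b_def m_def)
    have red: "splits (ram n P1) \<longleftrightarrow> splits (ram n P)" if "n > 0" for n
      unfolding P1_def ram_pcompose_linear[OF that] fls_compose_power_1_left[OF that]
      by (rule splits_pcompose_iff) simp
    show ?thesis
    proof (cases "\<exists>i<m. coeff P1 i \<noteq> 0")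
      case False
      hence "P1 = monom 1 m" using lcP1 dP1
        by (intro poly_eqI) (metis coeff_eq_0 coeff_monom linorder_neqE_nat)
      moreover have "monom 1 m = smult 1 (\<Prod>r\<leftarrow>replicate m (0 :: 'a fls). [:- r, 1:])"
        by (simp add: monom_altdef)
      ultimately have "P1 = smult 1 (\<Prod>r\<leftarrow>replicate m (0 :: 'a fls). [:- r, 1:])" by (rule trans)
      hence "splits P1" unfolding splits_def by (intro exI)
      hence "splits (ram 1 P1)" by (rule ram_splits_mono[rotated]) simp
      hence "splits (ram 1 P)" by (simp only: red[of 1, OF less_numeral_extra(1)])
      thus ?thesis by (intro exI[of _ "1::nat"] conjI less_numeral_extra(1))
    next
      case True
      \<comment> \<open>the minimal slope \<open>p / q\<close> of the Newton polygon is attained at \<open>i0\<close>\<close>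
      define S where "S = {i. i < m \<and> coeff P1 i \<noteq> 0}"
      define sl where "sl i = (of_int (fls_subdegree (coeff P1 i)) / of_nat (m - i) :: rat)" for i
      have "finite S" "S \<noteq> {}" using True by (auto simp: S_def)
      then obtain i0 where i0: "i0 \<in> S" "\<And>i. i \<in> S \<Longrightarrow> sl i0 \<le> sl i"
        using ex_min_if_finite[of "sl ` S"] by (auto simp: not_less)
      define p where "p = fls_subdegree (coeff P1 i0)"
      define q where "q = m - i0"
      have q0: "q > 0" using i0 by (auto simp: S_def q_def)
      have ineq: "p * int (m - i) \<le> int q * fls_subdegree (coeff P1 i)" if "i \<in> S" for i
      proof -
        have "of_int (p * int (m - i)) \<le> (of_int (int q * fls_subdegree (coeff P1 i)) :: rat)"
          using i0(2)[OF that] that q0 by (simp add: sl_def S_def p_def q_def field_simps)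
        thus ?thesis by linarith
      qed
      \<comment> \<open>substituting \<open>t = s\<^sup>q\<close> and \<open>Y = s\<^sup>p Y\<close> and dividing by \<open>s\<^sup>p\<^sup>m\<close> makes all coefficients integral\<close>
      define P2 where "P2 = smult (fls_shift (p * int m) 1) (pcompose (ram q P1) [:0, fls_shift (- p) 1:])"
      have cP2: "coeff P2 i = fls_shift (p * int m - p * int i) (fls_compose_power (coeff P1 i) q)" for i
        by (simp add: P2_def coeff_pcompose_linear coeff_map_poly fls_shift_one_power fls_shift_one_mult)
      have sd: "fls_subdegree (coeff P2 i) = int q * fls_subdegree (coeff P1 i) - p * int (m - i)"
        if "i \<le> m" "coeff P1 i \<noteq> 0" for i
      proof -
        have "fls_compose_power (coeff P1 i) q \<noteq> 0"
          using that(2) q0 by (simp add: fls_compose_power_eq_0_iff)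
        thus ?thesis using that q0
          by (simp add: cP2 fls_subdegree_compose_power of_nat_diff algebra_simps)
      qed
      have lcP2: "coeff P2 m = 1" using q0 by (simp add: cP2 lcP1)
      have cP2_0: "coeff P2 i = 0 \<longleftrightarrow> coeff P1 i = 0" for i
        using q0 by (simp add: cP2 fls_compose_power_eq_0_iff fls_shift_eq0_iff)
      have dP2: "degree P2 = m"
      proof (rule antisym)
        show "degree P2 \<le> m" by (rule degree_le) (auto simp: cP2_0 coeff_eq_0 dP1)
        show "m \<le> degree P2" by (rule le_degree) (simp add: lcP2)
      qed
      have int: "fls_subdegree (coeff P2 i) \<ge> 0" for i
      proof (cases "i < m \<and> coeff P1 i \<noteq> 0")
        case True
        thus ?thesis using ineq[of i] sd[of i] by (simp add: S_def)
      next
        case False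
        hence "coeff P2 i = 0 \<or> i = m" using cP2_0[of i] dP1
          by (metis coeff_eq_0 linorder_neqE_nat)
        thus ?thesis using lcP2 by auto
      qed
      define p0 where "p0 = map_poly (\<lambda>s. fls_nth s 0) P2"
      have cp0: "coeff p0 i = fls_nth (coeff P2 i) 0" for i by (simp add: p0_def coeff_map_poly)
      have dp0: "degree p0 = m"
      proof (rule antisym)
        show "degree p0 \<le> m" using degree_map_poly_le[of "\<lambda>s. fls_nth s 0" P2] dP2 by (simp add: p0_def)
        show "m \<le> degree p0" by (rule le_degree) (simp add: cp0 lcP2)
      qed
      have "coeff p0 i0 \<noteq> 0"
      proof -
        have "coeff P1 i0 \<noteq> 0" "i0 < m" using i0 by (auto simp: S_def)
        hence "fls_subdegree (coeff P2 i0) = 0" by (subst sd) (simp_all add: p_def q_def)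
        thus ?thesis using \<open>coeff P1 i0 \<noteq> 0\<close> cP2_0[of i0]
          by (metis cp0 nth_fls_subdegree_zero_iff)
      qed
      moreover have "coeff p0 (m - 1) = 0" using P1m cP2_0[of "m - 1"] by (simp add: cp0)
      moreover have "i0 < m" using i0 by (auto simp: S_def)
      ultimately obtain x y where "poly p0 x = 0" "poly p0 y = 0" "x \<noteq> y"
        using two_distinct_roots[OF dp0 m2] by blast
      moreover have "lead_coeff p0 = 1" by (simp add: dp0 cp0 lcP2)
      ultimately obtain g h where gh: "p0 = g * h" "coprime g h" "degree g > 0" "degree h > 0"
          "lead_coeff g = 1" "lead_coeff h = 1"
        using two_roots_imp_coprime_factors by metis
      from hensel_fls[of P2 g h] dP2 lcP2 int gh obtain G H where
        GH: "P2 = G * H" "lead_coeff G = 1" "lead_coeff H = 1" "degree G = degree g" "degree H = degree h"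
        unfolding p0_def by auto
      have "m = degree g + degree h"
        using gh dp0 by (metis degree_mult_eq degree_0 less_numeral_extra(3))
      hence lt: "degree G < degree P" "degree H < degree P" using GH gh by (auto simp: m_def)
      obtain n1 where n1: "n1 > 0" "splits (ram n1 G)" using less.hyps[OF lt(1) GH(2)] by blast
      have "lead_coeff (ram n1 H) = 1" "degree (ram n1 H) = degree H"
      proof -
        show "degree (ram n1 H) = degree H" using n1(1) GH(3) by (intro degree_map_poly) auto
        thus "lead_coeff (ram n1 H) = 1" using n1(1) GH(3) by (simp add: coeff_map_poly)
      qed
      then obtain n2 where n2: "n2 > 0" "splits (ram n2 (ram n1 H))"
        using less.hyps[of "ram n1 H"] lt(2) by auto
      have "splits (ram n2 (ram n1 (G * H)))"
      proof -
        interpret a: inj_comm_ring_hom "\<lambda>s :: 'a fls. fls_compose_power s n1"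
          by (rule fls_compose_power_hom[OF n1(1)])
        interpret am: map_poly_inj_comm_ring_hom "\<lambda>s :: 'a fls. fls_compose_power s n1" ..
        interpret b: inj_comm_ring_hom "\<lambda>s :: 'a fls. fls_compose_power s n2"
          by (rule fls_compose_power_hom[OF n2(1)])
        interpret bm: map_poly_inj_comm_ring_hom "\<lambda>s :: 'a fls. fls_compose_power s n2" ..
        show ?thesis using n2(2) ram_splits_mono[OF n2(1) n1(2)]
          by (simp add: am.hom_mult bm.hom_mult splits_mult)
      qed
      define n where "n = n1 * n2"
      have n0: "n > 0" using n1 n2 by (simp add: n_def)
      have "splits (ram n P2)"
        using \<open>splits (ram n2 (ram n1 (G * H)))\<close> n1 n2 by (simp add: ram_ram n_def GH)
      moreover have "ram n P2 = smult (fls_shift (int n * (p * int m)) 1) (pcompose (ram n (ram q P1)) [:0, fls_shift (int n * (- p)) 1:])"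
        unfolding P2_def using n0 by (simp add: ram_smult ram_pcompose_linear)
      ultimately have "splits (smult (fls_shift (- int n * (p * int m)) 1) (smult (fls_shift (int n * (p * int m)) 1)
           (pcompose (ram n (ram q P1)) [:0, fls_shift (int n * (- p)) 1:])))"
        by (metis splits_smult)
      hence "splits (pcompose (ram n (ram q P1)) [:0, fls_shift (int n * (- p)) 1:])"
        by (simp add: fls_shift_one_mult)
      hence "splits (ram (q * n) P1)"
        using n0 q0 by (subst (asm) splits_pcompose_iff) (simp_all add: ram_ram)
      thus ?thesis using red[of "q * n"] n0 q0 by (intro exI[of _ "q * n"]) auto
    qed
  qed
qed

text \<open>
  The monic case applies after division by the leading coefficient; ramification turns \<open>emb 1\<close> into \<open>emb n\<close>.
\<close>
theorem emb_splits_exists: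
  fixes f :: "'a::{alg_closed_field, field_char_0} poly poly"
  assumes "f \<noteq> 0"
  shows "\<exists>N>0. splits (map_poly (emb N) f)"
proof -
  interpret e: inj_comm_ring_hom "emb (Suc 0) :: 'a poly \<Rightarrow> 'a fls" by (rule emb_inj_hom) simp
  define c where "c = emb 1 (lead_coeff f)"
  have c0: "c \<noteq> 0" using assms by (simp add: c_def)
  define P where "P = smult (1 / c) (map_poly (emb 1) f)"
  have "lead_coeff P = 1" using c0 by (simp add: P_def c_def coeff_map_poly)
  then obtain n where n: "n > 0" "splits (ram n P)" using ram_splits_exists by blast
  have eq: "map_poly (emb 1) f = smult c P" using c0 by (simp add: P_def)
  have "ram n (map_poly (emb 1) f) = map_poly (emb n) f"
    using n(1) by (simp add: map_poly_map_poly o_def emb_compose_power)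
  moreover have "ram n (map_poly (emb 1) f) = smult (fls_compose_power c n) (ram n P)"
    unfolding eq by (rule ram_smult[OF n(1)])
  ultimately have "splits (map_poly (emb n) f)" using splits_smult[OF n(2)] by simp
  thus ?thesis using n(1) by blast
qed

section \<open>Vandermonde determinants and resultants by roots\<close>

text \<open>
  The powers decrease with the row index, which matches the order of the columns of the Sylvester matrix.
\<close>
definition vander :: "nat \<Rightarrow> (nat \<Rightarrow> 'a::comm_ring_1) \<Rightarrow> 'a mat" where
  "vander m r = mat m m (\<lambda>(i, j). r j ^ (m - 1 - i))"

lemma det_zero_imp_left_kernel:
  fixes A :: "'a::field mat"
  assumes "A \<in> carrier_mat n n" "det A = 0"
  shows "\<exists>c. (\<exists>i<n. c i \<noteq> 0) \<and> (\<forall>j<n. (\<Sum>i<n. c i * A $$ (i, j)) = 0)"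
proof -
  have "det (transpose_mat A) = 0" using assms det_transpose by metis
  then obtain v where v: "v \<in> carrier_vec n" "v \<noteq> 0\<^sub>v n" "transpose_mat A *\<^sub>v v = 0\<^sub>v n"
    using det_0_iff_vec_prod_zero_field[of "transpose_mat A" n] assms by auto
  have "(\<Sum>i<n. vec_index v i * A $$ (i, j)) = 0" if "j < n" for j
  proof -
    have "vec_index (transpose_mat A *\<^sub>v v) j = (\<Sum>i<n. vec_index v i * A $$ (i, j))"
      using assms v(1) that by (auto simp: scalar_prod_def mult.commute lessThan_atLeast0 intro!: sum.cong)
    thus ?thesis using v(3) that by simp
  qed
  moreover have "\<exists>i<n. vec_index v i \<noteq> 0"
  proof (rule ccontr)
    assume "\<not> ?thesis"
    hence "v = 0\<^sub>v n" using v(1) by (intro eq_vecI) auto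
    thus False using v(2) by simp
  qed
  ultimately show ?thesis by blast
qed

lemma prod_list_map_upt: "prod_list (map f [0..<m]) = (\<Prod>i<m. f i)" for f :: "nat \<Rightarrow> 'a::comm_monoid_mult"
  by (induction m) (simp_all add: mult.commute)

lemma poly_sum_lessThan: "degree p < n \<Longrightarrow> poly p x = (\<Sum>i<n. coeff p i * x ^ i)"
  for p :: "'a::comm_semiring_1 poly"
  unfolding poly_altdef by (rule sum.mono_neutral_left) (auto simp: coeff_eq_0)

lemma det_vander_nonzero:
  fixes r :: "nat \<Rightarrow> 'a::field"
  assumes "inj_on r {..<m}"
  shows "det (vander m r) \<noteq> 0"
proof
  assume "det (vander m r) = 0"
  then obtain c where c: "\<exists>i<m. c i \<noteq> 0"
    and k: "\<And>j. j < m \<Longrightarrow> (\<Sum>i<m. c i * vander m r $$ (i, j)) = 0"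
    using det_zero_imp_left_kernel[of "vander m r" m] by (auto simp: vander_def)
  define p where "p = (\<Sum>i<m. monom (c i) (m - 1 - i))"
  have "poly p (r j) = 0" if "j < m" for j
    using k[OF that] that by (simp add: p_def poly_sum poly_monom vander_def)
  hence sub: "r ` {..<m} \<subseteq> {x. poly p x = 0}" by auto
  have "p = 0"
  proof (rule ccontr)
    assume p0: "p \<noteq> 0"
    hence m0: "m > 0" by (cases m) (auto simp: p_def)
    have "degree p < m" unfolding p_def
      by (rule degree_sum_less) (use m0 in \<open>auto intro!: le_less_trans[OF degree_monom_le]\<close>)
    moreover have "m \<le> card {x. poly p x = 0}"
      using card_mono[OF poly_roots_finite[OF p0] sub] card_image[OF assms] by simp
    moreover have "card {x. poly p x = 0} \<le> degree p" by (rule card_poly_roots_bound[OF p0])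
    ultimately show False by linarith
  qed
  have "c i = 0" if "i < m" for i
  proof -
    have "0 = coeff p (m - 1 - i)" using \<open>p = 0\<close> by simp
    also have "\<dots> = (\<Sum>k<m. if k = i then c i else 0)"
      unfolding p_def coeff_sum using that by (intro sum.cong) auto
    finally show ?thesis using that by simp
  qed
  thus False using c by blast
qed

text \<open>
  The Sylvester matrix times a block matrix built from an identity and the Vandermonde matrix of the roots of \<open>f\<close> is
  block triangular: the rows belonging to \<open>f\<close> vanish at the roots, and those belonging to \<open>g\<close> become scaled rows of the
  Vandermonde matrix.
\<close>
lemma resultant_roots:
  fixes f g :: "'a::field poly"
  assumes f: "degree f = m" and r: "inj_on r {..<m}" "\<And>i. i < m \<Longrightarrow> poly f (r i) = 0"
  shows "resultant f g = lead_coeff f ^ degree g * (\<Prod>i<m. poly g (r i))"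
proof -
  define n where "n = degree g"
  define S where "S = sylvester_mat f g"
  have S: "S \<in> carrier_mat (n + m) (n + m)" by (auto simp: S_def f n_def)
  define T where "T = four_block_mat (1\<^sub>m n) (mat n m (\<lambda>(i, j). r j ^ (m + n - 1 - i))) (0\<^sub>m m n) (vander m r)"
  define A where "A = mat n n (\<lambda>(i, j). S $$ (i, j))"
  define B where "B = mat m n (\<lambda>(i, j). S $$ (n + i, j))"
  define D where "D = mat m m (\<lambda>(i, j). poly g (r j) * r j ^ (m - 1 - i))"
  have V: "vander m r \<in> carrier_mat m m" by (simp add: vander_def)
  have T: "T \<in> carrier_mat (n + m) (n + m)" unfolding T_def using V by (intro four_block_carrier_mat) auto
  have Tij: "T $$ (k, j) = (if j < n then (if k = j then 1 else 0) else r (j - n) ^ (m + n - 1 - k))"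
    if "k < n + m" "j < n + m" for k j
  proof -
    have "m + n - Suc k = m - Suc (k - n)" if "n \<le> k" using that \<open>k < n + m\<close> by linarith
    thus ?thesis using that V by (auto simp: T_def vander_def)
  qed
  have row: "(\<Sum>k<n + m. S $$ (i, k) * x ^ (m + n - 1 - k)) =
      (if i < n then x ^ (n - 1 - i) * poly f x else x ^ (m + n - 1 - i) * poly g x)"
    if i: "i < n + m" for i x
  proof -
    define p where "p = (if i < n then monom 1 (n - 1 - i) * f else monom 1 (m + n - 1 - i) * g)"
    have pS: "S $$ (i, k) = coeff p (m + n - 1 - k)" if "k < n + m" for k
    proof -
      have a: "n - i = Suc (n - 1 - i)" if "i < n" using that by simp
      have b: "m + n - i = Suc (m + n - 1 - i)" using i by simp
      have c: "m + n - k = Suc (m + n - 1 - k)" using \<open>k < n + m\<close> by simp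
      have "S $$ (i, k) = (if i < n then coeff (monom 1 (n - i) * f) (m + n - k)
              else coeff (monom 1 (m + n - i) * g) (m + n - k))"
        unfolding S_def using i that sylvester_index_mat2[of i f g k] by (simp add: f n_def add.commute)
      also have "\<dots> = coeff p (m + n - 1 - k)"
        unfolding p_def using a by (auto simp: b c monom_Suc)
      finally show ?thesis .
    qed
    have "degree p < m + n"
    proof (cases "i < n")
      case True
      have "degree p \<le> (n - 1 - i) + m" unfolding p_def using True
        by (auto intro!: order.trans[OF degree_mult_le] simp: degree_monom_eq f)
      thus ?thesis using True by linarith
    next
      case False
      have "degree p \<le> (m + n - 1 - i) + n" unfolding p_def using False
        by (auto intro!: order.trans[OF degree_mult_le] simp: degree_monom_eq n_def)
      thus ?thesis using False i by linarith
    qed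
    hence "poly p x = (\<Sum>k<m + n. coeff p k * x ^ k)"
      by (rule poly_sum_lessThan)
    also have "\<dots> = (\<Sum>k<m + n. coeff p (m + n - 1 - k) * x ^ (m + n - 1 - k))"
      by (rule sum.reindex_bij_witness[of _ "\<lambda>k. m + n - 1 - k" "\<lambda>k. m + n - 1 - k"]) auto
    also have "\<dots> = (\<Sum>k<n + m. S $$ (i, k) * x ^ (m + n - 1 - k))"
      using pS by (intro sum.cong) auto
    finally show ?thesis by (cases "i < n") (simp_all add: p_def poly_monom)
  qed
  have prod: "S * T = four_block_mat A (0\<^sub>m n m) B D"
  proof (rule eq_matI)
    fix i j assume ij: "i < dim_row (four_block_mat A (0\<^sub>m n m) B D)" "j < dim_col (four_block_mat A (0\<^sub>m n m) B D)"
    hence ij: "i < n + m" "j < n + m" by (auto simp: A_def D_def)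
    have "(S * T) $$ (i, j) = (\<Sum>k<n + m. S $$ (i, k) * T $$ (k, j))"
      using S T ij by (auto simp: scalar_prod_def lessThan_atLeast0 intro!: sum.cong)
    also have "\<dots> = four_block_mat A (0\<^sub>m n m) B D $$ (i, j)"
    proof (cases "j < n")
      case True
      have "(\<Sum>k<n + m. S $$ (i, k) * T $$ (k, j)) = (\<Sum>k<n + m. if k = j then S $$ (i, j) else 0)"
        using True ij by (intro sum.cong) (auto simp: Tij)
      thus ?thesis using True ij by (auto simp: A_def B_def D_def)
    next
      case False
      have "(\<Sum>k<n + m. S $$ (i, k) * T $$ (k, j)) = (\<Sum>k<n + m. S $$ (i, k) * r (j - n) ^ (m + n - 1 - k))"
        using False ij by (intro sum.cong) (auto simp: Tij)
      also have "\<dots> = (if i < n then 0 else r (j - n) ^ (m + n - 1 - i) * poly g (r (j - n)))"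
        using row[OF ij(1), of "r (j - n)"] r(2)[of "j - n"] ij False by auto
      also have "\<dots> = (if i < n then 0 else r (j - n) ^ (m - 1 - (i - n)) * poly g (r (j - n)))"
        using ij by (auto simp: algebra_simps intro!: arg_cong[of _ _ "\<lambda>k. _ * _ ^ k"])
      finally show ?thesis using False ij by (auto simp: A_def B_def D_def)
    qed
    finally show "(S * T) $$ (i, j) = four_block_mat A (0\<^sub>m n m) B D $$ (i, j)" .
  qed (use S T in \<open>auto simp: A_def D_def\<close>)
  have dT: "det T = det (vander m r)"
    unfolding T_def using V by (subst det_four_block_mat_lower_left_zero[of _ n _ m]) auto
  have dA: "det A = lead_coeff f ^ n"
  proof -
    have "upper_triangular A"
      unfolding upper_triangular_def A_def S_def using sylvester_index_mat[of _ f g] by (auto simp: n_def)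
    hence "det A = prod_list (diag_mat A)" by (rule det_upper_triangular[of _ n]) (simp add: A_def)
    also have "diag_mat A = replicate n (lead_coeff f)"
      unfolding diag_mat_def A_def S_def using sylvester_index_mat[of _ f g]
      by (intro nth_equalityI) (auto simp: n_def)
    finally show ?thesis by simp
  qed
  have dD: "det D = det (vander m r) * (\<Prod>i<m. poly g (r i))"
  proof -
    define E where "E = mat m m (\<lambda>(i, j). if i = j then poly g (r i) else 0)"
    have "D = vander m r * E"
    proof (rule eq_matI)
      fix i j assume "i < dim_row (vander m r * E)" "j < dim_col (vander m r * E)"
      hence ij: "i < m" "j < m" by (auto simp: vander_def E_def)
      have "(vander m r * E) $$ (i, j) = (\<Sum>k<m. r k ^ (m - 1 - i) * (if k = j then poly g (r k) else 0))"
        using ij by (auto simp: scalar_prod_def vander_def E_def lessThan_atLeast0 intro!: sum.cong)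
      also have "\<dots> = (\<Sum>k<m. if k = j then r j ^ (m - 1 - i) * poly g (r j) else 0)" by (intro sum.cong) auto
      finally show "D $$ (i, j) = (vander m r * E) $$ (i, j)" using ij by (simp add: D_def)
    qed (auto simp: D_def E_def vander_def)
    moreover have "det E = (\<Prod>i<m. poly g (r i))"
    proof -
      have "det E = prod_list (diag_mat E)"
        by (rule det_upper_triangular[of _ m]) (auto simp: E_def upper_triangular_def)
      also have "diag_mat E = map (\<lambda>i. poly g (r i)) [0..<m]"
        by (auto simp: diag_mat_def E_def)
      finally show ?thesis by (simp add: prod_list_map_upt)
    qed
    ultimately show ?thesis using V by (simp add: det_mult[of _ m] E_def)
  qed
  have "det S * det T = det A * det D"
    using det_mult[OF S T] unfolding prod
    by (subst (asm) det_four_block_mat_upper_right_zero[of _ n _ m]) (auto simp: A_def B_def D_def)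
  hence "det S * det (vander m r) = lead_coeff f ^ n * (\<Prod>i<m. poly g (r i)) * det (vander m r)"
    by (simp add: dT dA dD mult_ac)
  thus ?thesis using det_vander_nonzero[OF r(1)] by (simp add: S_def resultant_def n_def)
qed

section \<open>Degrees of discriminants and resultants\<close>

lemma smult_prod_roots:
  fixes p :: "'a::field poly"
  assumes "p \<noteq> 0" "finite S" "\<And>r. r \<in> S \<Longrightarrow> poly p r = 0" "card S = degree p"
  shows "p = smult (lead_coeff p) (\<Prod>r\<in>S. [:- r, 1:])"
proof -
  have "(\<Prod>r\<in>S. [:- r, 1:]) dvd p" using assms(2,3)
  proof (induction S)
    case (insert a S)
    then obtain q where q: "p = (\<Prod>r\<in>S. [:- r, 1:]) * q" by (auto elim: dvdE)
    have "poly (\<Prod>r\<in>S. [:- r, 1:]) a \<noteq> 0" using insert by (auto simp: poly_prod)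
    hence "poly q a = 0" using insert.prems[of a] q by simp
    hence "[:- a, 1:] dvd q" by (simp add: poly_eq_0_iff_dvd)
    thus ?case using insert.hyps q by (simp add: mult_dvd_mono mult.commute del: mult_pCons_left mult_pCons_right)
  qed simp
  then obtain q where q: "p = (\<Prod>r\<in>S. [:- r, 1:]) * q" by (elim dvdE)
  have monic: "degree (\<Prod>r\<in>S. [:- r, 1:]) = card S" "lead_coeff (\<Prod>r\<in>S. [:- r, 1:]) = 1"
    by (simp add: degree_prod_eq_sum_degree) (intro monic_prod, simp)
  have "q \<noteq> 0" using assms(1) q by auto
  hence "degree q = 0" using q assms(1,4) monic by (metis degree_mult_eq add_cancel_right_right mult_zero_left)
  then obtain c where c: "q = [:c:]" by (auto elim: degree_eq_zeroE)
  have "lead_coeff p = lead_coeff (\<Prod>r\<in>S. [:- r, 1:]) * c"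
    unfolding q c by (simp only: lead_coeff_mult) simp
  hence "lead_coeff p = c" using monic(2) by simp
  moreover have "p = smult c (\<Prod>r\<in>S. [:- r, 1:])" using q unfolding c by simp
  ultimately show ?thesis by (simp only:)
qed

text \<open>
  The branches of the curve \<open>f = 0\<close> at \<open>x = \<infinity>\<close>.
\<close>
definition lroots :: "nat \<Rightarrow> 'a::field poly poly \<Rightarrow> 'a fls set" where
  "lroots N f = {r. poly (map_poly (emb N) f) r = 0}"

text \<open>
  \<open>f\<close> has as many distinct roots as its degree, that is, it splits with simple roots after \<open>x = t\<^sup>-\<^sup>N\<close>.
\<close>
definition sep_split :: "nat \<Rightarrow> 'a::field poly poly \<Rightarrow> bool" where
  "sep_split N f \<longleftrightarrow> N > 0 \<and> f \<noteq> 0 \<and> card (lroots N f) = degree f"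

abbreviation lpoly :: "nat \<Rightarrow> 'a::field poly poly \<Rightarrow> 'a fls \<Rightarrow> 'a fls" where
  "lpoly N f r \<equiv> poly (map_poly (emb N) f) r"

context
  fixes N :: nat and ty :: "'a::field itself"
  assumes N: "N > 0"
begin

interpretation e: inj_comm_ring_hom "emb N :: 'a poly \<Rightarrow> 'a fls" by (rule emb_inj_hom[OF N])
interpretation em: map_poly_inj_comm_ring_hom "emb N :: 'a poly \<Rightarrow> 'a fls" ..

lemma lpoly_mult: "lpoly N (f * g) (r :: 'a fls) = lpoly N f r * lpoly N g r"
  by (simp add: em.hom_mult)
lemma lpoly_add: "lpoly N (f + g) (r :: 'a fls) = lpoly N f r + lpoly N g r"
  by (simp add: em.hom_add)
lemma lpoly_diff: "lpoly N (f - g) (r :: 'a fls) = lpoly N f r - lpoly N g r"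
  by (simp add: em.hom_minus)
lemma lpoly_pCons: "lpoly N (pCons c f) (r :: 'a fls) = emb N c + r * lpoly N f r"
  by (simp add: e.map_poly_pCons_hom)
lemma lpoly_smult: "lpoly N (smult c f) (r :: 'a fls) = emb N c * lpoly N f r"
  by (simp add: e.map_poly_hom_smult)
lemma lpoly_prod: "lpoly N (\<Prod>i\<in>I. g i) (r :: 'a fls) = (\<Prod>i\<in>I. lpoly N (g i) r)"
  by (simp add: em.hom_prod poly_prod)
lemma lpoly_altdef: "degree f < n \<Longrightarrow> lpoly N f (r :: 'a fls) = (\<Sum>i<n. emb N (coeff f i) * r ^ i)"
  by (subst poly_sum_lessThan[of _ n]) (simp_all)

lemma lead_coeff_lpoly: "lead_coeff (map_poly (emb N) (f :: 'a poly poly)) = emb N (lead_coeff f)" by simp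
lemma lroots_finite: "f \<noteq> 0 \<Longrightarrow> finite (lroots N (f :: 'a poly poly))"
  unfolding lroots_def by (rule poly_roots_finite) simp

lemma card_lroots_le: "f \<noteq> 0 \<Longrightarrow> card (lroots N (f :: 'a poly poly)) \<le> degree f"
  unfolding lroots_def using card_poly_roots_bound[of "map_poly (emb N) f"] by simp

lemma sep_split_factor:
  fixes f :: "'a poly poly"
  assumes "sep_split N f"
  shows "map_poly (emb N) f = smult (emb N (lead_coeff f)) (\<Prod>r\<in>lroots N f. [:- r, 1:])"
proof -
  have f: "f \<noteq> 0" "card (lroots N f) = degree f" using assms by (auto simp: sep_split_def)
  have "map_poly (emb N) f = smult (lead_coeff (map_poly (emb N) f)) (\<Prod>r\<in>lroots N f. [:- r, 1:])"
    by (rule smult_prod_roots) (use f lroots_finite[OF f(1)] in \<open>simp_all add: lroots_def\<close>)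
  thus ?thesis unfolding lead_coeff_lpoly .
qed

lemma emb_resultant:
  fixes f g :: "'a poly poly"
  assumes "sep_split N f"
  shows "emb N (resultant f g) = emb N (lead_coeff f) ^ degree g * (\<Prod>r\<in>lroots N f. lpoly N g r)"
proof -
  have fin: "finite (lroots N f)" "f \<noteq> 0" using assms lroots_finite by (auto simp: sep_split_def)
  obtain r where r: "bij_betw r {..<degree f} (lroots N f)"
    using ex_bij_betw_nat_finite[OF fin(1)] assms by (auto simp: sep_split_def lessThan_atLeast0)
  have "emb N (resultant f g) = resultant (map_poly (emb N) f) (map_poly (emb N) g)"
    by (simp add: e.resultant_hom)
  also have "\<dots> = emb N (lead_coeff f) ^ degree g * (\<Prod>i<degree f. lpoly N g (r i))"
  proof (subst resultant_roots[of _ "degree f" r])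
    show "inj_on r {..<degree f}" using r by (rule bij_betw_imp_inj_on)
    show "lpoly N f (r i) = 0" if "i < degree f" for i
      using bij_betwE[OF r] that by (auto simp: lroots_def)
  qed simp_all
  also have "(\<Prod>i<degree f. lpoly N g (r i)) = (\<Prod>r\<in>lroots N f. lpoly N g r)"
    using prod.reindex_bij_betw[OF r] by simp
  finally show ?thesis .
qed

lemma lroots_mult: "lroots N (f * g) = lroots N f \<union> lroots N (g :: 'a poly poly)"
  by (auto simp: lroots_def lpoly_mult)

lemma sep_split_mult_iff:
  fixes f g :: "'a poly poly"
  assumes "f \<noteq> 0" "g \<noteq> 0"
  shows "sep_split N (f * g) \<longleftrightarrow> sep_split N f \<and> sep_split N g \<and> lroots N f \<inter> lroots N g = {}"
proof -
  have "card (lroots N (f * g)) + card (lroots N f \<inter> lroots N g) = card (lroots N f) + card (lroots N g)"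
    unfolding lroots_mult using card_Un_Int[of "lroots N f" "lroots N g"] assms lroots_finite by metis
  moreover have "card (lroots N f \<inter> lroots N g) = 0 \<longleftrightarrow> lroots N f \<inter> lroots N g = {}"
    using lroots_finite[OF assms(1)] by simp
  moreover have "degree (f * g) = degree f + degree g" using assms by (rule degree_mult_eq)
  ultimately show ?thesis unfolding sep_split_def using card_lroots_le[OF assms(1)] card_lroots_le[OF assms(2)] N assms
    by auto
qed

lemma resultant_nonzero:
  fixes f g :: "'a poly poly"
  assumes "sep_split N f" "g \<noteq> 0" "lroots N f \<inter> lroots N g = {}"
  shows "resultant f g \<noteq> 0"
proof -
  have "emb N (resultant f g) \<noteq> 0"
    using assms lroots_finite by (auto simp: emb_resultant sep_split_def lroots_def)
  thus ?thesis by auto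
qed

lemma resultant_mult_right:
  fixes f g h :: "'a poly poly"
  assumes "sep_split N f" "g \<noteq> 0" "h \<noteq> 0"
  shows "resultant f (g * h) = resultant f g * resultant f h"
proof -
  have "emb N (resultant f (g * h)) = emb N (resultant f g * resultant f h)"
    using assms by (simp add: emb_resultant e.hom_mult degree_mult_eq power_add lpoly_mult prod.distrib)
  thus ?thesis by simp
qed
end

lemma degree_resultant_sym: "degree (resultant f g) = degree (resultant g f)" for f g :: "'a::field poly poly"
proof -
  have "(- 1 :: 'a poly) ^ k = [:(- 1) ^ k:]" for k
    by (induction k) (simp_all add: one_pCons[symmetric])
  thus ?thesis by (subst resultant_swap) simp
qed

text \<open>
  The degree of the discriminant, written so that it makes sense without divisibility by the leading
  coefficient.  Integers avoid truncated subtraction.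
\<close>
definition discdeg :: "'a::field poly poly \<Rightarrow> int" where
  "discdeg f = int (degree (resultant f (pderiv f))) - int (degree (lead_coeff f))"

definition resdeg :: "'a::field poly poly \<Rightarrow> 'a poly poly \<Rightarrow> int" where
  "resdeg f g = int (degree (resultant f g))"

lemma resdeg_sym: "resdeg f g = resdeg g f" by (simp add: resdeg_def degree_resultant_sym)
lemma resdeg_nonneg [simp]: "resdeg f g \<ge> 0" by (simp add: resdeg_def)

text \<open>
  At a simple root the derivative is the product of the differences to the other roots.
\<close>
lemma sep_split_pderiv_nonzero:
  fixes f :: "'a::field poly poly"
  assumes "sep_split N f" "r \<in> lroots N f"
  shows "lpoly N (pderiv f) r \<noteq> 0"
proof -
  have N: "N > 0" using assms by (simp add: sep_split_def)
  interpret e: inj_comm_ring_hom "emb N :: 'a poly \<Rightarrow> 'a fls" by (rule emb_inj_hom[OF N])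
  define c where "c = emb N (lead_coeff f)"
  have c0: "c \<noteq> 0" using assms by (simp add: c_def sep_split_def)
  have fin: "finite (lroots N f)" using lroots_finite[OF N, of f] assms by (simp add: sep_split_def)
  define q where "q = (\<Prod>s\<in>lroots N f - {r}. [:- s, 1:])"
  have "map_poly (emb N) f = smult c ([:- r, 1:] * q)"
    using sep_split_factor[OF N assms(1)] unfolding c_def q_def prod.remove[OF fin assms(2)] .
  hence "pderiv (map_poly (emb N) f) = smult c ([:- r, 1:] * pderiv q + q)"
    by (simp add: pderiv_smult pderiv_mult pderiv_pCons del: mult_pCons_left)
  hence "poly (pderiv (map_poly (emb N) f)) r = c * poly q r" by simp
  moreover have "poly q r \<noteq> 0" using fin by (auto simp: q_def poly_prod)
  ultimately show ?thesis using c0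
    idom_hom.map_poly_pderiv[OF idom_hom.intro[OF e.comm_ring_hom_axioms], of f] by simp
qed

lemma resultant_pderiv_nonzero:
  fixes f :: "'a::field poly poly"
  assumes "sep_split N f"
  shows "resultant f (pderiv f) \<noteq> 0"
proof -
  have N: "N > 0" using assms by (simp add: sep_split_def)
  have "emb N (resultant f (pderiv f)) \<noteq> 0"
    using assms sep_split_pderiv_nonzero[OF assms] lroots_finite[OF N, of f]
    by (auto simp: emb_resultant[OF N assms] sep_split_def emb_eq_0_iff)
  thus ?thesis using N by (auto simp: emb_eq_0_iff)
qed

text \<open>
  At a root of \<open>f\<close> the derivative of \<open>f g\<close> is \<open>f' g\<close>, so the resultant of \<open>f g\<close> with its
  derivative contains the resultant of \<open>f\<close> and \<open>g\<close> twice.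
\<close>
lemma discdeg_mult:
  fixes f g :: "'a::field_char_0 poly poly"
  assumes "sep_split N (f * g)" "degree f > 0" "degree g > 0"
  shows "discdeg (f * g) = discdeg f + discdeg g + 2 * resdeg f g"
proof -
  have N: "N > 0" using assms by (simp add: sep_split_def)
  interpret e: inj_comm_ring_hom "emb N :: 'a poly \<Rightarrow> 'a fls" by (rule emb_inj_hom[OF N])
  have nz: "f \<noteq> 0" "g \<noteq> 0" using assms by auto
  have ss: "sep_split N f" "sep_split N g" and disj: "lroots N f \<inter> lroots N g = {}"
    using sep_split_mult_iff[OF N nz] assms(1) by auto
  have fin: "finite (lroots N f)" "finite (lroots N g)" using nz lroots_finite[OF N] by auto
  define a where "a = emb N (lead_coeff f)"
  define b where "b = emb N (lead_coeff g)"
  have dd: "degree (pderiv (f * g)) = (degree f - 1) + degree g" "degree (pderiv (f * g)) = (degree g - 1) + degree f"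
    using assms nz by (auto simp: degree_pderiv degree_mult_eq)
  have "emb N (resultant (f * g) (pderiv (f * g))) = emb N (resultant f (pderiv f) * resultant g (pderiv g) * (resultant f g * resultant g f))"
  proof -
    have "(\<Prod>r\<in>lroots N f. lpoly N (pderiv (f * g)) r) = (\<Prod>r\<in>lroots N f. lpoly N (pderiv f) r * lpoly N g r)"
      by (intro prod.cong) (auto simp: pderiv_mult lroots_def lpoly_mult[OF N] lpoly_add[OF N])
    moreover have "(\<Prod>r\<in>lroots N g. lpoly N (pderiv (f * g)) r) = (\<Prod>r\<in>lroots N g. lpoly N f r * lpoly N (pderiv g) r)"
      by (intro prod.cong) (auto simp: pderiv_mult lroots_def lpoly_mult[OF N] lpoly_add[OF N])
    moreover have "(a * b) ^ degree (pderiv (f * g)) = (a ^ (degree f - 1) * a ^ degree g) * (b ^ (degree g - 1) * b ^ degree f)"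
    proof -
      have "a ^ degree (pderiv (f * g)) = a ^ (degree f - 1) * a ^ degree g" unfolding dd(1) power_add ..
      moreover have "b ^ degree (pderiv (f * g)) = b ^ (degree g - 1) * b ^ degree f" unfolding dd(2) power_add ..
      ultimately show ?thesis by (simp only: power_mult_distrib)
    qed
    ultimately show ?thesis
      using fin disj
      by (simp add: emb_resultant[OF N] assms ss e.hom_mult lroots_mult[OF N] prod.union_disjoint prod.distrib
        degree_pderiv lead_coeff_mult a_def[symmetric] b_def[symmetric] mult_ac)
  qed
  hence eq: "resultant (f * g) (pderiv (f * g)) = resultant f (pderiv f) * resultant g (pderiv g) * (resultant f g * resultant g f)"
    by (simp only: e.eq_iff)
  have "resultant f g \<noteq> 0" "resultant g f \<noteq> 0"
    using resultant_nonzero[OF N] ss nz disj by (auto simp: Int_commute)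
  hence "degree (resultant (f * g) (pderiv (f * g))) = degree (resultant f (pderiv f)) + degree (resultant g (pderiv g)) + (degree (resultant f g) + degree (resultant g f))"
    using resultant_pderiv_nonzero[OF ss(1)] resultant_pderiv_nonzero[OF ss(2)] by (simp add: eq degree_mult_eq)
  thus ?thesis using nz degree_resultant_sym[of g f]
    by (simp add: discdeg_def resdeg_def coeff_mult_degree_sum degree_mult_eq)
qed

lemma discdeg_smult_const:
  fixes f :: "'a::field_char_0 poly poly"
  assumes "c \<noteq> 0"
  shows "discdeg (smult [:c:] f) = discdeg f"
proof -
  have p: "[:c:] ^ k = [:c ^ k:]" for k by (induction k) (simp_all add: one_pCons[symmetric])
  show ?thesis using assms
    by (simp add: discdeg_def pderiv_smult resultant_smult_left resultant_smult_right p degree_smult_eq)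
qed

lemma discdeg_prod:
  fixes g :: "'i \<Rightarrow> 'a::field_char_0 poly poly"
  assumes "finite I" "sep_split N (\<Prod>i\<in>I. g i)" "\<And>i. i \<in> I \<Longrightarrow> degree (g i) > 0"
  shows "discdeg (\<Prod>i\<in>I. g i) = (\<Sum>i\<in>I. discdeg (g i)) + (\<Sum>i\<in>I. \<Sum>j\<in>I - {i}. resdeg (g i) (g j))"
  using assms
proof (induction I)
  case empty thus ?case by (simp add: discdeg_def)
next
  case (insert a I)
  have N: "N > 0" using insert by (simp add: sep_split_def)
  have ga: "g a \<noteq> 0" using insert.prems(2)[of a] by auto
  have gi: "g i \<noteq> 0" if "i \<in> I" for i using insert.prems(2)[of i] that by auto
  hence nz: "(\<Prod>i\<in>I. g i) \<noteq> 0" using insert.hyps by simp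
  have ss: "sep_split N (g a * (\<Prod>i\<in>I. g i))" using insert by simp
  hence ss': "sep_split N (g a)" "sep_split N (\<Prod>i\<in>I. g i)" "lroots N (g a) \<inter> lroots N (\<Prod>i\<in>I. g i) = {}"
    using sep_split_mult_iff[OF N ga nz] by auto
  show ?case
  proof (cases "I = {}")
    case True thus ?thesis by simp
  next
    case False
    have "degree (\<Prod>i\<in>I. g i) > 0"
    proof -
      have "degree (\<Prod>i\<in>I. g i) = (\<Sum>i\<in>I. degree (g i))" using gi by (intro degree_prod_eq_sum_degree) auto
      also have "\<dots> > 0" using False insert by (intro sum_pos) auto
      finally show ?thesis .
    qed
    hence 1: "discdeg (g a * (\<Prod>i\<in>I. g i)) = discdeg (g a) + discdeg (\<Prod>i\<in>I. g i) + 2 * resdeg (g a) (\<Prod>i\<in>I. g i)"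
      using insert.prems(2)[of a] by (intro discdeg_mult[OF ss]) auto
    have 2: "resdeg (g a) (\<Prod>i\<in>J. g i) = (\<Sum>i\<in>J. resdeg (g a) (g i))" if "J \<subseteq> I" for J
      using finite_subset[OF that insert.hyps(1)] that
    proof (induction J)
      case empty thus ?case by (simp add: resdeg_def)
    next
      case (insert j J)
      have nz: "g j \<noteq> 0" "(\<Prod>i\<in>J. g i) \<noteq> 0" using insert gi by auto
      have "j \<in> I" using insert by auto
      hence d: "lroots N (g a) \<inter> lroots N (g j) = {}" 
        using ss'(3) \<open>finite I\<close> by (auto simp: lroots_def lpoly_prod[OF N])
      have d': "lroots N (g a) \<inter> lroots N (\<Prod>i\<in>J. g i) = {}"
        using ss'(3) \<open>finite I\<close> insert by (auto simp: lroots_def lpoly_prod[OF N])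
      have "resultant (g a) (g j) \<noteq> 0" "resultant (g a) (\<Prod>i\<in>J. g i) \<noteq> 0"
        using resultant_nonzero[OF N ss'(1)] nz d d' by auto
      thus ?case using insert nz
        by (simp add: resdeg_def resultant_mult_right[OF N ss'(1)] degree_mult_eq)
    qed
    have 3: "(\<Sum>i\<in>insert a I. \<Sum>j\<in>insert a I - {i}. resdeg (g i) (g j)) =
       2 * (\<Sum>i\<in>I. resdeg (g a) (g i)) + (\<Sum>i\<in>I. \<Sum>j\<in>I - {i}. resdeg (g i) (g j))"
    proof -
      have "(\<Sum>j\<in>insert a I - {i}. resdeg (g i) (g j)) = resdeg (g a) (g i) + (\<Sum>j\<in>I - {i}. resdeg (g i) (g j))"
        if "i \<in> I" for i
      proof -
        have "insert a I - {i} = insert a (I - {i})" using insert that by auto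
        thus ?thesis using insert by (simp add: resdeg_sym)
      qed
      moreover have "insert a I - {a} = I" using insert by auto
      ultimately show ?thesis using insert by (simp add: sum.distrib)
    qed
    show ?thesis using insert 1 2[of I] 3 ss'(2) by simp
  qed
qed

lemma degree_poly_div: "q \<noteq> 0 \<Longrightarrow> degree (p div q) = degree p - degree q" for p q :: "'a::field poly"
proof (cases "degree p < degree q")
  case False
  assume q: "q \<noteq> 0"
  show ?thesis
  proof (cases "p div q = 0")
    case True
    hence "p = p mod q" using div_mult_mod_eq[of p q] by simp
    hence "p = 0 \<or> degree p < degree q" using degree_mod_less[OF q, of p] by auto
    thus ?thesis using False True by auto
  next
    case n0: False
    have "degree (p div q * q) = degree (p div q) + degree q" using n0 q by (simp add: degree_mult_eq)
    moreover have "degree p = degree (p div q * q)"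
    proof (cases "p mod q = 0")
      case True thus ?thesis using div_mult_mod_eq[of p q] by simp
    next
      case False
      hence "degree (p mod q) < degree q" using degree_mod_less[OF q, of p] by auto
      hence "degree (p div q * q + p mod q) = degree (p div q * q)"
        using calculation by (intro degree_add_eq_left) auto
      thus ?thesis by simp
    qed
    ultimately show ?thesis by simp
  qed
qed (simp add: div_poly_less)

text \<open>
  Division of polynomials lowers the degree by that of the divisor, exact or not.
\<close>
lemma degree_discriminant:
  fixes f :: "'a::field_char_0 poly poly"
  assumes "degree f > 0" "discdeg f \<ge> 0"
  shows "int (degree (discriminant f)) = discdeg f"
proof (cases "degree f = 1")
  case True
  then obtain a b where f: "f = [:b, a:]" "a \<noteq> 0" using degree1_coeffs by metis
  hence "discdeg f = 0" by (simp add: discdeg_def pderiv_pCons)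
  thus ?thesis using True by (simp add: discriminant_def)
next
  case False
  have "(- 1 :: 'a poly) ^ k = [:(- 1) ^ k:]" for k
    by (induction k) (simp_all add: one_pCons[symmetric])
  hence "degree (discriminant f) = degree (resultant f (pderiv f) div lead_coeff f)"
    using False assms by (simp add: discriminant_def)
  also have "\<dots> = degree (resultant f (pderiv f)) - degree (lead_coeff f)"
    using assms by (intro degree_poly_div) auto
  finally show ?thesis using assms by (simp add: discdeg_def of_nat_diff)
qed

section \<open>Primitive irreducible factors\<close>

text \<open>
  Irreducible factors of positive degree in \<open>y\<close>: for primitive polynomials, irreducibility over \<open>K(x)\<close>
  and over \<open>K[x]\<close> agree.
\<close>
definition prim_irr :: "'a::field poly poly \<Rightarrow> bool" where
  "prim_irr g \<longleftrightarrow> primitive_in_y g \<and> degree g > 0 \<and> (\<forall>a b. g = a * b \<longrightarrow> degree a = 0 \<or> degree b = 0)"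

lemma primitive_dvd: "primitive_in_y f \<Longrightarrow> g dvd f \<Longrightarrow> primitive_in_y g"
  unfolding primitive_in_y_def using dvd_trans by blast

lemma squarefree_divisor: "squarefree f \<Longrightarrow> g dvd f \<Longrightarrow> squarefree g"
  unfolding squarefree_def using dvd_trans by blast

text \<open>
  The lemma of Gauss.  As \<open>K\<close> is algebraically closed, \<open>a\<close> is a product of linear polynomials, each prime in \<open>K[x,y]\<close>
  and not dividing \<open>Q\<close>; they can be cancelled one at a time.
\<close>
lemma gauss_primitive_dvd:
  fixes Q h s :: "'a::alg_closed_field poly poly"
  assumes "primitive_in_y Q" "a \<noteq> 0" "[:a:] * h = Q * s"
  shows "Q dvd h"
  using assms(2,3)
proof (induction "degree a" arbitrary: a s)
  case 0
  then obtain c where c: "a = [:c:]" "c \<noteq> 0" by (metis degree_eq_zeroE pCons_0_0)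
  have "h = [:[:1 / c:]:] * ([:a:] * h)" using c by (simp add: one_pCons[symmetric])
  also have "\<dots> = [:[:1 / c:]:] * (Q * s)" by (simp only: "0.prems"(2))
  also have "\<dots> = Q * ([:[:1 / c:]:] * s)" by (simp only: mult_ac)
  finally show ?case by (metis dvd_triv_left)
next
  case (Suc n)
  obtain \<alpha> where "poly a \<alpha> = 0" using alg_closed_imp_poly_has_root[of a] Suc.hyps(2) by auto
  then obtain b where b: "a = [:- \<alpha>, 1:] * b" by (auto simp: poly_eq_0_iff_dvd elim: dvdE)
  define c where "c = [:- \<alpha>, 1:]"
  have b0: "b \<noteq> 0" and c0: "c \<noteq> 0" and ab: "a = c * b" using Suc b by (auto simp: c_def)
  have db: "degree b = n" using Suc.hyps(2) b0 c0 by (simp add: ab degree_mult_eq c_def del: mult_pCons_left)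
  have "prime_elem [:c:]" unfolding c_def by (intro lift_prime_elem_poly prime_elem_linear_field_poly) simp
  moreover have "[:c:] dvd Q * s"
  proof
    show "Q * s = [:c:] * ([:b:] * h)" using Suc.prems(2) by (simp add: ab mult.commute)
  qed
  moreover have "\<not> [:c:] dvd Q"
    using assms(1) unfolding primitive_in_y_def by (auto simp: c_def dest!: spec[of _ c])
  ultimately have "[:c:] dvd s" using prime_elem_dvd_mult_iff by blast
  then obtain t where t: "s = [:c:] * t" by (elim dvdE)
  have "[:c:] * ([:b:] * h) = [:c:] * (Q * t)"
    using Suc.prems(2) unfolding ab t by (simp add: mult_ac)
  hence "[:b:] * h = Q * t" using c0 by (simp only: mult_cancel_left) simp
  thus ?case using Suc.hyps(1)[of b t] db b0 by simp
qed

lemma primitive_part_exists: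
  fixes Q :: "'a::field poly poly"
  assumes "Q \<noteq> 0"
  shows "\<exists>c Q0. c \<noteq> 0 \<and> Q = smult c Q0 \<and> primitive_in_y Q0"
proof -
  define P where "P c \<longleftrightarrow> [:c:] dvd Q" for c
  have "degree c \<le> degree (lead_coeff Q)" if "P c" for c
    using that assms by (auto simp: P_def const_poly_dvd_iff intro!: dvd_imp_degree_le)
  moreover have "P 1" by (simp add: P_def one_pCons[symmetric])
  ultimately obtain c where c: "P c" "\<And>e. P e \<Longrightarrow> degree e \<le> degree c"
    using ex_has_greatest_nat[of P 1 degree "Suc (degree (lead_coeff Q))"] by (auto simp: less_Suc_eq_le)
  obtain Q0 where Q0: "Q = [:c:] * Q0" using c(1) by (auto simp: P_def elim: dvdE)
  have c0: "c \<noteq> 0" using assms Q0 by auto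
  have "primitive_in_y Q0" unfolding primitive_in_y_def
  proof (intro allI impI)
    fix e assume "[:e:] dvd Q0"
    then obtain R where R: "Q0 = [:e:] * R" by (elim dvdE)
    have "e \<noteq> 0" using assms Q0 R by auto
    have "Q = [:c * e:] * R" by (simp add: Q0 R mult.commute)
    hence "P (c * e)" unfolding P_def by (rule dvdI)
    from c(2)[OF this] show "degree e = 0" using c0 \<open>e \<noteq> 0\<close> by (simp add: degree_mult_eq)
  qed
  thus ?thesis using c0 Q0 by auto
qed

text \<open>
  Take a polynomial of least degree vanishing at \<open>r\<close> and make it primitive.  Pseudo-division shows that it
  divides a multiple of every \<open>h\<close>, and the lemma of Gauss removes the multiplier.
\<close>
lemma minimal_polynomial_exists:
  fixes r :: "'a::alg_closed_field fls"
  assumes N: "N > 0" and f: "f \<noteq> 0" "lpoly N f r = 0"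
  shows "\<exists>Q. primitive_in_y Q \<and> degree Q > 0 \<and> lpoly N Q r = 0 \<and> (\<forall>h. lpoly N h r = 0 \<longrightarrow> Q dvd h)"
proof -
  obtain Q1 where Q1: "Q1 \<noteq> 0" "lpoly N Q1 r = 0" and min1: "\<And>h. h \<noteq> 0 \<Longrightarrow> lpoly N h r = 0 \<Longrightarrow> degree Q1 \<le> degree h"
    using ex_has_least_nat[of "\<lambda>h. h \<noteq> 0 \<and> lpoly N h r = 0" f degree] f by auto
  obtain c Q where cQ: "c \<noteq> 0" "Q1 = smult c Q" "primitive_in_y Q" using primitive_part_exists[OF Q1(1)] by auto
  have Q0: "Q \<noteq> 0" using Q1 cQ by auto
  have Qr: "lpoly N Q r = 0" using Q1(2) cQ N by (simp add: lpoly_smult emb_eq_0_iff)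
  have dQ: "degree Q1 = degree Q" using cQ by simp
  have "degree Q > 0"
  proof (rule ccontr)
    assume "\<not> ?thesis"
    then obtain b where "Q = [:b:]" by (auto elim: degree_eq_zeroE)
    thus False using Qr Q0 N by (simp add: lpoly_pCons emb_eq_0_iff)
  qed
  moreover have "Q dvd h" if h: "lpoly N h r = 0" for h
  proof -
    obtain s t where st: "pseudo_divmod h Q = (s, t)" by (cases "pseudo_divmod h Q")
    define a where "a = lead_coeff Q ^ (Suc (degree h) - degree Q)"
    have eq: "smult a h = Q * s + t" and t: "t = 0 \<or> degree t < degree Q"
      using pseudo_divmod[OF Q0 st] by (auto simp: a_def)
    have "lpoly N t r = lpoly N (smult a h - Q * s) r" by (simp add: eq)
    also have "\<dots> = 0" using N h Qr by (simp add: lpoly_diff lpoly_smult lpoly_mult)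
    finally have "lpoly N t r = 0" .
    hence "t = 0" using t min1[of t] dQ by (cases "t = 0") auto
    hence "[:a:] * h = Q * s" using eq by simp
    thus ?thesis using Q0 by (intro gauss_primitive_dvd[OF cQ(3)]) (auto simp: a_def)
  qed
  ultimately show ?thesis using cQ(3) Qr by blast
qed

text \<open>
  An irreducible polynomial is associated to the minimal polynomial of each of its roots.
\<close>
lemma prim_irr_dvd:
  fixes r :: "'a::alg_closed_field fls"
  assumes N: "N > 0" and g: "prim_irr g" "lpoly N g r = 0" and h: "lpoly N h r = 0"
  shows "g dvd h"
proof -
  have "g \<noteq> 0" using g by (auto simp: prim_irr_def)
  from minimal_polynomial_exists[OF N this g(2)] obtain Q where
    Q: "degree Q > 0" "\<And>h. lpoly N h r = 0 \<Longrightarrow> Q dvd h" by blast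
  obtain s where s: "g = Q * s" using Q(2)[OF g(2)] by (elim dvdE)
  have "degree s = 0" using g(1) Q(1) s unfolding prim_irr_def by (metis less_numeral_extra(3))
  then obtain c where c: "s = [:c:]" by (auto elim: degree_eq_zeroE)
  hence "[:c:] dvd g" using s by (metis dvd_triv_right)
  hence "degree c = 0" using g(1) unfolding prim_irr_def primitive_in_y_def by blast
  then obtain b where b: "c = [:b:]" by (auto elim: degree_eq_zeroE)
  have "b \<noteq> 0" using \<open>g \<noteq> 0\<close> s c b by auto
  hence "is_unit s" by (simp add: c b is_unit_const_poly_iff)
  hence "g dvd Q" unfolding s by (simp add: mult_unit_dvd_iff)
  thus ?thesis using Q(2)[OF h] by (rule dvd_trans)
qed

text \<open>
  At a double root the derivative of \<open>f\<close> vanishes as well, so the minimal polynomial of the root divides \<open>f\<close> twice.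
\<close>
lemma sep_split_exists:
  fixes f :: "'a::{alg_closed_field, field_char_0} poly poly"
  assumes "f \<noteq> 0" "squarefree f"
  shows "\<exists>N. sep_split N f"
proof -
  obtain N where N: "N > 0" and sp: "splits (map_poly (emb N) f)" using emb_splits_exists[OF assms(1)] by blast
  interpret e: inj_comm_ring_hom "emb N :: 'a poly \<Rightarrow> 'a fls" by (rule emb_inj_hom[OF N])
  obtain c rs where F: "map_poly (emb N) f = smult c (\<Prod>r\<leftarrow>rs. [:- r, 1:])" using sp unfolding splits_def by blast
  have c0: "c \<noteq> 0" using F assms(1) by auto
  have "distinct rs"
  proof (rule ccontr)
    assume "\<not> distinct rs"
    then obtain as r bs cs where rs: "rs = as @ [r] @ bs @ [r] @ cs" using not_distinct_decomp by blast
    define G where "G = smult c ((\<Prod>r\<leftarrow>as. [:- r, 1:]) * (\<Prod>r\<leftarrow>bs. [:- r, 1:]) * (\<Prod>r\<leftarrow>cs. [:- r, 1:]))"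
    have F2: "map_poly (emb N) f = [:- r, 1:] * ([:- r, 1:] * G)"
      by (simp add: F rs G_def mult_ac del: mult_pCons_left mult_pCons_right)
    have fr: "lpoly N f r = 0" by (simp add: F2)
    have "poly (pderiv (map_poly (emb N) f)) r = 0"
      unfolding F2 by (simp only: pderiv_mult poly_add poly_mult) simp
    hence fr': "lpoly N (pderiv f) r = 0"
      using idom_hom.map_poly_pderiv[OF idom_hom.intro[OF e.comm_ring_hom_axioms], of f] by simp
    from minimal_polynomial_exists[OF N assms(1) fr] obtain Q where
      Q: "degree Q > 0" "lpoly N Q r = 0" "\<And>h. lpoly N h r = 0 \<Longrightarrow> Q dvd h" by blast
    have Q': "lpoly N (pderiv Q) r \<noteq> 0"
    proof
      assume "lpoly N (pderiv Q) r = 0"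
      hence "Q dvd pderiv Q" by (rule Q(3))
      moreover have "pderiv Q \<noteq> 0" using Q(1) by (simp add: pderiv_eq_0_iff)
      ultimately have "degree Q \<le> degree (pderiv Q)" by (rule dvd_imp_degree_le)
      thus False using Q(1) by (simp add: degree_pderiv)
    qed
    obtain h where h: "f = Q * h" using Q(3)[OF fr] by (elim dvdE)
    have "lpoly N (pderiv Q) r * lpoly N h r = 0"
      using fr' N Q(2) by (simp add: h pderiv_mult lpoly_add lpoly_mult mult.commute)
    hence "Q dvd h" using Q' Q(3) by auto
    hence "Q ^ 2 dvd f" unfolding h power2_eq_square by (intro mult_dvd_mono) auto
    hence "is_unit Q" using assms(2) unfolding squarefree_def by blast
    thus False using Q(1) by (metis is_unit_iff_degree poly_dvd_1 less_numeral_extra(3))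
  qed
  moreover have "lroots N f = set rs"
    unfolding lroots_def F using c0 by (auto simp: poly_prod_list prod_list_zero_iff)
  moreover have "degree f = length rs"
  proof -
    have "degree (\<Prod>r\<leftarrow>rs. [:- r, 1:]) = length rs"
      by (subst degree_prod_list_eq) (auto simp: o_def sum_list_triv)
    moreover have "degree f = degree (map_poly (emb N) f)" by simp
    ultimately show ?thesis using c0 by (simp only: F degree_smult_eq) simp
  qed
  ultimately have "sep_split N f" using N assms(1) by (simp add: sep_split_def distinct_card)
  thus ?thesis by blast
qed

lemma prim_irr_factorization:
  fixes f :: "'a::field poly poly"
  assumes "primitive_in_y f" "squarefree f" "degree f > 0"
  shows "\<exists>S. finite S \<and> f = \<Prod>S \<and> (\<forall>g\<in>S. prim_irr g)"
  using assms
proof (induction "degree f" arbitrary: f rule: less_induct)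
  case less
  show ?case
  proof (cases "prim_irr f")
    case True thus ?thesis by (intro exI[of _ "{f}"]) auto
  next
    case False
    then obtain a b where ab: "f = a * b" "degree a > 0" "degree b > 0" using less.prems unfolding prim_irr_def by blast
    have "a \<noteq> 0" "b \<noteq> 0" using ab by auto
    hence d: "degree f = degree a + degree b" using ab by (simp add: degree_mult_eq)
    have dv: "a dvd f" "b dvd f" using ab by auto
    obtain A where A: "finite A" "a = \<Prod>A" "\<forall>g\<in>A. prim_irr g"
      using less.hyps[of a] d ab primitive_dvd[OF less.prems(1) dv(1)] squarefree_divisor[OF less.prems(2) dv(1)] by auto
    obtain B where B: "finite B" "b = \<Prod>B" "\<forall>g\<in>B. prim_irr g"
      using less.hyps[of b] d ab primitive_dvd[OF less.prems(1) dv(2)] squarefree_divisor[OF less.prems(2) dv(2)] by auto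
    have "A \<inter> B = {}"
    proof (rule ccontr)
      assume "A \<inter> B \<noteq> {}"
      then obtain g where g: "g \<in> A" "g \<in> B" by auto
      have "g dvd a" "g dvd b" using g A B by (auto intro: dvd_prodI)
      hence "g ^ 2 dvd f" unfolding ab power2_eq_square by (rule mult_dvd_mono)
      hence "is_unit g" using less.prems(2) unfolding squarefree_def by blast
      moreover have "degree g > 0" using g A by (auto simp: prim_irr_def)
      ultimately show False by (metis is_unit_iff_degree poly_dvd_1 less_numeral_extra(3))
    qed
    hence "f = \<Prod>(A \<union> B)" using A B ab by (simp add: prod.union_disjoint)
    thus ?thesis using A B by (intro exI[of _ "A \<union> B"]) auto
  qed
qed

section \<open>The ring of multipliers of an irreducible polynomial\<close>

lemma fls_nth_mult_low:
  fixes f g :: "'a::field fls"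
  assumes "\<And>n. n < a \<Longrightarrow> fls_nth f n = 0" "\<And>n. n < b \<Longrightarrow> fls_nth g n = 0"
  shows "fls_nth (f * g) (a + b) = fls_nth f a * fls_nth g b" "\<And>n. n < a + b \<Longrightarrow> fls_nth (f * g) n = 0"
proof -
  have *: "fls_nth (f * g) (a + b) = fls_nth f a * fls_nth g b \<and> (\<forall>n < a + b. fls_nth (f * g) n = 0)"
  proof (cases "f = 0 \<or> g = 0")
    case False
    hence "a \<le> fls_subdegree f" "b \<le> fls_subdegree g" using assms by (auto intro: fls_subdegree_geI)
    thus ?thesis using fls_nth_mult_leading[of a f b g] by (auto intro!: fls_times_nth_eq0)
  qed auto
  show "fls_nth (f * g) (a + b) = fls_nth f a * fls_nth g b" "\<And>n. n < a + b \<Longrightarrow> fls_nth (f * g) n = 0"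
    using * by blast+
qed

lemma fls_nth_prod_low:
  fixes f :: "'i \<Rightarrow> 'a::field fls"
  assumes "\<And>k n. k \<in> S \<Longrightarrow> n < a k \<Longrightarrow> fls_nth (f k) n = 0"
  shows "fls_nth (\<Prod>k\<in>S. f k) (\<Sum>k\<in>S. a k) = (\<Prod>k\<in>S. fls_nth (f k) (a k)) \<and>
         (\<forall>n < (\<Sum>k\<in>S. a k). finite S \<longrightarrow> fls_nth (\<Prod>k\<in>S. f k) n = 0)"
  using assms
proof (induction S rule: infinite_finite_induct)
  case (insert x S)
  have IH: "fls_nth (\<Prod>k\<in>S. f k) (\<Sum>k\<in>S. a k) = (\<Prod>k\<in>S. fls_nth (f k) (a k))"
    "\<And>n. n < (\<Sum>k\<in>S. a k) \<Longrightarrow> fls_nth (\<Prod>k\<in>S. f k) n = 0" using insert by auto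
  have x: "\<And>n. n < a x \<Longrightarrow> fls_nth (f x) n = 0" using insert by auto
  show ?case using insert.hyps fls_nth_mult_low[OF x IH(2)] IH(1) by auto
qed auto

lemma fls_nth_power_low:
  fixes f :: "'a::field fls"
  assumes "\<And>n. n < a \<Longrightarrow> fls_nth f n = 0"
  shows "fls_nth (f ^ k) (int k * a) = fls_nth f a ^ k \<and> (\<forall>n < int k * a. fls_nth (f ^ k) n = 0)"
  using fls_nth_prod_low[of "{..<k}" "\<lambda>_. a" "\<lambda>_. f"] assms by simp

text \<open>
  Testing with a polynomial that vanishes at \<open>0\<close> and at every value except \<open>s\<close> turns power sums into
  the number of indices with value \<open>s\<close>.  This uses characteristic zero.
\<close>
lemma power_sums_eq:
  fixes a b :: "nat \<Rightarrow> 'a::field_char_0"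
  assumes "\<And>n. n \<ge> 1 \<Longrightarrow> (\<Sum>i<m. a i ^ n) = (\<Sum>i<m. b i ^ n)" "s \<noteq> 0"
  shows "card {i. i < m \<and> a i = s} = card {i. i < m \<and> b i = s}"
proof -
  define S where "S = a ` {..<m} \<union> b ` {..<m}"
  \<comment> \<open>the factor \<open>[:0, 1:]\<close> removes the zeroth power sum, which is not controlled\<close>
  define q where "q = [:0, 1:] * (\<Prod>t\<in>S - {s}. [:- t, 1:])"
  have fin: "finite S" by (simp add: S_def)
  have q0: "poly q 0 = 0" by (simp add: q_def)
  have qs: "poly q s \<noteq> 0" using fin assms(2) by (auto simp: q_def poly_prod)
  have qt: "poly q t = 0" if "t \<in> S" "t \<noteq> s" for t using fin that by (auto simp: q_def poly_prod)
  have sumq: "(\<Sum>i<m. poly q (z i)) = of_nat (card {i. i < m \<and> z i = s}) * poly q s"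
    if "z ` {..<m} \<subseteq> S" for z
  proof -
    have "(\<Sum>i<m. poly q (z i)) = (\<Sum>i<m. if z i = s then poly q s else 0)"
      using that qt by (intro sum.cong) auto
    also have "\<dots> = (\<Sum>i\<in>{i. i < m \<and> z i = s}. poly q s)"
      by (simp add: sum.If_cases Collect_conj_eq lessThan_def)
    finally show ?thesis by simp
  qed
  have pw: "(\<Sum>i<m. poly q (z i)) = (\<Sum>n\<in>{1..degree q}. coeff q n * (\<Sum>i<m. z i ^ n))" for z
  proof -
    have "poly q x = (\<Sum>n\<in>{1..degree q}. coeff q n * x ^ n)" for x
    proof -
      have "poly q x = coeff q 0 + (\<Sum>n\<in>{1..degree q}. coeff q n * x ^ n)"
        unfolding poly_altdef by (simp add: atMost_atLeast0 sum.atLeast_Suc_atMost)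
      thus ?thesis using q0 by (simp add: poly_0_coeff_0)
    qed
    thus ?thesis by (simp add: sum_distrib_left sum.swap[of _ "{..<m}"])
  qed
  have "(\<Sum>i<m. poly q (a i)) = (\<Sum>i<m. poly q (b i))"
    unfolding pw using assms(1) by (intro sum.cong) auto
  hence "of_nat (card {i. i < m \<and> a i = s}) * poly q s = of_nat (card {i. i < m \<and> b i = s}) * poly q s"
    using sumq[of a] sumq[of b] by (simp add: S_def)
  thus ?thesis using qs by simp
qed

lemma power_sums_zero:
  fixes a :: "nat \<Rightarrow> 'a::field_char_0"
  assumes "\<And>n. n \<ge> 1 \<Longrightarrow> (\<Sum>i<m. a i ^ n) = 0" "i < m"
  shows "a i = 0"
proof (rule ccontr)
  assume n0: "a i \<noteq> 0"
  have "card {k. k < m \<and> a k = a i} = card {k. k < m \<and> (0 :: 'a) = a i}"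
    by (rule power_sums_eq[where m = m and a = a and b = "\<lambda>_. 0"]) (use assms n0 in auto)
  hence "{k. k < m \<and> a k = a i} = {}" using n0 by simp
  thus False using assms(2) by blast
qed

lemma det_replace_row:
  fixes w :: "nat \<Rightarrow> nat \<Rightarrow> 'a::comm_ring_1"
  assumes "finite J" "J \<subseteq> {..<m}" "j \<in> J"
  shows "det (mat m m (\<lambda>(k, i). if k = j then (\<Sum>k\<in>J. a k * w k i) else w k i)) = a j * det (mat m m (\<lambda>(k, i). w k i))"
proof -
  define W where "W b S = mat m m (\<lambda>(k, i). if k = j then b * w j i + (\<Sum>k\<in>S. a k * w k i) else w k i)" for b S
  have jm: "j < m" using assms by auto
  have "finite (J - {j})" "J - {j} \<subseteq> {..<m} - {j}" using assms by auto
  hence "det (W b (J - {j})) = det (W b {})" for b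
  proof (induction "J - {j}" arbitrary: J rule: finite_induct)
    case empty thus ?case by metis
  next
    case (insert x F)
    have e: "J - {j} = insert x F" using insert by simp
    have x: "x < m" "x \<noteq> j" using insert.prems e by auto
    have "W b (insert x F) = addrow (a x) j x (W b F)"
    proof (rule eq_matI)
      fix k i assume ki: "k < dim_row (addrow (a x) j x (W b F))" "i < dim_col (addrow (a x) j x (W b F))"
      hence ki: "k < m" "i < m" by (auto simp: W_def)
      have "(\<Sum>l\<in>insert x F. a l * w l i) = a x * w x i + (\<Sum>l\<in>F. a l * w l i)"
        by (rule sum.insert[OF insert.hyps(1,2)])
      thus "W b (insert x F) $$ (k, i) = addrow (a x) j x (W b F) $$ (k, i)"
        using ki x jm by (simp add: W_def)
    qed (auto simp: W_def)
    moreover have "W b F \<in> carrier_mat m m" by (simp add: W_def)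
    ultimately have 1: "det (W b (insert x F)) = det (W b F)"
      using det_addrow[of x m j "W b F" "a x"] x by simp
    have F: "F = F - {j}" using e by auto
    have "det (W b (F - {j})) = det (W b {})" using insert.hyps(3)[of F] F insert.prems e by auto
    thus ?case using 1 e F by metis
  qed
  moreover have "W (a j) (J - {j}) = mat m m (\<lambda>(k, i). if k = j then (\<Sum>k\<in>J. a k * w k i) else w k i)"
    unfolding W_def using assms by (intro cong_mat) (auto simp: sum.remove[of J j])
  moreover have "W (a j) {} = multrow j (a j) (mat m m (\<lambda>(k, i). w k i))"
    by (rule eq_matI) (auto simp: W_def)
  ultimately show ?thesis using det_multrow[OF jm, of "mat m m (\<lambda>(k, i). w k i)" "a j"] by (metis mat_carrier)
qed

text \<open>
  \<open>y\<close> enumerates the roots of the irreducible polynomial \<open>g\<close> among the Laurent series, that is, its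
  conjugate expansions at infinity.
\<close>
locale branches =
  fixes N :: nat and g :: "'a::{alg_closed_field, field_char_0} poly poly" and m :: nat and y :: "nat \<Rightarrow> 'a fls"
  assumes N: "N > 0" and irr: "prim_irr g" and m: "degree g = m" and m2: "m \<ge> 2"
    and inj: "inj_on y {..<m}" and roots: "y ` {..<m} = lroots N g"
begin

lemma g_root: "i < m \<Longrightarrow> lpoly N g (y i) = 0"
  using roots by (auto simp: lroots_def)

lemma vanish_dvd: "i < m \<Longrightarrow> lpoly N h (y i) = 0 \<Longrightarrow> g dvd h"
  using prim_irr_dvd[OF N irr g_root] by blast

lemma vanish_eq_0: "i < m \<Longrightarrow> lpoly N h (y i) = 0 \<Longrightarrow> degree h < m \<Longrightarrow> h = 0"
  using vanish_dvd[of i h] dvd_imp_degree_le[of g h] m by force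

text \<open>
  The ring \<open>\<Lambda>\<close> of multipliers of the \<open>K[x]\<close>-module spanned by \<open>1, y, \<dots>, y\<^sup>m\<^sup>-\<^sup>1\<close>.  For monic \<open>g\<close> it is
  \<open>K[x,y] / (g)\<close>.  In general \<open>y\<close> itself need not be a multiplier, and the members are the functions regular on
  the closure of the curve \<open>g = 0\<close> in the product of the affine line and the projective line.
\<close>
definition Lam :: "(nat \<Rightarrow> 'a fls) \<Rightarrow> bool" where
  "Lam z \<longleftrightarrow> (\<forall>P. degree P < m \<longrightarrow> (\<exists>Q. degree Q < m \<and> (\<forall>i<m. z i * lpoly N P (y i) = lpoly N Q (y i))))"

lemma Lam_1: "Lam (\<lambda>_. 1)"
  unfolding Lam_def by auto

lemma Lam_emb: "Lam (\<lambda>_. emb N c)"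
  unfolding Lam_def
proof (intro allI impI)
  fix P :: "'a poly poly" assume "degree P < m"
  thus "\<exists>Q. degree Q < m \<and> (\<forall>i<m. emb N c * lpoly N P (y i) = lpoly N Q (y i))"
    by (intro exI[of _ "smult c P"]) (auto simp: lpoly_smult[OF N] intro: le_less_trans[OF degree_smult_le])
qed

lemma Lam_add: "Lam z \<Longrightarrow> Lam z' \<Longrightarrow> Lam (\<lambda>i. z i + z' i)"
  unfolding Lam_def
proof (intro allI impI)
  fix P :: "'a poly poly"
  assume a: "\<forall>P. degree P < m \<longrightarrow> (\<exists>Q. degree Q < m \<and> (\<forall>i<m. z i * lpoly N P (y i) = lpoly N Q (y i)))"
    "\<forall>P. degree P < m \<longrightarrow> (\<exists>Q. degree Q < m \<and> (\<forall>i<m. z' i * lpoly N P (y i) = lpoly N Q (y i)))"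
    "degree P < m"
  then obtain Q Q' where "degree Q < m" "\<forall>i<m. z i * lpoly N P (y i) = lpoly N Q (y i)"
     "degree Q' < m" "\<forall>i<m. z' i * lpoly N P (y i) = lpoly N Q' (y i)" by metis
  thus "\<exists>Q. degree Q < m \<and> (\<forall>i<m. (z i + z' i) * lpoly N P (y i) = lpoly N Q (y i))"
    by (intro exI[of _ "Q + Q'"]) (auto simp: lpoly_add[OF N] algebra_simps intro: degree_add_less)
qed

lemma Lam_mult: "Lam z \<Longrightarrow> Lam z' \<Longrightarrow> Lam (\<lambda>i. z i * z' i)"
  unfolding Lam_def
proof (intro allI impI)
  fix P :: "'a poly poly"
  assume a: "\<forall>P. degree P < m \<longrightarrow> (\<exists>Q. degree Q < m \<and> (\<forall>i<m. z i * lpoly N P (y i) = lpoly N Q (y i)))"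
    "\<forall>P. degree P < m \<longrightarrow> (\<exists>Q. degree Q < m \<and> (\<forall>i<m. z' i * lpoly N P (y i) = lpoly N Q (y i)))"
    "degree P < m"
  then obtain Q where Q: "degree Q < m" "\<forall>i<m. z' i * lpoly N P (y i) = lpoly N Q (y i)" by metis
  then obtain R where "degree R < m" "\<forall>i<m. z i * lpoly N Q (y i) = lpoly N R (y i)" using a by metis
  thus "\<exists>Q. degree Q < m \<and> (\<forall>i<m. z i * z' i * lpoly N P (y i) = lpoly N Q (y i))"
    using Q by (intro exI[of _ R]) (auto simp: mult.assoc)
qed

lemma Lam_power: "Lam z \<Longrightarrow> Lam (\<lambda>i. z i ^ n)"
  by (induction n) (auto simp: Lam_1 intro: Lam_mult)

lemma Lam_sum: "(\<And>k. k \<in> S \<Longrightarrow> Lam (z k)) \<Longrightarrow> Lam (\<lambda>i. \<Sum>k\<in>S. z k i)"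
proof (induction S rule: infinite_finite_induct)
  case (insert x S) thus ?case by (simp add: Lam_add)
qed (use Lam_emb[of 0] in auto)

lemma Lam_imp_poly: "Lam z \<Longrightarrow> \<exists>Q. degree Q < m \<and> (\<forall>i<m. z i = lpoly N Q (y i))"
proof -
  interpret e: comm_ring_hom "emb N :: 'a poly \<Rightarrow> 'a fls" by (rule emb_hom)
  have 1: "map_poly (emb N) (1 :: 'a poly poly) = 1" by (rule poly_eqI) (simp add: coeff_map_poly)
  assume "Lam z"
  moreover have "degree (1 :: 'a poly poly) < m" using m2 by simp
  ultimately obtain Q where "degree Q < m" "\<forall>i<m. z i * lpoly N 1 (y i) = lpoly N Q (y i)"
    unfolding Lam_def by blast
  thus ?thesis by (intro exI[of _ Q]) (auto simp: 1)
qed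

text \<open>
  Stability needs to be tested on the powers of \<open>y\<close> only.
\<close>
lemma Lam_monomI:
  assumes "\<And>s. s < m \<Longrightarrow> \<exists>Q. degree Q < m \<and> (\<forall>i<m. z i * y i ^ s = lpoly N Q (y i))"
  shows "Lam z"
  unfolding Lam_def
proof (intro allI impI)
  fix P :: "'a poly poly" assume P: "degree P < m"
  obtain Q where Q: "\<And>s. s < m \<Longrightarrow> degree (Q s) < m \<and> (\<forall>i<m. z i * y i ^ s = lpoly N (Q s) (y i))"
    using assms by metis
  interpret em: map_poly_comm_ring_hom "emb N :: 'a poly \<Rightarrow> 'a fls" 
    by (simp add: map_poly_comm_ring_hom_def emb_hom)
  have "degree (\<Sum>s<m. smult (coeff P s) (Q s)) < m"
    using Q m2 by (intro degree_sum_less) (auto intro: le_less_trans[OF degree_smult_le])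
  moreover have "z i * lpoly N P (y i) = lpoly N (\<Sum>s<m. smult (coeff P s) (Q s)) (y i)" if "i < m" for i
  proof -
    have "z i * lpoly N P (y i) = (\<Sum>s<m. emb N (coeff P s) * (z i * y i ^ s))"
      by (simp add: lpoly_altdef[OF N P] sum_distrib_left mult_ac)
    also have "\<dots> = (\<Sum>s<m. emb N (coeff P s) * lpoly N (Q s) (y i))"
      using Q that by (intro sum.cong) auto
    finally show ?thesis by (simp add: em.hom_sum poly_sum lpoly_smult[OF N])
  qed
  ultimately show "\<exists>Q. degree Q < m \<and> (\<forall>i<m. z i * lpoly N P (y i) = lpoly N Q (y i))" by blast
qed

text \<open>
  Multiplication by \<open>z\<close> acts on the free module with basis \<open>1, y, \<dots>, y\<^sup>m\<^sup>-\<^sup>1\<close> by a matrix over \<open>K[x]\<close>;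
  its eigenvalues are the \<open>z\<^sub>i\<close>, so the trace is a polynomial.  The Vandermonde matrix diagonalises it.
\<close>
lemma Lam_trace:
  assumes "Lam z"
  shows "\<exists>q. (\<Sum>i<m. z i) = emb N q"
proof -
  define E where "E = vander m y"
  have E: "E \<in> carrier_mat m m" by (simp add: E_def vander_def)
  have "det E \<noteq> 0" using det_vander_nonzero[OF inj] by (simp add: E_def)
  then obtain B where B: "B \<in> carrier_mat m m" "E * B = 1\<^sub>m m" "B * E = 1\<^sub>m m"
    using det_non_zero_imp_unit[OF E] unfolding Units_def ring_mat_def by auto
  have "\<exists>Q. degree Q < m \<and> (\<forall>i<m. z i * y i ^ (m - 1 - s) = lpoly N Q (y i))" if "s < m" for s
  proof -
    interpret e: comm_ring_hom "emb N :: 'a poly \<Rightarrow> 'a fls" by (rule emb_hom)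
    have "lpoly N (monom 1 k) r = r ^ k" for k and r :: "'a fls"
      by (simp add: poly_monom)
    moreover have "degree (monom (1 :: 'a poly) (m - 1 - s)) < m" using m2 by (simp add: degree_monom_eq)
    ultimately show ?thesis using assms unfolding Lam_def by (metis mult.commute)
  qed
  then obtain Q where Q: "\<And>s. s < m \<Longrightarrow> degree (Q s) < m"
    "\<And>s i. s < m \<Longrightarrow> i < m \<Longrightarrow> z i * y i ^ (m - 1 - s) = lpoly N (Q s) (y i)" by metis
  have zE: "z i * E $$ (s, i) = (\<Sum>k<m. emb N (coeff (Q s) (m - 1 - k)) * E $$ (k, i))" if "s < m" "i < m" for s i
  proof -
    have "z i * E $$ (s, i) = (\<Sum>k<m. emb N (coeff (Q s) k) * y i ^ k)"
      using Q that lpoly_altdef[OF N Q(1)] by (simp add: E_def vander_def)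
    also have "\<dots> = (\<Sum>k<m. emb N (coeff (Q s) (m - 1 - k)) * y i ^ (m - 1 - k))"
      by (rule sum.reindex_bij_witness[of _ "\<lambda>k. m - 1 - k" "\<lambda>k. m - 1 - k"]) auto
    finally show ?thesis using that by (simp add: E_def vander_def)
  qed
  have EB: "(\<Sum>i<m. E $$ (k, i) * B $$ (i, s)) = (if k = s then 1 else 0)" if "k < m" "s < m" for k s
  proof -
    have "(E * B) $$ (k, s) = (\<Sum>i<m. E $$ (k, i) * B $$ (i, s))"
      using E B(1) that by (auto simp: scalar_prod_def lessThan_atLeast0 intro!: sum.cong)
    thus ?thesis using B that by simp
  qed
  have BE: "(\<Sum>s<m. B $$ (i, s) * E $$ (s, i)) = 1" if "i < m" for i
  proof -
    have "(B * E) $$ (i, i) = (\<Sum>s<m. B $$ (i, s) * E $$ (s, i))"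
      using E B(1) that by (auto simp: scalar_prod_def lessThan_atLeast0 intro!: sum.cong)
    thus ?thesis using B that by simp
  qed
  have "(\<Sum>i<m. z i) = (\<Sum>i<m. \<Sum>s<m. B $$ (i, s) * (z i * E $$ (s, i)))"
    using BE by (intro sum.cong) (auto simp: sum_distrib_left[symmetric] mult_ac)
  also have "\<dots> = (\<Sum>i<m. \<Sum>s<m. \<Sum>k<m. emb N (coeff (Q s) (m - 1 - k)) * (E $$ (k, i) * B $$ (i, s)))"
    using zE by (intro sum.cong) (auto simp: sum_distrib_left mult_ac)
  also have "\<dots> = (\<Sum>s<m. \<Sum>k<m. \<Sum>i<m. emb N (coeff (Q s) (m - 1 - k)) * (E $$ (k, i) * B $$ (i, s)))"
    by (rule trans[OF sum.swap], rule sum.cong[OF refl], rule sum.swap)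
  also have "\<dots> = (\<Sum>s<m. \<Sum>k<m. emb N (coeff (Q s) (m - 1 - k)) * (if k = s then 1 else 0))"
    using EB by (intro sum.cong) (auto simp: sum_distrib_left[symmetric])
  also have "\<dots> = (\<Sum>s<m. emb N (coeff (Q s) (m - 1 - s)))"
    by (intro sum.cong refl) (simp add: if_distrib[of "\<lambda>x. _ * x"] cong: if_cong)
  also have "\<dots> = emb N (\<Sum>s<m. coeff (Q s) (m - 1 - s))"
  proof -
    interpret e: comm_ring_hom "emb N :: 'a poly \<Rightarrow> 'a fls" by (rule emb_hom)
    show ?thesis by (simp add: e.hom_sum)
  qed
  finally show ?thesis by blast
qed

text \<open>
  All pole orders of the tuple are at most \<open>v\<close>.
\<close>
definition bnd :: "(nat \<Rightarrow> 'a fls) \<Rightarrow> int \<Rightarrow> bool" where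
  "bnd z v \<longleftrightarrow> (\<forall>i<m. \<forall>n. n < - v \<longrightarrow> fls_nth (z i) n = 0)"

text \<open>
  The vector of leading coefficients with respect to the pole order \<open>v\<close>.
\<close>
definition ld :: "(nat \<Rightarrow> 'a fls) \<Rightarrow> int \<Rightarrow> nat \<Rightarrow> 'a" where
  "ld z v i = fls_nth (z i) (-v)"

lemma bnd_mult: 
  assumes "bnd z a" "bnd z' b"
  shows "bnd (\<lambda>i. z i * z' i) (a + b)" "i < m \<Longrightarrow> ld (\<lambda>i. z i * z' i) (a + b) i = ld z a i * ld z' b i"
proof -
  have *: "fls_nth (z i * z' i) (- a + - b) = fls_nth (z i) (- a) * fls_nth (z' i) (- b)"
     "\<And>n. n < - a + - b \<Longrightarrow> fls_nth (z i * z' i) n = 0" if "i < m" for i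
    using fls_nth_mult_low[of "-a" "z i" "-b" "z' i"] assms that unfolding bnd_def by auto
  show "bnd (\<lambda>i. z i * z' i) (a + b)" using *(2) by (simp add: bnd_def)
  show "i < m \<Longrightarrow> ld (\<lambda>i. z i * z' i) (a + b) i = ld z a i * ld z' b i"
    using *(1) by (simp add: ld_def)
qed

lemma bnd_power: 
  assumes "bnd z a"
  shows "bnd (\<lambda>i. z i ^ k) (int k * a)" "i < m \<Longrightarrow> ld (\<lambda>i. z i ^ k) (int k * a) i = ld z a i ^ k"
  using fls_nth_power_low[of "-a" "z _" k] assms unfolding bnd_def ld_def by auto

lemma bnd_sum: "(\<And>k. k \<in> S \<Longrightarrow> bnd (z k) a) \<Longrightarrow> bnd (\<lambda>i. \<Sum>k\<in>S. z k i) a"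
  unfolding bnd_def by (auto simp: fls_sum_nth)

lemma ld_sum: "ld (\<lambda>i. \<Sum>k\<in>S. z k i) a i = (\<Sum>k\<in>S. ld (z k) a i)"
  unfolding ld_def by (simp add: fls_sum_nth)

lemma bnd_monom:
  assumes "bnd z a"
  shows "bnd (\<lambda>i. emb N (monom c e) * z i) (int (N * e) + a)"
    "i < m \<Longrightarrow> ld (\<lambda>i. emb N (monom c e) * z i) (int (N * e) + a) i = c * ld z a i"
proof -
  have b: "bnd (\<lambda>_. emb N (monom c e)) (int (N * e))"
  proof (cases "c = 0")
    case False
    hence "fls_subdegree (emb N (monom c e)) = - int (N * e)"
      using emb_subdegree[OF N, of "monom c e"] by (simp add: degree_monom_eq)
    thus ?thesis by (auto simp: bnd_def)
  qed (simp add: bnd_def)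
  have "ld (\<lambda>_. emb N (monom c e)) (int (N * e)) i = c"
    using N by (simp add: ld_def emb_nth)
  thus "i < m \<Longrightarrow> ld (\<lambda>i. emb N (monom c e) * z i) (int (N * e) + a) i = c * ld z a i"
    using bnd_mult(2)[OF b assms] by simp
  show "bnd (\<lambda>i. emb N (monom c e) * z i) (int (N * e) + a)" using bnd_mult(1)[OF b assms] .
qed

text \<open>
  The sum of the leading coefficients is the coefficient of \<open>t\<^sup>-\<^sup>v\<close> in the trace, and the trace is a
  polynomial in \<open>t\<^sup>-\<^sup>N\<close>.
\<close>
lemma trace_nonzero:
  assumes "Lam z" "(\<Sum>i<m. ld z v i) \<noteq> 0"
  shows "v \<ge> 0" "int N dvd v"
proof -
  obtain q where q: "(\<Sum>i<m. z i) = emb N q" using Lam_trace[OF assms(1)] by blast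
  have "fls_nth (\<Sum>i<m. z i) (- v) \<noteq> 0" using assms(2) by (simp add: fls_sum_nth ld_def)
  thus "v \<ge> 0" "int N dvd v" unfolding q using N by (auto simp: emb_nth split: if_splits)
qed

text \<open>
  The traces of all powers vanish at infinity, and a polynomial vanishing at infinity is zero.
\<close>
lemma Lam_neg_bnd:
  assumes "Lam z" "bnd z v" "v < 0" "i < m"
  shows "z i = 0"
proof (rule power_sums_zero[OF _ assms(4)])
  fix n :: nat assume n: "n \<ge> 1"
  obtain q where q: "(\<Sum>i<m. z i ^ n) = emb N q" using Lam_trace[OF Lam_power[OF assms(1)]] by blast
  show "(\<Sum>i<m. z i ^ n) = 0"
  proof (rule fls_eqI)
    fix k
    show "fls_nth (\<Sum>i<m. z i ^ n) k = fls_nth 0 k"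
    proof (cases "k \<le> 0")
      case True
      have "int n * v < 0" using n assms(3) by (simp add: mult_pos_neg)
      hence "k < - (int n * v)" using True by linarith
      thus ?thesis using bnd_power(1)[OF assms(2), of n] by (simp add: bnd_def fls_sum_nth)
    next
      case False thus ?thesis unfolding q using N by (simp add: emb_nth)
    qed
  qed
qed

text \<open>
  Without poles the traces of all powers are constants, so \<open>z\<close> has the same power sums as the vector of
  its constant terms and its entries are constants.  Conjugate constants are equal since \<open>g\<close> is irreducible.
\<close>
lemma Lam_bnd_0:
  assumes "Lam z" "bnd z 0"
  shows "\<exists>c. \<forall>i<m. z i = fls_const c"
proof -
  define b where "b i = fls_const (ld z 0 i)" for i
  have pw: "(\<Sum>i<m. z i ^ n) = (\<Sum>i<m. b i ^ n)" for n
  proof (rule fls_eqI)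
    fix k
    obtain q where q: "(\<Sum>i<m. z i ^ n) = emb N q" using Lam_trace[OF Lam_power[OF assms(1)]] by blast
    have B: "b i ^ n = fls_const (ld z 0 i ^ n)" for i by (simp add: b_def fls_const_power)
    show "fls_nth (\<Sum>i<m. z i ^ n) k = fls_nth (\<Sum>i<m. b i ^ n) k"
    proof (cases k "0 :: int" rule: linorder_cases)
      case less
      thus ?thesis using bnd_power(1)[OF assms(2), of n] by (simp add: bnd_def fls_sum_nth B)
    next
      case equal
      thus ?thesis using bnd_power(2)[OF assms(2), of _ n] by (simp add: fls_sum_nth B ld_def)
    next
      case greater
      have "fls_nth (\<Sum>i<m. z i ^ n) k = 0" unfolding q using N greater by (simp add: emb_nth)
      thus ?thesis using greater by (simp add: fls_sum_nth B)
    qed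
  qed
  have const: "\<exists>c. z i = fls_const c" if "i < m" for i
  proof (cases "z i = 0")
    case True thus ?thesis by (intro exI[of _ 0]) simp
  next
    case False
    have "card {k. k < m \<and> z k = z i} = card {k. k < m \<and> b k = z i}"
      using pw False by (intro power_sums_eq) auto
    moreover have "i \<in> {k. k < m \<and> z k = z i}" using that by simp
    hence "card {k. k < m \<and> z k = z i} > 0" by (subst card_gt_0_iff) auto
    ultimately obtain k where "k < m" "b k = z i" by (metis (mono_tags, lifting) card_gt_0_iff ex_in_conv mem_Collect_eq)
    hence "z i = fls_const (ld z 0 k)" by (simp add: b_def)
    thus ?thesis by (rule exI)
  qed
  obtain Q where Q: "degree Q < m" "\<And>i. i < m \<Longrightarrow> z i = lpoly N Q (y i)" using Lam_imp_poly[OF assms(1)] by blast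
  obtain c where c: "z 0 = fls_const c" using const[of 0] m2 by auto
  have "Q - [:[:c:]:] = 0"
  proof (rule vanish_eq_0[of 0])
    show "lpoly N (Q - [:[:c:]:]) (y 0) = 0"
      using Q(2)[of 0] c m2 by (simp add: lpoly_diff[OF N] lpoly_pCons[OF N])
    show "degree (Q - [:[:c:]:]) < m" using Q m2 by (intro degree_diff_less) auto
  qed (use m2 in auto)
  hence "z i = fls_const c" if "i < m" for i
    using Q(2)[OF that] by (simp add: lpoly_pCons[OF N])
  thus ?thesis by (intro exI[of _ c] allI impI)
qed

end

section \<open>The discriminant as a determinant of multipliers\<close>

lemma coeff_synthetic_div: "coeff (synthetic_div p a) k = poly (poly_shift (Suc k) p) a"
  for p :: "'b::comm_ring_1 poly"
proof (induction p arbitrary: k)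
  case (pCons b p)
  have "poly_shift (Suc k) (pCons b p) = poly_shift k p" for k
    by (rule poly_eqI) (simp add: coeff_poly_shift coeff_pCons)
  moreover have "poly_shift 0 p = p" by (rule poly_eqI) (simp add: coeff_poly_shift)
  ultimately show ?case using pCons by (cases k) simp_all
qed simp

context branches begin

text \<open>
  The values of \<open>c\<^sub>m y\<^sup>m\<^sup>-\<^sup>k\<^sup>-\<^sup>1 + \<dots> + c\<^sub>k\<^sub>+\<^sub>1\<close>, where \<open>c\<^sub>j\<close> are the coefficients of \<open>g\<close>.  The last of
  these would be the constant \<open>c\<^sub>m\<close> and is replaced by \<open>1\<close>: this is the classical basis of the order attached to a
  binary form.
\<close>
definition w0 :: "nat \<Rightarrow> nat \<Rightarrow> 'a fls" where
  "w0 k i = (if k = m - 1 then 1 else lpoly N (poly_shift (Suc k) g) (y i))"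

text \<open>
  Multiplying by a low power of \<open>y\<close> keeps the degree small; for a high power the equation
  \<open>g(y) = 0\<close> exchanges the upper part of \<open>g\<close> for the negative of the lower part.
\<close>
lemma Lam_w0: "Lam (w0 k)"
proof (cases "k = m - 1")
  case True
  hence "w0 k = (\<lambda>_. 1)" by (simp add: w0_def fun_eq_iff)
  thus ?thesis using Lam_1 by simp
next
  case False
  interpret e: inj_comm_ring_hom "emb N :: 'a poly \<Rightarrow> 'a fls" by (rule emb_inj_hom[OF N])
  have "Lam (\<lambda>i. lpoly N (poly_shift (Suc k) g) (y i))"
  proof (rule Lam_monomI)
    fix s assume s: "s < m"
    define H where "H = poly_shift (Suc k) g"
    have mon: "lpoly N (monom 1 j) r = r ^ j" for j and r :: "'a fls" by (simp add: poly_monom)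
    show "\<exists>Q. degree Q < m \<and> (\<forall>i<m. lpoly N (poly_shift (Suc k) g) (y i) * y i ^ s = lpoly N Q (y i))"
    proof (cases "s \<le> k")
      case True
      have "degree H \<le> m - Suc k" unfolding H_def
        by (rule degree_le) (auto simp: coeff_poly_shift m[symmetric] intro!: coeff_eq_0)
      hence "degree (monom 1 s * H) \<le> s + (m - Suc k)"
        by (intro order.trans[OF degree_mult_le] add_mono) (auto simp: degree_monom_le)
      show ?thesis
      proof (cases "k < m")
        case True
        hence "degree (monom 1 s * H) < m" using \<open>s \<le> k\<close> \<open>degree (monom 1 s * H) \<le> s + (m - Suc k)\<close> by linarith
        thus ?thesis by (intro exI[of _ "monom 1 s * H"]) (auto simp: lpoly_mult[OF N] poly_monom H_def mult.commute)
      next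
        case False
        hence "H = 0" unfolding H_def by (intro poly_eqI) (simp add: coeff_poly_shift coeff_eq_0 m)
        thus ?thesis using m2 by (intro exI[of _ 0]) (auto simp: H_def[symmetric])
      qed
    next
      case False
      define A where "A = poly_cutoff (Suc k) g"
      have gA: "g = A + monom 1 (Suc k) * H"
        by (rule poly_eqI) (auto simp: A_def H_def coeff_poly_cutoff coeff_monom_mult coeff_poly_shift)
      define Q where "Q = - (monom 1 (s - Suc k) * A)"
      have "degree A \<le> k" unfolding A_def by (rule degree_le) (auto simp: coeff_poly_cutoff)
      hence "degree Q \<le> (s - Suc k) + k" unfolding Q_def degree_minus
        by (intro order.trans[OF degree_mult_le] add_mono) (auto simp: degree_monom_le)
      hence "degree Q < m" using s False by linarith
      moreover have "lpoly N H (y i) * y i ^ s = lpoly N Q (y i)" if "i < m" for i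
      proof -
        have "lpoly N A (y i) + y i ^ Suc k * lpoly N H (y i) = 0"
          using g_root[OF that] by (subst (asm) gA) (simp only: lpoly_add[OF N] lpoly_mult[OF N] mon)
        hence LA: "y i ^ Suc k * lpoly N H (y i) = - lpoly N A (y i)" by (simp add: add_eq_0_iff2)
        have ys: "y i ^ s = y i ^ (s - Suc k) * y i ^ Suc k" using False by (simp only: power_add[symmetric]) simp
        have "lpoly N H (y i) * y i ^ s = y i ^ (s - Suc k) * (y i ^ Suc k * lpoly N H (y i))"
          unfolding ys by (simp only: mult_ac)
        also have "\<dots> = y i ^ (s - Suc k) * - lpoly N A (y i)" by (simp only: LA)
        also have "\<dots> = lpoly N 0 (y i) - lpoly N (monom 1 (s - Suc k) * A) (y i)"
          by (simp add: lpoly_mult[OF N] poly_monom)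
        also have "\<dots> = lpoly N Q (y i)" unfolding Q_def by (subst lpoly_diff[OF N, symmetric]) simp
        finally show ?thesis .
      qed
      ultimately show ?thesis unfolding H_def by blast
    qed
  qed
  moreover have "w0 k = (\<lambda>i. lpoly N (poly_shift (Suc k) g) (y i))" using False by (simp add: w0_def fun_eq_iff)
  ultimately show ?thesis by simp
qed

definition dmat :: "(nat \<Rightarrow> nat \<Rightarrow> 'a fls) \<Rightarrow> 'a fls mat" where
  "dmat w = mat m m (\<lambda>(k, i). w k i)"

text \<open>
  The matrix of the unmodified family is a triangular matrix times the Vandermonde matrix, and its
  transpose times the Vandermonde matrix is diagonal with entries \<open>g'(y\<^sub>i)\<close>, because its entries are the
  coefficients of \<open>g / (Y - y\<^sub>i)\<close>.  Comparing pole orders gives the formula.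
\<close>
lemma discdeg_w0: "det (dmat w0) \<noteq> 0" "int N * discdeg g = - 2 * fls_subdegree (det (dmat w0))"
proof -
  interpret e: inj_comm_ring_hom "emb N :: 'a poly \<Rightarrow> 'a fls" by (rule emb_inj_hom[OF N])
  interpret ei: idom_hom "emb N :: 'a poly \<Rightarrow> 'a fls" by (rule idom_hom.intro[OF e.comm_ring_hom_axioms])
  define F where "F = map_poly (emb N) g"
  define c where "c = emb N (lead_coeff g)"
  have g0: "g \<noteq> 0" using m m2 by auto
  have c0: "c \<noteq> 0" using g0 by (simp add: c_def)
  have dF: "degree F = m" "coeff F m = c" by (simp_all add: F_def c_def m)
  have sh: "lpoly N (poly_shift k g) r = poly (poly_shift k F) r" for k r
  proof -
    have "map_poly (emb N) (poly_shift k g) = poly_shift k F"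
      by (rule poly_eqI) (simp add: F_def coeff_poly_shift)
    thus ?thesis by simp
  qed
  define eta where "eta k i = poly (poly_shift (Suc k) F) (y i)" for k i
  define V where "V = vander m y"
  define H where "H = dmat eta"
  have carr: "V \<in> carrier_mat m m" "H \<in> carrier_mat m m" by (auto simp: V_def vander_def H_def dmat_def)
  have V0: "det V \<noteq> 0" using det_vander_nonzero[OF inj] by (simp add: V_def)
  have etam: "eta (m - 1) i = c" for i
  proof -
    have "poly_shift m F = [:c:]"
      by (rule poly_eqI) (use dF in \<open>auto simp: coeff_poly_shift coeff_pCons coeff_eq_0 split: nat.split\<close>)
    thus ?thesis using m2 by (simp add: eta_def)
  qed
  have HW: "det H = c * det (dmat w0)"
  proof -
    have "H = multrow (m - 1) c (dmat w0)"
      by (rule eq_matI) (auto simp: H_def dmat_def w0_def etam[unfolded One_nat_def] sh eta_def[symmetric])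
    thus ?thesis using det_multrow[of "m - 1" m "dmat w0" c] m2 by (simp add: dmat_def)
  qed
  have HV: "det H = c ^ m * det V"
  proof -
    define C where "C = mat m m (\<lambda>(k, s). coeff F (k + 1 + (m - 1 - s)))"
    have C: "C \<in> carrier_mat m m" by (simp add: C_def)
    have "H = C * V"
    proof (rule eq_matI)
      fix k i assume "k < dim_row (C * V)" "i < dim_col (C * V)"
      hence ki: "k < m" "i < m" by (auto simp: C_def V_def vander_def)
      have "degree (poly_shift (Suc k) F) < m"
      proof -
        have "degree (poly_shift (Suc k) F) \<le> m - Suc k"
          by (rule degree_le) (auto simp: coeff_poly_shift dF intro!: coeff_eq_0)
        thus ?thesis using ki by linarith
      qed
      hence "eta k i = (\<Sum>s<m. coeff F (k + 1 + s) * y i ^ s)"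
        by (simp add: eta_def poly_sum_lessThan coeff_poly_shift add_ac)
      also have "\<dots> = (\<Sum>s<m. coeff F (k + 1 + (m - 1 - s)) * y i ^ (m - 1 - s))"
        by (rule sum.reindex_bij_witness[of _ "\<lambda>k. m - 1 - k" "\<lambda>k. m - 1 - k"]) auto
      also have "\<dots> = (C * V) $$ (k, i)"
        using ki by (auto simp: C_def V_def vander_def scalar_prod_def lessThan_atLeast0 intro!: sum.cong)
      finally show "H $$ (k, i) = (C * V) $$ (k, i)" using ki by (simp add: H_def dmat_def)
    qed (auto simp: H_def dmat_def C_def V_def vander_def)
    moreover have "det C = c ^ m"
    proof -
      have "det C = prod_list (diag_mat C)"
        by (rule det_upper_triangular[OF _ C]) (auto simp: upper_triangular_def C_def dF intro!: coeff_eq_0)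
      also have "diag_mat C = replicate m c"
        by (intro nth_equalityI) (auto simp: diag_mat_def C_def dF(2)[symmetric])
      finally show ?thesis by simp
    qed
    ultimately show ?thesis using det_mult[OF C carr(1)] by simp
  qed
  define E2 where "E2 = mat m m (\<lambda>(k, i). y i ^ k)"
  have E2: "E2 \<in> carrier_mat m m" by (simp add: E2_def)
  have E2V: "det E2 ^ 2 = det V ^ 2"
  proof -
    define P where "P = mat m m (\<lambda>(i, j). if j = m - 1 - i then 1 else (0 :: 'a fls))"
    have P: "P \<in> carrier_mat m m" by (simp add: P_def)
    have pm: "(\<Sum>k<m. (if k = m - 1 - i then 1 else 0) * f k) = f (m - 1 - i)" if "i < m" for i and f :: "nat \<Rightarrow> 'a fls"
    proof -
      have "(\<Sum>k<m. (if k = m - 1 - i then 1 else 0) * f k) = (\<Sum>k<m. if k = m - 1 - i then f k else 0)"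
        by (intro sum.cong) auto
      thus ?thesis using that by simp
    qed
    have "E2 = P * V"
    proof (rule eq_matI)
      fix i j assume "i < dim_row (P * V)" "j < dim_col (P * V)"
      hence ij: "i < m" "j < m" by (auto simp: P_def V_def vander_def)
      have "(P * V) $$ (i, j) = (\<Sum>k<m. (if k = m - 1 - i then 1 else 0) * y j ^ (m - 1 - k))"
        using ij by (auto simp: P_def V_def vander_def scalar_prod_def lessThan_atLeast0 intro!: sum.cong)
      also have "\<dots> = y j ^ i" using ij by (subst pm) auto
      finally show "E2 $$ (i, j) = (P * V) $$ (i, j)" using ij by (simp add: E2_def)
    qed (auto simp: E2_def P_def V_def vander_def)
    moreover have "P * P = 1\<^sub>m m"
    proof (rule eq_matI)
      fix i j assume "i < dim_row (1\<^sub>m m :: 'a fls mat)" "j < dim_col (1\<^sub>m m :: 'a fls mat)"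
      hence ij: "i < m" "j < m" by auto
      have "(P * P) $$ (i, j) = (\<Sum>k<m. (if k = m - 1 - i then 1 else 0) * (if j = m - 1 - k then 1 else 0))"
        using ij by (auto simp: P_def scalar_prod_def lessThan_atLeast0 intro!: sum.cong)
      also have "\<dots> = (if j = i then 1 else 0)" using ij by (subst pm) auto
      finally show "(P * P) $$ (i, j) = 1\<^sub>m m $$ (i, j)" using ij by simp
    qed (auto simp: P_def)
    hence "det P * det P = 1" using det_mult[OF P P] by simp
    ultimately show ?thesis using det_mult[OF P carr(1)] by (simp add: power2_eq_square mult_ac)
  qed
  define d where "d i = lpoly N (pderiv g) (y i)" for i
  have HE: "det H * det E2 = (\<Prod>i<m. d i)"
  proof -
    define Dg where "Dg = mat m m (\<lambda>(i, j). if i = j then d i else 0)"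
    have "transpose_mat H * E2 = Dg"
    proof (rule eq_matI)
      fix i j assume "i < dim_row Dg" "j < dim_col Dg"
      hence ij: "i < m" "j < m" by (auto simp: Dg_def)
      define S where "S = synthetic_div F (y i)"
      have dS: "degree S < m" using m2 by (simp add: S_def degree_synthetic_div dF)
      have Fi: "poly F (y i) = 0" "poly F (y j) = 0" using g_root ij by (auto simp: F_def)
      have FS: "F = [:- y i, 1:] * S"
        using synthetic_div_correct'[of "y i" F] Fi by (simp add: S_def del: mult_pCons_left)
      have "(transpose_mat H * E2) $$ (i, j) = (\<Sum>k<m. eta k i * y j ^ k)"
        using ij by (auto simp: H_def dmat_def E2_def scalar_prod_def lessThan_atLeast0 intro!: sum.cong)
      also have "\<dots> = poly S (y j)"
        by (subst poly_sum_lessThan[OF dS]) (simp add: S_def coeff_synthetic_div eta_def)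
      also have "\<dots> = (if i = j then d i else 0)"
      proof (cases "i = j")
        case True
        have "pderiv F = S + [:- y i, 1:] * pderiv S" unfolding FS by (subst pderiv_mult) (simp add: pderiv_pCons)
        hence "poly (pderiv F) (y i) = poly S (y i)" by simp
        moreover have "poly (pderiv F) (y i) = d i" by (simp add: F_def d_def ei.map_poly_pderiv)
        ultimately show ?thesis using True by simp
      next
        case False
        hence "y i \<noteq> y j" using inj ij by (auto simp: inj_on_def)
        moreover have "(y j - y i) * poly S (y j) = 0" using Fi(2) unfolding FS by auto
        ultimately show ?thesis using False by auto
      qed
      finally show "(transpose_mat H * E2) $$ (i, j) = Dg $$ (i, j)" using ij by (simp add: Dg_def)
    qed (use carr in \<open>auto simp: Dg_def E2_def\<close>)
    moreover have "det (transpose_mat H * E2) = det H * det E2"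
      using det_mult[of "transpose_mat H" m E2] carr E2 det_transpose[OF carr(2)] by simp
    moreover have "det Dg = (\<Prod>i<m. d i)"
    proof -
      have "det Dg = prod_list (diag_mat Dg)"
        by (rule det_upper_triangular[of _ m]) (auto simp: Dg_def upper_triangular_def)
      also have "diag_mat Dg = map d [0..<m]" by (auto simp: diag_mat_def Dg_def)
      finally show ?thesis by (simp add: prod_list_map_upt)
    qed
    ultimately show ?thesis by simp
  qed
  have ss: "sep_split N g"
    using N g0 card_image[OF inj] by (simp add: sep_split_def roots m)
  have R: "emb N (resultant g (pderiv g)) = c ^ (m - 1) * (\<Prod>i<m. d i)"
  proof -
    have "(\<Prod>r\<in>lroots N g. lpoly N (pderiv g) r) = (\<Prod>i<m. d i)"
      unfolding roots[symmetric] by (subst prod.reindex[OF inj]) (simp add: d_def)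
    thus ?thesis by (simp add: emb_resultant[OF N ss] degree_pderiv m c_def)
  qed
  have R0: "resultant g (pderiv g) \<noteq> 0" by (rule resultant_pderiv_nonzero[OF ss])
  have d0: "(\<Prod>i<m. d i) \<noteq> 0" using R R0 by (metis emb_eq_0_iff[OF N] mult_zero_right)
  show W0: "det (dmat w0) \<noteq> 0" using HV HW V0 c0 by auto
  define v where "v = (fls_subdegree :: 'a fls \<Rightarrow> int)"
  have E20: "det E2 \<noteq> 0" using E2V V0 by auto
  have vE: "v (det E2) = v (det V)"
  proof -
    have "v (det E2 ^ 2) = v (det V ^ 2)" using E2V by simp
    thus ?thesis using E20 V0 by (simp add: v_def power2_eq_square)
  qed
  have H0: "det H \<noteq> 0" using HV V0 c0 by simp
  have 1: "v (det H) = v c + v (det (dmat w0))" using HW c0 W0 by (simp add: v_def)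
  have 2: "v (det H) = int m * v c + v (det V)" using HV c0 V0 by (simp add: v_def fls_subdegree_pow)
  have 3: "v (det H) + v (det V) = v (\<Prod>i<m. d i)"
    using arg_cong[OF HE, of v] H0 E20 vE by (simp add: v_def)
  have 4: "v (emb N (resultant g (pderiv g))) = int (m - 1) * v c + v (\<Prod>i<m. d i)"
    using arg_cong[OF R, of v] c0 d0 by (simp add: v_def fls_subdegree_pow)
  have 5: "v (emb N (resultant g (pderiv g))) = - int (N * degree (resultant g (pderiv g)))"
    unfolding v_def by (rule emb_subdegree[OF N R0])
  have 6: "v c = - int (N * degree (lead_coeff g))"
    unfolding v_def c_def by (rule emb_subdegree[OF N]) (use g0 in auto)
  have "int N * discdeg g = v c - v (emb N (resultant g (pderiv g)))"
    by (simp add: discdeg_def 5 6 algebra_simps)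
  also have "\<dots> = - 2 * v (det (dmat w0))"
    using 1 2 3 4 m2 by (simp add: of_nat_diff algebra_simps)
  finally show "int N * discdeg g = - 2 * fls_subdegree (det (dmat w0))" by (simp add: v_def)
qed

end

section \<open>Reduced families of multipliers\<close>

context branches begin

text \<open>
  Families of multipliers with bounds for their poles whose determinant has the same order as that of
  \<open>w0\<close>.  Minimising the sum of the bounds among them is the reduction of a lattice basis.
\<close>
definition adm :: "(nat \<Rightarrow> nat \<Rightarrow> 'a fls) \<Rightarrow> (nat \<Rightarrow> nat) \<Rightarrow> bool" where
  "adm w v \<longleftrightarrow> (\<forall>k<m. Lam (w k) \<and> bnd (w k) (int (v k))) \<and> det (dmat w) \<noteq> 0 \<and>
     fls_subdegree (det (dmat w)) = fls_subdegree (det (dmat w0))"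

lemma bnd_exists: "\<exists>b::nat. bnd z (int b)"
proof -
  have "bnd z (int (\<Sum>i<m. nat (- fls_subdegree (z i))))"
    unfolding bnd_def
  proof (intro allI impI)
    fix i n assume i: "i < m" and n: "n < - int (\<Sum>i<m. nat (- fls_subdegree (z i)))"
    have "nat (- fls_subdegree (z i)) \<le> (\<Sum>i<m. nat (- fls_subdegree (z i)))"
      using i by (intro member_le_sum) auto
    hence "n < fls_subdegree (z i)" using n by linarith
    thus "fls_nth (z i) n = 0" by simp
  qed
  thus ?thesis by blast
qed

lemma minimal_exists:
  "\<exists>w v. adm w v \<and> (\<forall>w' v'. adm w' v' \<longrightarrow> (\<Sum>k<m. v k) \<le> (\<Sum>k<m. v' k))"
proof -
  have "\<forall>k. \<exists>b. bnd (w0 k) (int b)" using bnd_exists by blast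
  from choice[OF this] obtain v where "\<And>k. bnd (w0 k) (int (v k))" by blast
  hence "adm w0 v" using Lam_w0 discdeg_w0(1) by (simp add: adm_def)
  hence "(case (w0, v) of (w, v) \<Rightarrow> adm w v)" by simp
  from ex_has_least_nat[of "\<lambda>(w, v). adm w v" _ "\<lambda>(w, v). \<Sum>k<m. v k", OF this]
  show ?thesis by auto
qed

text \<open>
  Multiplying by powers of \<open>x\<close> shifts pole orders by multiples of \<open>N\<close>, so only members in one class
  modulo \<open>N\<close> can be combined.
\<close>
definition lead_comb :: "(nat \<Rightarrow> nat \<Rightarrow> 'a fls) \<Rightarrow> (nat \<Rightarrow> nat) \<Rightarrow> (nat \<Rightarrow> 'a) \<Rightarrow> nat \<Rightarrow> nat \<Rightarrow> 'a" where
  "lead_comb w v c \<rho> i = (\<Sum>k\<in>{k. k < m \<and> v k mod N = \<rho>}. c k * ld (w k) (int (v k)) i)"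

text \<open>
  Members whose pole orders are congruent modulo \<open>N\<close> are brought to the same order \<open>B\<close> by powers of
  \<open>x\<close> and then added.
\<close>
lemma class_comb:
  fixes c :: "nat \<Rightarrow> 'a"
  assumes w: "\<And>k. k < m \<Longrightarrow> Lam (w k) \<and> bnd (w k) (int (v k))"
    and S: "S \<subseteq> {..<m}" "\<And>k. k \<in> S \<Longrightarrow> v k \<le> B \<and> v k mod N = B mod N"
  defines "z \<equiv> \<lambda>i. \<Sum>k\<in>S. emb N (monom (c k) ((B - v k) div N)) * w k i"
  shows "Lam z" "bnd z (int B)" "\<And>i. i < m \<Longrightarrow> ld z (int B) i = (\<Sum>k\<in>S. c k * ld (w k) (int (v k)) i)"
proof -
  have e: "int (N * ((B - v k) div N)) + int (v k) = int B" if "k \<in> S" for k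
  proof -
    have "N dvd B - v k" using S(2)[OF that] mod_eq_dvd_iff_nat[of "v k" B N] by metis
    thus ?thesis using S(2)[OF that] by (simp add: of_nat_diff del: of_nat_mult)
  qed
  show "Lam z" unfolding z_def using w S(1) by (intro Lam_sum Lam_mult[OF Lam_emb]) auto
  have b: "bnd (\<lambda>i. emb N (monom (c k) ((B - v k) div N)) * w k i) (int B)" if "k \<in> S" for k
    using bnd_monom(1)[of "w k" "int (v k)" "c k" "(B - v k) div N"] w[of k] S(1) that e[OF that] by auto
  show "bnd z (int B)" unfolding z_def by (rule bnd_sum[OF b])
  fix i assume i: "i < m"
  show "ld z (int B) i = (\<Sum>k\<in>S. c k * ld (w k) (int (v k)) i)"
    unfolding z_def ld_sum
  proof (intro sum.cong refl)
    fix k assume k: "k \<in> S"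
    show "ld (\<lambda>i. emb N (monom (c k) ((B - v k) div N)) * w k i) (int B) i = c k * ld (w k) (int (v k)) i"
      using bnd_monom(2)[of "w k" "int (v k)" i "c k" "(B - v k) div N"] w[of k] S(1) k i e[OF k] by auto
  qed
qed

text \<open>
  A linear relation among leading vectors splits into its classes modulo \<open>N\<close>.  Otherwise some power
  sum of the part \<open>s\<^sub>\<rho>\<close> is nonzero, which fixes a pole order modulo \<open>N\<close>; then \<open>s\<^sub>\<rho>\<^sup>n\<^sup>-\<^sup>1\<close> is orthogonal to the parts of
  all other classes, and the sum of all parts is zero.
\<close>
lemma lead_comb_zero:
  assumes w: "\<And>k. k < m \<Longrightarrow> Lam (w k) \<and> bnd (w k) (int (v k))"
    and c: "\<And>i. i < m \<Longrightarrow> (\<Sum>k<m. c k * ld (w k) (int (v k)) i) = 0"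
    and \<rho>: "\<rho> < N" and i: "i < m"
  shows "lead_comb w v c \<rho> i = 0"
proof -
  define s where "s = lead_comb w v c"
  \<comment> \<open>an order in the class of \<open>\<sigma>\<close> that is at least every \<open>v k\<close>\<close>
  define B where "B \<sigma> = \<sigma> + N * (\<Sum>k<m. v k)" for \<sigma>
  define S where "S \<sigma> = {k. k < m \<and> v k mod N = \<sigma>}" for \<sigma>
  define z where "z \<sigma> i = (\<Sum>k\<in>S \<sigma>. emb N (monom (c k) ((B \<sigma> - v k) div N)) * w k i)" for \<sigma> i
  have zz: "Lam (z \<sigma>)" "bnd (z \<sigma>) (int (B \<sigma>))" "\<And>i. i < m \<Longrightarrow> ld (z \<sigma>) (int (B \<sigma>)) i = s \<sigma> i"
    if "\<sigma> < N" for \<sigma>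
  proof -
    have sub: "S \<sigma> \<subseteq> {..<m}" by (auto simp: S_def)
    have le: "v k \<le> B \<sigma> \<and> v k mod N = B \<sigma> mod N" if "k \<in> S \<sigma>" for k
    proof -
      have "v k \<le> (\<Sum>k<m. v k)" using that by (intro member_le_sum) (auto simp: S_def)
      also have "\<dots> \<le> N * (\<Sum>k<m. v k)" using N by simp
      finally show ?thesis using that \<open>\<sigma> < N\<close> by (simp add: B_def S_def)
    qed
    have zs: "z \<sigma> = (\<lambda>i. \<Sum>k\<in>S \<sigma>. emb N (monom (c k) ((B \<sigma> - v k) div N)) * w k i)"
      by (simp add: z_def fun_eq_iff)
    show "Lam (z \<sigma>)" unfolding zs by (rule class_comb(1)[where v = v and B = "B \<sigma>"]) (use w sub le in auto)
    show "bnd (z \<sigma>) (int (B \<sigma>))" unfolding zs by (rule class_comb(2)[where v = v and B = "B \<sigma>"]) (use w sub le in auto)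
    show "ld (z \<sigma>) (int (B \<sigma>)) i = s \<sigma> i" if "i < m" for i
    proof -
      have "ld (z \<sigma>) (int (B \<sigma>)) i = (\<Sum>k\<in>S \<sigma>. c k * ld (w k) (int (v k)) i)"
        unfolding zs by (rule class_comb(3)[where v = v and B = "B \<sigma>"]) (use w sub le that in auto)
      thus ?thesis by (simp add: s_def lead_comb_def S_def)
    qed
  qed
  have total: "(\<Sum>\<sigma><N. s \<sigma> i) = 0" if "i < m" for i
  proof -
    have "(\<Sum>\<sigma><N. s \<sigma> i) = (\<Sum>\<sigma><N. \<Sum>k<m. if v k mod N = \<sigma> then c k * ld (w k) (int (v k)) i else 0)"
      unfolding s_def lead_comb_def by (intro sum.cong refl sum.mono_neutral_cong_left) auto
    also have "\<dots> = (\<Sum>k<m. \<Sum>\<sigma><N. if v k mod N = \<sigma> then c k * ld (w k) (int (v k)) i else 0)" by (rule sum.swap)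
    also have "\<dots> = (\<Sum>k<m. c k * ld (w k) (int (v k)) i)" using N by (intro sum.cong refl) simp
    finally show ?thesis using c[OF that] by simp
  qed
  have "s \<rho> i = 0"
  proof (rule power_sums_zero[OF _ i])
    fix n :: nat assume n: "n \<ge> 1"
    show "(\<Sum>i<m. s \<rho> i ^ n) = 0"
    proof (rule ccontr)
      assume nz: "(\<Sum>i<m. s \<rho> i ^ n) \<noteq> 0"
      have ld1: "ld (\<lambda>i. z \<rho> i ^ k) (int k * int (B \<rho>)) i = s \<rho> i ^ k" if "i < m" for i k
        using bnd_power(2)[OF zz(2)[OF \<rho>] that, of k] zz(3)[OF \<rho> that] by simp
      have "(\<Sum>i<m. ld (\<lambda>i. z \<rho> i ^ n) (int n * int (B \<rho>)) i) \<noteq> 0" using nz ld1 by simp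
      from trace_nonzero(2)[OF Lam_power[OF zz(1)[OF \<rho>]] this] have d1: "int N dvd int n * int (B \<rho>)" .
      have orth: "(\<Sum>i<m. s \<sigma> i * s \<rho> i ^ (n - 1)) = 0" if \<sigma>: "\<sigma> < N" "\<sigma> \<noteq> \<rho>" for \<sigma>
      proof (rule ccontr)
        assume nz': "(\<Sum>i<m. s \<sigma> i * s \<rho> i ^ (n - 1)) \<noteq> 0"
        have "ld (\<lambda>i. z \<sigma> i * z \<rho> i ^ (n - 1)) (int (B \<sigma>) + int (n - 1) * int (B \<rho>)) i = s \<sigma> i * s \<rho> i ^ (n - 1)"
          if "i < m" for i
          using bnd_mult(2)[OF zz(2)[OF \<sigma>(1)] bnd_power(1)[OF zz(2)[OF \<rho>], of "n - 1"] that]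
            zz(3)[OF \<sigma>(1) that] ld1[OF that, of "n - 1"] by simp
        hence "(\<Sum>i<m. ld (\<lambda>i. z \<sigma> i * z \<rho> i ^ (n - 1)) (int (B \<sigma>) + int (n - 1) * int (B \<rho>)) i) \<noteq> 0"
          using nz' by simp
        from trace_nonzero(2)[OF Lam_mult[OF zz(1)[OF \<sigma>(1)] Lam_power[OF zz(1)[OF \<rho>]]] this]
        have "int N dvd int (B \<sigma>) + int (n - 1) * int (B \<rho>)" .
        hence "int N dvd int n * int (B \<rho>) - (int (B \<sigma>) + int (n - 1) * int (B \<rho>))" using d1 by (rule dvd_diff[rotated])
        hence "int N dvd int (B \<rho>) - int (B \<sigma>)" using n by (simp add: of_nat_diff algebra_simps)
        hence "int (B \<rho>) mod int N = int (B \<sigma>) mod int N" by (simp add: mod_eq_dvd_iff)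
        hence "B \<rho> mod N = B \<sigma> mod N" by (metis of_nat_mod of_nat_eq_iff)
        thus False using \<rho> \<sigma> by (simp add: B_def)
      qed
      have "0 = (\<Sum>i<m. (\<Sum>\<sigma><N. s \<sigma> i) * s \<rho> i ^ (n - 1))" using total by simp
      also have "\<dots> = (\<Sum>\<sigma><N. \<Sum>i<m. s \<sigma> i * s \<rho> i ^ (n - 1))"
        by (simp only: sum_distrib_right) (rule sum.swap)
      also have "\<dots> = (\<Sum>\<sigma><N. if \<sigma> = \<rho> then (\<Sum>i<m. s \<rho> i * s \<rho> i ^ (n - 1)) else 0)"
        using orth by (intro sum.cong) auto
      also have "\<dots> = (\<Sum>i<m. s \<rho> i ^ n)" using \<rho> n by (simp add: power_eq_if[of _ n])
      finally show False using nz by simp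
    qed
  qed
  thus ?thesis by (simp add: s_def)
qed

text \<open>
  A relation within one class produces a multiplier with a smaller pole order that may replace the member
  with the largest pole order, without changing the determinant except for a constant.  This contradicts minimality.
\<close>
lemma lead_independent:
  assumes adm: "adm w v" and min: "\<And>w' v'. adm w' v' \<Longrightarrow> (\<Sum>k<m. v k) \<le> (\<Sum>k<m. v' k)"
    and c: "\<And>i. i < m \<Longrightarrow> (\<Sum>k<m. c k * ld (w k) (int (v k)) i) = 0" and k: "k < m"
  shows "c k = 0"
proof (rule ccontr)
  assume ck: "c k \<noteq> 0"
  have w: "\<And>k. k < m \<Longrightarrow> Lam (w k) \<and> bnd (w k) (int (v k))" using adm by (auto simp: adm_def)
  define \<rho> where "\<rho> = v k mod N"
  have \<rho>: "\<rho> < N" using N by (simp add: \<rho>_def)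
  define J where "J = {l. l < m \<and> v l mod N = \<rho> \<and> c l \<noteq> 0}"
  have J: "finite J" "J \<noteq> {}" "J \<subseteq> {..<m}" using k ck by (auto simp: J_def \<rho>_def)
  then obtain j where j: "j \<in> J" "\<And>l. l \<in> J \<Longrightarrow> v l \<le> v j"
    using Max_in[of "v ` J"] Max_ge[of "v ` J"] by (metis (no_types, lifting) finite_imageI image_iff image_is_empty)
  have jm: "j < m" and cj: "c j \<noteq> 0" using j by (auto simp: J_def)
  define z where "z i = (\<Sum>l\<in>J. emb N (monom (c l) ((v j - v l) div N)) * w l i)" for i
  have zs: "z = (\<lambda>i. \<Sum>l\<in>J. emb N (monom (c l) ((v j - v l) div N)) * w l i)"
    by (simp add: z_def fun_eq_iff)
  have le: "v l \<le> v j \<and> v l mod N = v j mod N" if "l \<in> J" for l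
    using j(2)[OF that] that j(1) by (simp add: J_def)
  note zz = class_comb[where w = w and v = v and S = J and B = "v j" and c = c, OF w J(3) le, folded zs]
  have "(\<Sum>l\<in>J. c l * ld (w l) (int (v l)) i) = 0" if "i < m" for i
  proof -
    have "(\<Sum>l\<in>J. c l * ld (w l) (int (v l)) i) = lead_comb w v c \<rho> i"
      unfolding lead_comb_def by (rule sum.mono_neutral_left) (auto simp: J_def)
    thus ?thesis using lead_comb_zero[OF w c \<rho> that] by simp
  qed
  hence bz: "bnd z (int (v j) - 1)"
    using zz(2,3) unfolding bnd_def ld_def by (smt (verit, best))
  define w' where "w' = w(j := z)"
  have dw': "det (dmat w') = fls_const (c j) * det (dmat w)"
  proof -
    have "det (mat m m (\<lambda>(k, i). if k = j then (\<Sum>l\<in>J. emb N (monom (c l) ((v j - v l) div N)) * w l i) else w k i)) =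
       emb N (monom (c j) ((v j - v j) div N)) * det (mat m m (\<lambda>(k, i). w k i))"
      by (rule det_replace_row[OF J(1,3) j(1)])
    moreover have "dmat w' = mat m m (\<lambda>(k, i). if k = j then (\<Sum>l\<in>J. emb N (monom (c l) ((v j - v l) div N)) * w l i) else w k i)"
      unfolding dmat_def w'_def z_def by (intro cong_mat) auto
    ultimately show ?thesis by (simp add: dmat_def monom_0)
  qed
  hence d0: "det (dmat w') \<noteq> 0" using adm cj by (simp add: adm_def fls_const_nonzero)
  have sd: "fls_subdegree (det (dmat w')) = fls_subdegree (det (dmat w0))"
    unfolding dw' using adm cj by (simp add: adm_def fls_const_nonzero)
  show False
  proof (cases "v j = 0")
    case True
    have z0: "z i = 0" if "i < m" for i using Lam_neg_bnd[OF zz(1) bz _ that] True by simp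
    have "det (dmat w') = 0"
    proof -
      have "dmat w' = multrow j 0 (dmat w')"
        by (rule eq_matI) (auto simp: dmat_def w'_def z0)
      hence "det (dmat w') = det (multrow j 0 (dmat w'))" by simp
      also have "\<dots> = 0" using det_multrow[OF jm, of "dmat w'" 0] by (simp add: dmat_def)
      finally show ?thesis .
    qed
    thus False using d0 by simp
  next
    case False
    define v' where "v' = v(j := v j - 1)"
    have "adm w' v'" unfolding adm_def
      using w zz(1) bz d0 sd False by (auto simp: w'_def v'_def of_nat_diff)
    from min[OF this] have "(\<Sum>k<m. v k) \<le> (\<Sum>k<m. v' k)" .
    moreover have "(\<Sum>k<m. v' k) < (\<Sum>k<m. v k)"
      by (rule sum_strict_mono_ex1) (use jm False in \<open>auto simp: v'_def\<close>)
    ultimately show False by simp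
  qed
qed

text \<open>
  The coefficient of the determinant at the expected order is the determinant of the leading vectors.
\<close>
lemma subdegree_det:
  assumes "\<And>k. k < m \<Longrightarrow> bnd (w k) (int (v k))"
    and "det (mat m m (\<lambda>(k, i). ld (w k) (int (v k)) i)) \<noteq> 0"
  shows "fls_subdegree (det (dmat w)) = - int (\<Sum>k<m. v k)"
proof -
  define Pm where "Pm = {p. p permutes {0..<m}}"
  have P: "fls_nth (\<Prod>k<m. w k (p k)) (- int (\<Sum>k<m. v k)) = (\<Prod>k<m. ld (w k) (int (v k)) (p k))"
    "\<And>n. n < - int (\<Sum>k<m. v k) \<Longrightarrow> fls_nth (\<Prod>k<m. w k (p k)) n = 0" if "p \<in> Pm" for p
  proof -
    have "p k < m" if "k < m" for k using \<open>p \<in> Pm\<close> that permutes_in_image[of p "{0..<m}" k] by (auto simp: Pm_def)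
    hence "fls_nth (w k (p k)) n = 0" if "k \<in> {..<m}" "n < - int (v k)" for k n
      using assms(1)[of k] that unfolding bnd_def by auto
    from fls_nth_prod_low[of "{..<m}" "\<lambda>k. - int (v k)" "\<lambda>k. w k (p k)", OF this]
    show "fls_nth (\<Prod>k<m. w k (p k)) (- int (\<Sum>k<m. v k)) = (\<Prod>k<m. ld (w k) (int (v k)) (p k))"
      "\<And>n. n < - int (\<Sum>k<m. v k) \<Longrightarrow> fls_nth (\<Prod>k<m. w k (p k)) n = 0"
      by (auto simp: ld_def sum_negf)
  qed
  have det1: "det (dmat w) = (\<Sum>p\<in>Pm. signof p * (\<Prod>k<m. w k (p k)))"
  proof -
    have "(\<Prod>k = 0..<m. dmat w $$ (k, p k)) = (\<Prod>k<m. w k (p k))" if "p \<in> Pm" for p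
      using that permutes_in_image[of p "{0..<m}"] unfolding lessThan_atLeast0
      by (intro prod.cong) (auto simp: dmat_def Pm_def)
    thus ?thesis unfolding det_def Pm_def by (simp add: dmat_def)
  qed
  have det2: "det (mat m m (\<lambda>(k, i). ld (w k) (int (v k)) i)) = (\<Sum>p\<in>Pm. signof p * (\<Prod>k<m. ld (w k) (int (v k)) (p k)))"
  proof -
    have "(\<Prod>k = 0..<m. mat m m (\<lambda>(k, i). ld (w k) (int (v k)) i) $$ (k, p k)) = (\<Prod>k<m. ld (w k) (int (v k)) (p k))" if "p \<in> Pm" for p
      using that permutes_in_image[of p "{0..<m}"] unfolding lessThan_atLeast0
      by (intro prod.cong) (auto simp: Pm_def)
    thus ?thesis unfolding det_def Pm_def by simp
  qed
  have sg: "fls_nth (signof p * f) n = signof p * fls_nth f n" for p :: "nat \<Rightarrow> nat" and f :: "'a fls" and n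
    by (simp add: sign_def)
  show ?thesis
  proof (rule fls_subdegree_eqI)
    have "fls_nth (det (dmat w)) (- int (\<Sum>k<m. v k)) = det (mat m m (\<lambda>(k, i). ld (w k) (int (v k)) i))"
      unfolding det1 det2 fls_sum_nth sg using P(1) by (intro sum.cong refl) simp
    thus "fls_nth (det (dmat w)) (- int (\<Sum>k<m. v k)) \<noteq> 0" using assms(2) by simp
  next
    fix n assume "n < - int (\<Sum>k<m. v k)"
    thus "fls_nth (det (dmat w)) n = 0" unfolding det1 fls_sum_nth sg using P(2) by (intro sum.neutral) simp
  qed
qed

lemma reduced_family_exists:
  "\<exists>w v. (\<forall>k<m. Lam (w k) \<and> bnd (w k) (int (v k))) \<and>
     det (mat m m (\<lambda>(k, i). ld (w k) (int (v k)) i)) \<noteq> 0 \<and>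
     int N * discdeg g = 2 * int (\<Sum>k<m. v k)"
proof -
  obtain w v where adm: "adm w v" and min: "\<And>w' v'. adm w' v' \<Longrightarrow> (\<Sum>k<m. v k) \<le> (\<Sum>k<m. v' k)"
    using minimal_exists by blast
  have w: "\<And>k. k < m \<Longrightarrow> Lam (w k) \<and> bnd (w k) (int (v k))" using adm by (auto simp: adm_def)
  have d0: "det (mat m m (\<lambda>(k, i). ld (w k) (int (v k)) i)) \<noteq> 0"
  proof
    assume "det (mat m m (\<lambda>(k, i). ld (w k) (int (v k)) i)) = 0"
    then obtain c where c: "\<exists>k<m. c k \<noteq> 0"
      "\<And>i. i < m \<Longrightarrow> (\<Sum>k<m. c k * mat m m (\<lambda>(k, i). ld (w k) (int (v k)) i) $$ (k, i)) = 0"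
      using det_zero_imp_left_kernel[of "mat m m (\<lambda>(k, i). ld (w k) (int (v k)) i)" m] by auto
    hence "\<And>i. i < m \<Longrightarrow> (\<Sum>k<m. c k * ld (w k) (int (v k)) i) = 0" by simp
    hence "c k = 0" if "k < m" for k
      using that by (intro lead_independent[OF adm, of c k] min)
    thus False using c(1) by blast
  qed
  have "fls_subdegree (det (dmat w)) = - int (\<Sum>k<m. v k)"
    using subdegree_det[OF _ d0] w by blast
  hence "int N * discdeg g = 2 * int (\<Sum>k<m. v k)"
    using discdeg_w0(2) adm by (simp add: adm_def)
  thus ?thesis using w d0 by blast
qed

end

section \<open>The lower bound for irreducible polynomials\<close>

lemma det_zero_row:
  assumes "j < m" "\<And>i. i < m \<Longrightarrow> A $$ (j, i) = 0" "A \<in> carrier_mat m m"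
  shows "det A = (0 :: 'a::comm_ring_1)"
proof -
  have "A = multrow j 0 A" by (rule eq_matI) (use assms in auto)
  hence "det A = det (multrow j 0 A)" by simp
  also have "\<dots> = 0" using det_multrow[OF assms(1,3), of 0] by simp
  finally show ?thesis .
qed

lemma det_nonzero_imp_independent:
  fixes w :: "nat \<Rightarrow> nat \<Rightarrow> 'a::field"
  assumes "det (mat m m (\<lambda>(k, i). w k i)) \<noteq> 0" "\<And>i. i < m \<Longrightarrow> (\<Sum>k<m. c k * w k i) = 0" "j < m"
  shows "c j = 0"
proof -
  have "det (mat m m (\<lambda>(k, i). if k = j then (\<Sum>k\<in>{..<m}. c k * w k i) else w k i)) = c j * det (mat m m (\<lambda>(k, i). w k i))"
    by (rule det_replace_row) (use assms in auto)
  moreover have "det (mat m m (\<lambda>(k, i). if k = j then (\<Sum>k\<in>{..<m}. c k * w k i) else w k i)) = 0"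
    by (rule det_zero_row[OF assms(3)]) (use assms in auto)
  ultimately show ?thesis using assms(1) by simp
qed

lemma det_nonzero_imp_right_independent:
  fixes w :: "nat \<Rightarrow> nat \<Rightarrow> 'a::field"
  assumes "det (mat m m (\<lambda>(k, i). w k i)) \<noteq> 0" "\<And>k. k < m \<Longrightarrow> (\<Sum>i<m. c i * w k i) = 0" "j < m"
  shows "c j = 0"
proof (rule det_nonzero_imp_independent[where w = "\<lambda>i k. w k i" and m = m])
  have "transpose_mat (mat m m (\<lambda>(k, i). w k i)) = mat m m (\<lambda>(i, k). w k i)" by (rule eq_matI) auto
  thus "det (mat m m (\<lambda>(i, k). w k i)) \<noteq> 0" using assms(1) det_transpose by (metis mat_carrier)
qed (use assms in auto)

text \<open>
  The Gram matrix of the rows is invertible, so its Leibniz expansion has a nonzero term.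
\<close>
lemma nonzero_det_imp_permutation:
  fixes w :: "nat \<Rightarrow> nat \<Rightarrow> 'a::field"
  assumes "det (mat m m (\<lambda>(k, i). w k i)) \<noteq> 0"
  shows "\<exists>p. p permutes {..<m} \<and> (\<forall>k<m. (\<Sum>i<m. w k i * w (p k) i) \<noteq> 0)"
proof -
  define U where "U = mat m m (\<lambda>(k, i). w k i)"
  define G where "G = U * transpose_mat U"
  have U: "U \<in> carrier_mat m m" by (simp add: U_def)
  have "det G = det U * det U"
    unfolding G_def using det_mult[OF U, of "transpose_mat U"] U det_transpose[OF U] by simp
  hence "det G \<noteq> 0" using assms by (simp add: U_def)
  moreover have "det G = (\<Sum>p\<in>{p. p permutes {0..<m}}. signof p * (\<Prod>k = 0..<m. G $$ (k, p k)))"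
    unfolding det_def G_def U_def by simp
  ultimately obtain p where p: "p permutes {0..<m}" "(\<Prod>k = 0..<m. G $$ (k, p k)) \<noteq> 0"
    by (metis (no_types, lifting) mem_Collect_eq mult_zero_right sum.neutral)
  have "(\<Sum>i<m. w k i * w (p k) i) \<noteq> 0" if "k < m" for k
  proof -
    have pk: "p k < m" using p(1) that permutes_in_image[of p "{0..<m}" k] by auto
    have "G $$ (k, p k) = (\<Sum>i<m. w k i * w (p k) i)"
      using that pk by (auto simp: G_def U_def scalar_prod_def lessThan_atLeast0 intro!: sum.cong)
    thus ?thesis using p(2) that by auto
  qed
  thus ?thesis using p(1) by (auto simp: lessThan_atLeast0)
qed

context branches begin

abbreviation reduced :: "(nat \<Rightarrow> nat \<Rightarrow> 'a fls) \<Rightarrow> (nat \<Rightarrow> nat) \<Rightarrow> bool" where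
  "reduced w v \<equiv> (\<forall>k<m. Lam (w k) \<and> bnd (w k) (int (v k))) \<and>
     det (mat m m (\<lambda>(k, i). ld (w k) (int (v k)) i)) \<noteq> 0"

text \<open>
  Multipliers without poles are constant, so their leading vectors are proportional.
\<close>
lemma reduced_zero_unique:
  assumes r: "reduced w v" and kl: "k < m" "l < m" "v k = 0" "v l = 0"
  shows "k = l"
proof (rule ccontr)
  assume "k \<noteq> l"
  have z: "\<exists>c. \<forall>i<m. ld (w k) (int (v k)) i = c" if "k < m" "v k = 0" for k
  proof -
    have "Lam (w k)" "bnd (w k) 0" using r that by auto
    from Lam_bnd_0[OF this] obtain c where "\<forall>i<m. w k i = fls_const c" by blast
    thus ?thesis using that by (intro exI[of _ c]) (auto simp: ld_def)
  qed
  obtain c d where cd: "\<And>i. i < m \<Longrightarrow> ld (w k) (int (v k)) i = c" "\<And>i. i < m \<Longrightarrow> ld (w l) (int (v l)) i = d"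
    using z[of k] z[of l] kl by blast
  \<comment> \<open>the two leading vectors are \<open>c\<close> and \<open>d\<close> times the all-one vector; \<open>e\<close> is the relation between them\<close>
  define e where "e j = (if j = k then (if c = 0 then 1 else d) else if j = l then (if c = 0 then 0 else - c) else 0)" for j
  have "(\<Sum>j<m. e j * ld (w j) (int (v j)) i) = 0" if "i < m" for i
  proof -
    have "(\<Sum>j<m. e j * ld (w j) (int (v j)) i) = (\<Sum>j\<in>{k, l}. e j * ld (w j) (int (v j)) i)"
      using kl by (intro sum.mono_neutral_right) (auto simp: e_def)
    thus ?thesis using \<open>k \<noteq> l\<close> cd that by (simp add: e_def)
  qed
  hence "e j = 0" if "j < m" for j
    using det_nonzero_imp_independent[of m "\<lambda>k i. ld (w k) (int (v k)) i" e j] r that by blast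
  hence "e k = 0" "e l = 0" using kl by auto
  thus False using \<open>k \<noteq> l\<close> by (auto simp: e_def split: if_splits)
qed

text \<open>
  The permutation from the Gram matrix pairs \<open>k\<close> with \<open>p k\<close> such that \<open>N\<close> divides \<open>v k + v (p k)\<close>.
  Outside \<open>Z\<close> each pair contributes at least \<open>N\<close>; inside \<open>Z\<close> every \<open>v k\<close> except possibly one is itself at
  least \<open>N\<close>.
\<close>
lemma reduced_count:
  assumes r: "reduced w v" and D: "int N * discdeg g = 2 * int (\<Sum>k<m. v k)"
  defines "Z \<equiv> {k. k < m \<and> N dvd v k}"
  shows "discdeg g \<ge> int m - 1" "discdeg g \<ge> int m + int (card Z) - 2"
proof -
  obtain p where p: "p permutes {..<m}" "\<And>k. k < m \<Longrightarrow> (\<Sum>i<m. ld (w k) (int (v k)) i * ld (w (p k)) (int (v (p k))) i) \<noteq> 0"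
    using nonzero_det_imp_permutation[of m "\<lambda>k i. ld (w k) (int (v k)) i"] r by blast
  have pm: "p k < m" if "k < m" for k using p(1) that permutes_in_image[of p "{..<m}" k] by auto
  have dv: "N dvd v k + v (p k)" if k: "k < m" for k
  proof -
    have "(\<Sum>i<m. ld (\<lambda>i. w k i * w (p k) i) (int (v k) + int (v (p k))) i) \<noteq> 0"
      using p(2)[OF k] bnd_mult(2)[of "w k" "int (v k)" "w (p k)" "int (v (p k))"] r k pm[OF k] by simp
    hence "int N dvd int (v k) + int (v (p k))"
      using r k pm[OF k] by (intro trace_nonzero(2)[OF Lam_mult]) auto
    thus ?thesis by (metis of_nat_add of_nat_dvd_iff)
  qed
  have Zm: "Z \<subseteq> {..<m}" "finite Z" by (auto simp: Z_def)
  have pZ: "p k \<in> Z \<longleftrightarrow> k \<in> Z" if "k < m" for k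
    using dv[OF that] pm[OF that] that by (auto simp: Z_def dvd_add_right_iff dvd_add_left_iff)
  have "p ` Z \<subseteq> Z" using pZ by (auto simp: Z_def)
  hence bij: "bij_betw p Z Z"
    using Zm permutes_inj_on[OF p(1)] by (simp add: bij_betw_def endo_inj_surj)
  have tot: "(\<Sum>k<m. v k + v (p k)) = 2 * (\<Sum>k<m. v k)"
    using sum.permute[OF p(1), of v] by (simp add: sum.distrib o_def)
  have split: "(\<Sum>k<m. v k + v (p k)) = (\<Sum>k\<in>Z. v k + v (p k)) + (\<Sum>k\<in>{..<m} - Z. v k + v (p k))"
    using sum.subset_diff[OF Zm(1), of "\<lambda>k. v k + v (p k)"] by (simp only: finite_lessThan add.commute)
  have out: "(\<Sum>k\<in>{..<m} - Z. v k + v (p k)) \<ge> (m - card Z) * N"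
  proof -
    have "v k + v (p k) \<ge> N" if "k \<in> {..<m} - Z" for k
    proof -
      have "v k > 0" using that by (auto simp: Z_def intro: Nat.gr0I)
      thus ?thesis using dv[of k] that by (auto intro: dvd_imp_le)
    qed
    hence "(\<Sum>k\<in>{..<m} - Z. v k + v (p k)) \<ge> (\<Sum>k\<in>{..<m} - Z. N)" by (intro sum_mono)
    thus ?thesis using Zm by (simp add: card_Diff_subset)
  qed
  have inZ: "(\<Sum>k\<in>Z. v k + v (p k)) \<ge> 2 * (card Z - 1) * N"
  proof -
    have "(\<Sum>k\<in>Z. v k + v (p k)) = 2 * (\<Sum>k\<in>Z. v k)"
      using sum.reindex_bij_betw[OF bij, of v] by (simp add: sum.distrib)
    moreover have "(\<Sum>k\<in>Z. v k) \<ge> (card Z - 1) * N"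
    proof (cases "\<exists>k\<in>Z. v k = 0")
      case True
      then obtain k0 where k0: "k0 \<in> Z" "v k0 = 0" by blast
      have "v k \<ge> N" if "k \<in> Z - {k0}" for k
      proof -
        have "v k \<noteq> 0" using reduced_zero_unique[OF r, of k k0] k0 that by (auto simp: Z_def)
        thus ?thesis using that by (auto simp: Z_def intro: dvd_imp_le)
      qed
      hence "(\<Sum>k\<in>Z - {k0}. v k) \<ge> (\<Sum>k\<in>Z - {k0}. N)" by (intro sum_mono)
      thus ?thesis using k0 Zm by (simp add: sum.remove[of Z k0])
    next
      case False
      hence "v k \<ge> N" if "k \<in> Z" for k using that by (auto simp: Z_def intro: dvd_imp_le)
      hence "(\<Sum>k\<in>Z. v k) \<ge> (\<Sum>k\<in>Z. N)" by (intro sum_mono)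
      thus ?thesis by (simp add: diff_mult_distrib)
    qed
    ultimately show ?thesis by simp
  qed
  have cZ: "card Z \<le> m" using card_mono[OF _ Zm(1)] by simp
  have "2 * (\<Sum>k<m. v k) \<ge> 2 * (card Z - 1) * N + (m - card Z) * N" using tot split out inZ by linarith
  hence "2 * (\<Sum>k<m. v k) \<ge> N * (2 * (card Z - 1) + (m - card Z))" by (simp add: algebra_simps)
  hence "int N * discdeg g \<ge> int N * int (2 * (card Z - 1) + (m - card Z))"
    unfolding D by (metis of_nat_le_iff of_nat_mult of_nat_numeral)
  hence *: "discdeg g \<ge> int (2 * (card Z - 1) + (m - card Z))" using N by (simp add: mult_le_cancel_left)
  show "discdeg g \<ge> int m + int (card Z) - 2" using * cZ m2 by linarith
  show "discdeg g \<ge> int m - 1" using * cZ m2 by linarith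
qed

text \<open>
  The \<open>N\<close>-th powers of the leading vectors of the \<open>z j\<close> are orthogonal to the leading vectors outside
  the class \<open>N dvd v k\<close>, by divisibility of the pole orders of traces.  If there were more of them than members in that class, a
  combination of them would be orthogonal to all leading vectors.  Disjoint supports exclude this.
\<close>
lemma disjoint_leads_le:
  fixes z :: "nat \<Rightarrow> nat \<Rightarrow> 'a fls" and V :: "nat \<Rightarrow> int"
  assumes r: "reduced w v"
    and z: "\<And>j. j < b \<Longrightarrow> Lam (z j)" "\<And>j. j < b \<Longrightarrow> bnd (z j) (V j)"
    and nz: "\<And>j. j < b \<Longrightarrow> \<exists>i<m. ld (z j) (V j) i \<noteq> 0"
    and disj: "\<And>j l i. j < b \<Longrightarrow> l < b \<Longrightarrow> j \<noteq> l \<Longrightarrow> i < m \<Longrightarrow> ld (z j) (V j) i = 0 \<or> ld (z l) (V l) i = 0"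
  shows "b \<le> card {k. k < m \<and> N dvd v k}"
proof (rule ccontr)
  define Z where "Z = {k. k < m \<and> N dvd v k}"
  assume "\<not> b \<le> card {k. k < m \<and> N dvd v k}"
  hence less: "card Z < b" by (simp add: Z_def)
  define u where "u k i = ld (w k) (int (v k)) i" for k i
  define Q where "Q j i = ld (z j) (V j) i ^ N" for j i
  have orth: "(\<Sum>i<m. Q j i * u k i) = 0" if "j < b" "k < m" "k \<notin> Z" for j k
  proof (rule ccontr)
    assume "\<not> ?thesis"
    moreover have "Q j i * u k i = ld (\<lambda>i. z j i ^ N * w k i) (int N * V j + int (v k)) i" if "i < m" for i
      using bnd_mult(2)[OF bnd_power(1)[OF z(2)[OF \<open>j < b\<close>], of N], of "w k" "int (v k)" i]
        bnd_power(2)[OF z(2)[OF \<open>j < b\<close>] that, of N] r \<open>k < m\<close> that by (simp add: Q_def u_def)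
    ultimately have "(\<Sum>i<m. ld (\<lambda>i. z j i ^ N * w k i) (int N * V j + int (v k)) i) \<noteq> 0" by simp
    hence "int N dvd int N * V j + int (v k)"
      using r z(1) that by (intro trace_nonzero(2)[OF Lam_mult[OF Lam_power]]) auto
    hence "N dvd v k" by (simp add: dvd_add_right_iff)
    thus False using that by (simp add: Z_def)
  qed
  have finZ: "finite Z" by (simp add: Z_def)
  obtain h where h: "bij_betw h {..<card Z} Z" using ex_bij_betw_nat_finite[OF finZ] by (auto simp: lessThan_atLeast0)
  \<comment> \<open>padding with zero columns turns the dimension count into a vanishing determinant\<close>
  define A where "A = mat b b (\<lambda>(j, t). if t < card Z then (\<Sum>i<m. Q j i * u (h t) i) else 0)"
  have A: "A \<in> carrier_mat b b" by (simp add: A_def)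
  have "det (transpose_mat A) = 0"
    by (rule det_zero_row[of "card Z" b]) (use less in \<open>auto simp: A_def\<close>)
  hence "det A = 0" using det_transpose[OF A] by simp
  from det_zero_imp_left_kernel[OF A this] obtain c where
    c: "\<exists>j<b. c j \<noteq> 0" "\<And>t. t < b \<Longrightarrow> (\<Sum>j<b. c j * A $$ (j, t)) = 0" by blast
  define R where "R i = (\<Sum>j<b. c j * Q j i)" for i
  have swap: "(\<Sum>i<m. R i * u k i) = (\<Sum>j<b. c j * (\<Sum>i<m. Q j i * u k i))" for k
    unfolding R_def sum_distrib_right sum_distrib_left by (subst sum.swap) (simp add: mult_ac)
  have "(\<Sum>i<m. R i * u k i) = 0" if "k < m" for k
  proof (cases "k \<in> Z")
    case True
    then obtain t where t: "t < card Z" "h t = k" using h True unfolding bij_betw_def by (metis imageE lessThan_iff)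
    have "(\<Sum>j<b. c j * (\<Sum>i<m. Q j i * u k i)) = (\<Sum>j<b. c j * A $$ (j, t))"
      using t less by (intro sum.cong) (auto simp: A_def)
    thus ?thesis using c(2)[of t] t less swap by simp
  next
    case False
    thus ?thesis using swap orth that by simp
  qed
  hence R0: "R i = 0" if "i < m" for i
    using det_nonzero_imp_right_independent[of m u R i] r that unfolding u_def by blast
  obtain j where j: "j < b" "c j \<noteq> 0" using c(1) by blast
  obtain i where i: "i < m" "ld (z j) (V j) i \<noteq> 0" using nz[OF j(1)] by blast
  have "R i = (\<Sum>l<b. if l = j then c j * Q j i else 0)"
    unfolding R_def using disj[OF j(1) _ _ i(1)] i N by (intro sum.cong) (auto simp: Q_def)
  also have "\<dots> = c j * Q j i" using j by simp
  finally show False using R0[OF i(1)] j i by (simp add: Q_def)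
qed

lemma discdeg_ge: "discdeg g \<ge> int m - 1"
  using reduced_family_exists reduced_count(1) by metis

end

section \<open>Sharpening the bound by omitted linear forms\<close>

lemma lroots_linear:
  fixes a b :: "'a::field poly"
  assumes "N > 0" "a \<noteq> 0"
  shows "lroots N [:b, a:] = {- emb N b / emb N a}"
proof -
  have "emb N a \<noteq> 0" using assms by (simp add: emb_eq_0_iff)
  thus ?thesis using assms
    by (auto simp: lroots_def lpoly_pCons field_simps add_eq_0_iff2)
qed

lemma emb_resultant_linear:
  fixes a b :: "'a::field poly"
  assumes "N > 0" "a \<noteq> 0"
  shows "emb N (resultant [:b, a:] f) = emb N a ^ degree f * lpoly N f (- emb N b / emb N a)"
proof -
  have "sep_split N [:b, a:]" using assms by (simp add: sep_split_def lroots_linear)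
  from emb_resultant[OF assms(1) this, of f] show ?thesis using assms by (simp add: lroots_linear)
qed

lemma resultant_linear_linear:
  fixes a b a' b' :: "'a::field poly"
  assumes "a \<noteq> 0" "a' \<noteq> 0"
  shows "resultant [:b, a:] [:b', a':] = a * b' - a' * b"
proof -
  interpret e: inj_comm_ring_hom "emb (Suc 0) :: 'a poly \<Rightarrow> 'a fls" by (rule emb_inj_hom) simp
  have "emb (Suc 0) a \<noteq> 0" using assms by (simp add: emb_eq_0_iff)
  hence "emb (Suc 0) (resultant [:b, a:] [:b', a':]) = emb (Suc 0) (a * b' - a' * b)"
    using emb_resultant_linear[of "Suc 0" a b "[:b', a':]"] assms
    by (simp add: lpoly_pCons e.hom_mult e.hom_minus right_diff_distrib mult.commute)
  thus ?thesis by (simp only: e.eq_iff)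
qed

lemma linear_poly_coeffs:
  assumes "degree l = 1"
  shows "\<exists>a b. l = [:b, a:] \<and> a \<noteq> (0 :: 'a::field poly)"
  using assms degree1_coeffs by blast

context branches begin

lemma linear_nonzero: "l \<noteq> 0 \<Longrightarrow> degree l \<le> 1 \<Longrightarrow> i < m \<Longrightarrow> lpoly N l (y i) \<noteq> 0"
  using vanish_eq_0[of i l] m2 by auto

text \<open>
  Since \<open>l\<close> and \<open>g\<close> have a constant resultant, \<open>g\<close> takes a constant nonzero value at the zero of \<open>l\<close>,
  in homogeneous coordinates; subtracting a
  multiple of \<open>g\<close> makes \<open>l' P\<close> divisible by \<open>l\<close>.
\<close>
lemma Lam_quotient:
  assumes l: "prim_irr l" "degree l = 1" and k: "resultant l g \<noteq> 0" "degree (resultant l g) = 0"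
    and l': "degree l' \<le> 1"
  shows "Lam (\<lambda>i. lpoly N l' (y i) / lpoly N l (y i))"
  unfolding Lam_def
proof (intro allI impI)
  fix P :: "'a poly poly" assume P: "degree P < m"
  obtain a b where ab: "l = [:b, a:]" "a \<noteq> 0" using linear_poly_coeffs[OF l(2)] by blast
  define \<beta> where "\<beta> = - emb N b / emb N a"
  have ea: "emb N a \<noteq> 0" using ab N by (simp add: emb_eq_0_iff)
  obtain \<kappa> where \<kappa>: "resultant l g = [:\<kappa>:]" using k by (auto elim: degree_eq_zeroE)
  have \<kappa>0: "\<kappa> \<noteq> 0" using k \<kappa> by simp
  define F where "F = l' * P"
  have dF: "degree F \<le> m" unfolding F_def using degree_mult_le[of l' P] l' P by linarith
  interpret e: inj_comm_ring_hom "emb N :: 'a poly \<Rightarrow> 'a fls" by (rule emb_inj_hom[OF N])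
  define t where "t = a ^ (m - degree F) * resultant l F"
  have t: "emb N t = emb N a ^ m * lpoly N F \<beta>"
    using emb_resultant_linear[OF N ab(2), of b F] dF
    by (simp add: t_def ab(1) e.hom_mult e.hom_power \<beta>_def mult.assoc[symmetric] power_add[symmetric])
  have g\<beta>: "emb N a ^ m * lpoly N g \<beta> = fls_const \<kappa>"
    using emb_resultant_linear[OF N ab(2), of b g] \<kappa> by (simp add: ab(1) \<beta>_def m)
  define \<mu> where "\<mu> = t * [:1 / \<kappa>:]"
  have "emb N \<mu> * lpoly N g \<beta> = lpoly N F \<beta> * (emb N a ^ m * lpoly N g \<beta>) * fls_const (1 / \<kappa>)"
    by (simp only: \<mu>_def e.hom_mult t emb_const mult_ac)
  also have "\<dots> = lpoly N F \<beta>" using \<kappa>0 by (simp add: g\<beta> mult.assoc fls_const_mult_const)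
  finally have "lpoly N (F - smult \<mu> g) \<beta> = 0" by (simp add: lpoly_diff[OF N] lpoly_smult[OF N])
  moreover have "lpoly N l \<beta> = 0" using lroots_linear[OF N ab(2), of b] by (auto simp: lroots_def ab(1) \<beta>_def)
  ultimately have "l dvd F - smult \<mu> g" using prim_irr_dvd[OF N l(1)] by blast
  then obtain Q where Q: "F - smult \<mu> g = l * Q" by (elim dvdE)
  have l0: "l \<noteq> 0" using ab by auto
  have "degree Q < m"
  proof (cases "Q = 0")
    case False
    have "degree (l * Q) \<le> m" unfolding Q[symmetric] using dF m
      by (intro degree_diff_le) (auto intro: order.trans[OF degree_smult_le])
    thus ?thesis using False l0 l(2) by (simp add: degree_mult_eq)
  qed (use m2 in auto)
  moreover have "lpoly N l' (y i) / lpoly N l (y i) * lpoly N P (y i) = lpoly N Q (y i)" if "i < m" for i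
  proof -
    have "lpoly N F (y i) = lpoly N (F - smult \<mu> g) (y i)"
      using g_root[OF that] by (simp add: lpoly_diff[OF N] lpoly_smult[OF N])
    hence "lpoly N F (y i) = lpoly N l (y i) * lpoly N Q (y i)"
      by (simp only: Q lpoly_mult[OF N])
    hence "lpoly N l' (y i) * lpoly N P (y i) = lpoly N l (y i) * lpoly N Q (y i)"
      by (simp only: F_def lpoly_mult[OF N])
    thus ?thesis using linear_nonzero[OF l0 _ that] l(2) by (simp add: field_simps)
  qed
  ultimately show "\<exists>Q. degree Q < m \<and> (\<forall>i<m. lpoly N l' (y i) / lpoly N l (y i) * lpoly N P (y i) = lpoly N Q (y i))"
    by blast
qed

lemma minimal_bnd_exists:
  assumes "\<not> bnd z 0"
  shows "\<exists>V>0. bnd z V \<and> (\<exists>i<m. ld z V i \<noteq> 0)"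
proof -
  define V where "V = (LEAST b::nat. bnd z (int b))"
  have V: "bnd z (int V)" unfolding V_def using bnd_exists by (rule LeastI_ex)
  have "V \<noteq> 0" using V assms by (intro notI) simp
  hence "\<not> bnd z (int (V - 1))" using not_less_Least[of "V - 1" "\<lambda>b. bnd z (int b)"] by (simp add: V_def)
  then obtain i n where i: "i < m" "n < - int (V - 1)" "fls_nth (z i) n \<noteq> 0" unfolding bnd_def by blast
  have "\<not> n < - int V" using V i unfolding bnd_def by blast
  hence "n = - int V" using i(2) \<open>V \<noteq> 0\<close> by linarith
  hence "ld z (int V) i \<noteq> 0" using i by (simp add: ld_def)
  thus ?thesis using V \<open>V \<noteq> 0\<close> i by (intro exI[of _ "int V"]) auto
qed

text \<open>
  The multipliers are quotients of two linear forms of \<open>S\<close>.  Any three of the forms are related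
  by constant coefficients, so along each branch at most one of them can vanish to higher order than the others.
  Hence these quotients have poles, and leading coefficients, on disjoint sets of branches.
\<close>
lemma discdeg_ge_omitted:
  assumes fin: "finite S" and card2: "card S \<ge> 2"
    and lin: "\<And>l. l \<in> S \<Longrightarrow> prim_irr l \<and> degree l = 1"
    and om: "\<And>l. l \<in> S \<Longrightarrow> resdeg g l = 0"
    and cst: "\<And>l l'. l \<in> S \<Longrightarrow> l' \<in> S \<Longrightarrow> l \<noteq> l' \<Longrightarrow> resultant l l' \<noteq> 0 \<and> resdeg l l' = 0"
  shows "discdeg g \<ge> int m + int (card S) - 2"
proof -
  interpret e: inj_comm_ring_hom "emb N :: 'a poly \<Rightarrow> 'a fls" by (rule emb_inj_hom[OF N])
  obtain w v where wv: "reduced w v" "int N * discdeg g = 2 * int (\<Sum>k<m. v k)" using reduced_family_exists by blast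
  define b where "b = card S"
  obtain l where l: "bij_betw l {..<b} S" using ex_bij_betw_nat_finite[OF fin] by (auto simp: lessThan_atLeast0 b_def)
  have lS: "l j \<in> S" if "j < b" for j using l that by (auto simp: bij_betw_def)
  have linj: "l j \<noteq> l k" if "j < b" "k < b" "j \<noteq> k" for j k
    using l that by (auto simp: bij_betw_def inj_on_def)
  define a where "a j = coeff (l j) 1" for j
  define c where "c j = coeff (l j) 0" for j
  have lac: "l j = [:c j, a j:]" "a j \<noteq> 0" if j: "j < b" for j
  proof -
    obtain a' b' where "l j = [:b', a':]" "a' \<noteq> 0" using linear_poly_coeffs lin[OF lS[OF j]] by blast
    thus "l j = [:c j, a j:]" "a j \<noteq> 0" by (auto simp: a_def c_def)
  qed
  have l0: "l j \<noteq> 0" "degree (l j) = 1" if "j < b" for j using lac[OF that] by auto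
  \<comment> \<open>\<open>\<sigma> j\<close> is some index other than \<open>j\<close>; \<open>z j\<close> is a quotient with denominator \<open>l j\<close>\<close>
  define \<sigma> where "\<sigma> j = (if j = (0::nat) then 1 else 0 :: nat)" for j
  have \<sigma>: "\<sigma> j < b" "\<sigma> j \<noteq> j" if "j < b" for j using card2 that by (auto simp: \<sigma>_def b_def)
  define lam where "lam j i = lpoly N (l j) (y i)" for j i
  have lam0: "lam j i \<noteq> 0" if "j < b" "i < m" for j i
    using linear_nonzero[OF l0(1)[OF that(1)] _ that(2)] l0(2)[OF that(1)] by (simp add: lam_def)
  define z where "z j i = lam (\<sigma> j) i / lam j i" for j i
  define br where "br j k = a j * c k - a k * c j" for j k
  have br: "\<exists>r. br j k = [:r:]" if "j < b" "k < b" for j k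
  proof (cases "j = k")
    case False
    have "resultant (l j) (l k) = br j k" unfolding lac(1)[OF that(1)] lac(1)[OF that(2)] br_def
      using lac(2) that by (intro resultant_linear_linear) auto
    hence "degree (br j k) = 0"
      using cst[OF lS[OF that(1)] lS[OF that(2)] linj[OF that False]] by (simp add: resdeg_def)
    thus ?thesis by (auto elim: degree_eq_zeroE)
  qed (intro exI[of _ 0], simp add: br_def)
  have br0: "br j k \<noteq> 0" if "j < b" "k < b" "j \<noteq> k" for j k
  proof -
    have "resultant (l j) (l k) = br j k" unfolding lac(1)[OF that(1)] lac(1)[OF that(2)] br_def
      using lac(2) that by (intro resultant_linear_linear) auto
    thus ?thesis using cst[OF lS lS linj] that by metis
  qed
  have three: "br j k = [:r:] \<Longrightarrow> br h k = [:s:] \<Longrightarrow> br j h = [:t:] \<Longrightarrow>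
     fls_const r * lam h i = fls_const s * lam j i + fls_const t * lam k i" if "j < b" "k < b" "h < b" for j k h i r s t
  proof -
    assume r: "br j k = [:r:]" "br h k = [:s:]" "br j h = [:t:]"
    have "smult (br j k) (l h) = smult (br h k) (l j) + smult (br j h) (l k)"
      unfolding lac(1)[OF that(1)] lac(1)[OF that(2)] lac(1)[OF that(3)] br_def by (simp add: algebra_simps)
    hence "lpoly N (smult (br j k) (l h)) (y i) = lpoly N (smult (br h k) (l j) + smult (br j h) (l k)) (y i)" by simp
    thus ?thesis unfolding r by (simp add: lpoly_smult[OF N] lpoly_add[OF N] lam_def)
  qed
  have minval: "min (fls_subdegree (lam j i)) (fls_subdegree (lam k i)) \<le> fls_subdegree (lam h i)"
    if jkh: "j < b" "k < b" "h < b" "j \<noteq> k" and i: "i < m" for j k h i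
  proof -
    obtain r s t where r: "br j k = [:r:]" "br h k = [:s:]" "br j h = [:t:]" using br jkh by metis
    have r0: "r \<noteq> 0" using br0[OF jkh(1,2,4)] r by simp
    show ?thesis
    proof (rule fls_subdegree_geI[OF lam0[OF jkh(3) i]])
      fix n assume n: "n < min (fls_subdegree (lam j i)) (fls_subdegree (lam k i))"
      have "fls_nth (fls_const r * lam h i) n = 0"
        unfolding three[OF jkh(1-3) r] using n by simp
      thus "fls_nth (lam h i) n = 0" using r0 by simp
    qed
  qed
  have Lz: "Lam (z j)" if "j < b" for j
  proof -
    have "l j \<in> S" by (rule lS[OF that])
    have "\<not> g dvd l j" 
      using dvd_imp_degree_le[of g "l j"] l0[OF that] m m2 by auto
    have "resultant (l j) g \<noteq> 0"
    proof
      assume "resultant (l j) g = 0"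
      hence "emb N (a j) ^ degree g * lpoly N g (- emb N (c j) / emb N (a j)) = 0"
        using emb_resultant_linear[OF N lac(2)[OF that], of "c j" g] lac(1)[OF that] by simp
      hence "lpoly N g (- emb N (c j) / emb N (a j)) = 0" using lac(2)[OF that] by simp
      moreover have "lpoly N (l j) (- emb N (c j) / emb N (a j)) = 0"
        using lroots_linear[OF N lac(2)[OF that], of "c j"] lac(1)[OF that] by (auto simp: lroots_def)
      ultimately have "g dvd l j" using prim_irr_dvd[OF N irr] by blast
      thus False using \<open>\<not> g dvd l j\<close> by simp
    qed
    moreover have "degree (resultant (l j) g) = 0"
      using om[OF lS[OF that]] by (simp add: resdeg_def degree_resultant_sym[of g])
    ultimately show ?thesis unfolding z_def[abs_def] lam_def
      using lin[OF lS[OF that]] l0(2)[OF \<sigma>(1)[OF that]] by (intro Lam_quotient) auto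
  qed
  have nb: "\<not> bnd (z j) 0" if j: "j < b" for j
  proof
    assume "bnd (z j) 0"
    from Lam_bnd_0[OF Lz[OF j] this] obtain r where r: "z j 0 = fls_const r" using m2 by auto
    have m0: "0 < m" using m2 by simp
    have "lpoly N (l (\<sigma> j) - smult [:r:] (l j)) (y 0) = 0"
      using r lam0[OF j m0] by (simp add: z_def lam_def lpoly_diff[OF N] lpoly_smult[OF N] field_simps)
    moreover have "degree (l (\<sigma> j) - smult [:r:] (l j)) < m"
      using l0[OF j] l0[OF \<sigma>(1)[OF j]] m2 by (intro degree_diff_less) (auto intro: le_less_trans[OF degree_smult_le])
    ultimately have "l (\<sigma> j) - smult [:r:] (l j) = 0" using vanish_eq_0[OF m0] by blast
    hence "l (\<sigma> j) = smult [:r:] (l j)" by simp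
    hence "c (\<sigma> j) = [:r:] * c j" "a (\<sigma> j) = [:r:] * a j" unfolding a_def c_def by (metis coeff_smult)+
    hence "br (\<sigma> j) j = 0" by (simp add: br_def algebra_simps)
    thus False using br0[OF \<sigma>(1)[OF j] j \<sigma>(2)[OF j]] by simp
  qed
  have "\<forall>j. \<exists>V. j < b \<longrightarrow> V > 0 \<and> bnd (z j) V \<and> (\<exists>i<m. ld (z j) V i \<noteq> 0)"
    using minimal_bnd_exists nb by blast
  from choice[OF this] obtain V where V: "\<And>j. j < b \<Longrightarrow> V j > 0 \<and> bnd (z j) (V j) \<and> (\<exists>i<m. ld (z j) (V j) i \<noteq> 0)" by blast
  have big: "fls_subdegree (lam (\<sigma> j) i) < fls_subdegree (lam j i)" if "j < b" "i < m" "ld (z j) (V j) i \<noteq> 0" for j i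
  proof -
    have "fls_subdegree (z j i) \<le> - V j" using that(3) by (intro fls_subdegree_leI) (simp add: ld_def)
    hence "fls_subdegree (z j i) < 0" using V[OF that(1)] by linarith
    thus ?thesis using lam0[OF that(1,2)] lam0[OF \<sigma>(1)[OF that(1)] that(2)] by (simp add: z_def fls_divide_subdegree)
  qed
  have "b \<le> card {k. k < m \<and> N dvd v k}"
  proof (rule disjoint_leads_le[OF wv(1), of b z V])
    fix j k i assume jk: "j < b" "k < b" "j \<noteq> k" "i < m"
    show "ld (z j) (V j) i = 0 \<or> ld (z k) (V k) i = 0"
    proof (rule ccontr)
      assume "\<not> ?thesis"
      hence "fls_subdegree (lam (\<sigma> j) i) < fls_subdegree (lam j i)" "fls_subdegree (lam (\<sigma> k) i) < fls_subdegree (lam k i)"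
        using big jk by auto
      thus False using minval[OF jk(1,2) \<sigma>(1)[OF jk(1)] jk(3,4)] minval[OF jk(1,2) \<sigma>(1)[OF jk(2)] jk(3,4)] by linarith
    qed
  qed (use V Lz in auto)
  thus ?thesis using reduced_count(2)[OF wv] by (simp add: b_def)
qed

end

lemma branches_exist:
  fixes g :: "'a::{alg_closed_field, field_char_0} poly poly"
  assumes "sep_split N g" "prim_irr g" "degree g \<ge> 2"
  shows "\<exists>y. branches N g (degree g) y"
proof -
  have N: "N > 0" and c: "card (lroots N g) = degree g" "g \<noteq> 0" using assms by (auto simp: sep_split_def)
  have "finite (lroots N g)" using lroots_finite[OF N c(2)] .
  then obtain y where "bij_betw y {..<degree g} (lroots N g)"
    using ex_bij_betw_nat_finite c(1) by (metis lessThan_atLeast0)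
  hence "branches N g (degree g) y"
    using assms N by unfold_locales (auto simp: bij_betw_def)
  thus ?thesis by blast
qed

text \<open>
  The bound is attained by \<open>y\<^sup>m + x\<close>.
\<close>
theorem irreducible_discdeg_ge:
  fixes g :: "'a::{alg_closed_field, field_char_0} poly poly"
  assumes "sep_split N g" "prim_irr g" "degree g \<ge> 2"
  shows "discdeg g \<ge> int (degree g) - 1"
  using branches_exist[OF assms] branches.discdeg_ge by blast

text \<open>
  For one omitted linear form this is the general bound.
\<close>
theorem irreducible_discdeg_ge_omitted:
  fixes g :: "'a::{alg_closed_field, field_char_0} poly poly"
  assumes g: "sep_split N g" "prim_irr g" "degree g \<ge> 2"
    and S: "finite S" "S \<noteq> {}" "\<And>l. l \<in> S \<Longrightarrow> prim_irr l \<and> degree l = 1"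
      "\<And>l. l \<in> S \<Longrightarrow> resdeg g l = 0"
      "\<And>l l'. l \<in> S \<Longrightarrow> l' \<in> S \<Longrightarrow> l \<noteq> l' \<Longrightarrow> resultant l l' \<noteq> 0 \<and> resdeg l l' = 0"
  shows "discdeg g \<ge> int (degree g) + int (card S) - 2"
proof (cases "card S \<ge> 2")
  case True
  thus ?thesis using branches_exist[OF g] branches.discdeg_ge_omitted[OF _ S(1) True S(3,4,5)] by blast
next
  case False
  hence "card S = 1" using S(1,2) by (metis One_nat_def Suc_1 card_gt_0_iff le_less_linear less_2_cases_iff not_gr0)
  thus ?thesis using irreducible_discdeg_ge[OF g] by simp
qed

section \<open>Counting over the factors\<close>

lemma discdeg_linear: "degree l = 1 \<Longrightarrow> discdeg l = 0"
proof -
  assume "degree l = 1"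
  then obtain a b where "l = [:b, a:]" "a \<noteq> 0" using degree1_coeffs by metis
  thus ?thesis by (simp add: discdeg_def pderiv_pCons)
qed

text \<open>
  Pluecker's relation between the resultants of four linear forms.
\<close>
lemma resdeg_linear_combination:
  fixes l p q h :: "'a::field poly poly"
  assumes deg: "degree l = 1" "degree p = 1" "degree q = 1" "degree h = 1"
    and pq: "resultant p q \<noteq> 0" "resdeg p q = 0" and lp: "resdeg l p = 0" "resdeg l q = 0"
    and h: "resdeg p h = 0" "resdeg q h = 0"
  shows "resdeg l h = 0"
proof -
  obtain a b where l: "l = [:b, a:]" "a \<noteq> 0" using linear_poly_coeffs[OF deg(1)] by blast
  obtain a1 b1 where p: "p = [:b1, a1:]" "a1 \<noteq> 0" using linear_poly_coeffs[OF deg(2)] by blast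
  obtain a2 b2 where q: "q = [:b2, a2:]" "a2 \<noteq> 0" using linear_poly_coeffs[OF deg(3)] by blast
  obtain a3 b3 where h3: "h = [:b3, a3:]" "a3 \<noteq> 0" using linear_poly_coeffs[OF deg(4)] by blast
  note rl = resultant_linear_linear
  have r: "resultant p q = a1 * b2 - a2 * b1" "resultant l p = a * b1 - a1 * b" "resultant l q = a * b2 - a2 * b"
    "resultant p h = a1 * b3 - a3 * b1" "resultant q h = a2 * b3 - a3 * b2" "resultant l h = a * b3 - a3 * b"
    using l p q h3 by (simp_all add: rl)
  have id: "resultant p q * resultant l h = resultant l q * resultant p h - resultant l p * resultant q h"
    unfolding r by (simp add: algebra_simps)
  have c: "resdeg u v = 0 \<Longrightarrow> \<exists>c. resultant u v = [:c:]" for u v :: "'a poly poly"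
    by (auto simp: resdeg_def elim: degree_eq_zeroE)
  obtain e1 e2 e3 e4 e5 where e: "resultant p q = [:e1:]" "resultant l p = [:e2:]" "resultant l q = [:e3:]"
    "resultant p h = [:e4:]" "resultant q h = [:e5:]"
    using c[OF pq(2)] c[OF lp(1)] c[OF lp(2)] c[OF h(1)] c[OF h(2)] by blast
  have "e1 \<noteq> 0" using pq(1) e by simp
  have "smult e1 (resultant l h) = [:e3 * e4 - e2 * e5:]" using id unfolding e by (simp add: mult_ac)
  hence "degree (smult e1 (resultant l h)) = 0" by simp
  thus ?thesis using \<open>e1 \<noteq> 0\<close> by (simp add: resdeg_def)
qed

text \<open>
  \<open>S\<close> is the set of primitive irreducible factors.
\<close>
locale factors =
  fixes N :: nat and S :: "'a::{alg_closed_field, field_char_0} poly poly set"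
  assumes fin: "finite S" and irr: "\<And>g. g \<in> S \<Longrightarrow> prim_irr g" and ss: "sep_split N (\<Prod>S)"
begin

lemma N: "N > 0" using ss by (simp add: sep_split_def)

lemma nz: "g \<in> S \<Longrightarrow> g \<noteq> 0" "g \<in> S \<Longrightarrow> degree g > 0"
  using irr[of g] by (auto simp: prim_irr_def)

lemma sep_split_member:
  assumes "g \<in> S"
  shows "sep_split N g" "h \<in> S \<Longrightarrow> h \<noteq> g \<Longrightarrow> lroots N g \<inter> lroots N h = {}"
proof -
  have "\<Prod>S = g * \<Prod>(S - {g})" using prod.remove[OF fin assms, of id] by simp
  moreover have "\<Prod>(S - {g}) \<noteq> 0" using nz fin by auto
  ultimately have *: "sep_split N g" "lroots N g \<inter> lroots N (\<Prod>(S - {g})) = {}"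
    using ss sep_split_mult_iff[OF N nz(1)[OF assms]] by auto
  show "sep_split N g" by fact
  assume h: "h \<in> S" "h \<noteq> g"
  have "lpoly N (\<Prod>(S - {g})) r = 0" if "lpoly N h r = 0" for r
    using lpoly_prod[OF N, of id "S - {g}" r] h fin that by auto
  thus "lroots N g \<inter> lroots N h = {}" using *(2) by (auto simp: lroots_def)
qed

lemma resultant_member_nonzero: "g \<in> S \<Longrightarrow> h \<in> S \<Longrightarrow> h \<noteq> g \<Longrightarrow> resultant g h \<noteq> 0"
  using resultant_nonzero[OF N sep_split_member(1) nz(1)] sep_split_member(2) by blast

text \<open>
  By additivity this is the degree of the discriminant of the product.
\<close>
definition T :: int where
  "T = (\<Sum>g\<in>S. discdeg g) + (\<Sum>g\<in>S. \<Sum>h\<in>S - {g}. resdeg g h)"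

lemma discdeg_prod_eq: "discdeg (\<Prod>S) = T"
  using discdeg_prod[of S N "\<lambda>g. g"] fin ss nz by (simp add: T_def)

definition L where "L = {g \<in> S. degree g = 1}"
definition G where "G = {g \<in> S. degree g \<ge> 2}"

lemma LG: "S = L \<union> G" "L \<inter> G = {}" "finite L" "finite G"
  using fin nz(2) by (force simp: L_def G_def)+

lemma D_G: "g \<in> G \<Longrightarrow> discdeg g \<ge> int (degree g) - 1"
  using irreducible_discdeg_ge sep_split_member(1) irr by (auto simp: G_def)
lemma D_L: "l \<in> L \<Longrightarrow> discdeg l = 0"
  using discdeg_linear by (auto simp: L_def)
lemma degree_prod_S: "int (degree (\<Prod>S)) = int (card L) + (\<Sum>g\<in>G. int (degree g))"
proof -
  have "degree (\<Prod>S) = (\<Sum>g\<in>S. degree g)" using nz degree_prod_eq_sum_degree[of S "\<lambda>g. g"] by simp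
  also have "\<dots> = (\<Sum>g\<in>L. degree g) + (\<Sum>g\<in>G. degree g)"
    by (subst LG(1)) (rule sum.union_disjoint[OF LG(3,4,2)])
  also have "(\<Sum>g\<in>L. degree g) = card L" by (simp add: L_def)
  finally show ?thesis by simp
qed

lemma sum_discdeg: "(\<Sum>g\<in>S. discdeg g) = (\<Sum>g\<in>G. discdeg g)"
proof -
  have "(\<Sum>g\<in>S. discdeg g) = (\<Sum>g\<in>L. discdeg g) + (\<Sum>g\<in>G. discdeg g)"
    by (subst LG(1)) (rule sum.union_disjoint[OF LG(3,4,2)])
  thus ?thesis using D_L by simp
qed

definition R where "R = (\<Sum>g\<in>S. \<Sum>h\<in>S - {g}. resdeg g h)"

lemma R_nonneg: "R \<ge> 0" unfolding R_def by (intro sum_nonneg) auto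

lemma R_zero: "R = 0 \<Longrightarrow> g \<in> S \<Longrightarrow> h \<in> S \<Longrightarrow> g \<noteq> h \<Longrightarrow> resdeg g h = 0"
proof -
  assume "R = 0" "g \<in> S" "h \<in> S" "g \<noteq> h"
  hence "(\<Sum>h\<in>S - {g}. resdeg g h) = 0"
    using fin unfolding R_def by (subst (asm) sum_nonneg_eq_0_iff) (auto intro: sum_nonneg)
  thus ?thesis using fin \<open>h \<in> S\<close> \<open>g \<noteq> h\<close> by (subst (asm) sum_nonneg_eq_0_iff) auto
qed

lemma T_eq: "T = (\<Sum>g\<in>G. discdeg g) + R"
  by (simp add: T_def R_def sum_discdeg)

text \<open>
  Only the pairs with exactly one member in \<open>C\<close> are counted, each in both orders.
\<close>
lemma R_ge_cut:
  assumes "C \<subseteq> S"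
  shows "R \<ge> 2 * (\<Sum>g\<in>S - C. \<Sum>h\<in>C. resdeg g h)"
proof -
  have finC: "finite C" using assms fin finite_subset by blast
  have "(\<Sum>g\<in>C. \<Sum>h\<in>S - C. resdeg g h) = (\<Sum>g\<in>S - C. \<Sum>h\<in>C. resdeg g h)"
    by (subst sum.swap) (simp add: resdeg_sym)
  moreover have "(\<Sum>g\<in>S - C. \<Sum>h\<in>C. resdeg g h) \<le> (\<Sum>g\<in>S - C. \<Sum>h\<in>S - {g}. resdeg g h)"
    using assms fin by (intro sum_mono sum_mono2) auto
  moreover have "(\<Sum>g\<in>C. \<Sum>h\<in>S - C. resdeg g h) \<le> (\<Sum>g\<in>C. \<Sum>h\<in>S - {g}. resdeg g h)"
    using assms fin by (intro sum_mono sum_mono2) auto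
  moreover have "R = (\<Sum>g\<in>S - C. \<Sum>h\<in>S - {g}. resdeg g h) + (\<Sum>g\<in>C. \<Sum>h\<in>S - {g}. resdeg g h)"
    unfolding R_def by (rule sum.subset_diff[OF assms fin])
  ultimately show ?thesis by linarith
qed

text \<open>
  Linear factors with pairwise constant resultants: any two of them span the others over
  the constants.
\<close>
definition clique where
  "clique C \<longleftrightarrow> C \<subseteq> L \<and> (\<forall>l\<in>C. \<forall>h\<in>C. l \<noteq> h \<longrightarrow> resdeg l h = 0)"

lemma T_clique:
  assumes "clique L" "S = L"
  shows "T = 0"
proof -
  have "resdeg g h = 0" if "g \<in> S" "h \<in> S" "g \<noteq> h" for g h
  proof -
    have "g \<in> L" "h \<in> L" using that assms(2) by blast+
    thus ?thesis using assms(1) that(3) unfolding clique_def by blast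
  qed
  hence "R = 0" unfolding R_def by (intro sum.neutral ballI) auto
  moreover have "G = {}" using assms(2) LG(2) LG(1) by blast
  ultimately show ?thesis by (simp add: T_eq)
qed

lemma max_clique_exists: "\<exists>C. clique C \<and> (\<forall>C'. clique C' \<longrightarrow> card C' \<le> card C)"
proof -
  have "clique {}" by (simp add: clique_def)
  moreover have "\<forall>C. clique C \<longrightarrow> card C < Suc (card L)"
    using LG(3) card_mono by (auto simp: clique_def less_Suc_eq_le)
  ultimately show ?thesis using ex_has_greatest_nat[of clique "{}" card "Suc (card L)"] by blast
qed

lemma sum_ge_card_support:
  fixes r :: "'b \<Rightarrow> int"
  assumes "finite C" "\<And>h. h \<in> C \<Longrightarrow> r h \<ge> 0"
  shows "(\<Sum>h\<in>C. r h) \<ge> int (card {h \<in> C. r h \<noteq> 0})"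
proof -
  have "int (card {h \<in> C. r h \<noteq> 0}) = (\<Sum>h\<in>{h \<in> C. r h \<noteq> 0}. 1)" by simp
  also have "\<dots> \<le> (\<Sum>h\<in>{h \<in> C. r h \<noteq> 0}. r h)" using assms by (intro sum_mono) force
  also have "\<dots> \<le> (\<Sum>h\<in>C. r h)" using assms by (intro sum_mono2) auto
  finally show ?thesis .
qed

text \<open>
  Each form of the clique either has a constant resultant with \<open>g\<close> and improves the bound for
  \<open>discdeg g\<close>, or contributes to the degree of a resultant.
\<close>
lemma nonlinear_contribution:
  assumes C: "clique C" "C \<noteq> {}" and g: "g \<in> G"
  shows "discdeg g + 2 * (\<Sum>h\<in>C. resdeg g h) \<ge> int (degree g) + int (card C) - 2"
proof -
  have finC: "finite C" using C LG(3) finite_subset by (auto simp: clique_def)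
  define Om where "Om = {h \<in> C. resdeg g h = 0}"
  have "(\<Sum>h\<in>C. resdeg g h) \<ge> int (card {h \<in> C. resdeg g h \<noteq> 0})" by (rule sum_ge_card_support[OF finC]) simp
  moreover have "card C = card Om + card {h \<in> C. resdeg g h \<noteq> 0}"
    unfolding Om_def by (subst card_Un_disjoint[symmetric]) (use finC in \<open>auto intro!: arg_cong[of _ _ card]\<close>)
  moreover have "discdeg g \<ge> int (degree g) - 1" using D_G[OF g] .
  moreover have "discdeg g \<ge> int (degree g) + int (card Om) - 2" if "Om \<noteq> {}"
  proof (rule irreducible_discdeg_ge_omitted)
    show "sep_split N g" "prim_irr g" "degree g \<ge> 2" using g sep_split_member(1) irr by (auto simp: G_def)
    show "finite Om" "Om \<noteq> {}" using finC that by (auto simp: Om_def)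
    have OL: "Om \<subseteq> L" using C by (auto simp: clique_def Om_def)
    show "prim_irr l \<and> degree l = 1" if "l \<in> Om" for l using OL that irr by (auto simp: L_def)
    show "resdeg g l = 0" if "l \<in> Om" for l using that by (simp add: Om_def)
    show "resultant l l' \<noteq> 0 \<and> resdeg l l' = 0" if "l \<in> Om" "l' \<in> Om" "l \<noteq> l'" for l l'
      using that C OL resultant_member_nonzero[of l l'] by (auto simp: clique_def Om_def L_def)
  qed
  moreover have "card Om = 0 \<Longrightarrow> Om = {}" using finC by (simp add: Om_def)
  ultimately show ?thesis by (cases "Om = {}") auto
qed

text \<open>
  A linear form with constant resultants with two members of the clique has constant resultants with
  all of them, which contradicts maximality.
\<close>
lemma linear_contribution:
  assumes C: "clique C" "\<And>C'. clique C' \<Longrightarrow> card C' \<le> card C" and l: "l \<in> L - C" 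
  shows "(\<Sum>h\<in>C. resdeg l h) \<ge> 1" "(\<Sum>h\<in>C. resdeg l h) \<ge> int (card C) - 1"
proof -
  have CL: "C \<subseteq> L" and cl: "\<And>p q. p \<in> C \<Longrightarrow> q \<in> C \<Longrightarrow> p \<noteq> q \<Longrightarrow> resdeg p q = 0" using C by (auto simp: clique_def)
  have finC: "finite C" using CL LG(3) finite_subset by auto
  define Z where "Z = {h \<in> C. resdeg l h = 0}"
  have Zne: "Z \<noteq> C"
  proof
    assume "Z = C"
    hence "resdeg l h = 0" "resdeg h l = 0" if "h \<in> C" for h using that resdeg_sym[of h l] by (auto simp: Z_def)
    hence "clique (insert l C)" using CL cl l unfolding clique_def by auto
    from C(2)[OF this] show False using l finC by simp
  qed
  have Z1: "card Z \<le> 1"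
  proof (rule ccontr)
    assume "\<not> card Z \<le> 1"
    then obtain p q where pq: "p \<in> Z" "q \<in> Z" "p \<noteq> q"
      using finC by (metis (no_types, lifting) Z_def card_le_Suc0_iff_eq finite_Collect_conjI finite_subset mem_Collect_eq One_nat_def subsetI)
    have "resdeg l h = 0" if h: "h \<in> C" for h
    proof (cases "h = p \<or> h = q")
      case True thus ?thesis using pq by (auto simp: Z_def)
    next
      case False
      have "p \<in> C" "q \<in> C" using pq by (auto simp: Z_def)
      hence "p \<in> S" "q \<in> S" "degree l = 1" "degree p = 1" "degree q = 1" "degree h = 1"
        using CL h l by (auto simp: L_def)
      thus ?thesis
        using resdeg_linear_combination[of l p q h] resultant_member_nonzero[of p q] cl pq h False by (auto simp: Z_def)
    qed
    hence "Z = C" by (auto simp: Z_def)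
    thus False using Zne by simp
  qed
  have s: "(\<Sum>h\<in>C. resdeg l h) \<ge> int (card {h \<in> C. resdeg l h \<noteq> 0})" by (rule sum_ge_card_support[OF finC]) simp
  have "card C = card Z + card {h \<in> C. resdeg l h \<noteq> 0}"
    unfolding Z_def by (subst card_Un_disjoint[symmetric]) (use finC in \<open>auto intro!: arg_cong[of _ _ card]\<close>)
  thus "(\<Sum>h\<in>C. resdeg l h) \<ge> int (card C) - 1" using s Z1 by linarith
  have "{h \<in> C. resdeg l h \<noteq> 0} \<noteq> {}" using Zne by (auto simp: Z_def)
  hence "card {h \<in> C. resdeg l h \<noteq> 0} > 0" using finC by (simp add: card_gt_0_iff)
  thus "(\<Sum>h\<in>C. resdeg l h) \<ge> 1" using s by linarith
qed

lemma T_ge: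
  assumes C: "clique C" "\<And>C'. clique C' \<Longrightarrow> card C' \<le> card C" and L0: "L \<noteq> {}"
  shows "card C \<ge> 1" "card C \<le> card L"
    "T \<ge> (\<Sum>g\<in>G. int (degree g) + int (card C) - 2) + 2 * (max 1 (int (card C) - 1)) * (int (card L) - int (card C))"
proof -
  have CL: "C \<subseteq> L" using C by (auto simp: clique_def)
  have finC: "finite C" using CL LG(3) finite_subset by auto
  obtain l where l: "l \<in> L" using L0 by blast
  have "clique {l}" using l by (simp add: clique_def)
  from C(2)[OF this] show c1: "card C \<ge> 1" by simp
  show cL: "card C \<le> card L" by (rule card_mono[OF LG(3) CL])
  have Cne: "C \<noteq> {}" using c1 by auto
  have SC: "S - C = G \<union> (L - C)" "G \<inter> (L - C) = {}" using LG CL by auto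
  have "(\<Sum>g\<in>S - C. \<Sum>h\<in>C. resdeg g h) = (\<Sum>g\<in>G. \<Sum>h\<in>C. resdeg g h) + (\<Sum>g\<in>L - C. \<Sum>h\<in>C. resdeg g h)"
    unfolding SC(1) by (rule sum.union_disjoint) (use LG SC in auto)
  hence "T \<ge> (\<Sum>g\<in>G. discdeg g) + 2 * (\<Sum>g\<in>G. \<Sum>h\<in>C. resdeg g h) + 2 * (\<Sum>g\<in>L - C. \<Sum>h\<in>C. resdeg g h)"
    using R_ge_cut[of C] CL LG(1) unfolding T_eq by (auto simp: algebra_simps)
  moreover have "(\<Sum>g\<in>G. discdeg g) + 2 * (\<Sum>g\<in>G. \<Sum>h\<in>C. resdeg g h) = (\<Sum>g\<in>G. discdeg g + 2 * (\<Sum>h\<in>C. resdeg g h))"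
    by (simp add: sum.distrib sum_distrib_left)
  moreover have "(\<Sum>g\<in>G. discdeg g + 2 * (\<Sum>h\<in>C. resdeg g h)) \<ge> (\<Sum>g\<in>G. int (degree g) + int (card C) - 2)"
    using nonlinear_contribution[OF C(1) Cne] by (intro sum_mono) auto
  moreover have "(\<Sum>g\<in>L - C. \<Sum>h\<in>C. resdeg g h) \<ge> (\<Sum>g\<in>L - C. max 1 (int (card C) - 1))"
    using linear_contribution[OF C] by (intro sum_mono) (simp add: max_def)
  moreover have "(\<Sum>g\<in>L - C. max 1 (int (card C) - 1)) = max 1 (int (card C) - 1) * (int (card L) - int (card C))"
    using CL finC cL by (simp add: card_Diff_subset of_nat_diff mult.commute)
  ultimately show "T \<ge> (\<Sum>g\<in>G. int (degree g) + int (card C) - 2) + 2 * (max 1 (int (card C) - 1)) * (int (card L) - int (card C))"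
    by linarith
qed

lemma sum_eq_one_int:
  fixes r :: "'b \<Rightarrow> int"
  assumes "finite A" "\<And>x. x \<in> A \<Longrightarrow> r x \<ge> 0" "sum r A \<le> 1"
  shows "(\<forall>x\<in>A. r x = 0) \<or> (\<exists>a\<in>A. r a = 1 \<and> (\<forall>x\<in>A - {a}. r x = 0))"
proof (cases "\<forall>x\<in>A. r x = 0")
  case False
  then obtain a where a: "a \<in> A" "r a \<noteq> 0" by blast
  have "sum r A = r a + sum r (A - {a})" using a assms(1) by (simp add: sum.remove)
  moreover have "sum r (A - {a}) \<ge> 0" using assms by (intro sum_nonneg) auto
  moreover have "r a \<ge> 1" using a assms(2)[of a] by auto
  ultimately have "r a = 1" "sum r (A - {a}) = 0" using assms(3) by linarith+
  moreover from this have "\<forall>x\<in>A - {a}. r x = 0"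
    using assms by (subst (asm) sum_nonneg_eq_0_iff) auto
  ultimately show ?thesis using a by blast
qed simp

text \<open>
  The configurations of factors whose discriminant can have minimal positive degree.
\<close>
definition extremal :: bool where
  "extremal \<longleftrightarrow>
    (L = {} \<and> R = 0 \<and> (\<forall>g\<in>S. degree g = 2 \<and> discdeg g = 1)) \<or>
    (\<exists>l. L = {l} \<and> R = 0 \<and> (\<forall>g\<in>S - {l}. degree g = 2 \<and> discdeg g = 1)) \<or>
    (\<exists>l c. L = {l} \<and> R = 0 \<and> c \<in> S \<and> degree c = 3 \<and> discdeg c = 2 \<and> (\<forall>g\<in>S - {l, c}. degree g = 2 \<and> discdeg g = 1)) \<or>
    (\<exists>l l' g. S = {l, l', g} \<and> l \<noteq> l' \<and> degree l = 1 \<and> degree l' = 1 \<and> resdeg l l' = 0 \<and> degree g = 2 \<and> T = 2)"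

text \<open>
  The contributions are summed over the factors outside a maximal clique of linear factors.
  If not all factors lie in one clique, then \<open>2 * T\<close> exceeds the degree except when there is at most one linear
  factor or when there are exactly two linear factors and they form a clique.
\<close>
lemma classification:
  assumes S: "S \<noteq> {}"
  shows "(T = 0 \<and> S = L \<and> clique L) \<or>
     (T > 0 \<and> 2 * T \<ge> int (degree (\<Prod>S)) - 1 \<and> (2 * T \<le> int (degree (\<Prod>S)) \<longrightarrow> extremal))"
proof -
  define d where "d = int (degree (\<Prod>S))"
  have d: "d = int (card L) + (\<Sum>g\<in>G. int (degree g))" by (simp add: d_def degree_prod_S)
  have G2: "g \<in> S" "int (degree g) \<ge> 2" "discdeg g \<ge> int (degree g) - 1" if "g \<in> G" for g
    using that D_G[OF that] by (auto simp: G_def)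
  have tm: "2 * discdeg g - int (degree g) \<ge> int (degree g) - 2" "2 * discdeg g - int (degree g) \<ge> 0" if "g \<in> G" for g
    using G2[OF that] by auto
  have T2: "2 * T = (\<Sum>g\<in>G. 2 * discdeg g - int (degree g)) + (\<Sum>g\<in>G. int (degree g)) + 2 * R"
    by (simp add: T_eq sum_subtractf sum_distrib_left)
  have tm_nn: "(\<Sum>g\<in>G. 2 * discdeg g - int (degree g)) \<ge> 0" using tm by (intro sum_nonneg) auto
  have TG: "T \<ge> 1" if "G \<noteq> {}"
  proof -
    have "(\<Sum>g\<in>G. discdeg g) > 0" using that LG(4) G2 by (intro sum_pos) force+
    thus ?thesis using R_nonneg by (simp add: T_eq)
  qed
  have quad: "degree g = 2 \<and> discdeg g = 1" if "g \<in> G" "2 * discdeg g - int (degree g) = 0" for g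
    using G2[OF that(1)] that(2) by auto
  consider "L = {}" | "card L = 1" | "card L \<ge> 2"
    using LG(3) by (metis One_nat_def Suc_leI card_0_eq le_neq_implies_less not_gr0 numeral_2_eq_2)
  thus ?thesis
  proof cases
    case 1
    hence G: "G = S" using LG by auto
    have cL: "int (card L) = 0" using 1 by simp
    have "extremal" if "2 * T \<le> d"
    proof -
      have s0: "(\<Sum>g\<in>G. 2 * discdeg g - int (degree g)) = 0" "R = 0"
        using that T2 d cL tm_nn R_nonneg by linarith+
      have "2 * discdeg g - int (degree g) = 0" if "g \<in> G" for g
        using s0(1) that tm LG(4) by (subst (asm) sum_nonneg_eq_0_iff) auto
      hence "\<forall>g\<in>S. degree g = 2 \<and> discdeg g = 1" using quad G by blast
      thus ?thesis unfolding extremal_def using 1 s0(2) by (intro disjI1 conjI)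
    qed
    moreover have "2 * T \<ge> d" using T2 d cL tm_nn R_nonneg by linarith
    ultimately show ?thesis using TG G S unfolding d_def by force
  next
    case 2
    then obtain l where l: "L = {l}" by (auto simp: card_1_singleton_iff)
    show ?thesis
    proof (cases "G = {}")
      case True
      hence SL: "S = L" using LG by auto
      have "x = l" if "x \<in> L" for x using that l by (metis singletonD)
      hence cl: "clique L" unfolding clique_def by (intro conjI ballI impI subset_refl) metis
      show ?thesis using T_clique[OF cl SL] cl SL by blast
    next
      case False
      have cL: "int (card L) = 1" using l by simp
      have "2 * T \<ge> d - 1" using T2 d cL tm_nn R_nonneg by linarith
      moreover have "extremal" if "2 * T \<le> d"
      proof -
        have s1: "(\<Sum>g\<in>G. 2 * discdeg g - int (degree g)) \<le> 1" "R = 0"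
          using that T2 d cL tm_nn R_nonneg by linarith+
        have SG: "S - {l} = G" "S - {l, c} = G - {c}" for c using LG l by auto
        from sum_eq_one_int[OF LG(4) tm(2) s1(1)]
        show ?thesis
        proof
          assume "\<forall>g\<in>G. 2 * discdeg g - int (degree g) = 0"
          hence "\<forall>g\<in>S - {l}. degree g = 2 \<and> discdeg g = 1" unfolding SG(1) using quad by blast
          thus ?thesis unfolding extremal_def using l s1(2)
            by (intro disjI2[OF disjI1] exI[of _ l] conjI)
        next
          assume "\<exists>c\<in>G. 2 * discdeg c - int (degree c) = 1 \<and> (\<forall>g\<in>G - {c}. 2 * discdeg g - int (degree g) = 0)"
          then obtain c where cG: "c \<in> G" and c': "2 * discdeg c - int (degree c) = 1 \<and>
            (\<forall>g\<in>G - {c}. 2 * discdeg g - int (degree g) = 0)" by (rule bexE)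
          note c = cG c'[THEN conjunct1] c'[THEN conjunct2]
          have "degree c = 3 \<and> discdeg c = 2" using c(2) G2[OF c(1)] by presburger
          moreover have "\<forall>g\<in>S - {l, c}. degree g = 2 \<and> discdeg g = 1" unfolding SG(2) using c(3) quad by blast
          ultimately show ?thesis unfolding extremal_def using G2(1)[OF c(1)] l s1(2)
            by (intro disjI2[OF disjI2[OF disjI1]] exI[of _ l] exI[of _ c] conjI) simp_all
        qed
      qed
      ultimately show ?thesis using TG[OF False] unfolding d_def[symmetric]
        by (intro disjI2 conjI impI) linarith+
    qed
  next
    case 3
    hence L0: "L \<noteq> {}" by auto
    obtain C where C: "clique C" "\<And>C'. clique C' \<Longrightarrow> card C' \<le> card C" using max_clique_exists by blast
    define k where "k = int (card C)"
    define l where "l = int (card L)"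
    have kl: "1 \<le> k" "k \<le> l" "2 \<le> l" using T_ge(1,2)[OF C L0] 3 by (auto simp: k_def l_def)
    have Tg: "T \<ge> (\<Sum>g\<in>G. int (degree g) + k - 2) + 2 * (max 1 (k - 1)) * (l - k)"
      using T_ge(3)[OF C L0] by (simp add: k_def l_def)
    have main: "2 * T - d \<ge> (\<Sum>g\<in>G. int (degree g) + 2 * k - 4) + 4 * (max 1 (k - 1)) * (l - k) - l"
    proof -
      have "(\<Sum>g\<in>G. int (degree g) + 2 * k - 4) = 2 * (\<Sum>g\<in>G. int (degree g) + k - 2) - (\<Sum>g\<in>G. int (degree g))"
        by (simp add: sum_distrib_left sum.distrib sum_subtractf algebra_simps)
      thus ?thesis using Tg d by (simp add: l_def)
    qed
    show ?thesis
    proof (cases "k = l")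
      case True
      have CL: "C = L" using C(1) True card_subset_eq[OF LG(3), of C] by (auto simp: clique_def k_def l_def)
      show ?thesis
      proof (cases "G = {}")
        case True
        hence SL: "S = L" using LG by auto
        have cl: "clique L" using C(1) CL by blast
        show ?thesis using T_clique[OF cl SL] cl SL by blast
      next
        case False
        have ge: "(\<Sum>g\<in>G. int (degree g) + 2 * k - 4) \<ge> (\<Sum>g\<in>G. 2 * l - 2)"
          using G2(2) True by (intro sum_mono) force
        have cG: "card G \<ge> 1" using False LG(4) by (simp add: Suc_leI card_gt_0_iff)
        have ge2: "(\<Sum>g\<in>G. 2 * l - 2) \<ge> 2 * l - 2" 
          using mult_right_mono[of 1 "int (card G)" "2 * l - 2"] cG kl by simp
        have z: "4 * (max 1 (k - 1)) * (l - k) = 0" using True by simp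
        have "2 * T \<ge> d" using main ge ge2 kl z by linarith
        moreover have "extremal" if "2 * T \<le> d"
        proof -
          have m0: "(\<Sum>g\<in>G. int (degree g) + 2 * k - 4) \<le> l" using main that True by simp
          have "int (card G) * (2 * l - 2) \<le> l" using m0 ge by simp
          have l2: "l = 2" using m0 ge ge2 kl by linarith
          have "card G = 1" using \<open>int (card G) * (2 * l - 2) \<le> l\<close> cG l2 by simp
          then obtain g where g: "G = {g}" by (auto simp: card_1_singleton_iff)
          have dg: "degree g = 2" using m0 True l2 G2(2)[of g] g by simp
          have "card L = 2" using l2 by (simp add: l_def)
          then obtain a b where ab: "L = {a, b}" "a \<noteq> b" by (auto simp: card_2_iff)
          have SS: "S = {a, b, g}" using LG ab g by auto
          have "T \<ge> 2" using Tg g True l2 dg by simp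
          moreover have "T \<le> 2" using that d ab dg g by simp
          ultimately have "T = 2" by simp
          moreover have "degree a = 1" "degree b = 1" using ab by (auto simp: L_def)
          moreover have "resdeg a b = 0" using C(1) CL ab by (auto simp: clique_def)
          ultimately show ?thesis unfolding extremal_def using SS ab(2) dg
            by (intro disjI2[OF disjI2[OF disjI2]] exI[of _ a] exI[of _ b] exI[of _ g] conjI)
        qed
        ultimately show ?thesis using TG[OF False] unfolding d_def by auto
      qed
    next
      case False
      hence kl': "k + 1 \<le> l" using kl by simp
      have "(\<Sum>g\<in>G. int (degree g) + 2 * k - 4) \<ge> 0" using G2(2) kl by (intro sum_nonneg) force
      moreover have "4 * (max 1 (k - 1)) * (l - k) - l > 0"
      proof (cases "k \<le> 2")
        case True thus ?thesis using kl kl' by (cases "k = 1") auto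
      next
        case False
        define e where "e = l - k"
        have e: "e \<ge> 1" "l = k + e" using kl' by (auto simp: e_def)
        have "(4 * k - 5) * e \<ge> (4 * k - 5) * 1" using e False by (intro mult_left_mono) auto
        moreover have "4 * (max 1 (k - 1)) * (l - k) - l = (4 * k - 5) * e - k"
          using False e by (simp add: max_def algebra_simps)
        ultimately have "4 * (max 1 (k - 1)) * (l - k) - l \<ge> (4 * k - 5) * 1 - k" by simp
        moreover have "(4 * k - 5) * 1 - k > 0" using False by simp
        ultimately show ?thesis by (rule less_le_trans[rotated])
      qed
      ultimately have "2 * T > d" using main by linarith
      moreover have "d \<ge> 0" by (simp add: d_def)
      ultimately show ?thesis unfolding d_def by auto
    qed
  qed
qed

end

section \<open>Binary forms evaluated at linear forms\<close>

text \<open>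
  The form \<open>\<Sum> F\<^sub>k P\<^sup>k Q\<^sup>m\<^sup>-\<^sup>k\<close>.  A binary form of degree \<open>m\<close> is represented by its dehomogenisation \<open>F\<close>
  together with \<open>m\<close>; \<open>\<phi>\<close> embeds the coefficients into the ring of \<open>P\<close> and \<open>Q\<close>.
\<close>
definition gsub :: "('r::comm_ring_1 \<Rightarrow> 's::comm_ring_1) \<Rightarrow> nat \<Rightarrow> 'r poly \<Rightarrow> 's \<Rightarrow> 's \<Rightarrow> 's" where
  "gsub \<phi> m F P Q = (\<Sum>k\<le>m. \<phi> (coeff F k) * P ^ k * Q ^ (m - k))"

lemma gsub_pCons: "gsub \<phi> (Suc m) (pCons a F) P Q = \<phi> a * Q ^ Suc m + P * gsub \<phi> m F P Q"
  unfolding gsub_def sum.atMost_Suc_shift by (simp add: sum_distrib_left mult_ac)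

lemma gsub_0_exp: "gsub \<phi> 0 F P Q = \<phi> (coeff F 0)"
  by (simp add: gsub_def)

context comm_ring_hom begin

lemma gsub_add: "gsub hom m (F + G) P Q = gsub hom m F P Q + gsub hom m G P Q"
  by (simp add: gsub_def hom_add sum.distrib algebra_simps)

lemma gsub_0: "gsub hom m 0 P Q = 0"
  by (simp add: gsub_def)

lemma gsub_smult: "gsub hom m (smult c F) P Q = hom c * gsub hom m F P Q"
  by (simp add: gsub_def hom_mult sum_distrib_left mult_ac)

lemma gsub_sum: "gsub hom m (\<Sum>i\<in>I. F i) P Q = (\<Sum>i\<in>I. gsub hom m (F i) P Q)"
  by (induction I rule: infinite_finite_induct) (auto simp: gsub_0 gsub_add)

lemma gsub_Suc: "degree F \<le> m \<Longrightarrow> gsub hom (Suc m) F P Q = Q * gsub hom m F P Q"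
  by (simp add: gsub_def coeff_eq_0 sum_distrib_left Suc_diff_le mult_ac)

lemma gsub_add_exp: "degree F \<le> m \<Longrightarrow> gsub hom (n + m) F P Q = Q ^ n * gsub hom m F P Q"
  by (induction n) (simp_all add: gsub_Suc mult_ac)

lemma gsub_mult:
  assumes "degree F \<le> m" "degree G \<le> n"
  shows "gsub hom (m + n) (F * G) P Q = gsub hom m F P Q * gsub hom n G P Q"
  using assms(1)
proof (induction F arbitrary: m)
  case 0 thus ?case by (simp add: gsub_0)
next
  case (pCons a F)
  show ?case
  proof (cases m)
    case 0
    hence "F = 0" using pCons.prems by (simp split: if_splits)
    thus ?thesis by (simp add: 0 gsub_smult gsub_0_exp)
  next
    case (Suc k)
    hence F: "degree F \<le> k" using pCons.prems by (cases "F = 0") auto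
    have "gsub hom (Suc (k + n)) (smult a G) P Q = hom a * (Q ^ Suc k * gsub hom n G P Q)"
      using gsub_add_exp[OF assms(2), of "Suc k"] by (simp add: gsub_smult)
    thus ?thesis using pCons.IH[OF F]
      by (simp add: Suc gsub_add gsub_pCons[of _ _ 0] gsub_pCons[of _ _ a] algebra_simps)
  qed
qed

lemma gsub_power: "degree F \<le> 1 \<Longrightarrow> gsub hom k (F ^ k) P Q = gsub hom 1 F P Q ^ k"
proof (induction k)
  case 0 thus ?case by (simp add: gsub_def)
next
  case (Suc k)
  have "degree (F ^ k) \<le> k" using degree_power_le[of F k] Suc.prems
    by (metis mult.commute mult.right_neutral mult_le_mono2 order_trans)
  thus ?case using gsub_mult[of F 1 "F ^ k" k] Suc by simp
qed

lemma gsub_linear: "gsub hom 1 [:b, a:] P Q = hom a * P + hom b * Q"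
  by (simp add: gsub_def)

end

text \<open>
  The value of a form at two polynomials in \<open>y\<close>, in practice linear ones.
\<close>
definition hsub :: "nat \<Rightarrow> 'r::comm_ring_1 poly \<Rightarrow> 'r poly \<Rightarrow> 'r poly \<Rightarrow> 'r poly" where
  "hsub m F p q = gsub (\<lambda>c. [:c:]) m F p q"

lemma const_poly_hom: "comm_ring_hom (\<lambda>c :: 'r::comm_ring_1. [:c:])"
  by standard (simp_all add: one_pCons)

lemma hsub_altdef: "hsub m F p q = (\<Sum>k\<le>m. smult (coeff F k) (p ^ k * q ^ (m - k)))"
  by (simp add: hsub_def gsub_def)

lemma degree_hsub_le:
  assumes "degree p \<le> 1" "degree q \<le> 1"
  shows "degree (hsub m F p q) \<le> m"
  unfolding hsub_altdef
proof (rule degree_sum_le)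
  fix k assume k: "k \<in> {..m}"
  have "degree (p ^ k) \<le> k" "degree (q ^ (m - k)) \<le> m - k"
    using degree_power_le[of p k] degree_power_le[of q "m - k"] assms
    by (metis mult.commute mult.right_neutral mult_le_mono2 order_trans)+
  hence "degree (p ^ k * q ^ (m - k)) \<le> m" using degree_mult_le[of "p ^ k" "q ^ (m - k)"] k by auto
  thus "degree (smult (coeff F k) (p ^ k * q ^ (m - k))) \<le> m"
    using degree_smult_le order_trans by blast
qed auto

text \<open>
  Composition of linear substitutions.
\<close>
lemma (in comm_ring_hom) gsub_hsub:
  assumes "degree u \<le> 1" "degree v \<le> 1"
  shows "gsub hom m (hsub m F u v) P Q = gsub hom m F (gsub hom 1 u P Q) (gsub hom 1 v P Q)"
proof -
  have dp: "degree (w ^ k) \<le> k" if "degree w \<le> 1" for w :: "'a poly" and k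
    using degree_power_le[of w k] that by (metis mult.commute mult.right_neutral mult_le_mono2 order_trans)
  have "gsub hom m (u ^ k * v ^ (m - k)) P Q = gsub hom 1 u P Q ^ k * gsub hom 1 v P Q ^ (m - k)" if "k \<le> m" for k
    using gsub_mult[of "u ^ k" k "v ^ (m - k)" "m - k" P Q] dp assms that by (simp add: gsub_power)
  thus ?thesis unfolding hsub_altdef gsub_sum gsub_smult
    by (simp add: gsub_def[of hom m F] mult.assoc)
qed

lemma hsub_identity: "degree f \<le> m \<Longrightarrow> hsub m f [:0, 1:] [:1:] = f"
proof -
  assume d: "degree f \<le> m"
  have "[:0, 1:] ^ k * [:1:] ^ j = monom (1 :: 'a) k" for k j
    by (simp add: monom_altdef one_pCons[symmetric])
  hence "hsub m f [:0, 1:] [:1:] = (\<Sum>k\<le>m. monom (coeff f k) k)"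
    by (simp add: hsub_altdef smult_monom)
  also have "\<dots> = f" using d by (rule poly_as_sum_of_monoms')
  finally show ?thesis .
qed

text \<open>
  The determinant of two linear forms.
\<close>
definition pdet :: "'r::comm_ring_1 poly \<Rightarrow> 'r poly \<Rightarrow> 'r" where
  "pdet p q = coeff p 1 * coeff q 0 - coeff p 0 * coeff q 1"

lemma deg1_form: "degree p \<le> 1 \<Longrightarrow> p = [:coeff p 0, coeff p 1:]"
  by (rule poly_eqI) (auto simp: coeff_pCons coeff_eq_0 split: nat.split)

text \<open>
  The inverse substitution.
\<close>
lemma hsub_exists:
  fixes f :: "'a::field poly poly"
  assumes p: "degree p \<le> 1" and q: "degree q \<le> 1" and e: "pdet p q = [:e:]" "e \<noteq> 0" and f: "degree f \<le> m"
  shows "\<exists>F. degree F \<le> m \<and> f = hsub m F p q"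
proof -
  note clin = comm_ring_hom.gsub_linear[OF const_poly_hom]
  define k where "k = [:1 / e:]"
  define u where "u = [:- (k * coeff p 0), k * coeff q 0:]"
  define v where "v = [:k * coeff p 1, - (k * coeff q 1):]"
  have du: "degree u \<le> 1" "degree v \<le> 1" by (auto simp: u_def v_def)
  define F where "F = hsub m f u v"
  have ke: "k * pdet p q = 1" using e by (simp add: k_def one_pCons[symmetric])
  have ke': "k * (coeff p 1 * coeff q 0) - k * (coeff p 0 * coeff q 1) = 1"
    using ke by (simp add: pdet_def right_diff_distrib)
  have "gsub (\<lambda>c. [:c:]) 1 u p q = smult (k * coeff q 0) p - smult (k * coeff p 0) q"
    unfolding u_def clin by simp
  also have "\<dots> = [:0, 1:]"
    by (subst deg1_form[OF p], subst (2) deg1_form[OF q]) (use ke' in \<open>simp add: algebra_simps\<close>)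
  finally have 1: "gsub (\<lambda>c. [:c:]) 1 u p q = [:0, 1:]" .
  have "gsub (\<lambda>c. [:c:]) 1 v p q = smult (k * coeff p 1) q - smult (k * coeff q 1) p"
    unfolding v_def clin by simp
  also have "\<dots> = [:1:]"
    by (subst (2) deg1_form[OF p], subst deg1_form[OF q]) (use ke' in \<open>simp add: algebra_simps\<close>)
  finally have 2: "gsub (\<lambda>c. [:c:]) 1 v p q = [:1:]" .
  have "hsub m F p q = gsub (\<lambda>c. [:c:]) m F p q" by (simp only: hsub_def)
  also have "\<dots> = gsub (\<lambda>c. [:c:]) m f [:0, 1:] [:1:]"
    unfolding F_def comm_ring_hom.gsub_hsub[OF const_poly_hom du] 1 2 ..
  also have "\<dots> = f" using hsub_identity[OF f] by (simp only: hsub_def)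
  finally have "f = hsub m F p q" by (rule sym)
  thus ?thesis using degree_hsub_le[OF du, of m f] unfolding F_def by (intro exI[of _ "hsub m f u v"] conjI)
qed

context
  fixes N :: nat and p q F f :: "'a::{alg_closed_field, field_char_0} poly poly" and m :: nat and e :: 'a
  assumes ss: "sep_split N f" and p: "degree p \<le> 1" and q: "degree q \<le> 1" and e: "pdet p q = [:e:]" "e \<noteq> 0"
    and f: "f = hsub m F p q" "degree f = m" and F: "degree F = m"
begin

private lemma N: "N > 0" using ss by (simp add: sep_split_def)
private lemma f0: "f \<noteq> 0" using ss by (simp add: sep_split_def)

interpretation em: inj_comm_ring_hom "emb N :: 'a poly \<Rightarrow> 'a fls" by (rule emb_inj_hom[OF N])

private lemma F0: "F \<noteq> 0" using f f0 by (auto simp: hsub_altdef)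

private abbreviation "E \<equiv> (emb N :: 'a poly \<Rightarrow> 'a fls)"

private lemma lsub: "lpoly N (hsub n G p q) r = gsub E n G (lpoly N p r) (lpoly N q r)" for G n r
proof -
  interpret map_poly_comm_ring_hom E by (simp add: map_poly_comm_ring_hom_def emb_hom)
  show ?thesis
    unfolding hsub_altdef gsub_def
    by (simp add: hom_sum poly_sum lpoly_smult[OF N] lpoly_mult[OF N] hom_power mult.assoc)
qed

private lemma lpq: "lpoly N p r = E (coeff p 1) * r + E (coeff p 0)" "lpoly N q r = E (coeff q 1) * r + E (coeff q 0)" for r
  by (subst deg1_form[OF p], simp add: lpoly_pCons[OF N]) (subst deg1_form[OF q], simp add: lpoly_pCons[OF N])

private lemma Edet: "E (coeff p 1) * E (coeff q 0) - E (coeff p 0) * E (coeff q 1) = fls_const e"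
  using arg_cong[OF e(1), of E] by (simp add: pdet_def em.hom_minus em.hom_mult)

private lemma q_root_nz: "r \<in> lroots N f \<Longrightarrow> lpoly N q r \<noteq> 0"
proof
  assume r: "r \<in> lroots N f" and q0: "lpoly N q r = 0"
  have "0 = gsub E m F (lpoly N p r) 0" using r lsub[of m F r] q0 f by (simp add: lroots_def)
  also have "\<dots> = (\<Sum>k\<le>m. if k = m then E (coeff F m) * lpoly N p r ^ m else 0)"
    unfolding gsub_def by (intro sum.cong) auto
  also have "\<dots> = E (lead_coeff F) * lpoly N p r ^ m" using F by simp
  finally have "lpoly N p r ^ m = 0" using F0 by simp
  hence p0: "lpoly N p r = 0" by simp
  have "fls_const e = E (coeff p 1) * (E (coeff q 0) + E (coeff q 1) * r) - E (coeff q 1) * (E (coeff p 0) + E (coeff p 1) * r)"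
    using Edet by (simp add: algebra_simps)
  also have "\<dots> = 0" using p0 q0 unfolding lpq by (simp add: add.commute)
  finally show False using e(2) by simp
qed

private definition "\<rho> r = lpoly N p r / lpoly N q r"

private lemma lsub_rho: "r \<in> lroots N f \<Longrightarrow> degree G \<le> n \<Longrightarrow> lpoly N (hsub n G p q) r = lpoly N q r ^ n * lpoly N G (\<rho> r)"
proof -
  assume r: "r \<in> lroots N f" and G: "degree G \<le> n"
  have pr: "lpoly N p r = \<rho> r * lpoly N q r" using q_root_nz[OF r] by (simp add: \<rho>_def)
  have "lpoly N (hsub n G p q) r = (\<Sum>k\<le>n. E (coeff G k) * (\<rho> r) ^ k * lpoly N q r ^ n)"
    unfolding lsub gsub_def pr
    by (intro sum.cong) (auto simp: power_mult_distrib mult.assoc power_add[symmetric])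
  also have "\<dots> = lpoly N q r ^ n * lpoly N G (\<rho> r)"
    using lpoly_altdef[OF N, of G "Suc n"] G by (simp add: sum_distrib_left lessThan_Suc_atMost mult_ac)
  finally show ?thesis .
qed

private lemma rho_bij: "bij_betw \<rho> (lroots N f) (lroots N F)" and ssF: "sep_split N F"
proof -
  have inj: "inj_on \<rho> (lroots N f)"
  proof (rule inj_onI)
    fix r s assume rs: "r \<in> lroots N f" "s \<in> lroots N f" "\<rho> r = \<rho> s"
    have "lpoly N p r * lpoly N q s - lpoly N p s * lpoly N q r = 0"
      using rs q_root_nz by (simp add: \<rho>_def field_simps)
    moreover have "lpoly N p r * lpoly N q s - lpoly N p s * lpoly N q r = fls_const e * (r - s)"
      unfolding lpq Edet[symmetric] by (simp add: algebra_simps)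
    ultimately show "r = s" using e(2) by simp
  qed
  have sub: "\<rho> ` lroots N f \<subseteq> lroots N F"
  proof safe
    fix r assume r: "r \<in> lroots N f"
    have "lpoly N q r ^ m * lpoly N F (\<rho> r) = 0"
      using lsub_rho[OF r, of F m] r F f(1) by (simp add: lroots_def)
    thus "\<rho> r \<in> lroots N F" using q_root_nz[OF r] by (simp add: lroots_def)
  qed
  have "card (lroots N f) = m" using ss f by (simp add: sep_split_def)
  moreover have "card (lroots N f) \<le> card (lroots N F)"
    using card_inj_on_le[OF inj sub lroots_finite[OF N F0]] .
  moreover have "card (lroots N F) \<le> m" using card_lroots_le[OF N F0] F by simp
  ultimately have c: "card (lroots N F) = m" "card (\<rho> ` lroots N f) = m" using card_image[OF inj] by auto
  hence "\<rho> ` lroots N f = lroots N F" using card_subset_eq[OF lroots_finite[OF N F0] sub] by simp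
  thus "bij_betw \<rho> (lroots N f) (lroots N F)" using inj by (simp add: bij_betw_def)
  show "sep_split N F" using c N F0 F by (simp add: sep_split_def)
qed

private lemma lead_prod: "E (lead_coeff f) * (\<Prod>r\<in>lroots N f. lpoly N q r) = E (lead_coeff F) * fls_const e ^ m"
proof (cases "coeff q 1 = 0")
  case True
  have cm: "coeff (p ^ k * q ^ (m - k)) m = (if k = m then coeff p 1 ^ m else 0)" if "k \<le> m" for k
  proof -
    have q': "q = [:coeff q 0:]" using deg1_form[OF q] True by simp
    have qk: "q ^ j = [:coeff q 0 ^ j:]" for j
    proof -
      have "q ^ j = [:coeff q 0:] ^ j" using q' by metis
      also have "\<dots> = [:coeff q 0 ^ j:]" by (rule poly_const_pow)
      finally show ?thesis .
    qed
    have dpk: "degree (p ^ k) \<le> k" using degree_power_le[of p k] p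
      by (metis mult.commute mult.right_neutral mult_le_mono2 order_trans)
    have "coeff (p ^ m) m = coeff p 1 ^ m"
    proof (cases "degree p = 1")
      case True
      hence "p \<noteq> 0" by auto
      hence "degree (p ^ m) = m" using True by (simp add: degree_power_eq)
      thus ?thesis using lead_coeff_power[of p m] True by simp
    next
      case False
      hence p0: "degree p = 0" using p by simp
      hence "coeff p 1 = 0" by (simp add: coeff_eq_0)
      moreover have "coeff (p ^ m) m = (if m = 0 then 1 else 0)"
        using degree_power_le[of p m] p0 by (cases "m = 0") (auto intro!: coeff_eq_0)
      ultimately show ?thesis by (simp add: power_0_left)
    qed
    thus ?thesis using dpk that unfolding qk by (auto intro!: coeff_eq_0)
  qed
  have "lead_coeff f = (\<Sum>k\<le>m. if k = m then coeff F m * coeff p 1 ^ m else 0)"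
    unfolding f(2) by (subst f(1), unfold hsub_altdef coeff_sum) (intro sum.cong, auto simp: cm)
  hence lf: "lead_coeff f = lead_coeff F * coeff p 1 ^ m" using F by simp
  have "(\<Prod>r\<in>lroots N f. lpoly N q r) = E (coeff q 0) ^ m"
    unfolding lpq using True ss f by (simp add: sep_split_def)
  moreover have "E (coeff p 1) * E (coeff q 0) = fls_const e" using Edet True by simp
  ultimately show ?thesis
    by (simp add: lf em.hom_mult em.hom_power power_mult_distrib[symmetric] mult.assoc)
next
  case False
  define c where "c = E (coeff q 1)"
  have c0: "c \<noteq> 0" using False by (simp add: c_def)
  define s where "s = - E (coeff q 0) / c"
  have qs: "lpoly N q r = (- c) * (s - r)" for r using c0 unfolding lpq by (simp add: s_def c_def[symmetric, unfolded One_nat_def] field_simps)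
  have "c * lpoly N p s = - fls_const e"
    unfolding lpq Edet[symmetric] using c0 by (simp add: s_def c_def[symmetric, unfolded One_nat_def] field_simps)
  hence ps: "(- c) * lpoly N p s = fls_const e" by simp
  have "lpoly N f s = gsub E m F (lpoly N p s) 0" using lsub[of m F s] f qs[of s] by simp
  also have "\<dots> = (\<Sum>k\<le>m. if k = m then E (coeff F m) * lpoly N p s ^ m else 0)"
    unfolding gsub_def by (intro sum.cong) auto
  finally have fs: "lpoly N f s = E (lead_coeff F) * lpoly N p s ^ m" using F by simp
  have "lpoly N f s = E (lead_coeff f) * (\<Prod>r\<in>lroots N f. s - r)"
    unfolding sep_split_factor[OF N ss] by (simp add: poly_prod)
  hence "E (lead_coeff f) * (\<Prod>r\<in>lroots N f. lpoly N q r) = (- c) ^ m * lpoly N f s"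
    unfolding qs prod.distrib using ss f by (simp add: sep_split_def mult_ac)
  also have "\<dots> = E (lead_coeff F) * ((- c) * lpoly N p s) ^ m"
    unfolding fs by (simp only: power_mult_distrib mult_ac)
  finally show ?thesis unfolding ps .
qed

text \<open>
  On the roots, the change of coordinates is the Moebius transformation \<open>r \<mapsto> p(r) / q(r)\<close>, and the product
  of the denominators \<open>q(r)\<close> is accounted for by the leading coefficients.
\<close>
lemma resultant_hsub:
  assumes G: "g = hsub n G p q" "degree g = n" "degree G = n"
  shows "resultant f g = [:e:] ^ (m * n) * resultant F G"
proof -
  let ?Q = "\<Prod>r\<in>lroots N f. lpoly N q r"
  have "E (resultant f g) = E (lead_coeff f) ^ n * (\<Prod>r\<in>lroots N f. lpoly N q r ^ n * lpoly N G (\<rho> r))"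
    using emb_resultant[OF N ss, of g] lsub_rho[of _ G n] G by simp
  also have "\<dots> = (E (lead_coeff f) * ?Q) ^ n * (\<Prod>r\<in>lroots N f. lpoly N G (\<rho> r))"
    by (simp only: prod.distrib prod_power_distrib power_mult_distrib mult.assoc)
  also have "(\<Prod>r\<in>lroots N f. lpoly N G (\<rho> r)) = (\<Prod>r\<in>lroots N F. lpoly N G r)"
    by (rule prod.reindex_bij_betw[OF rho_bij])
  also have "(E (lead_coeff f) * ?Q) ^ n * \<dots> = fls_const e ^ (m * n) * E (resultant F G)"
    unfolding lead_prod emb_resultant[OF N ssF] G(3) by (simp only: power_mult_distrib power_mult mult_ac)
  also have "\<dots> = E ([:e:] ^ (m * n) * resultant F G)"
    by (simp only: em.hom_mult em.hom_power emb_const)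
  finally show ?thesis by (simp only: em.eq_iff)
qed

text \<open>
  The invariance of the discriminant.  At a root, \<open>q f'\<close> is \<open>e q\<^sup>m\<^sup>-\<^sup>1\<close> times the derivative of \<open>F\<close> at
  the transformed root; the terms with \<open>f\<close> itself vanish by Euler's identity.
\<close>
lemma discdeg_hsub:
  assumes m: "m > 0"
  shows "discdeg f = discdeg F"
proof -
  let ?Q = "\<Prod>r\<in>lroots N f. lpoly N q r"
  have pd: "lpoly N (pderiv w) r = E (coeff w 1)" if "degree w \<le> 1" for w r
    by (subst deg1_form[OF that]) (simp add: pderiv_pCons lpoly_pCons[OF N])
  have key: "lpoly N q r * lpoly N (pderiv f) r = fls_const e * lpoly N q r ^ (m - 1) * lpoly N (pderiv F) (\<rho> r)"
    if r: "r \<in> lroots N f" for r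
  proof -
    let ?p = "lpoly N p r" and ?q = "lpoly N q r"
    let ?p1 = "E (coeff p 1)" and ?q1 = "E (coeff q 1)"
    interpret map_poly_comm_ring_hom E by (simp add: map_poly_comm_ring_hom_def emb_hom)
    have pdpow: "lpoly N (pderiv (w ^ k)) r = of_nat k * lpoly N w r ^ (k - 1) * E (coeff w 1)" if "degree w \<le> 1" for w k
      using pd[OF that] by (cases k) (simp_all add: pderiv_power_Suc lpoly_mult[OF N] lpoly_smult[OF N] hom_power em.hom_of_nat em.hom_add del: power_Suc of_nat_Suc)
    define S where "S = (\<Sum>k\<le>m. E (coeff F k) * of_nat k * ?p ^ (k - 1) * ?q ^ (m - k))"
    have "lpoly N (pderiv f) r = (\<Sum>k\<le>m. E (coeff F k) * (of_nat k * ?p ^ (k - 1) * ?p1 * ?q ^ (m - k) + ?p ^ k * (of_nat (m - k) * ?q ^ (m - k - 1) * ?q1)))"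
      unfolding f(1) hsub_altdef pderiv_sum
      by (simp add: hom_sum poly_sum lpoly_smult[OF N] pderiv_smult pderiv_mult lpoly_add[OF N] lpoly_mult[OF N]
          pdpow[OF p] pdpow[OF q] hom_power algebra_simps)
    hence "?q * lpoly N (pderiv f) r = (\<Sum>k\<le>m. ?q * (E (coeff F k) * (of_nat k * ?p ^ (k - 1) * ?p1 * ?q ^ (m - k) + ?p ^ k * (of_nat (m - k) * ?q ^ (m - k - 1) * ?q1))))"
      by (simp add: sum_distrib_left)
    also have "\<dots> = (\<Sum>k\<le>m. (?p1 * ?q - ?q1 * ?p) * (E (coeff F k) * of_nat k * ?p ^ (k - 1) * ?q ^ (m - k)) + of_nat m * ?q1 * (E (coeff F k) * ?p ^ k * ?q ^ (m - k)))"
    proof (rule sum.cong[OF refl])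
      fix k assume k: "k \<in> {..m}"
      have a: "?q * (of_nat (m - k) * ?q ^ (m - k - 1)) = of_nat (m - k) * ?q ^ (m - k)"
        by (cases "m - k") auto
      have b: "?p * (of_nat k * ?p ^ (k - 1)) = of_nat k * ?p ^ k" by (cases k) auto
      have c: "of_nat (m - k) = (of_nat m - of_nat k :: 'a fls)" using k by (simp add: of_nat_diff)
      have "?q * (E (coeff F k) * (of_nat k * ?p ^ (k - 1) * ?p1 * ?q ^ (m - k) + ?p ^ k * (of_nat (m - k) * ?q ^ (m - k - 1) * ?q1)))
        = ?p1 * ?q * (E (coeff F k) * of_nat k * ?p ^ (k - 1) * ?q ^ (m - k)) + E (coeff F k) * ?p ^ k * ?q1 * (?q * (of_nat (m - k) * ?q ^ (m - k - 1)))"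
        by (simp add: algebra_simps)
      also have "\<dots> = ?p1 * ?q * (E (coeff F k) * of_nat k * ?p ^ (k - 1) * ?q ^ (m - k)) + of_nat m * ?q1 * (E (coeff F k) * ?p ^ k * ?q ^ (m - k))
          - E (coeff F k) * ?q1 * ?q ^ (m - k) * (of_nat k * ?p ^ k)"
        unfolding a by (simp add: c algebra_simps)
      also have "\<dots> = (?p1 * ?q - ?q1 * ?p) * (E (coeff F k) * of_nat k * ?p ^ (k - 1) * ?q ^ (m - k)) + of_nat m * ?q1 * (E (coeff F k) * ?p ^ k * ?q ^ (m - k))"
        unfolding b[symmetric] by (simp add: algebra_simps)
      finally show "?q * (E (coeff F k) * (of_nat k * ?p ^ (k - 1) * ?p1 * ?q ^ (m - k) + ?p ^ k * (of_nat (m - k) * ?q ^ (m - k - 1) * ?q1)))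
        = (?p1 * ?q - ?q1 * ?p) * (E (coeff F k) * of_nat k * ?p ^ (k - 1) * ?q ^ (m - k)) + of_nat m * ?q1 * (E (coeff F k) * ?p ^ k * ?q ^ (m - k))" .
    qed
    also have "\<dots> = (?p1 * ?q - ?q1 * ?p) * S + of_nat m * ?q1 * lpoly N f r"
      unfolding S_def f(1) lsub gsub_def by (simp only: sum.distrib sum_distrib_left)
    also have "lpoly N f r = 0" using r by (simp add: lroots_def)
    also have "?p1 * ?q - ?q1 * ?p = fls_const e" unfolding Edet[symmetric] lpq by (simp add: algebra_simps)
    also have "S = ?q ^ (m - 1) * lpoly N (pderiv F) (\<rho> r)"
    proof -
      have pr: "?p = \<rho> r * ?q" using q_root_nz[OF r] by (simp add: \<rho>_def)
      obtain m' where m': "m = Suc m'" using m by (cases m) auto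
      have "S = (\<Sum>k\<le>m'. E (coeff F (Suc k)) * of_nat (Suc k) * ?p ^ k * ?q ^ (m' - k))"
        unfolding S_def m' sum.atMost_Suc_shift by simp
      also have "\<dots> = (\<Sum>k\<le>m'. E (coeff (pderiv F) k) * \<rho> r ^ k * ?q ^ m')"
        unfolding pr by (intro sum.cong) (auto simp: power_mult_distrib power_add[symmetric] coeff_pderiv em.hom_mult em.hom_of_nat em.hom_add mult_ac)
      also have "\<dots> = ?q ^ m' * lpoly N (pderiv F) (\<rho> r)"
        using lpoly_altdef[OF N, of "pderiv F" "Suc m'"] F m'
        by (simp add: sum_distrib_left lessThan_Suc_atMost mult_ac degree_pderiv)
      finally show ?thesis by (simp add: m')
    qed
    finally show ?thesis by (simp add: mult_ac)
  qed
  have fin: "card (lroots N f) = m" using ss f by (simp add: sep_split_def)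
  have Q0: "?Q \<noteq> 0" using q_root_nz lroots_finite[OF N f0] by auto
  have A: "?Q * (\<Prod>r\<in>lroots N f. lpoly N (pderiv f) r) = fls_const e ^ m * ?Q ^ (m - 1) * (\<Prod>r\<in>lroots N F. lpoly N (pderiv F) r)"
  proof -
    have "?Q * (\<Prod>r\<in>lroots N f. lpoly N (pderiv f) r) = (\<Prod>r\<in>lroots N f. fls_const e * lpoly N q r ^ (m - 1) * lpoly N (pderiv F) (\<rho> r))"
      unfolding prod.distrib[symmetric] using key by (intro prod.cong) auto
    also have "\<dots> = fls_const e ^ m * ?Q ^ (m - 1) * (\<Prod>r\<in>lroots N f. lpoly N (pderiv F) (\<rho> r))"
      by (simp add: prod.distrib prod_power_distrib fin)
    also have "(\<Prod>r\<in>lroots N f. lpoly N (pderiv F) (\<rho> r)) = (\<Prod>r\<in>lroots N F. lpoly N (pderiv F) r)"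
      by (rule prod.reindex_bij_betw[OF rho_bij])
    finally show ?thesis .
  qed
  let ?a = "E (lead_coeff f)" and ?b = "E (lead_coeff F)" and ?e = "fls_const e :: 'a fls"
  let ?Pf = "\<Prod>r\<in>lroots N f. lpoly N (pderiv f) r" and ?PF = "\<Prod>r\<in>lroots N F. lpoly N (pderiv F) r"
  have Rf: "E (resultant f (pderiv f)) = ?a ^ (m - 1) * ?Pf"
    using emb_resultant[OF N ss, of "pderiv f"] f by (simp add: degree_pderiv)
  have RF: "E (resultant F (pderiv F)) = ?b ^ (m - 1) * ?PF"
    using emb_resultant[OF N ssF, of "pderiv F"] F by (simp add: degree_pderiv)
  have "(E (resultant f (pderiv f)) * ?b) * (?e ^ m) = ?a ^ (m - 1) * ?Pf * (?a * ?Q)"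
    unfolding Rf lead_prod by (simp only: mult_ac)
  also have "\<dots> = ?a * (?a ^ (m - 1) * (?Q * ?Pf))" by (simp only: mult_ac)
  also have "\<dots> = ?a * (?e ^ m * (?a * ?Q) ^ (m - 1) * ?PF)" unfolding A by (simp only: power_mult_distrib mult_ac)
  also have "\<dots> = (?a * E (resultant F (pderiv F)) * (?e ^ m) ^ (m - 1)) * ?e ^ m"
    unfolding lead_prod RF by (simp only: power_mult_distrib mult_ac)
  finally have "E (resultant f (pderiv f)) * ?b = ?a * E (resultant F (pderiv F)) * (?e ^ m) ^ (m - 1)"
    using e(2) by simp
  hence "E (resultant f (pderiv f) * lead_coeff F) = E (lead_coeff f * resultant F (pderiv F) * ([:e:] ^ m) ^ (m - 1))"
    by (simp only: em.hom_mult em.hom_power emb_const)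
  hence eq: "resultant f (pderiv f) * lead_coeff F = lead_coeff f * resultant F (pderiv F) * ([:e:] ^ m) ^ (m - 1)"
    by (simp only: em.eq_iff)
  have ek: "([:e:] ^ m) ^ (m - 1) = [:e ^ (m * (m - 1)):]"
  proof -
    have "([:e:] ^ m) ^ (m - 1) = [:e:] ^ (m * (m - 1))" by (simp only: power_mult)
    thus ?thesis by (simp only: poly_const_pow)
  qed
  have nz: "resultant f (pderiv f) \<noteq> 0" "resultant F (pderiv F) \<noteq> 0"
    using resultant_pderiv_nonzero[OF ss] resultant_pderiv_nonzero[OF ssF] by auto
  have "degree (resultant f (pderiv f)) + degree (lead_coeff F) = degree (lead_coeff f) + degree (resultant F (pderiv F))"
    using arg_cong[OF eq, of degree] nz f0 F0 e(2) unfolding ek by (simp add: degree_mult_eq)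
  thus ?thesis by (simp add: discdeg_def)
qed

lemma sep_split_hsub: "sep_split N F" by (rule ssF)

end

section \<open>Discriminants of quadratics and cubics\<close>

lemma hsub_explicit:
  "hsub 1 [:b, a:] p q = [:a:] * p + [:b:] * q"
  "hsub 2 [:c, b, a:] p q = [:a:] * p ^ 2 + [:b:] * p * q + [:c:] * q ^ 2"
  "hsub 3 [:d, c, b, a:] p q = [:a:] * p ^ 3 + [:b:] * p ^ 2 * q + [:c:] * p * q ^ 2 + [:d:] * q ^ 3"
  "hsub 4 [:e, d, c, b, a:] p q = [:a:] * p ^ 4 + [:b:] * p ^ 3 * q + [:c:] * p ^ 2 * q ^ 2 + [:d:] * p * q ^ 3 + [:e:] * q ^ 4"
  by (simp_all add: hsub_altdef numeral_eq_Suc mult.assoc add_ac)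

lemma coeffs_le_2: "degree G \<le> 2 \<Longrightarrow> G = [:coeff G 0, coeff G 1, coeff G 2:]"
  by (rule poly_eqI) (auto simp: coeff_pCons coeff_eq_0 numeral_eq_Suc split: nat.split)

lemma coeffs_le_3: "degree G \<le> 3 \<Longrightarrow> G = [:coeff G 0, coeff G 1, coeff G 2, coeff G 3:]"
  by (rule poly_eqI) (auto simp: coeff_pCons coeff_eq_0 numeral_eq_Suc split: nat.split)

text \<open>
  The derivative has the single root \<open>-b / 2a\<close>.
\<close>
lemma discdeg_quadratic_general:
  fixes a b c :: "'a::field_char_0 poly"
  assumes a: "a \<noteq> 0"
  shows "discdeg [:c, b, a:] = int (degree (a * (b\<^sup>2 - 4 * a * c))) - int (degree a)"
proof -
  interpret e: inj_comm_ring_hom "emb (Suc 0) :: 'a poly \<Rightarrow> 'a fls" by (rule emb_inj_hom) simp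
  have ea: "emb (Suc 0) a \<noteq> 0" using a by simp
  define A B C r where "A = emb (Suc 0) a" "B = emb (Suc 0) b" "C = emb (Suc 0) c" "r = - B / (2 * A)"
  have r: "2 * A * r = - B" using ea by (simp add: A_B_C_r_def)
  have "emb (Suc 0) (resultant [:b, 2 * a:] [:c, b, a:]) = (2 * A)\<^sup>2 * (C + r * (B + r * A))"
    using emb_resultant_linear[of "Suc 0" "2 * a" b "[:c, b, a:]"] a
    by (simp add: lpoly_pCons e.hom_mult e.hom_numeral A_B_C_r_def numeral_2_eq_2)
  also have "\<dots> = 4 * A\<^sup>2 * C + 2 * A * (2 * A * r) * B + A * (2 * A * r)\<^sup>2" by (simp add: algebra_simps power2_eq_square)
  also have "\<dots> = emb (Suc 0) (a * (4 * a * c - b\<^sup>2))"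
    unfolding r by (simp add: A_B_C_r_def e.hom_mult e.hom_minus e.hom_power e.hom_numeral algebra_simps power2_eq_square)
  finally have "emb (Suc 0) (resultant [:b, 2 * a:] [:c, b, a:]) = emb (Suc 0) (a * (4 * a * c - b\<^sup>2))" .
  hence r: "resultant [:b, 2 * a:] [:c, b, a:] = a * (4 * a * c - b\<^sup>2)" by simp
  have "pderiv [:c, b, a:] = [:b, 2 * a:]" by (simp add: pderiv_pCons)
  hence "degree (resultant [:c, b, a:] (pderiv [:c, b, a:])) = degree (a * (4 * a * c - b\<^sup>2))"
    using degree_resultant_sym[of "[:c, b, a:]" "[:b, 2 * a:]"] by (simp only: r)
  also have "a * (4 * a * c - b\<^sup>2) = - (a * (b\<^sup>2 - 4 * a * c))" by (simp add: algebra_simps)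
  finally show ?thesis using a by (simp add: discdeg_def)
qed

lemma discdeg_quadratic:
  fixes a b c :: "'a::field_char_0 poly"
  assumes "a \<noteq> 0" "b\<^sup>2 - 4 * a * c \<noteq> 0"
  shows "discdeg [:c, b, a:] = int (degree (b\<^sup>2 - 4 * a * c))"
  using assms by (simp add: discdeg_quadratic_general degree_mult_eq)

text \<open>
  The roots of the quadratic are \<open>\<plusminus>r\<close> with \<open>r\<^sup>2 = -\<xi>\<close>, where \<open>G\<close> takes the values \<open>U \<plusminus> V r\<close>.
\<close>
lemma resultant_pure_quadratic:
  fixes \<xi> \<kappa> U V :: "'a::field_char_0 poly"
  assumes ss: "sep_split N [:\<kappa> * \<xi>, 0, \<kappa>:]" and \<kappa>: "\<kappa> \<noteq> 0"
    and G: "G = [:\<xi>, 0, 1:] * W + [:U, V:]"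
  shows "resultant [:\<kappa> * \<xi>, 0, \<kappa>:] G = \<kappa> ^ degree G * (U\<^sup>2 + \<xi> * V\<^sup>2)"
proof -
  have N: "N > 0" using ss by (simp add: sep_split_def)
  interpret e: inj_comm_ring_hom "emb N :: 'a poly \<Rightarrow> 'a fls" by (rule emb_inj_hom[OF N])
  have ek: "emb N \<kappa> \<noteq> 0" using \<kappa> by simp
  have "card (lroots N [:\<kappa> * \<xi>, 0, \<kappa>:]) = 2" using ss \<kappa> by (simp add: sep_split_def)
  then obtain r s where rs: "lroots N [:\<kappa> * \<xi>, 0, \<kappa>:] = {r, s}" "r \<noteq> s" by (auto simp: card_2_iff)
  have sq: "t\<^sup>2 = - emb N \<xi>" if "t \<in> lroots N [:\<kappa> * \<xi>, 0, \<kappa>:]" for t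
  proof -
    have "emb N \<kappa> * (emb N \<xi> + t\<^sup>2) = 0"
      using that by (simp add: lroots_def lpoly_pCons[OF N] power2_eq_square e.hom_mult algebra_simps)
    thus ?thesis using ek by (simp add: eq_neg_iff_add_eq_0 add.commute)
  qed
  hence r2: "r\<^sup>2 = - emb N \<xi>" "s\<^sup>2 = - emb N \<xi>" using rs by auto
  have "(r - s) * (r + s) = r\<^sup>2 - s\<^sup>2" by (simp add: algebra_simps power2_eq_square)
  hence "(r - s) * (r + s) = 0" using r2 by simp
  hence s: "s = - r" using rs by (simp add: add_eq_0_iff)
  have Gt: "lpoly N G t = emb N U + emb N V * t" if "t\<^sup>2 = - emb N \<xi>" for t
  proof -
    have "emb N \<xi> + t * t = 0" using that by (simp add: power2_eq_square)
    thus ?thesis unfolding G lpoly_add[OF N] lpoly_mult[OF N] by (simp add: lpoly_pCons[OF N] mult.commute)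
  qed
  have Gs: "lpoly N G s = emb N U - emb N V * r" using Gt[OF r2(2)] s by simp
  have "emb N (resultant [:\<kappa> * \<xi>, 0, \<kappa>:] G) = emb N \<kappa> ^ degree G * (lpoly N G r * lpoly N G s)"
    using emb_resultant[OF N ss, of G] rs \<kappa> by simp
  also have "lpoly N G r * lpoly N G s = (emb N U)\<^sup>2 - (emb N V)\<^sup>2 * r\<^sup>2"
    unfolding Gt[OF r2(1)] Gs by (simp add: algebra_simps power2_eq_square)
  also have "emb N \<kappa> ^ degree G * \<dots> = emb N (\<kappa> ^ degree G * (U\<^sup>2 + \<xi> * V\<^sup>2))"
    unfolding r2 by (simp add: e.hom_add e.hom_mult e.hom_power)
  finally show ?thesis by simp
qed

text \<open>
  The two summands have degrees of different parity, so their leading terms cannot cancel.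
\<close>
lemma even_odd_sum_const:
  fixes \<xi> U V :: "'a::field poly"
  assumes "degree \<xi> = 1" "degree (U\<^sup>2 + \<xi> * V\<^sup>2) = 0"
  shows "V = 0 \<and> degree U = 0"
proof -
  have \<xi>: "\<xi> \<noteq> 0" using assms by auto
  have dU: "degree (U\<^sup>2) = 2 * degree U" by (cases "U = 0") (simp_all add: degree_power_eq)
  show ?thesis
  proof (cases "V = 0")
    case True thus ?thesis using assms dU by simp
  next
    case False
    have dV: "degree (\<xi> * V\<^sup>2) = 1 + 2 * degree V" using False \<xi> assms(1) by (simp add: degree_mult_eq degree_power_eq)
    have "degree (U\<^sup>2) \<noteq> degree (\<xi> * V\<^sup>2)" unfolding dU dV by presburger
    hence "degree (U\<^sup>2 + \<xi> * V\<^sup>2) = max (degree (U\<^sup>2)) (degree (\<xi> * V\<^sup>2))"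
      by (metis degree_add_eq_left degree_add_eq_right linorder_neq_iff max.absorb3 max.absorb4)
    thus ?thesis using assms(2) dV by simp
  qed
qed

lemma cubic_discriminant_identity:
  fixes r s :: "'b::field_char_0"
  shows "(- r\<^sup>2 - r * s - s\<^sup>2 + 3 * r\<^sup>2) * (- r\<^sup>2 - r * s - s\<^sup>2 + 3 * s\<^sup>2) * (- r\<^sup>2 - r * s - s\<^sup>2 + 3 * (- r - s)\<^sup>2) =
    4 * (- r\<^sup>2 - r * s - s\<^sup>2) ^ 3 + 27 * (r * s * (r + s))\<^sup>2"
  by (simp add: algebra_simps power2_eq_square power3_eq_cube)

lemma discdeg_depressed_cubic:
  fixes u v :: "'a::field_char_0 poly"
  assumes ss: "sep_split N [:v, u, 0, 1:]"
  shows "discdeg [:v, u, 0, 1:] = int (degree (4 * u ^ 3 + 27 * v\<^sup>2))"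
proof -
  have N: "N > 0" using ss by (simp add: sep_split_def)
  interpret e: inj_comm_ring_hom "emb N :: 'a poly \<Rightarrow> 'a fls" by (rule emb_inj_hom[OF N])
  have "card (lroots N [:v, u, 0, 1:]) = 3" using ss by (simp add: sep_split_def)
  then obtain r s t where rs: "lroots N [:v, u, 0, 1:] = {r, s, t}" "r \<noteq> s" "r \<noteq> t" "s \<noteq> t"
    by (auto simp: card_3_iff)
  have "map_poly (emb N) [:v, u, 0, 1:] = (\<Prod>x\<in>{r, s, t}. [:- x, 1:])"
    using sep_split_factor[OF N ss] unfolding rs by simp
  moreover have "(\<Prod>x\<in>{r, s, t}. [:- x, 1:]) = [:- r, 1:] * [:- s, 1:] * [:- t, 1:]"
    using rs by (simp only: prod.insert finite.intros insert_iff empty_iff prod.empty mult_1_right mult.assoc simp_thms)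
  moreover have "map_poly (emb N) [:v, u, 0, 1:] = [:emb N v, emb N u, 0, 1:]" by simp
  ultimately have eq: "[:emb N v, emb N u, 0, 1:] = [:- r, 1:] * [:- s, 1:] * [:- t, 1:]" by (simp only:)
  have eq': "[:- r, 1:] * [:- s, 1:] * [:- t, 1:] = [:- (r * s * t), r * s + r * t + s * t, - (r + s + t), 1:]"
    by (simp add: algebra_simps)
  have coeffs: "emb N v = - (r * s * t)" "emb N u = r * s + r * t + s * t" "r + s + t = 0"
    using eq unfolding eq' by (simp_all only: pCons_eq_iff neg_equal_0_iff_equal) (metis neg_equal_0_iff_equal)
  have t: "t = - r - s" using coeffs(3) by (metis add.commute add_implies_diff diff_0 diff_diff_eq)
  have u: "emb N u = - r\<^sup>2 - r * s - s\<^sup>2" and v: "emb N v = r * s * (r + s)"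
    using coeffs(1,2) unfolding t by (simp_all add: algebra_simps power2_eq_square)
  have "emb N (resultant [:v, u, 0, 1:] [:u, 0, 3:]) = (emb N u + 3 * r\<^sup>2) * (emb N u + 3 * s\<^sup>2) * (emb N u + 3 * t\<^sup>2)"
    using emb_resultant[OF N ss, of "[:u, 0, 3:]"] rs
    by (simp add: lpoly_pCons[OF N] e.hom_numeral power2_eq_square algebra_simps)
  also have "\<dots> = 4 * emb N u ^ 3 + 27 * (emb N v)\<^sup>2"
    unfolding t u v by (rule cubic_discriminant_identity)
  also have "\<dots> = emb N (4 * u ^ 3 + 27 * v\<^sup>2)" by (simp add: e.hom_add e.hom_mult e.hom_power e.hom_numeral)
  finally have "resultant [:v, u, 0, 1:] [:u, 0, 3:] = 4 * u ^ 3 + 27 * v\<^sup>2" by simp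
  moreover have "pderiv [:v, u, 0, 1:] = [:u, 0, 3:]" by (rule poly_eqI) (auto simp: coeff_pderiv coeff_pCons numeral_eq_Suc split: nat.split)
  ultimately show ?thesis by (simp add: discdeg_def)
qed

text \<open>
  At the zero of \<open>q\<close> only the term \<open>p\<^sup>n\<close> of the form survives, and \<open>p\<close> takes a unit value there.
\<close>
lemma degree_resultant_basis:
  fixes p q G :: "'a::{alg_closed_field, field_char_0} poly poly"
  assumes p: "degree p \<le> 1" and q: "degree q = 1" and e: "pdet p q = [:e:]" "e \<noteq> 0"
    and g: "g = hsub n G p q" "degree g = n"
  shows "resultant q g \<noteq> 0 \<longleftrightarrow> coeff G n \<noteq> 0" "resdeg q g = int (degree (coeff G n))"
proof -
  interpret e: inj_comm_ring_hom "emb (Suc 0) :: 'a poly \<Rightarrow> 'a fls" by (rule emb_inj_hom) simp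
  interpret m: map_poly_comm_ring_hom "emb (Suc 0) :: 'a poly \<Rightarrow> 'a fls" by (simp add: map_poly_comm_ring_hom_def emb_hom)
  obtain a b where ab: "q = [:b, a:]" "a \<noteq> 0" using linear_poly_coeffs[OF q] by blast
  define r where "r = - emb (Suc 0) b / emb (Suc 0) a"
  have ea: "emb (Suc 0) a \<noteq> 0" using ab by simp
  have q0: "lpoly (Suc 0) q r = 0" using ea by (simp add: ab r_def lpoly_pCons)
  have "lpoly (Suc 0) p r = emb (Suc 0) (coeff p 1) * r + emb (Suc 0) (coeff p 0)"
    by (subst deg1_form[OF p]) (simp add: lpoly_pCons)
  hence "emb (Suc 0) a * lpoly (Suc 0) p r = - emb (Suc 0) (pdet p q)"
    using ea by (simp add: ab pdet_def r_def field_simps e.hom_minus e.hom_mult)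
  hence ap: "emb (Suc 0) a * lpoly (Suc 0) p r = - fls_const e" by (simp add: e(1))
  have "lpoly (Suc 0) g r = (\<Sum>k\<le>n. emb (Suc 0) (coeff G k) * (lpoly (Suc 0) p r ^ k * 0 ^ (n - k)))"
    unfolding g(1) hsub_altdef using q0
    by (simp add: m.hom_sum poly_sum lpoly_smult lpoly_mult m.hom_power)
  also have "\<dots> = (\<Sum>k\<le>n. if k = n then emb (Suc 0) (coeff G n) * lpoly (Suc 0) p r ^ n else 0)"
    by (intro sum.cong) auto
  finally have "lpoly (Suc 0) g r = emb (Suc 0) (coeff G n) * lpoly (Suc 0) p r ^ n" by simp
  hence "emb (Suc 0) (resultant q g) = emb (Suc 0) (coeff G n) * (emb (Suc 0) a * lpoly (Suc 0) p r) ^ n"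
    using emb_resultant_linear[of "Suc 0" a b g] ab g(2) by (simp add: r_def power_mult_distrib mult_ac)
  also have "\<dots> = emb (Suc 0) (coeff G n * [:- e:] ^ n)" unfolding ap by (simp add: e.hom_mult e.hom_power e.hom_uminus)
  finally have eq: "resultant q g = coeff G n * [:- e:] ^ n" by simp
  have "[:- e:] ^ n = [:(- e) ^ n:]" by (rule poly_const_pow)
  thus "resultant q g \<noteq> 0 \<longleftrightarrow> coeff G n \<noteq> 0" "resdeg q g = int (degree (coeff G n))"
    using eq e(2) by (simp_all add: resdeg_def)
qed

section \<open>Bases of linear forms and quadratic reduction\<close>

text \<open>
  Two linear forms that generate the module of all linear forms over \<open>K[x]\<close>; the pairs obtained from
  \<open>y\<close> and \<open>1\<close> by the group \<open>GL\<^sub>2(K[x])\<close>.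
\<close>
definition basis :: "'a::field poly poly \<Rightarrow> 'a poly poly \<Rightarrow> bool" where
  "basis p q \<longleftrightarrow> degree p \<le> 1 \<and> degree q \<le> 1 \<and> (\<exists>e. e \<noteq> 0 \<and> pdet p q = [:e:])"

lemma basis_std: "basis [:0, 1:] [:1 :: 'a::field poly:]"
proof -
  have "pdet [:0, 1:] [:1 :: 'a poly:] = [:1:]" by (simp add: pdet_def)
  hence "\<exists>e. e \<noteq> 0 \<and> pdet [:0, 1:] [:1 :: 'a poly:] = [:e:]" by (intro exI[of _ 1] conjI one_neq_zero)
  moreover have "degree [:1 :: 'a poly:] \<le> 1" "degree [:0, 1 :: 'a poly:] \<le> 1" by simp_all
  ultimately show ?thesis unfolding basis_def by (intro conjI)
qed

lemma basis_swap:
  assumes "basis p q"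
  shows "basis q p"
proof -
  obtain e where e: "e \<noteq> 0" "pdet p q = [:e:]" using assms by (auto simp: basis_def)
  have "pdet q p = - pdet p q" by (simp add: pdet_def mult_ac)
  hence "pdet q p = [:- e:]" by (simp add: e)
  thus ?thesis using assms e(1) by (auto simp: basis_def intro!: exI[of _ "- e"])
qed

lemma basis_shear: "basis p q \<Longrightarrow> basis (p + [:t:] * q) q"
proof -
  assume b: "basis p q"
  have "pdet (p + [:t:] * q) q = pdet p q" by (simp add: pdet_def algebra_simps)
  moreover have "degree (p + [:t:] * q) \<le> 1" using b degree_smult_le[of t q] by (auto simp: basis_def intro!: degree_add_le)
  ultimately show ?thesis using b by (simp add: basis_def)
qed

lemma basis_scale:
  assumes "basis p q" "s \<noteq> 0"
  shows "basis p ([:[:s:]:] * q)"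
proof -
  obtain e where e: "e \<noteq> 0" "pdet p q = [:e:]" using assms by (auto simp: basis_def)
  have "pdet p ([:[:s:]:] * q) = [:s:] * pdet p q" by (simp add: pdet_def algebra_simps smult_diff_right)
  hence "pdet p ([:[:s:]:] * q) = [:s * e:]" by (simp add: e)
  thus ?thesis using assms e(1) degree_smult_le[of "[:s:]" q] by (auto simp: basis_def intro!: exI[of _ "s * e"])
qed

lemma const_simps:
  "[:x + y:] = [:x:] + [:y:]" "[:x - y:] = [:x:] - [:y:]" "[:- x:] = - [:x:]" "[:x * y:] = [:x:] * [:y:]" "[:x ^ n:] = [:x:] ^ n"
  for x y :: "'b::comm_ring_1"
  by (simp_all add: poly_const_pow)

text \<open>
  Reduction of a quadratic form as over the integers: make the middle coefficient smaller than \<open>2 a\<close> by a shear and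
  exchange the outer coefficients.  As the discriminant has degree one, the degree of \<open>a\<close> drops until \<open>a\<close> is a
  constant; then the square is completed and the linear discriminant is scaled.
\<close>
lemma quadratic_normal_form:
  fixes a b c :: "'a::{alg_closed_field, field_char_0} poly"
  assumes "basis p q" "g = hsub 2 [:c, b, a:] p q" "degree (b\<^sup>2 - 4 * a * c) = 1"
  shows "\<exists>p q \<alpha> \<beta>. basis p q \<and> \<alpha> \<noteq> 0 \<and> g = hsub 2 [:[:\<beta>, \<alpha>:], 0, [:\<alpha>:]:] p q"
  using assms
proof (induction "degree a" arbitrary: a b c p q rule: less_induct)
  case less
  have a0: "a \<noteq> 0"
  proof
    assume "a = 0"
    hence "degree (b\<^sup>2) = 1" using less.prems(3) by simp
    thus False by (cases "b = 0") (simp_all add: degree_power_eq)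
  qed
  define t where "t = b div (2 * a)"
  define b' where "b' = b mod (2 * a)"
  define c' where "c' = c - a * t\<^sup>2 - b' * t"
  have b: "b = 2 * a * t + b'" by (simp add: t_def b'_def)
  have c: "c = a * t\<^sup>2 + b' * t + c'" by (simp add: c'_def)
  have D: "b\<^sup>2 - 4 * a * c = b'\<^sup>2 - 4 * a * c'" unfolding b c by (simp add: algebra_simps power2_eq_square)
  define p' where "p' = p + [:t:] * q"
  have bas: "basis p' q" unfolding p'_def by (rule basis_shear[OF less.prems(1)])
  have g: "g = [:a:] * p'\<^sup>2 + [:b':] * p' * q + [:c':] * q\<^sup>2"
  proof -
    have "2 * a * t = a * t + a * t" by simp
    thus ?thesis unfolding less.prems(2) hsub_explicit p'_def b c
      by (simp only: const_simps) (simp only: algebra_simps power2_eq_square)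
  qed
  show ?case
  proof (cases "degree a = 0")
    case True
    then obtain \<alpha> where \<alpha>: "a = [:\<alpha>:]" by (elim degree_eq_zeroE)
    have \<alpha>0: "\<alpha> \<noteq> 0" using a0 \<alpha> by simp
    have "b = smult (2 * \<alpha>) (smult (1 / (2 * \<alpha>)) b)" using \<alpha>0 by simp
    hence "2 * a dvd b" unfolding \<alpha> by (intro dvdI[of _ _ "smult (1 / (2 * \<alpha>)) b"]) (simp add: numeral_poly)
    hence b'0: "b' = 0" by (simp add: b'_def)
    have "b\<^sup>2 - 4 * a * c = smult (- 4 * \<alpha>) c'" unfolding D unfolding b'0 \<alpha> by (simp add: numeral_poly mult.commute)
    hence dc: "degree c' = 1" using less.prems(3) \<alpha>0 by simp
    then obtain c0 c1 where c01: "c' = [:c0, c1:]" "c1 \<noteq> 0" using degree1_coeffs by metis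
    obtain s where s: "s ^ 2 = c1 / \<alpha>" using nth_root_exists[of 2 "c1 / \<alpha>"] by auto
    have s0: "s \<noteq> 0" using s c01 \<alpha>0 by auto
    have "c' = [:c0 / s\<^sup>2, \<alpha>:] * [:s:]\<^sup>2" unfolding c01 using s s0 \<alpha>0 by (simp add: poly_const_pow field_simps)
    hence "[:c':] = [:[:c0 / s\<^sup>2, \<alpha>:]:] * [:[:s:]:]\<^sup>2" by (simp only: const_simps)
    hence "g = hsub 2 [:[:c0 / s\<^sup>2, \<alpha>:], 0, [:\<alpha>:]:] p' ([:[:s:]:] * q)"
      unfolding g hsub_explicit b'0 \<alpha> by (simp only: power_mult_distrib mult.assoc) simp
    thus ?thesis using basis_scale[OF bas s0] \<alpha>0 by blast
  next
    case False
    have db: "b' = 0 \<or> degree b' < degree a"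
      using degree_mod_less[of "2 * a" b] a0 by (auto simp: b'_def degree_mult_eq numeral_poly)
    have "degree c' < degree a"
    proof (cases "c' = 0")
      case True thus ?thesis using False by simp
    next
      case c'0: False
      have "degree a + degree c' = degree (4 * a * c')" using a0 c'0 by (simp add: degree_mult_eq numeral_poly)
      also have "4 * a * c' = b'\<^sup>2 - (b\<^sup>2 - 4 * a * c)" unfolding D by simp
      also have "degree \<dots> \<le> max (degree (b'\<^sup>2)) 1" using degree_diff_le_max[of "b'\<^sup>2" "b\<^sup>2 - 4 * a * c"] less.prems(3) by simp
      also have "degree (b'\<^sup>2) \<le> 2 * (degree a - 1)" using db by (cases "b' = 0") (auto simp: degree_power_eq)
      finally have "degree a + degree c' \<le> max (2 * (degree a - 1)) 1" by simp
      thus ?thesis using False by (simp add: max_def split: if_splits)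
    qed
    moreover have "g = hsub 2 [:a, b', c':] q p'" unfolding g hsub_explicit by (simp add: algebra_simps)
    moreover have "degree (b'\<^sup>2 - 4 * c' * a) = 1" using less.prems(3) unfolding D by (simp add: mult_ac)
    ultimately show ?thesis using less.hyps basis_swap[OF bas] by blast
  qed
qed

lemma hsub_drop:
  assumes "coeff G (Suc n) = 0" "degree G \<le> Suc n"
  shows "hsub (Suc n) G p q = q * hsub n G p q"
proof -
  have "degree G \<noteq> Suc n" using assms(1) by (metis Zero_not_Suc degree_0 leading_coeff_0_iff)
  hence "degree G \<le> n" using assms(2) by simp
  thus ?thesis unfolding hsub_def by (rule comm_ring_hom.gsub_Suc[OF const_poly_hom])
qed

text \<open>
  If the coefficient of \<open>p\<^sup>n\<close> vanished, \<open>q\<close> would divide \<open>g\<close>.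
\<close>
lemma prim_irr_hsub_degree:
  fixes g :: "'a::field poly poly"
  assumes g: "prim_irr g" "degree g = n" "n \<ge> 2" and b: "basis p q" and G: "g = hsub n G p q" "degree G \<le> n"
  shows "degree G = n" "coeff G n \<noteq> 0"
proof -
  show c: "coeff G n \<noteq> 0"
  proof
    assume "coeff G n = 0"
    moreover have m: "n = Suc (n - 1)" "n - 1 \<ge> 1" using g(3) by linarith+
    ultimately have eq: "g = q * hsub (n - 1) G p q" 
      using hsub_drop[of G "n - 1" p q, folded m(1)] G by metis
    have "degree (hsub (n - 1) G p q) \<le> n - 1" "degree q \<le> 1" using b degree_hsub_le[of p q "n - 1" G] by (auto simp: basis_def)
    moreover have "degree g \<le> degree q + degree (hsub (n - 1) G p q)" by (subst eq) (rule degree_mult_le)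
    ultimately have "degree q > 0" "degree (hsub (n - 1) G p q) > 0" using g(2) m by linarith+
    moreover have "degree q = 0 \<or> degree (hsub (n - 1) G p q) = 0" 
      using g(1)[unfolded prim_irr_def, THEN conjunct2, THEN conjunct2, rule_format, OF eq] .
    ultimately show False by simp
  qed
  show "degree G = n" using le_degree[OF c] G(2) by simp
qed

lemma prim_irr_linear_multiple:
  assumes "prim_irr l" "l = [:\<beta>:] * q"
  shows "\<exists>b. \<beta> = [:b:]"
proof -
  have "[:\<beta>:] dvd l" using assms(2) by (rule dvdI)
  hence "degree \<beta> = 0" using assms(1) by (simp add: prim_irr_def primitive_in_y_def)
  thus ?thesis by (meson degree_eq_zeroE)
qed

text \<open>
  The coefficients of a primitive linear form are coprime.
\<close>
lemma basis_complement:
  fixes l :: "'a::field poly poly"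
  assumes "prim_irr l" "degree l = 1"
  shows "\<exists>p. basis p l"
proof -
  obtain a b where l: "l = [:b, a:]" "a \<noteq> 0" using linear_poly_coeffs[OF assms(2)] by blast
  have "coprime a b"
  proof (rule coprimeI)
    fix c assume c: "c dvd a" "c dvd b"
    then obtain a' b' where "a = c * a'" "b = c * b'" by (elim dvdE)
    hence "l = [:c:] * [:b', a':]" by (simp add: l)
    hence "[:c:] dvd l" by (rule dvdI)
    hence "degree c = 0" using assms(1) by (simp add: prim_irr_def primitive_in_y_def)
    moreover have "c \<noteq> 0" using c l(2) by auto
    ultimately show "c dvd 1" by (simp add: is_unit_iff_degree)
  qed
  from poly_bezout[OF this] obtain r s where rs: "r * a + s * b = 1" by blast
  have "pdet [:- r, s:] l = [:1:]" using rs by (simp add: pdet_def l add.commute one_pCons[symmetric])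
  hence "basis [:- r, s:] l" using assms(2) by (auto simp: basis_def intro!: exI[of _ 1])
  thus ?thesis by blast
qed

section \<open>Factors relative to a quadratic of linear discriminant\<close>

lemma basisE:
  assumes "basis p q"
  obtains e where "degree p \<le> 1" "degree q \<le> 1" "pdet p q = [:e:]" "e \<noteq> 0"
  using assms by (auto simp: basis_def)

lemma basis_coordinates:
  "basis p q \<Longrightarrow> degree g \<le> n \<Longrightarrow> \<exists>G. degree G \<le> n \<and> g = hsub n G p q"
  by (elim basisE) (rule hsub_exists)

lemma resdeg_self:
  assumes "sep_split N g" "degree g > 0"
  shows "resdeg g (g :: 'a::field_char_0 poly poly) = 0"
proof -
  have N: "N > 0" using assms by (simp add: sep_split_def)
  have "lroots N g \<noteq> {}" "finite (lroots N g)" using assms lroots_finite[OF N, of g] by (auto simp: sep_split_def)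
  then obtain r where "r \<in> lroots N g" by blast
  hence "(\<Prod>r\<in>lroots N g. lpoly N g r) = 0" using \<open>finite _\<close> by (intro prod_zero) (auto simp: lroots_def)
  hence "emb N (resultant g g) = 0" using emb_resultant[OF N assms(1), of g] by simp
  hence "resultant g g = 0" using N by (simp add: emb_eq_0_iff)
  thus ?thesis by (simp add: resdeg_def)
qed

text \<open>
  A constant resultant with \<open>p\<^sup>2 + \<xi> q\<^sup>2\<close>, where \<open>\<xi>\<close> is linear, forces the remainder of \<open>G\<close> modulo \<open>Y\<^sup>2 + \<xi>\<close> to be constant:
  the resultant is \<open>U\<^sup>2 + \<xi> V\<^sup>2\<close> up to a constant.
\<close>
lemma residue_modulo_quadratic:
  fixes g h p q :: "'a::{alg_closed_field, field_char_0} poly poly"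
  assumes b: "basis p q" and g: "sep_split N g" "degree g = 2" "g = hsub 2 [:[:\<alpha>:] * \<xi>, 0, [:\<alpha>:]:] p q" "\<alpha> \<noteq> 0" "degree \<xi> = 1"
    and h: "h = hsub n G p q" "degree h = n" "degree G = n" and r: "resdeg g h = 0"
    and G: "G = [:\<xi>, 0, 1:] * W + [:U, V:]"
  shows "V = 0" "degree U = 0"
proof -
  obtain e where e: "degree p \<le> 1" "degree q \<le> 1" "pdet p q = [:e:]" "e \<noteq> 0" using b by (elim basisE)
  have d: "degree [:[:\<alpha>:] * \<xi>, 0, [:\<alpha>:]:] = 2" using g(4) by simp
  have ssG: "sep_split N [:[:\<alpha>:] * \<xi>, 0, [:\<alpha>:]:]" by (rule sep_split_hsub[OF g(1) e g(3) g(2) d])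
  have "[:\<alpha>:] \<noteq> 0" using g(4) by simp
  note R = resultant_pure_quadratic[OF ssG this G]
  have "resultant g h = [:e:] ^ (2 * n) * resultant [:[:\<alpha>:] * \<xi>, 0, [:\<alpha>:]:] G"
    by (rule resultant_hsub[OF g(1) e g(3) g(2) d h])
  also have "\<dots> = smult (e ^ (2 * n) * \<alpha> ^ degree G) (U\<^sup>2 + \<xi> * V\<^sup>2)"
    unfolding R poly_const_pow by (simp add: mult.commute)
  finally have "degree (resultant g h) = degree (U\<^sup>2 + \<xi> * V\<^sup>2)" using e(4) g(4) by simp
  hence "degree (U\<^sup>2 + \<xi> * V\<^sup>2) = 0" using r by (simp add: resdeg_def)
  from even_odd_sum_const[OF g(5) this] show "V = 0" "degree U = 0" by auto
qed

text \<open>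
  A linear form involving \<open>p\<close> would have a nonconstant resultant with the quadratic.
\<close>
lemma linear_over_quadratic:
  fixes g l p q :: "'a::{alg_closed_field, field_char_0} poly poly"
  assumes b: "basis p q" and g: "sep_split N g" "degree g = 2" "g = hsub 2 [:[:\<alpha>:] * \<xi>, 0, [:\<alpha>:]:] p q" "\<alpha> \<noteq> 0" "degree \<xi> = 1"
    and l: "prim_irr l" "degree l = 1" "resdeg g l = 0"
  shows "\<exists>\<beta>. l = [:[:\<beta>:]:] * q"
proof -
  obtain F where F: "degree F \<le> 1" "l = hsub 1 F p q" using basis_coordinates[OF b, of l 1] l by auto
  have Fe: "F = [:coeff F 0, coeff F 1:]" by (rule deg1_form[OF F(1)])
  have "coeff F 1 = 0"
  proof (rule ccontr)
    assume c: "coeff F 1 \<noteq> 0"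
    hence "degree F = 1" using le_degree[OF c] F(1) by simp
    from residue_modulo_quadratic(1)[OF b g F(2) l(2) this l(3), of 0 "coeff F 0" "coeff F 1"] Fe c show False by simp
  qed
  hence "F = [:coeff F 0, 0:]" using Fe by simp
  hence lq: "l = [:coeff F 0:] * q" using F(2) hsub_explicit(1)[of "coeff F 0" 0 p q] by simp
  from prim_irr_linear_multiple[OF l(1) this] lq show ?thesis by auto
qed

text \<open>
  The mixed term vanishes by parity.  If \<open>A\<close> is the coefficient of \<open>p\<^sup>2\<close>, the
  discriminant then has degree \<open>2 * degree A + 1\<close>, so \<open>A\<close> is a constant.
\<close>
lemma quadratic_over_quadratic:
  fixes g h p q :: "'a::{alg_closed_field, field_char_0} poly poly"
  assumes b: "basis p q" and g: "sep_split N g" "degree g = 2" "g = hsub 2 [:[:\<alpha>:] * \<xi>, 0, [:\<alpha>:]:] p q" "\<alpha> \<noteq> 0" "degree \<xi> = 1"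
    and h: "prim_irr h" "degree h = 2" "sep_split N h" "discdeg h = 1" "resdeg g h = 0"
  shows "\<exists>a \<gamma>. h = hsub 2 [:[:a:] * \<xi> + [:\<gamma>:], 0, [:a:]:] p q"
proof -
  obtain F where F: "degree F \<le> 2" "h = hsub 2 F p q" using basis_coordinates[OF b, of h 2] h by auto
  have dF: "degree F = 2" "coeff F 2 \<noteq> 0" using prim_irr_hsub_degree[OF h(1,2) _ b F(2,1)] by auto
  define A B C where "A = coeff F 2" "B = coeff F 1" "C = coeff F 0"
  have Fe: "F = [:C, B, A:]" using coeffs_le_2[OF F(1)] by (simp add: A_B_C_def)
  have A0: "A \<noteq> 0" using dF(2) by (simp add: A_B_C_def)
  have "F = [:\<xi>, 0, 1:] * [:A:] + [:C - A * \<xi>, B:]" unfolding Fe by (simp add: mult.commute)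
  from residue_modulo_quadratic[OF b g F(2) h(2) dF(1) h(5) this]
  have B0: "B = 0" and "degree (C - A * \<xi>) = 0" by auto
  then obtain \<gamma> where "C - A * \<xi> = [:\<gamma>:]" by (elim degree_eq_zeroE)
  hence C: "C = A * \<xi> + [:\<gamma>:]" by (simp add: algebra_simps)
  have \<xi>: "\<xi> \<noteq> 0" using g(5) by auto
  have dC: "degree C = degree A + 1"
    unfolding C using A0 \<xi> g(5) by (subst degree_add_eq_left) (simp_all add: degree_mult_eq)
  hence C0: "C \<noteq> 0" by auto
  obtain e where e: "degree p \<le> 1" "degree q \<le> 1" "pdet p q = [:e:]" "e \<noteq> 0" using b by (elim basisE)
  have "discdeg F = 1" using discdeg_hsub[OF h(3) e F(2) h(2) dF(1)] h(4) by simp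
  moreover have "discdeg F = int (degree (B\<^sup>2 - 4 * A * C))"
    unfolding Fe by (rule discdeg_quadratic) (use A0 C0 B0 in \<open>simp_all\<close>)
  moreover have "degree (B\<^sup>2 - 4 * A * C) = degree A + degree C"
    using A0 C0 B0 by (simp add: degree_mult_eq numeral_poly)
  ultimately have "degree A = 0" using dC by simp
  then obtain a where "A = [:a:]" by (elim degree_eq_zeroE)
  thus ?thesis using F(2) unfolding Fe C B0 by blast
qed

text \<open>
  For \<open>E = 4 u\<^sup>3 + 27 v\<^sup>2\<close> one has \<open>3 u' E - u E' = 27 v (3 u' v - 2 u v')\<close>.  If \<open>u\<close> is not constant, then
  \<open>u\<close> and \<open>v\<close> have degrees \<open>2 k\<close> and \<open>3 k\<close>, the left side has degree \<open>2 k + 1\<close>, and so \<open>k = 1\<close>.  In this case the vanishing of the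
  coefficients of \<open>E\<close> in degrees three to six produces a linear root of the cubic.
\<close>
lemma davenport_cubic:
  fixes u v :: "'a::field_char_0 poly"
  assumes E: "degree (4 * u ^ 3 + 27 * v\<^sup>2) = 2"
  shows "(degree u = 0 \<and> degree v = 1) \<or> (\<exists>w. w ^ 3 + u * w + v = 0)"
proof (cases "degree u = 0")
  case True
  then obtain a where u: "u = [:a:]" by (elim degree_eq_zeroE)
  have v0: "v \<noteq> 0" using E u by (auto simp: poly_const_pow numeral_poly)
  have dv: "degree (27 * v\<^sup>2) = 2 * degree v" using v0 by (simp add: degree_mult_eq degree_power_eq numeral_poly)
  have c: "4 * u ^ 3 = [:4 * a ^ 3:]" by (simp add: u poly_const_pow numeral_poly)
  have "degree v = 1"
  proof (cases "degree v = 0")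
    case True
    hence "degree (4 * u ^ 3 + 27 * v\<^sup>2) \<le> 0" using dv c by (intro degree_add_le) auto
    thus ?thesis using E by simp
  next
    case False
    hence "degree (4 * u ^ 3 + 27 * v\<^sup>2) = degree (27 * v\<^sup>2)" using dv c by (intro degree_add_eq_right) simp
    thus ?thesis using E dv by simp
  qed
  thus ?thesis using True by simp
next
  case False
  define e where "e = 4 * u ^ 3 + 27 * v\<^sup>2"
  have u0: "u \<noteq> 0" using False by auto
  have du3: "degree (4 * u ^ 3) = 3 * degree u" using u0 by (simp add: degree_mult_eq degree_power_eq numeral_poly)
  have v0: "v \<noteq> 0" using E du3 False by auto
  have dv2: "degree (27 * v\<^sup>2) = 2 * degree v" using v0 by (simp add: degree_mult_eq degree_power_eq numeral_poly)
  have uv: "3 * degree u = 2 * degree v"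
  proof (rule ccontr)
    assume ne: "3 * degree u \<noteq> 2 * degree v"
    hence "degree e = max (3 * degree u) (2 * degree v)" unfolding e_def
      using degree_add_eq_left[of "27 * v\<^sup>2" "4 * u ^ 3"] degree_add_eq_right[of "4 * u ^ 3" "27 * v\<^sup>2"] du3 dv2
      by (auto simp: max_def not_le)
    thus False using E False unfolding e_def by (simp add: max_def split: if_splits) presburger+
  qed
  hence "\<exists>k. degree u = 2 * k \<and> degree v = 3 * k \<and> k \<ge> 1" using False by presburger
  then obtain k where k: "degree u = 2 * k" "degree v = 3 * k" "k \<ge> 1" by blast
  have e2: "degree e = 2" using E by (simp add: e_def)
  have e0: "e \<noteq> 0" using e2 by auto
  define D where "D = 3 * pderiv u * e - u * pderiv e"
  have Dv: "D = 27 * v * (3 * pderiv u * v - 2 * u * pderiv v)"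
    unfolding D_def e_def
    by (simp add: pderiv_add pderiv_mult pderiv_power pderiv_numeral power2_eq_square power3_eq_cube algebra_simps)
  have D0: "D \<noteq> 0"
  proof -
    have lu: "coeff (pderiv u) (2 * k - 1) = of_nat (2 * k) * lead_coeff u" and le: "coeff (pderiv e) 1 = 2 * lead_coeff e"
      using k(1,3) e2 by (simp_all add: coeff_pderiv numeral_2_eq_2)
    have 1: "coeff (pderiv u * e) (2 * k + 1) = of_nat (2 * k) * lead_coeff u * lead_coeff e"
      using coeff_mult_degree_sum[of "pderiv u" e] k(1,3) e2 lu by (simp add: degree_pderiv)
    have 2: "coeff (u * pderiv e) (2 * k + 1) = 2 * lead_coeff u * lead_coeff e"
      using coeff_mult_degree_sum[of u "pderiv e"] k(1) e2 le by (simp add: degree_pderiv)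
    have "D = smult 3 (pderiv u * e) - u * pderiv e" by (simp add: D_def numeral_poly)
    hence "coeff D (2 * k + 1) = (of_nat (6 * k) - of_nat 2) * lead_coeff u * lead_coeff e"
      by (simp only: coeff_diff coeff_smult 1 2) (simp add: algebra_simps)
    moreover have "(of_nat (6 * k) :: 'a) \<noteq> of_nat 2" using k(3) by (simp only: of_nat_eq_iff)
    ultimately have "coeff D (2 * k + 1) \<noteq> 0" using u0 e0 by simp
    thus ?thesis by auto
  qed
  have "degree D \<le> 2 * k + 1"
  proof -
    have "degree (3 * pderiv u * e) \<le> 2 * k + 1"
      using degree_mult_le[of "3 * pderiv u" e] k e2 by (simp add: numeral_poly degree_pderiv)
    moreover have "degree (u * pderiv e) \<le> 2 * k + 1"
      using degree_mult_le[of u "pderiv e"] k e2 by (simp add: degree_pderiv)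
    ultimately show ?thesis unfolding D_def by (rule degree_diff_le)
  qed
  moreover have "degree D = 3 * k + degree (3 * pderiv u * v - 2 * u * pderiv v)"
    unfolding Dv using D0 v0 k unfolding Dv by (subst degree_mult_eq) (auto simp: numeral_poly)
  ultimately have "k = 1" using k(3) by simp
  hence duv: "degree u = 2" "degree v = 3" using k by auto
  \<comment> \<open>a translation removes the linear term of \<open>u\<close>\<close>
  define b where "b = - coeff u 1 / (2 * coeff u 2)"
  define U where "U = pcompose u [:b, 1:]"
  define V where "V = pcompose v [:b, 1:]"
  have dUV: "degree U = 2" "degree V = 3" using duv by (simp_all add: U_def V_def degree_pcompose)
  have "coeff u 2 \<noteq> 0" using duv(1) u0 by (metis leading_coeff_0_iff)
  hence U1: "coeff U 1 = 0"
    using coeff_pcompose_shift[of u 1 b] duv by (simp add: U_def b_def numeral_2_eq_2[symmetric])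
  define m n where "m = coeff U 0" "n = coeff U 2"
  define \<alpha> \<beta> \<gamma> \<delta> where "\<alpha> = coeff V 0" "\<beta> = coeff V 1" "\<gamma> = coeff V 2" "\<delta> = coeff V 3"
  have Ue: "U = [:m, 0, n:]" using coeffs_le_2[of U] dUV(1) U1 by (simp add: m_n_def)
  have Ve: "V = [:\<alpha>, \<beta>, \<gamma>, \<delta>:]" using coeffs_le_3[of V] dUV(2) by (simp add: \<alpha>_\<beta>_\<gamma>_\<delta>_def)
  have n0: "n \<noteq> 0" using dUV(1) Ue by auto
  have d0: "\<delta> \<noteq> 0" using dUV(2) leading_coeff_0_iff[of V] by (auto simp: \<alpha>_\<beta>_\<gamma>_\<delta>_def)
  have "pcompose e [:b, 1:] = 4 * U ^ 3 + 27 * V\<^sup>2"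
    by (simp add: e_def U_def V_def power2_eq_square power3_eq_cube numeral_poly pcompose_add pcompose_mult pcompose_smult)
  hence "degree (4 * U ^ 3 + 27 * V\<^sup>2) = 2" using e2 degree_pcompose[of e "[:b, 1:]"] by simp
  hence z: "coeff (4 * U ^ 3 + 27 * V\<^sup>2) j = 0" if "j > 2" for j using that coeff_eq_0 by metis
  have ex: "4 * U ^ 3 + 27 * V\<^sup>2 = [:4 * m ^ 3 + 27 * \<alpha>\<^sup>2, 54 * \<alpha> * \<beta>, 12 * m\<^sup>2 * n + 54 * \<alpha> * \<gamma> + 27 * \<beta>\<^sup>2,
      54 * \<alpha> * \<delta> + 54 * \<beta> * \<gamma>, 12 * m * n\<^sup>2 + 54 * \<beta> * \<delta> + 27 * \<gamma>\<^sup>2, 54 * \<gamma> * \<delta>, 4 * n ^ 3 + 27 * \<delta>\<^sup>2:]"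
    unfolding Ue Ve by (simp add: numeral_poly power2_eq_square power3_eq_cube algebra_simps)
  have c3: "54 * \<alpha> * \<delta> + 54 * \<beta> * \<gamma> = 0" and c4: "12 * m * n\<^sup>2 + 54 * \<beta> * \<delta> + 27 * \<gamma>\<^sup>2 = 0"
    and c5: "54 * \<gamma> * \<delta> = 0" and c6: "4 * n ^ 3 + 27 * \<delta>\<^sup>2 = 0"
    using z[of 3] z[of 4] z[of 5] z[of 6] unfolding ex by (simp_all add: numeral_eq_Suc)
  have \<gamma>0: "\<gamma> = 0" using c5 d0 by simp
  have \<alpha>0: "\<alpha> = 0" using c3 d0 \<gamma>0 by simp
  \<comment> \<open>the root \<open>s x\<close> of the cubic: \<open>s\<close> is the double root of \<open>s\<^sup>3 + n s + \<delta>\<close>, whose discriminant vanishes\<close>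
  define s where "s = - 3 * \<delta> / (2 * n)"
  have s1: "s ^ 3 + n * s + \<delta> = 0"
  proof -
    have "8 * n ^ 3 * (s ^ 3 + n * s + \<delta>) = - \<delta> * (27 * \<delta>\<^sup>2 + 4 * n ^ 3)"
      using n0 by (simp add: s_def field_simps power2_eq_square power3_eq_cube)
    thus ?thesis using c6 n0 by (simp add: add.commute)
  qed
  have s2: "m * s + \<beta> = 0"
  proof -
    have "36 * n * \<delta> * (m * s + \<beta>) = 2 * n / 3 * (12 * m * n\<^sup>2 + 54 * \<beta> * \<delta>) - 2 * m * (4 * n ^ 3 + 27 * \<delta>\<^sup>2)"
      using n0 by (simp add: s_def field_simps power2_eq_square power3_eq_cube)
    hence "108 * (\<delta> * (m * s + \<beta>)) = 24 * (m * n\<^sup>2) + 108 * (\<beta> * \<delta>)" using c6 n0 by simp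
    also have "\<dots> = 2 * (12 * m * n\<^sup>2 + 54 * \<beta> * \<delta>)" by simp
    also have "12 * m * n\<^sup>2 + 54 * \<beta> * \<delta> = 0" using c4 \<gamma>0 by simp
    finally show ?thesis using d0 by simp
  qed
  define w where "w = pcompose [:0, s:] [:- b, 1:]"
  have root: "[:0, s:] ^ 3 + U * [:0, s:] + V = 0"
  proof -
    have "[:0, s:] ^ 3 + U * [:0, s:] + V = [:0, m * s + \<beta>, 0, s ^ 3 + n * s + \<delta>:]"
      unfolding Ue Ve \<alpha>0 \<gamma>0 by (simp add: power3_eq_cube mult.commute)
    thus ?thesis unfolding s1 s2 by simp
  qed
  have inv: "pcompose (pcompose h [:b, 1:]) [:- b, 1:] = h" for h
  proof -
    have "pcompose [:b, 1:] [:- b, 1:] = [:0, 1:]" by (simp add: pcompose_pCons)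
    thus ?thesis by (simp only: pcompose_assoc[symmetric] pcompose_idR)
  qed
  have "w ^ 3 + u * w + v = pcompose ([:0, s:] ^ 3 + U * [:0, s:] + V) [:- b, 1:]"
    by (simp only: power3_eq_cube pcompose_add pcompose_mult w_def U_def V_def inv)
  hence "w ^ 3 + u * w + v = 0" unfolding root by simp
  thus ?thesis by blast
qed

section \<open>Cubics with discriminant of degree two\<close>

lemma prim_irr_no_factor: "prim_irr g \<Longrightarrow> g = a * b \<Longrightarrow> degree a = 0 \<or> degree b = 0"
  unfolding prim_irr_def by (elim conjE) (drule spec, drule spec, erule mp)

lemma basis_power_coeff:
  fixes l g p :: "'a::{alg_closed_field, field_char_0} poly poly"
  assumes b: "basis p l" and l: "degree l = 1" "resultant l g \<noteq> 0" "resdeg l g = 0" and g: "g = hsub n G p l" "degree g = n"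
  obtains A where "coeff G n = [:A:]" "A \<noteq> 0"
proof -
  obtain e where e: "degree p \<le> 1" "degree l \<le> 1" "pdet p l = [:e:]" "e \<noteq> 0" using b by (elim basisE)
  have "coeff G n \<noteq> 0" "degree (coeff G n) = 0" using degree_resultant_basis[OF e(1) l(1) e(3,4) g] l by auto
  then obtain A where "coeff G n = [:A:]" "A \<noteq> 0" by (metis degree_eq_zeroE pCons_0_0)
  thus ?thesis by (rule that)
qed

text \<open>
  Expansions of a depressed cubic, of a quadratic without mixed term and of a cubic with a known root after the
  substitution \<open>P \<mapsto> P + t l\<close>.
\<close>
lemma shear_identities:
  fixes P t l A u v :: "'r::comm_ring_1"
  shows "A * P ^ 3 + (3 * A * t) * P\<^sup>2 * l + (A * u + 3 * A * t\<^sup>2) * P * l\<^sup>2 + (A * v + A * u * t + A * t ^ 3) * l ^ 3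
     = A * (P + t * l) ^ 3 + A * u * (P + t * l) * l\<^sup>2 + A * v * l ^ 3"
    "A * P ^ 3 + A * u * P * l\<^sup>2 + A * v * l ^ 3
     = A * (P + t * l) ^ 3 + (- 3 * A * t) * (P + t * l)\<^sup>2 * l + (A * (u + 3 * t\<^sup>2)) * (P + t * l) * l\<^sup>2 + (A * (v - u * t - t ^ 3)) * l ^ 3"
    "A * P\<^sup>2 + (2 * A * t) * P * l + (A * v + A * t\<^sup>2) * l\<^sup>2 = A * (P + t * l)\<^sup>2 + A * v * l\<^sup>2"
    "A * P ^ 3 + A * u * P * l\<^sup>2 + A * (- (t ^ 3) - u * t) * l ^ 3 = (P - t * l) * (A * (P\<^sup>2 + t * P * l + (t\<^sup>2 + u) * l\<^sup>2))"
  by (simp_all add: algebra_simps power2_eq_square power3_eq_cube)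

lemma const_numeral: "[:numeral k:] = (numeral k :: 'b::comm_ring_1 poly)"
  by (simp add: numeral_poly)

text \<open>
  The shear by a third of the second coefficient removes that coefficient.
\<close>
lemma depressed_cubic_coordinates:
  fixes d0 d1 d2 :: "'a::field_char_0 poly"
  assumes "A \<noteq> 0"
  defines "t \<equiv> smult (1 / (3 * A)) d2"
  defines "u \<equiv> smult (1 / A) (d1 - 3 * [:A:] * t\<^sup>2)"
  defines "v \<equiv> smult (1 / A) (d0 - [:A:] * u * t - [:A:] * t ^ 3)"
  shows "hsub 3 [:d0, d1, d2, [:A:]:] p l = hsub 3 [:[:A:] * v, [:A:] * u, 0, [:A:]:] (p + [:t:] * l) l"
proof -
  have d2: "d2 = 3 * [:A:] * t" using assms(1) by (simp add: t_def numeral_poly)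
  have d1: "d1 = [:A:] * u + 3 * [:A:] * t\<^sup>2" using assms(1) by (simp add: u_def)
  have d0: "d0 = [:A:] * v + [:A:] * u * t + [:A:] * t ^ 3" using assms(1) by (simp add: v_def)
  have "hsub 3 [:d0, d1, d2, [:A:]:] p l = [:[:A:]:] * (p + [:t:] * l) ^ 3 + [:[:A:]:] * [:u:] * (p + [:t:] * l) * l\<^sup>2 + [:[:A:]:] * [:v:] * l ^ 3"
    unfolding hsub_explicit d0 d1 d2
    using shear_identities(1)[of "[:[:A:]:]" p "[:t:]" l "[:u:]" "[:v:]"] by (simp only: const_simps const_numeral)
  thus ?thesis unfolding hsub_explicit by (simp only: const_simps) simp
qed

lemma discdeg_depressed_coordinates:
  fixes c p l :: "'a::{alg_closed_field, field_char_0} poly poly"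
  assumes c: "sep_split N c" "degree c = 3" and b: "basis p l" and A: "A \<noteq> 0"
    and c': "c = hsub 3 [:[:A:] * v, [:A:] * u, 0, [:A:]:] p l"
  shows "discdeg c = int (degree (4 * u ^ 3 + 27 * v\<^sup>2))"
proof -
  define F where "F = [:[:A:] * v, [:A:] * u, 0, [:A:]:]"
  have dF: "degree F = 3" using A by (simp add: F_def)
  obtain e where e: "degree p \<le> 1" "degree l \<le> 1" "pdet p l = [:e:]" "e \<noteq> 0" using b by (elim basisE)
  have cF: "c = hsub 3 F p l" using c' by (simp only: F_def)
  have ssF: "sep_split N F" by (rule sep_split_hsub[OF c(1) e cF c(2) dF])
  have Fm: "F = [:[:A:]:] * [:v, u, 0, 1:]" by (simp add: F_def)
  have N: "N > 0" using c(1) by (simp add: sep_split_def)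
  have ss1: "sep_split N [:v, u, 0, 1:]"
    using ssF sep_split_mult_iff[OF N, of "[:[:A:]:]" "[:v, u, 0, 1:]"] A unfolding Fm by simp
  have "discdeg F = discdeg c" using discdeg_hsub[OF c(1) e cF c(2) dF] by simp
  moreover have "F = smult [:A:] [:v, u, 0, 1:]" by (simp add: F_def)
  ultimately have "discdeg [:v, u, 0, 1:] = discdeg c" using discdeg_smult_const[OF A] by metis
  thus ?thesis using discdeg_depressed_cubic[OF ss1] by simp
qed

text \<open>
  The resultant with \<open>l\<close> makes the leading coefficient of the cubic constant, so that it can be depressed.
  The second alternative in the lemma of Davenport contradicts irreducibility.
\<close>
lemma cubic_normal_form:
  fixes l c :: "'a::{alg_closed_field, field_char_0} poly poly"
  assumes l: "prim_irr l" "degree l = 1" and c: "prim_irr c" "degree c = 3" "sep_split N c" "discdeg c = 2"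
    and r: "resultant l c \<noteq> 0" "resdeg l c = 0"
  shows "\<exists>p A u v. basis p l \<and> A \<noteq> 0 \<and> degree v = 1 \<and> c = hsub 3 [:[:A:] * v, [:A:] * [:u:], 0, [:A:]:] p l"
proof -
  obtain p0 where b0: "basis p0 l" using basis_complement[OF l] by blast
  obtain G where G: "degree G \<le> 3" "c = hsub 3 G p0 l" using basis_coordinates[OF b0, of c 3] c by auto
  obtain A where A: "coeff G 3 = [:A:]" "A \<noteq> 0" by (rule basis_power_coeff[OF b0 l(2) r G(2) c(2)])
  define d0 d1 d2 where "d0 = coeff G 0" "d1 = coeff G 1" "d2 = coeff G 2"
  have Ge: "G = [:d0, d1, d2, [:A:]:]" using coeffs_le_3[OF G(1)] A(1) by (simp add: d0_d1_d2_def)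
  obtain p u v where b: "basis p l" and c': "c = hsub 3 [:[:A:] * v, [:A:] * u, 0, [:A:]:] p l"
    by (rule that[OF basis_shear[OF b0] trans[OF G(2)[unfolded Ge] depressed_cubic_coordinates[OF A(2)]]])
  have ce: "c = [:[:A:]:] * p ^ 3 + [:[:A:]:] * [:u:] * p * l\<^sup>2 + [:[:A:]:] * [:v:] * l ^ 3"
    unfolding c' hsub_explicit by (simp only: const_simps) simp
  obtain e where e: "degree p \<le> 1" "degree l \<le> 1" "pdet p l = [:e:]" "e \<noteq> 0" using b by (elim basisE)
  have "degree (4 * u ^ 3 + 27 * v\<^sup>2) = 2" using discdeg_depressed_coordinates[OF c(3,2) b A(2) c'] c(4) by simp
  from davenport_cubic[OF this] show ?thesis
  proof
    assume uv: "degree u = 0 \<and> degree v = 1"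
    then obtain u' where "u = [:u':]" by (auto elim: degree_eq_zeroE)
    thus ?thesis using b A(2) uv c' by blast
  next
    assume "\<exists>w. w ^ 3 + u * w + v = 0"
    then obtain w where w: "w ^ 3 + u * w + v = 0" by blast
    have v: "v = - (w ^ 3) - u * w" using w by (metis add.commute add_eq_0_iff diff_minus_eq_add minus_add_distrib uminus_add_conv_diff)
    define a1 where "a1 = p - [:w:] * l"
    define a2 where "a2 = [:[:A:]:] * (p\<^sup>2 + [:w:] * p * l + ([:w:]\<^sup>2 + [:u:]) * l\<^sup>2)"
    have "[:v:] = - ([:w:] ^ 3) - [:u:] * [:w:]" unfolding v by (simp only: const_simps)
    hence c12: "c = a1 * a2" unfolding ce a1_def a2_def shear_identities(4)[symmetric] by (simp only: mult.assoc)
    have d2: "degree (p\<^sup>2) \<le> 2" "degree (p * l) \<le> 2" "degree (l\<^sup>2) \<le> 2"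
      using e(1,2) degree_power_le[of p 2] degree_power_le[of l 2] degree_mult_le[of p l] by auto
    have "degree a1 \<le> 1" unfolding a1_def using e(1,2) degree_smult_le[of w l] by (auto intro!: degree_diff_le)
    moreover have "degree a2 \<le> 2"
    proof -
      have "([:w:]\<^sup>2 + [:u:]) * l\<^sup>2 = smult (w\<^sup>2 + u) (l\<^sup>2)" by (simp add: poly_const_pow)
      moreover have "[:w:] * p * l = smult w (p * l)" by simp
      ultimately have "a2 = smult [:A:] (p\<^sup>2 + smult w (p * l) + smult (w\<^sup>2 + u) (l\<^sup>2))" by (simp add: a2_def)
      moreover have "degree (p\<^sup>2 + smult w (p * l) + smult (w\<^sup>2 + u) (l\<^sup>2)) \<le> 2"
        using d2 degree_smult_le[of w "p * l"] degree_smult_le[of "w\<^sup>2 + u" "l\<^sup>2"] by (intro degree_add_le) auto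
      ultimately show ?thesis using degree_smult_le[of "[:A:]"] order_trans by blast
    qed
    moreover have "degree c \<le> degree a1 + degree a2" unfolding c12 by (rule degree_mult_le)
    ultimately have "degree a1 \<noteq> 0" "degree a2 \<noteq> 0" using c(2) by linarith+
    hence False using prim_irr_no_factor[OF c(1) c12] by metis
    thus ?thesis ..
  qed
qed

text \<open>
  Up to a constant, the quadratic is \<open>P\<^sup>2 + \<xi> l\<^sup>2\<close> with a linear \<open>\<xi>\<close>; express the cubic in the same basis.  The constant
  resultant of the two gives \<open>\<xi> = u + 3 t\<^sup>2\<close> with a constant \<open>u\<close>, which has even degree.
\<close>
lemma no_quadratic_with_cubic:
  fixes l c g :: "'a::{alg_closed_field, field_char_0} poly poly"
  assumes l: "prim_irr l" "degree l = 1" and c: "prim_irr c" "degree c = 3" "sep_split N c" "discdeg c = 2"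
    and r: "resultant l c \<noteq> 0" "resdeg l c = 0"
    and g: "prim_irr g" "degree g = 2" "sep_split N g" "discdeg g = 1" "resultant l g \<noteq> 0" "resdeg l g = 0"
    and gc: "resdeg g c = 0"
  shows False
proof -
  obtain p A u v where b: "basis p l" and A: "A \<noteq> 0" and c': "c = hsub 3 [:[:A:] * v, [:A:] * [:u:], 0, [:A:]:] p l"
    using cubic_normal_form[OF l c r] by blast
  obtain G where G: "degree G \<le> 2" "g = hsub 2 G p l" using basis_coordinates[OF b, of g 2] g by auto
  obtain \<kappa> where \<kappa>: "coeff G 2 = [:\<kappa>:]" "\<kappa> \<noteq> 0" by (rule basis_power_coeff[OF b l(2) g(5,6) G(2) g(2)])
  define B C where "B = coeff G 1" "C = coeff G 0"
  define t where "t = smult (1 / (2 * \<kappa>)) B"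
  define \<xi> where "\<xi> = smult (1 / \<kappa>) (C - [:\<kappa>:] * t\<^sup>2)"
  have B: "B = 2 * [:\<kappa>:] * t" using \<kappa>(2) by (simp add: t_def numeral_poly)
  have C: "C = [:\<kappa>:] * \<xi> + [:\<kappa>:] * t\<^sup>2" using \<kappa>(2) by (simp add: \<xi>_def)
  have Ge: "G = [:C, B, [:\<kappa>:]:]" using coeffs_le_2[OF G(1)] \<kappa>(1) by (simp add: B_C_def)
  define P where "P = p + [:t:] * l"
  have bP: "basis P l" unfolding P_def by (rule basis_shear[OF b])
  have ge: "g = [:[:\<kappa>:]:] * P\<^sup>2 + [:[:\<kappa>:]:] * [:\<xi>:] * l\<^sup>2"
    unfolding G(2) Ge hsub_explicit P_def B C
    using shear_identities(3)[of "[:[:\<kappa>:]:]" p "[:t:]" l "[:\<xi>:]"] by (simp only: const_simps const_numeral)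
  hence g': "g = hsub 2 [:[:\<kappa>:] * \<xi>, 0, [:\<kappa>:]:] P l" unfolding hsub_explicit by (simp only: const_simps) simp
  obtain e where e: "degree P \<le> 1" "degree l \<le> 1" "pdet P l = [:e:]" "e \<noteq> 0" using bP by (elim basisE)
  have \<xi>0: "\<xi> \<noteq> 0"
  proof
    assume "\<xi> = 0"
    hence gP: "g = P * ([:[:\<kappa>:]:] * P)" using ge by (simp add: power2_eq_square)
    have "degree ([:[:\<kappa>:]:] * P) = degree P" using \<kappa>(2) by simp
    hence "degree g \<le> degree P + degree P" using degree_mult_le[of P "[:[:\<kappa>:]:] * P"] unfolding gP by simp
    hence "degree P \<noteq> 0" using g(2) by auto
    thus False using prim_irr_no_factor[OF g(1) gP] \<open>degree _ = degree P\<close> by auto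
  qed
  have dF: "degree [:[:\<kappa>:] * \<xi>, 0, [:\<kappa>:]:] = 2" using \<kappa>(2) by simp
  have "discdeg [:[:\<kappa>:] * \<xi>, 0, [:\<kappa>:]:] = 1" using discdeg_hsub[OF g(3) e g' g(2) dF] g(4) by simp
  moreover have "discdeg [:[:\<kappa>:] * \<xi>, 0, [:\<kappa>:]:] = int (degree (0\<^sup>2 - 4 * [:\<kappa>:] * ([:\<kappa>:] * \<xi>)))"
    by (rule discdeg_quadratic) (use \<kappa>(2) \<xi>0 in \<open>simp_all\<close>)
  moreover have "0\<^sup>2 - 4 * [:\<kappa>:] * ([:\<kappa>:] * \<xi>) = smult (- 4 * \<kappa> * \<kappa>) \<xi>" by (simp add: numeral_poly mult_ac)
  ultimately have "degree (smult (- 4 * \<kappa> * \<kappa>) \<xi>) = 1" by (metis of_nat_1 of_nat_eq_iff)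
  hence d\<xi>: "degree \<xi> = 1" using \<kappa>(2) by simp
  define H where "H = [:[:A:] * (v - [:u:] * t - t ^ 3), [:A:] * ([:u:] + 3 * t\<^sup>2), - 3 * [:A:] * t, [:A:]:]"
  have cP: "c = hsub 3 H P l"
  proof -
    have "c = [:[:A:]:] * p ^ 3 + [:[:A:]:] * [:[:u:]:] * p * l\<^sup>2 + [:[:A:]:] * [:v:] * l ^ 3"
      unfolding c' hsub_explicit by (simp only: const_simps) simp
    thus ?thesis
      unfolding shear_identities(2)[of _ p _ _ _ "[:t:]"] H_def hsub_explicit P_def
      by (simp only: const_simps const_numeral)
  qed
  have dH: "degree H = 3" using A by (simp add: H_def)
  have "H = [:\<xi>, 0, 1:] * [:- 3 * [:A:] * t, [:A:]:] + [:[:A:] * (v - [:u:] * t - t ^ 3) + 3 * [:A:] * t * \<xi>, [:A:] * ([:u:] + 3 * t\<^sup>2) - [:A:] * \<xi>:]"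
    unfolding H_def by (simp add: algebra_simps)
  from residue_modulo_quadratic(1)[OF bP g(3,2) g' \<kappa>(2) d\<xi> cP c(2) dH gc this]
  have "smult A ([:u:] + 3 * t\<^sup>2 - \<xi>) = 0" by (simp add: smult_diff_right smult_add_right)
  hence \<xi>: "\<xi> = [:u:] + 3 * t\<^sup>2" using A by simp
  have d3: "degree (3 * t\<^sup>2) = 2 * degree t" by (cases "t = 0") (simp_all add: numeral_poly degree_power_eq)
  show False
  proof (cases "degree t = 0")
    case True
    hence "degree \<xi> \<le> 0" unfolding \<xi> using d3 by (intro degree_add_le) auto
    thus False using d\<xi> by simp
  next
    case False
    hence "degree \<xi> = 2 * degree t" unfolding \<xi> d3[symmetric] using d3 by (intro degree_add_eq_right) simp
    thus False using d\<xi> by presburger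
  qed
qed

section \<open>Normal forms of products\<close>

text \<open>
  This and the following predicates say that \<open>f\<close> is the value of a form of the given shape at a basis of linear forms.
\<close>
definition const_form :: "nat \<Rightarrow> 'a::field poly poly \<Rightarrow> bool" where
  "const_form d f \<longleftrightarrow> (\<exists>p q h. basis p q \<and> degree h \<le> d \<and> f = hsub d (map_poly (\<lambda>c. [:c:]) h) p q)"

definition biquadratic_form :: "'a::field poly poly \<Rightarrow> bool" where
  "biquadratic_form f \<longleftrightarrow> (\<exists>p q \<mu> \<nu>. basis p q \<and> \<mu> \<noteq> 0 \<and> f = hsub 4 [:0, 1, [:\<nu>, \<mu>:], 1:] p q)"

definition cubic_form :: "'a::field poly poly \<Rightarrow> bool" where
  "cubic_form f \<longleftrightarrow> (\<exists>p q h. basis p q \<and> degree h \<le> 3 \<and> f = q * hsub 3 (map_poly (\<lambda>c. [:c:]) h + [:[:0, 1:]:]) p q)"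

abbreviation (input) parabola :: "'a::field poly poly" where
  "parabola \<equiv> [:[:0, 1:], 0, 1:]"

definition parabolic_form :: "nat \<Rightarrow> nat \<Rightarrow> 'a::field poly poly \<Rightarrow> bool" where
  "parabolic_form r n f \<longleftrightarrow> (\<exists>p q h. basis p q \<and> degree h \<le> n \<and>
     f = q ^ r * hsub (2 * n) (pcompose (map_poly (\<lambda>c. [:c:]) h) parabola) p q)"

lemma hsub_prod:
  assumes "finite I" "\<And>i. i \<in> I \<Longrightarrow> degree (F i) \<le> m i"
  shows "hsub (\<Sum>i\<in>I. m i) (\<Prod>i\<in>I. F i) p q = (\<Prod>i\<in>I. hsub (m i) (F i) p q)"
  using assms
proof (induction I)
  case empty thus ?case by (simp add: hsub_altdef)
next
  case (insert i I)
  have "degree (prod F I) \<le> (\<Sum>i\<in>I. m i)"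
    using degree_prod_sum_le[OF insert.hyps(1), of F] sum_mono[of I "\<lambda>i. degree (F i)" m] insert.prems by (auto simp: o_def)
  hence "hsub (m i + (\<Sum>i\<in>I. m i)) (F i * prod F I) p q = hsub (m i) (F i) p q * hsub (\<Sum>i\<in>I. m i) (prod F I) p q"
    unfolding hsub_def using insert.prems by (intro comm_ring_hom.gsub_mult[OF const_poly_hom]) auto
  thus ?case using insert by simp
qed

lemma cmap_hom: "comm_ring_hom (map_poly (\<lambda>c :: 'a::field. [:c:]))"
proof -
  interpret c: comm_ring_hom "\<lambda>c :: 'a. [:c:]" by (rule const_poly_hom)
  interpret map_poly_comm_ring_hom "\<lambda>c :: 'a. [:c:]" ..
  show ?thesis ..
qed

lemma cmap_prod: "map_poly (\<lambda>c :: 'a::field. [:c:]) (\<Prod>i\<in>I. h i) = (\<Prod>i\<in>I. map_poly (\<lambda>c. [:c:]) (h i))"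
proof -
  interpret c: comm_ring_hom "map_poly (\<lambda>c :: 'a. [:c:])" by (rule cmap_hom)
  show ?thesis by (induction I rule: infinite_finite_induct) (simp_all add: c.hom_mult)
qed

lemma degree_cmap [simp]: "degree (map_poly (\<lambda>c :: 'a::field. [:c:]) h) = degree h"
  by (rule degree_map_poly) simp

lemma coeff_cmap [simp]: "coeff (map_poly (\<lambda>c :: 'a::field. [:c:]) h) i = [:coeff h i:]"
  by (simp add: coeff_map_poly)

lemma cmap_linear: "map_poly (\<lambda>c :: 'a::field. [:c:]) [:b, a:] = [:[:b:], [:a:]:]"
  by (rule poly_eqI) (simp add: coeff_pCons split: nat.split)

context factors begin

lemma swap_coordinate: "hsub 1 F p q = hsub 1 [:coeff F 1, coeff F 0:] q p"
  by (simp add: hsub_altdef add_ac)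

lemma basis_of_linear_pair:
  assumes "l \<in> S" "l' \<in> S" "degree l = 1" "degree l' = 1" "l \<noteq> l'" "resdeg l l' = 0"
  shows "basis l l'"
proof -
  obtain a b a' b' where ab: "l = [:b, a:]" "a \<noteq> 0" "l' = [:b', a':]" "a' \<noteq> 0"
    using linear_poly_coeffs[OF assms(3)] linear_poly_coeffs[OF assms(4)] by blast
  have "pdet l l' = resultant l l'" using ab by (simp add: pdet_def resultant_linear_linear mult.commute)
  moreover have "resultant l l' \<noteq> 0" using resultant_member_nonzero assms by blast
  moreover have "degree (resultant l l') = 0" using assms(6) by (simp add: resdeg_def)
  ultimately have "\<exists>e. e \<noteq> 0 \<and> pdet l l' = [:e:]" by (metis degree_eq_zeroE pCons_0_0)
  thus ?thesis using assms by (simp add: basis_def)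
qed

text \<open>
  Two of the linear factors form a basis in which all others have constant coordinates, since the coordinates are
  resultants.
\<close>
lemma const_form_of_clique:
  assumes "S \<noteq> {}" "S = L" "clique L"
  shows "const_form (degree (\<Prod>S)) (\<Prod>S)"
proof -
  have d1: "degree l = 1" if "l \<in> S" for l using that by (subst (asm) assms(2)) (simp add: L_def)
  have r0: "resdeg l h = 0" if "l \<in> S" "h \<in> S" for l h
  proof (cases "l = h")
    case True thus ?thesis using resdeg_self[of N l] sep_split_member(1)[OF that(1)] d1[OF that(1)] by simp
  next
    case False
    have "l \<in> L" "h \<in> L" using that assms(2) by blast+
    thus ?thesis using assms(3) False by (simp add: clique_def)
  qed
  obtain q where q: "q \<in> S" using assms(1) by blast
  have "\<exists>p. basis p q \<and> (\<forall>l\<in>S. \<exists>h. degree h \<le> 1 \<and> l = hsub 1 (map_poly (\<lambda>c. [:c:]) h) p q)"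
  proof (cases "\<exists>p\<in>S. p \<noteq> q")
    case True
    then obtain p where p: "p \<in> S" "p \<noteq> q" by blast
    have b: "basis p q" by (rule basis_of_linear_pair[OF p(1) q d1[OF p(1)] d1[OF q] p(2) r0[OF p(1) q]])
    obtain e where e: "degree p \<le> 1" "degree q \<le> 1" "pdet p q = [:e:]" "e \<noteq> 0" using b by (elim basisE)
    obtain e' where e': "pdet q p = [:e':]" "e' \<noteq> 0" using basis_swap[OF b] by (elim basisE)
    have "\<exists>h. degree h \<le> 1 \<and> l = hsub 1 (map_poly (\<lambda>c. [:c:]) h) p q" if l: "l \<in> S" for l
    proof -
      obtain F where F: "degree F \<le> 1" "l = hsub 1 F p q" using basis_coordinates[OF b, of l 1] d1[OF l] by auto
      have F': "l = hsub 1 [:coeff F 1, coeff F 0:] q p" using F(2) swap_coordinate by metis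
      have "degree (coeff F 1) = 0"
        using degree_resultant_basis(2)[OF e(1) d1[OF q] e(3,4) F(2) d1[OF l]] r0[OF q l] by simp
      moreover have "degree (coeff F 0) = 0"
        using degree_resultant_basis(2)[OF e(2) d1[OF p(1)] e' F' d1[OF l]] r0[OF p(1) l] by simp
      ultimately obtain a b where ab: "coeff F 1 = [:a:]" "coeff F 0 = [:b:]" by (metis degree_eq_zeroE)
      have "F = map_poly (\<lambda>c. [:c:]) [:b, a:]" 
        by (subst deg1_form[OF F(1)]) (simp only: ab cmap_linear)
      thus ?thesis using F by (intro exI[of _ "[:b, a:]"]) auto
    qed
    thus ?thesis using b by blast
  next
    case False
    obtain p where b: "basis p q" using basis_complement[OF irr[OF q] d1[OF q]] by blast
    have "q = hsub 1 (map_poly (\<lambda>c. [:c:]) [:1:]) p q" by (simp add: hsub_altdef one_pCons[symmetric])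
    moreover have "degree [:1 :: 'a:] \<le> 1" by simp
    ultimately show ?thesis using b False by (intro exI[of _ p] conjI ballI exI[of _ "[:1:]"]) auto
  qed
  then obtain p where b: "basis p q" and ex: "\<forall>l\<in>S. \<exists>h. degree h \<le> 1 \<and> l = hsub 1 (map_poly (\<lambda>c. [:c:]) h) p q" by blast
  from bchoice[OF ex] obtain h where h: "\<And>l. l \<in> S \<Longrightarrow> degree (h l) \<le> 1" "\<And>l. l \<in> S \<Longrightarrow> l = hsub 1 (map_poly (\<lambda>c. [:c:]) (h l)) p q" by blast
  have "degree (\<Prod>S) = card S" using degree_prod_eq_sum_degree[of S "\<lambda>g. g"] nz d1 by simp
  moreover have "(\<Prod>l\<in>S. l) = (\<Prod>l\<in>S. hsub 1 (map_poly (\<lambda>c. [:c:]) (h l)) p q)" using h(2) by (rule prod.cong[OF refl])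
  moreover have "\<dots> = hsub (\<Sum>l\<in>S. 1) (\<Prod>l\<in>S. map_poly (\<lambda>c. [:c:]) (h l)) p q"
    by (rule hsub_prod[symmetric]) (use fin h(1) in auto)
  ultimately have "\<Prod>S = hsub (degree (\<Prod>S)) (map_poly (\<lambda>c. [:c:]) (\<Prod>l\<in>S. h l)) p q" by (simp add: cmap_prod)
  moreover have "degree (\<Prod>l\<in>S. h l) \<le> degree (\<Prod>S)"
    using degree_prod_sum_le[OF fin, of h] sum_mono[of S "\<lambda>l. degree (h l)" "\<lambda>_. 1"] h(1) \<open>degree (\<Prod>S) = card S\<close>
    by (auto simp: o_def)
  ultimately show ?thesis using b unfolding const_form_def by blast
qed

text \<open>
  One of the quadratics is brought to the normal form \<open>p\<^sup>2 + (x + \<theta>) q\<^sup>2\<close>; all members of \<open>Q\<close> are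
  then constant combinations of \<open>p\<^sup>2 + x q\<^sup>2\<close> and \<open>q\<^sup>2\<close>, and linear factors are constant multiples of \<open>q\<close>.
\<close>
lemma quadratics_normal_form:
  assumes R: "R = 0" and Q: "Q \<subseteq> S" "\<And>g. g \<in> Q \<Longrightarrow> degree g = 2 \<and> discdeg g = 1" "Q \<noteq> {}"
  obtains p q h where "basis p q" "degree h \<le> card Q" "\<Prod>Q = hsub (2 * card Q) (pcompose (map_poly (\<lambda>c. [:c:]) h) parabola) p q"
    "\<And>l. l \<in> S \<Longrightarrow> degree l = 1 \<Longrightarrow> \<exists>\<beta>. l = [:[:\<beta>:]:] * q"
proof -
  obtain g where g: "g \<in> Q" using Q by blast
  have gS: "g \<in> S" and dg: "degree g = 2" "discdeg g = 1" using g Q by auto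
  have ssg: "sep_split N g" by (rule sep_split_member(1)[OF gS])
  have ge: "g = [:coeff g 0, coeff g 1, coeff g 2:]" using coeffs_le_2[of g] dg by simp
  have l0: "coeff g 2 \<noteq> 0" using dg nz(1)[OF gS] by (metis leading_coeff_0_iff)
  define a b c where "a = coeff g 2" "b = coeff g 1" "c = coeff g 0"
  have ge: "g = [:c, b, a:]" using ge by (simp add: a_b_c_def)
  have a0: "a \<noteq> 0" using l0 by (simp add: a_b_c_def)
  have "degree (b\<^sup>2 - 4 * a * c) = 1"
  proof (cases "b\<^sup>2 - 4 * a * c = 0")
    case True
    hence "discdeg g \<le> 0" unfolding ge discdeg_quadratic_general[OF a0] by simp
    thus ?thesis using dg(2) by simp
  next
    case False thus ?thesis using dg(2) discdeg_quadratic[OF a0 False] unfolding ge by simp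
  qed
  moreover have "g = hsub 2 [:c, b, a:] [:0, 1:] [:1:]" using hsub_identity[of g 2] dg(1) ge by simp
  ultimately obtain p q \<alpha> \<beta> where b: "basis p q" and \<alpha>: "\<alpha> \<noteq> 0" and gn: "g = hsub 2 [:[:\<beta>, \<alpha>:], 0, [:\<alpha>:]:] p q"
    using quadratic_normal_form[OF basis_std] by blast
  \<comment> \<open>\<open>\<theta> = \<beta> / \<alpha>\<close> is absorbed into the constant multiples of \<open>q\<^sup>2\<close> below\<close>
  define \<xi> where "\<xi> = [:\<beta> / \<alpha>, 1:]"
  have gn: "g = hsub 2 [:[:\<alpha>:] * \<xi>, 0, [:\<alpha>:]:] p q" using gn \<alpha> by (simp add: \<xi>_def)
  have d\<xi>: "degree \<xi> = 1" by (simp add: \<xi>_def)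
  have rg: "resdeg g h = 0" if "h \<in> S" for h
    using R_zero[OF R gS that] resdeg_self[OF ssg] dg by (cases "g = h") auto
  have lin: "\<exists>\<beta>. l = [:[:\<beta>:]:] * q" if "l \<in> S" "degree l = 1" for l
    by (rule linear_over_quadratic[OF b ssg dg(1) gn \<alpha> d\<xi> irr[OF that(1)] that(2) rg[OF that(1)]])
  have ex: "\<forall>h\<in>Q. \<exists>k. degree k \<le> 1 \<and> h = hsub 2 (pcompose (map_poly (\<lambda>c. [:c:]) k) parabola) p q"
  proof
    fix h assume h: "h \<in> Q"
    hence hS: "h \<in> S" "degree h = 2" "discdeg h = 1" using Q by auto
    obtain a \<gamma> where ag: "h = hsub 2 [:[:a:] * \<xi> + [:\<gamma>:], 0, [:a:]:] p q"
      using quadratic_over_quadratic[OF b ssg dg(1) gn \<alpha> d\<xi> irr[OF hS(1)] hS(2) sep_split_member(1)[OF hS(1)] hS(3) rg[OF hS(1)]] by blast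
    have "pcompose (map_poly (\<lambda>c. [:c:]) [:\<gamma> + a * (\<beta> / \<alpha>), a:]) parabola = [:[:a:] * \<xi> + [:\<gamma>:], 0, [:a:]:]"
      by (simp add: cmap_linear \<xi>_def pcompose_pCons add.commute mult.commute)
    thus "\<exists>k. degree k \<le> 1 \<and> h = hsub 2 (pcompose (map_poly (\<lambda>c. [:c:]) k) parabola) p q"
      using ag by (intro exI[of _ "[:\<gamma> + a * (\<beta> / \<alpha>), a:]"]) simp
  qed
  from bchoice[OF ex] obtain k where k: "\<And>h. h \<in> Q \<Longrightarrow> degree (k h) \<le> 1"
    "\<And>h. h \<in> Q \<Longrightarrow> h = hsub 2 (pcompose (map_poly (\<lambda>c. [:c:]) (k h)) parabola) p q" by blast
  have finQ: "finite Q" using Q(1) fin finite_subset by blast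
  have dk: "degree (\<Prod>h\<in>Q. k h) \<le> card Q"
    using degree_prod_sum_le[OF finQ, of k] sum_mono[of Q "\<lambda>i. degree (k i)" "\<lambda>_. 1"] k(1) by (auto simp: o_def)
  have "(\<Prod>h\<in>Q. h) = (\<Prod>h\<in>Q. hsub 2 (pcompose (map_poly (\<lambda>c. [:c:]) (k h)) parabola) p q)" using k(2) by (rule prod.cong[OF refl])
  also have "\<dots> = hsub (\<Sum>h\<in>Q. 2) (\<Prod>h\<in>Q. pcompose (map_poly (\<lambda>c. [:c:]) (k h)) parabola) p q"
    by (rule hsub_prod[symmetric]) (use finQ k(1) in \<open>fastforce simp: degree_pcompose\<close>)+
  also have "(\<Prod>h\<in>Q. pcompose (map_poly (\<lambda>c. [:c:]) (k h)) parabola) = pcompose (map_poly (\<lambda>c. [:c:]) (\<Prod>h\<in>Q. k h)) parabola"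
    by (simp add: cmap_prod pcompose_prod)
  finally have "\<Prod>Q = hsub (2 * card Q) (pcompose (map_poly (\<lambda>c. [:c:]) (\<Prod>h\<in>Q. k h)) parabola) p q" by (simp add: mult.commute)
  from that[OF b dk this lin] show ?thesis .
qed
end

section \<open>Normal forms of extremal configurations\<close>

lemma rescale_cubic:
  fixes \<sigma> :: "'r::comm_ring_1"
  assumes "H3 * \<sigma> = A" "H1 * \<sigma> ^ 3 = A1" "H0 * \<sigma> ^ 4 = A0"
  shows "l * (A * p ^ 3 + A1 * p * l\<^sup>2 + A0 * l ^ 3) = (\<sigma> * l) * (H3 * p ^ 3 + 0 * p\<^sup>2 * (\<sigma> * l) + H1 * p * (\<sigma> * l)\<^sup>2 + H0 * (\<sigma> * l) ^ 3)"
  unfolding assms[symmetric] by (simp add: algebra_simps eval_nat_numeral)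

lemma rescale_biquadratic:
  fixes \<sigma> \<tau> :: "'r::comm_ring_1"
  assumes "\<sigma> ^ 3 * \<tau> = A" "M * (\<sigma> * \<tau>)\<^sup>2 = B" "\<sigma> * \<tau> ^ 3 = C"
  shows "l * m * (A * l\<^sup>2 + B * l * m + C * m\<^sup>2) =
    (\<sigma> * l) ^ 3 * (\<tau> * m) + M * (\<sigma> * l)\<^sup>2 * (\<tau> * m)\<^sup>2 + (\<sigma> * l) * (\<tau> * m) ^ 3"
  unfolding assms[symmetric] by (simp add: algebra_simps eval_nat_numeral)

context factors begin

text \<open>
  After scaling \<open>q\<close> by a fourth root, the coefficient of \<open>x q\<^sup>4\<close> is \<open>1\<close>.
\<close>
lemma cubic_form_of_pair:
  assumes S: "S = {l, c}" "l \<noteq> c" "degree l = 1" "degree c = 3" "discdeg c = 2" "resdeg l c = 0"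
  shows "cubic_form (\<Prod>S)"
proof -
  have m: "l \<in> S" "c \<in> S" using S by auto
  have r: "resultant l c \<noteq> 0" using resultant_member_nonzero m S(2) by metis
  obtain p A u v where b: "basis p l" and A: "A \<noteq> 0" and v: "degree v = 1"
    and c': "c = hsub 3 [:[:A:] * v, [:A:] * [:u:], 0, [:A:]:] p l"
    using cubic_normal_form[OF irr[OF m(1)] S(3) irr[OF m(2)] S(4) sep_split_member(1)[OF m(2)] S(5) r S(6)] by blast
  obtain v0 v1 where v01: "v = [:v0, v1:]" "v1 \<noteq> 0" using degree1_coeffs[OF v] by blast
  obtain s where s: "s ^ 4 = A * v1" using nth_root_exists[of 4 "A * v1"] by auto
  have s0: "s \<noteq> 0" using s A v01 by auto
  define h where "h = [:A * v0 / s ^ 4, A * u / s ^ 3, 0, A / s:]"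
  define \<sigma> where "\<sigma> = [:[:s:]:]"
  have \<sigma>p: "\<sigma> ^ k = [:[:s ^ k:]:]" for k unfolding \<sigma>_def by (simp only: poly_const_pow)
  have "map_poly (\<lambda>c. [:c:]) h + [:[:0, 1:]:] = [:[:A * v0 / s ^ 4, 1:], [:A * u / s ^ 3:], 0, [:A / s:]:]"
    by (rule poly_eqI) (auto simp: h_def coeff_pCons split: nat.split)
  hence hx: "hsub 3 (map_poly (\<lambda>c. [:c:]) h + [:[:0, 1:]:]) p (\<sigma> * l) =
    [:[:A / s:]:] * p ^ 3 + 0 * p\<^sup>2 * (\<sigma> * l) + [:[:A * u / s ^ 3:]:] * p * (\<sigma> * l)\<^sup>2 + [:[:A * v0 / s ^ 4, 1:]:] * (\<sigma> * l) ^ 3"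
    by (simp add: hsub_explicit)
  have "\<Prod>S = l * c" using S by simp
  also have "c = [:[:A:]:] * p ^ 3 + [:[:A * u:]:] * p * l\<^sup>2 + [:[:A * v0, A * v1:]:] * l ^ 3"
    unfolding c' hsub_explicit v01 by (simp add: mult.commute)
  also have "l * \<dots> = (\<sigma> * l) * hsub 3 (map_poly (\<lambda>c. [:c:]) h + [:[:0, 1:]:]) p (\<sigma> * l)"
    unfolding hx
  proof (rule rescale_cubic)
    show "[:[:A / s:]:] * \<sigma> = [:[:A:]:]" using s0 by (simp add: \<sigma>_def)
    show "[:[:A * u / s ^ 3:]:] * \<sigma> ^ 3 = [:[:A * u:]:]" using s0 by (simp add: \<sigma>p)
    show "[:[:A * v0 / s ^ 4, 1:]:] * \<sigma> ^ 4 = [:[:A * v0, A * v1:]:]" using s0 s v01 A by (simp add: \<sigma>p)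
  qed
  finally have "\<Prod>S = (\<sigma> * l) * hsub 3 (map_poly (\<lambda>c. [:c:]) h + [:[:0, 1:]:]) p (\<sigma> * l)" .
  moreover have "basis p (\<sigma> * l)" unfolding \<sigma>_def by (rule basis_scale[OF b s0])
  moreover have "degree h \<le> 3" by (simp add: h_def)
  ultimately show ?thesis unfolding cubic_form_def by blast
qed

text \<open>
  The two linear factors are the basis.  As \<open>T = 2\<close>, their resultants with the quadratic are constant, so its outer
  coefficients are constant and its middle coefficient is linear; scaling the basis makes the outer coefficients \<open>1\<close>.
\<close>
lemma biquadratic_form_of_triple:
  assumes S: "S = {l, l', g}" "l \<noteq> l'" "degree l = 1" "degree l' = 1" "resdeg l l' = 0" "degree g = 2" and T: "T = 2"
  shows "biquadratic_form (\<Prod>S)"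
proof -
  have m: "l \<in> S" "l' \<in> S" "g \<in> S" using S by auto
  have ne: "g \<noteq> l" "g \<noteq> l'" using S by auto
  have G: "G = {g}" unfolding G_def using S by auto
  have Tg: "T = discdeg g + R" using T_eq G by simp
  have Dg: "discdeg g \<ge> 1" using D_G[of g] G S by simp
  have "R \<ge> 2 * (\<Sum>h\<in>S - {g}. \<Sum>k\<in>{g}. resdeg h k)" using R_ge_cut[of "{g}"] m by simp
  moreover have "S - {g} = {l, l'}" using S ne by auto
  ultimately have R2: "R \<ge> 2 * (resdeg l g + resdeg l' g)" using S(2) by simp
  have "resdeg l g \<ge> 0" "resdeg l' g \<ge> 0" by simp_all
  moreover have "2 * (resdeg l g + resdeg l' g) \<le> 1" using R2 Tg Dg T by linarith
  hence "resdeg l g + resdeg l' g \<le> 0" by presburger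
  ultimately have rg: "resdeg l g = 0" "resdeg l' g = 0" by linarith+
  have "resdeg h k = 0" if "h \<in> S" "k \<in> S - {h}" for h k
  proof -
    have "h \<in> {l, l', g}" "k \<in> {l, l', g}" "k \<noteq> h" using that S(1) by blast+
    thus ?thesis using rg S(5) resdeg_sym[of g l] resdeg_sym[of g l'] resdeg_sym[of l' l] by auto
  qed
  hence "R = 0" unfolding R_def by (intro sum.neutral ballI) auto
  hence Dg: "discdeg g = 2" using Tg T by simp
  have b: "basis l l'" by (rule basis_of_linear_pair[OF m(1,2) S(3,4,2,5)])
  obtain F where F: "degree F \<le> 2" "g = hsub 2 F l l'" using basis_coordinates[OF b, of g 2] S(6) by auto
  define B where "B = coeff F 1"
  obtain A where A: "coeff F 2 = [:A:]" "A \<noteq> 0"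
    by (rule basis_power_coeff[OF b S(4) resultant_member_nonzero[OF m(2,3) ne(2)] rg(2) F(2) S(6)])
  have Fe: "F = [:coeff F 0, B, [:A:]:]" using coeffs_le_2[OF F(1)] A by (simp add: B_def)
  have F': "g = hsub 2 [:[:A:], B, coeff F 0:] l' l"
    unfolding F(2) by (subst Fe) (simp only: hsub_explicit ac_simps)
  obtain C where C: "coeff [:[:A:], B, coeff F 0:] 2 = [:C:]" "C \<noteq> 0"
    by (rule basis_power_coeff[OF basis_swap[OF b] S(3) resultant_member_nonzero[OF m(1,3) ne(1)] rg(1) F' S(6)])
  have Fe: "F = [:[:C:], B, [:A:]:]" using Fe C by (simp add: numeral_2_eq_2)
  have dF: "degree F = 2" using A unfolding Fe by simp
  obtain e where e: "degree l \<le> 1" "degree l' \<le> 1" "pdet l l' = [:e:]" "e \<noteq> 0" using b by (elim basisE)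
  have DF: "discdeg F = 2" using discdeg_hsub[OF sep_split_member(1)[OF m(3)] e F(2) S(6) dF] Dg by simp
  have "discdeg F = int (degree ([:A:] * (B\<^sup>2 - 4 * [:A:] * [:C:])))" 
    using A unfolding Fe by (subst discdeg_quadratic_general) simp_all
  hence dD: "degree (B\<^sup>2 - [:4 * A * C:]) = 2" using DF A by (simp add: numeral_poly mult_ac)
  have "degree B = 1"
  proof (cases "degree B = 0")
    case True
    hence "degree (B\<^sup>2) = 0" using degree_power_le[of B 2] by simp
    hence "degree (B\<^sup>2 - [:4 * A * C:]) \<le> 0" by (intro degree_diff_le) auto
    thus ?thesis using dD by simp
  next
    case False
    have d2: "degree (B\<^sup>2) = 2 * degree B" using False by (cases "B = 0") (simp_all add: degree_power_eq)
    hence "degree (B\<^sup>2 + - [:4 * A * C:]) = degree (B\<^sup>2)" using False by (intro degree_add_eq_left) simp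
    thus ?thesis using dD d2 unfolding add_uminus_conv_diff by linarith
  qed
  then obtain b0 b1 where b01: "B = [:b0, b1:]" "b1 \<noteq> 0" using degree1_coeffs by blast
  \<comment> \<open>scaling factors \<open>s, r\<close> with \<open>s\<^sup>3 r = A\<close> and \<open>s r\<^sup>3 = C\<close>\<close>
  obtain w where w: "w\<^sup>2 = C / A" using nth_root_exists[of 2 "C / A"] by auto
  have w0: "w \<noteq> 0" using w A C by auto
  obtain s where s: "s ^ 4 = A / w" using nth_root_exists[of 4 "A / w"] by auto
  have s0: "s \<noteq> 0" using s A w0 by auto
  define r where "r = w * s"
  have r0: "r \<noteq> 0" using s0 w0 by (simp add: r_def)
  have e1: "s ^ 3 * r = A" using s w0 by (simp add: r_def eval_nat_numeral field_simps)
  have "s * r ^ 3 = w\<^sup>2 * (w * s ^ 4)" by (simp add: r_def eval_nat_numeral)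
  hence e2: "s * r ^ 3 = C" using w s w0 A by simp
  define \<nu> \<mu> where "\<nu> = b0 / (s * r)\<^sup>2" "\<mu> = b1 / (s * r)\<^sup>2"
  define \<sigma> \<tau> where "\<sigma> = [:[:s:]:]" "\<tau> = [:[:r:]:]"
  have \<sigma>p: "\<sigma> ^ k = [:[:s ^ k:]:]" "\<tau> ^ k = [:[:r ^ k:]:]" for k unfolding \<sigma>_\<tau>_def by (simp_all only: poly_const_pow)
  have "\<Prod>S = l * l' * g" using S(1,2) ne by (simp add: mult.assoc)
  also have "g = [:[:A:]:] * l\<^sup>2 + [:B:] * l * l' + [:[:C:]:] * l'\<^sup>2"
    unfolding F(2) Fe by (simp only: hsub_explicit)
  also have "l * l' * \<dots> = (\<sigma> * l) ^ 3 * (\<tau> * l') + [:[:\<nu>, \<mu>:]:] * (\<sigma> * l)\<^sup>2 * (\<tau> * l')\<^sup>2 + (\<sigma> * l) * (\<tau> * l') ^ 3"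
  proof (rule rescale_biquadratic)
    show "\<sigma> ^ 3 * \<tau> = [:[:A:]:]" "\<sigma> * \<tau> ^ 3 = [:[:C:]:]" unfolding \<sigma>p using e1 e2 by (simp_all add: \<sigma>_\<tau>_def)
    have "(\<sigma> * \<tau>)\<^sup>2 = [:[:(s * r)\<^sup>2:]:]" unfolding power_mult_distrib \<sigma>p by simp
    thus "[:[:\<nu>, \<mu>:]:] * (\<sigma> * \<tau>)\<^sup>2 = [:B:]" using s0 r0 by (simp add: b01 \<nu>_\<mu>_def)
  qed
  also have "\<dots> = hsub 4 [:0, 1, [:\<nu>, \<mu>:], 1:] (\<sigma> * l) (\<tau> * l')"
  proof -
    have "hsub 4 [:0, 1, [:\<nu>, \<mu>:], 1:] (\<sigma> * l) (\<tau> * l') = hsub 4 [:0, 1, [:\<nu>, \<mu>:], 1, 0:] (\<sigma> * l) (\<tau> * l')" by simp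
    also have "\<dots> = (\<sigma> * l) ^ 3 * (\<tau> * l') + [:[:\<nu>, \<mu>:]:] * (\<sigma> * l)\<^sup>2 * (\<tau> * l')\<^sup>2 + (\<sigma> * l) * (\<tau> * l') ^ 3"
      unfolding hsub_explicit by simp
    finally show ?thesis by simp
  qed
  finally have "\<Prod>S = hsub 4 [:0, 1, [:\<nu>, \<mu>:], 1:] (\<sigma> * l) (\<tau> * l')" .
  moreover have "basis (\<sigma> * l) (\<tau> * l')"
    unfolding \<sigma>_\<tau>_def by (rule basis_scale[OF basis_swap[OF basis_scale[OF basis_swap[OF b] s0]] r0])
  moreover have "\<mu> \<noteq> 0" using b01 s0 r0 by (simp add: \<nu>_\<mu>_def)
  ultimately show ?thesis unfolding biquadratic_form_def by blast
qed

lemma extremal_normal_form: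
  assumes ext: "extremal" and T: "T > 0"
  shows "(degree (\<Prod>S) = 4 \<and> biquadratic_form (\<Prod>S)) \<or> (degree (\<Prod>S) = 4 \<and> cubic_form (\<Prod>S)) \<or>
    (\<exists>n. degree (\<Prod>S) = 2 * n + 1 \<and> parabolic_form 1 n (\<Prod>S)) \<or> (\<exists>n. degree (\<Prod>S) = 2 * n \<and> parabolic_form 0 n (\<Prod>S))"
proof -
  have degQ: "degree (\<Prod>Q) = 2 * card Q" if "Q \<subseteq> S" "\<And>g. g \<in> Q \<Longrightarrow> degree g = 2" for Q
  proof -
    have "\<forall>i\<in>Q. i \<noteq> 0" using nz(1) that(1) by blast
    from degree_prod_eq_sum_degree[of Q "\<lambda>g. g", simplified, OF this] show ?thesis using that(2) by simp
  qed
  have SL: "T = 0" if "S = L" "R = 0"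
  proof -
    have "G = {}" using LG that by auto
    thus ?thesis using T_eq that by simp
  qed
  show ?thesis
    using ext[unfolded extremal_def]
  proof (elim disjE exE conjE, goal_cases)
    case 1
    note quads = this
    have "S \<noteq> {}" using T quads(2) T_eq by (auto simp: G_def)
    obtain p q h where "basis p q" "degree h \<le> card S" "\<Prod>S = hsub (2 * card S) (pcompose (map_poly (\<lambda>c. [:c:]) h) parabola) p q"
      by (rule quadratics_normal_form[OF quads(2) subset_refl _ \<open>S \<noteq> {}\<close>]) (use quads(3) in blast)
    hence "parabolic_form 0 (card S) (\<Prod>S)" unfolding parabolic_form_def by (intro exI[of _ p] exI[of _ q] exI[of _ h]) simp
    moreover have "degree (\<Prod>S) = 2 * card S" using degQ[of S] quads by auto
    ultimately show ?thesis by blast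
  next
    case (2 l)
    note line = this
    have lS: "l \<in> S" "degree l = 1" using line(1) by (auto simp: L_def)
    have "S - {l} \<noteq> {}"
    proof
      assume "S - {l} = {}"
      hence "S = {l}" using lS by blast
      hence "S = L" using line(1) by metis
      thus False using SL line T by simp
    qed
    define k where "k = card (S - {l})"
    obtain p q h where b: "basis p q" "degree h \<le> k"
      "\<Prod>(S - {l}) = hsub (2 * k) (pcompose (map_poly (\<lambda>c. [:c:]) h) parabola) p q"
      and lin: "\<And>l. l \<in> S \<Longrightarrow> degree l = 1 \<Longrightarrow> \<exists>\<beta>. l = [:[:\<beta>:]:] * q"
      using quadratics_normal_form[of "S - {l}"] line \<open>S - {l} \<noteq> {}\<close> unfolding k_def by blast
    obtain \<beta> where \<beta>: "l = [:[:\<beta>:]:] * q" using lin lS by blast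
    have pS: "\<Prod>S = l * \<Prod>(S - {l})" using prod.remove[OF fin lS(1), of id] by simp
    have "map_poly (\<lambda>c. [:c:]) (smult \<beta> h) = smult [:\<beta>:] (map_poly (\<lambda>c. [:c:]) h)" by (rule poly_eqI) simp
    hence "hsub (2 * k) (pcompose (map_poly (\<lambda>c. [:c:]) (smult \<beta> h)) parabola) p q = [:[:\<beta>:]:] * \<Prod>(S - {l})"
      by (simp add: pcompose_smult b(3) hsub_def comm_ring_hom.gsub_smult[OF const_poly_hom])
    hence "\<Prod>S = q ^ 1 * hsub (2 * k) (pcompose (map_poly (\<lambda>c. [:c:]) (smult \<beta> h)) parabola) p q"
      unfolding pS by (subst \<beta>) simp
    moreover have "degree (smult \<beta> h) \<le> k" using b(2) degree_smult_le order_trans by blast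
    ultimately have "parabolic_form 1 (card (S - {l})) (\<Prod>S)" unfolding parabolic_form_def k_def[symmetric] using b(1) by blast
    moreover have "degree (\<Prod>S) = 2 * card (S - {l}) + 1"
    proof -
      have "\<Prod>(S - {l}) \<noteq> 0" using nz(1) fin by auto
      thus ?thesis unfolding pS using degQ[of "S - {l}"] line lS nz(1) by (subst degree_mult_eq) auto
    qed
    ultimately show ?thesis by blast
  next
    case (3 l c)
    note cubic = this
    have lS: "l \<in> S" "degree l = 1" using cubic(1) by (auto simp: L_def)
    have lc: "l \<noteq> c" using lS cubic by auto
    have rlc: "resdeg l c = 0" using R_zero cubic lS lc by blast
    have rn: "resultant l g \<noteq> 0" if "g \<in> S" "g \<noteq> l" for g using resultant_member_nonzero lS that by blast
    have "S - {l, c} = {}"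
    proof (rule ccontr)
      assume "S - {l, c} \<noteq> {}"
      then obtain g where g: "g \<in> S" "g \<noteq> l" "g \<noteq> c" by blast
      have "degree g = 2" "discdeg g = 1" using cubic(6) g by auto
      thus False using no_quadratic_with_cubic[OF irr[OF lS(1)] lS(2) irr[OF cubic(3)] cubic(4) sep_split_member(1)[OF cubic(3)] cubic(5)
          rn[OF cubic(3)] rlc irr[OF g(1)] _ sep_split_member(1)[OF g(1)] _ rn[OF g(1,2)]]
          R_zero[OF cubic(2)] g lS lc cubic(3) by metis
    qed
    hence S: "S = {l, c}" using lS cubic(3) by blast
    have "degree (\<Prod>S) = 4"
      unfolding S using lc lS cubic nz(1)[of l] nz(1)[of c] by (simp add: degree_mult_eq)
    thus ?thesis using cubic_form_of_pair[OF S lc lS(2) cubic(4,5) rlc] by blast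
  next
    case (4 l l' g)
    note triple = this
    have "g \<noteq> l" "g \<noteq> l'" using triple by auto
    hence "degree (\<Prod>S) = 4"
      unfolding triple(1) using triple nz(1)[of l] nz(1)[of l'] nz(1)[of g] by (simp add: degree_mult_eq)
    thus ?thesis using biquadratic_form_of_triple[OF triple] by blast
  qed
qed
end

section \<open>Discriminants of the normal forms\<close>

lemma sep_split_no_square:
  fixes q X :: "'a::{alg_closed_field, field_char_0} poly poly"
  assumes "sep_split N (q * (q * X))" "degree q > 0"
  shows False
proof -
  have N: "N > 0" and nz: "q * (q * X) \<noteq> 0" using assms by (auto simp: sep_split_def)
  hence q0: "q \<noteq> 0" "q * X \<noteq> 0" by auto
  have "sep_split N q" "lroots N q \<inter> lroots N (q * X) = {}" using assms(1) sep_split_mult_iff[OF N q0] by auto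
  moreover have "lroots N q \<subseteq> lroots N (q * X)" using lroots_mult[OF N, of q X] by blast
  ultimately have "lroots N q = {}" by blast
  thus False using \<open>sep_split N q\<close> assms(2) by (simp add: sep_split_def)
qed

lemma hsub_Suc: "degree F \<le> n \<Longrightarrow> hsub (Suc n) F p q = q * hsub n F p q"
  unfolding hsub_def by (rule comm_ring_hom.gsub_Suc[OF const_poly_hom])

lemma degree_hsub_drop:
  assumes b: "basis p q" and "degree (q * hsub n F p q) = Suc n"
  shows "degree q = 1" "degree (hsub n F p q) = n"
proof -
  have "degree q \<le> 1" "degree (hsub n F p q) \<le> n" using b degree_hsub_le[of p q n F] by (auto simp: basis_def)
  moreover have "degree (q * hsub n F p q) \<le> degree q + degree (hsub n F p q)" by (rule degree_mult_le)
  ultimately show "degree q = 1" "degree (hsub n F p q) = n" using assms(2) by linarith+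
qed

text \<open>
  If two leading coefficients of the form vanish, \<open>q\<^sup>2\<close> divides \<open>f\<close>.
\<close>
lemma hsub_degree_lower_bound:
  fixes f p q :: "'a::{alg_closed_field, field_char_0} poly poly"
  assumes ss: "sep_split N f" "degree f = m" and b: "basis p q" and f: "f = hsub m F p q"
  shows "m \<le> Suc (degree F)"
proof (rule ccontr)
  assume "\<not> ?thesis"
  then obtain k where k: "m = Suc (Suc k)" "degree F \<le> k" by (metis Suc_le_D not_less_eq_eq Suc_le_mono)
  have "f = q * (q * hsub k F p q)" unfolding f k(1) using k(2) by (simp add: hsub_Suc)
  moreover have "degree q = 1"
    using degree_hsub_drop(1)[OF b, of "Suc k" F] ss(2) k hsub_Suc[of F "Suc k" p q] f by simp
  ultimately show False using sep_split_no_square[of N q] ss(1) by simp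
qed

text \<open>
  The factor \<open>q\<close> of a form with vanishing leading coefficient is split off.
\<close>
lemma discdeg_drop:
  fixes f p q :: "'a::{alg_closed_field, field_char_0} poly poly"
  assumes ss: "sep_split N f" "degree f = Suc n" and n: "n > 0" and b: "basis p q" and f: "f = q * hsub n F p q"
  shows "sep_split N (hsub n F p q)" "degree (hsub n F p q) = n"
    "discdeg f = discdeg (hsub n F p q) + 2 * int (degree (coeff F n))"
proof -
  have N: "N > 0" and f0: "f \<noteq> 0" using ss by (auto simp: sep_split_def)
  have d: "degree q = 1" "degree (hsub n F p q) = n" using degree_hsub_drop[OF b] ss(2) f by auto
  show "degree (hsub n F p q) = n" by fact
  have "q \<noteq> 0" "hsub n F p q \<noteq> 0" using f0 f by auto
  thus "sep_split N (hsub n F p q)" using ss(1) sep_split_mult_iff[OF N] unfolding f by blast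
  obtain e where e: "degree p \<le> 1" "degree q \<le> 1" "pdet p q = [:e:]" "e \<noteq> 0" using b by (elim basisE)
  have "discdeg f = discdeg q + discdeg (hsub n F p q) + 2 * resdeg q (hsub n F p q)"
    unfolding f by (rule discdeg_mult[of N]) (use ss f d n in auto)
  thus "discdeg f = discdeg (hsub n F p q) + 2 * int (degree (coeff F n))"
    using discdeg_linear[OF d(1)] degree_resultant_basis(2)[OF e(1) d(1) e(3,4) refl d(2)] by simp
qed

text \<open>
  The root at infinity that \<open>F\<close> may have is the factor \<open>q\<close> of \<open>f\<close>; a constant leading coefficient of \<open>F\<close> means that it
  contributes nothing.
\<close>
lemma discdeg_hsub_general:
  fixes f p q :: "'a::{alg_closed_field, field_char_0} poly poly"
  assumes ss: "sep_split N f" "degree f = m" "m > 0" and b: "basis p q" and f: "f = hsub m F p q" "degree F \<le> m"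
    and c: "degree (lead_coeff F) = 0" and F: "degree F > 0"
  shows "sep_split N F \<and> discdeg f = discdeg F"
proof -
  obtain e where e: "degree p \<le> 1" "degree q \<le> 1" "pdet p q = [:e:]" "e \<noteq> 0" using b by (elim basisE)
  have "m = degree F \<or> m = Suc (degree F)" using hsub_degree_lower_bound[OF ss(1,2) b f(1)] f(2) by linarith
  thus ?thesis
  proof
    assume "m = degree F"
    thus ?thesis using discdeg_hsub[OF ss(1) e f(1) ss(2) _ ss(3)] sep_split_hsub[OF ss(1) e f(1) ss(2)] by simp
  next
    assume m: "m = Suc (degree F)"
    have fq: "f = q * hsub (degree F) F p q" using f(1) unfolding m by (simp add: hsub_Suc)
    note D = discdeg_drop[OF ss(1) ss(2)[unfolded m] F b fq]
    show ?thesis using discdeg_hsub[OF D(1) e refl D(2) refl F] sep_split_hsub[OF D(1) e refl D(2) refl] D(3) c by simp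
  qed
qed

lemma const_poly_inj_hom: "inj_comm_ring_hom (\<lambda>c :: 'r::comm_ring_1. [:c:])"
proof -
  interpret comm_ring_hom "\<lambda>c :: 'r. [:c:]" by (rule const_poly_hom)
  show ?thesis by unfold_locales simp
qed

lemma discdeg_const_form:
  fixes f :: "'a::{alg_closed_field, field_char_0} poly poly"
  assumes ss: "sep_split N f" "degree f = d" "d > 0" and f: "const_form d f"
  shows "discdeg f = 0"
proof -
  obtain p q h where b: "basis p q" and h: "degree h \<le> d" "f = hsub d (map_poly (\<lambda>c. [:c:]) h) p q"
    using f by (auto simp: const_form_def)
  show ?thesis
  proof (cases "degree h = 0")
    case True
    hence "d = 1" using hsub_degree_lower_bound[OF ss(1,2) b h(2)] ss(3) by simp
    thus ?thesis using discdeg_linear[of f] ss(2) by simp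
  next
    case False
    have "discdeg f = discdeg (map_poly (\<lambda>c. [:c:]) h)"
      using discdeg_hsub_general[OF ss b h(2)] h(1) False by simp
    also have "pderiv (map_poly (\<lambda>c. [:c:]) h) = map_poly (\<lambda>c. [:c:]) (pderiv h)"
      by (rule poly_eqI) (simp add: coeff_pderiv of_nat_poly)
    hence "discdeg (map_poly (\<lambda>c. [:c:]) h) = 0" by (simp add: discdeg_def inj_comm_ring_hom.resultant_hom[OF const_poly_inj_hom])
    finally show ?thesis .
  qed
qed

lemma discdeg_biquadratic_form:
  fixes f :: "'a::{alg_closed_field, field_char_0} poly poly"
  assumes ss: "sep_split N f" "degree f = 4" and f: "biquadratic_form f"
  shows "discdeg f = 2"
proof -
  obtain p q \<mu> \<nu> where b: "basis p q" and m: "\<mu> \<noteq> 0" and h: "f = hsub 4 [:0, 1, [:\<nu>, \<mu>:], 1:] p q"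
    using f by (auto simp: biquadratic_form_def)
  define g where "g = [:1, [:\<nu>, \<mu>:], 1:]"
  have F: "[:0, 1, [:\<nu>, \<mu>:], 1:] = pCons 0 g" unfolding g_def ..
  have Fm: "pCons 0 g = [:0, 1:] * g" by simp
  have S: "sep_split N ([:0, 1:] * g) \<and> discdeg f = discdeg ([:0, 1:] * g)"
    unfolding Fm[symmetric] F[symmetric] by (rule discdeg_hsub_general[OF ss _ b h]) simp_all
  have "discdeg ([:0, 1:] * g) = discdeg [:0, 1 :: 'a poly:] + discdeg g + 2 * resdeg [:0, 1:] g"
    by (rule discdeg_mult[OF S[THEN conjunct1]]) (simp_all add: g_def)
  moreover have "discdeg [:0, 1 :: 'a poly:] = 0" by (rule discdeg_linear) simp
  moreover have "resdeg [:0, 1:] g = 0"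
  proof -
    interpret e: inj_comm_ring_hom "emb (Suc 0) :: 'a poly \<Rightarrow> 'a fls" by (rule emb_inj_hom) simp
    have "emb (Suc 0) (resultant [:0, 1:] g) = emb (Suc 0) 1"
      using emb_resultant_linear[of "Suc 0" 1 0 g] by (simp add: g_def lpoly_pCons)
    hence "resultant [:0, 1:] g = 1" by (simp only: e.eq_iff)
    thus ?thesis by (simp add: resdeg_def)
  qed
  moreover have "discdeg g = 2"
  proof -
    have "[:\<nu>, \<mu>:]\<^sup>2 - 4 * 1 * 1 = [:\<nu>\<^sup>2 - 4, 2 * \<nu> * \<mu>, \<mu>\<^sup>2:]" by (simp add: power2_eq_square numeral_poly)
    thus ?thesis unfolding g_def using m by (subst discdeg_quadratic) auto
  qed
  ultimately have "discdeg ([:0, 1:] * g) = 2" by linarith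
  thus ?thesis using S by metis
qed

lemma discdeg_cubic_form:
  fixes f :: "'a::{alg_closed_field, field_char_0} poly poly"
  assumes ss: "sep_split N f" "degree f = 4" and f: "cubic_form f"
  shows "discdeg f = 2"
proof -
  obtain p q h where b: "basis p q" and h: "degree h \<le> 3" "f = q * hsub 3 (map_poly (\<lambda>c. [:c:]) h + [:[:0, 1:]:]) p q"
    using f by (auto simp: cubic_form_def)
  define F where "F = map_poly (\<lambda>c. [:c:]) h + [:[:0, 1:]:]"
  have d3: "degree F \<le> 3" unfolding F_def using h(1) by (intro degree_add_le) auto
  have "f = hsub 4 F p q" using h(2) hsub_Suc[OF d3, of p q] by (simp add: F_def)
  hence "4 \<le> Suc (degree F)" using hsub_degree_lower_bound[OF ss b] by blast
  hence dF: "degree F = 3" using d3 by simp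
  define A where "A = coeff h 3"
  have c3: "coeff F 3 = [:A:]" by (simp add: F_def A_def coeff_pCons split: nat.split)
  have A: "A \<noteq> 0" using dF c3 by (metis degree_0 leading_coeff_0_iff pCons_0_0 zero_neq_numeral)
  have Fe: "F = [:[:coeff h 0, 1:], [:coeff h 1:], [:coeff h 2:], [:A:]:]"
    by (subst coeffs_le_3[OF d3]) (simp add: F_def A_def coeff_pCons split: nat.split)
  note D = discdeg_drop[OF ss(1) _ _ b h(2)[folded F_def]]
  define t where "t = [:coeff h 2 / (3 * A):]"
  define u where "u = [:(coeff h 1 - 3 * A * (coeff h 2 / (3 * A))\<^sup>2) / A:]"
  define v where "v = smult (1 / A) ([:coeff h 0, 1:] - [:A:] * u * t - [:A:] * t ^ 3)"
  have u: "u = smult (1 / A) ([:coeff h 1:] - 3 * [:A:] * t\<^sup>2)" by (simp add: u_def t_def poly_const_pow numeral_poly)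
  have t: "t = smult (1 / (3 * A)) [:coeff h 2:]" by (simp add: t_def)
  have eq: "hsub 3 F p q = hsub 3 [:[:A:] * v, [:A:] * u, 0, [:A:]:] (p + [:t:] * q) q"
    unfolding Fe v_def u t by (rule depressed_cubic_coordinates[OF A])
  have "discdeg (hsub 3 F p q) = int (degree (4 * u ^ 3 + 27 * v\<^sup>2))"
    by (rule discdeg_depressed_coordinates[OF D(1,2) basis_shear[OF b] A eq]) (use ss in simp_all)
  moreover have "degree (4 * u ^ 3 + 27 * v\<^sup>2) = 2"
  proof -
    obtain w where v': "v = [:w, 1 / A:]" by (simp add: v_def u_def t_def poly_const_pow)
    obtain z where "4 * u ^ 3 = [:z:]" by (simp add: u_def poly_const_pow numeral_poly)
    moreover have "27 * v\<^sup>2 = [:27 * w\<^sup>2, 54 * w / A, 27 / A\<^sup>2:]" unfolding v' by (simp add: power2_eq_square numeral_poly)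
    ultimately show ?thesis using A by simp
  qed
  ultimately show ?thesis using D(3) ss c3 by simp
qed

lemma lpoly_pcompose:
  assumes N: "N > 0"
  shows "lpoly N (pcompose G g) (r :: 'a::field fls) = poly (map_poly (emb N) G) (lpoly N g r)"
proof (induction G)
  case 0 thus ?case by simp
next
  case (pCons a G)
  interpret e: inj_comm_ring_hom "emb N :: 'a poly \<Rightarrow> 'a fls" by (rule emb_inj_hom[OF N])
  show ?case using pCons.IH by (simp add: pcompose_pCons lpoly_add[OF N] lpoly_mult[OF N] lpoly_pCons[OF N])
qed

lemma const_poly_split:
  fixes h :: "'a::{alg_closed_field, field_char_0} poly"
  assumes "h \<noteq> 0"
  obtains xs where "h = smult (lead_coeff h) (\<Prod>x\<leftarrow>xs. [:- x, 1:])"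
proof -
  obtain A where "h = smult (lead_coeff h) (\<Prod>x\<in>#A. [:- x, 1:])" using alg_closed_imp_factorization[OF assms] by blast
  moreover obtain xs where "A = mset xs" by (metis ex_mset)
  ultimately have "h = smult (lead_coeff h) (\<Prod>x\<leftarrow>xs. [:- x, 1:])" by (metis mset_map prod_mset_prod_list)
  thus ?thesis by (rule that)
qed

lemma emb_cmap: "map_poly (emb N) (map_poly (\<lambda>c. [:c:]) k) = map_poly fls_const (k :: 'a::field poly)"
  by (rule poly_eqI) (simp add: coeff_map_poly)

text \<open>
  A polynomial with coefficients in the algebraically closed field \<open>K\<close> already splits over \<open>K\<close>.
\<close>
lemma root_of_const_poly:
  fixes h :: "'a::{alg_closed_field, field_char_0} poly"
  assumes "h \<noteq> 0" "poly (map_poly fls_const h) s = 0"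
  shows "\<exists>a. s = fls_const a"
proof -
  interpret c: inj_comm_ring_hom "fls_const :: 'a \<Rightarrow> 'a fls" by standard (simp_all add: fls_plus_const fls_const_mult_const)
  interpret m: map_poly_inj_comm_ring_hom "fls_const :: 'a \<Rightarrow> 'a fls" ..
  obtain xs where h: "h = smult (lead_coeff h) (\<Prod>x\<leftarrow>xs. [:- x, 1:])" by (rule const_poly_split[OF assms(1)])
  have "poly (map_poly fls_const (\<Prod>x\<leftarrow>xs. [:- x, 1:])) s = (\<Prod>x\<leftarrow>xs. s - fls_const x)"
  proof (induction xs)
    case (Cons x xs)
    have "map_poly fls_const [:- x, 1:] = [:- fls_const x, 1:]" by simp
    thus ?case using Cons by (simp only: list.map prod_list.Cons m.hom_mult poly_mult) simp
  qed simp
  moreover have "map_poly fls_const h = smult (fls_const (lead_coeff h)) (map_poly fls_const (\<Prod>x\<leftarrow>xs. [:- x, 1:]))"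
  proof -
    have gen: "map_poly fls_const (smult a X) = smult (fls_const a) (map_poly fls_const X)" for a :: 'a and X
      by (rule poly_eqI) (simp add: coeff_map_poly)
    show ?thesis by (rule trans[OF arg_cong[OF h, of "map_poly fls_const"] gen])
  qed
  ultimately have "(\<Prod>x\<leftarrow>xs. s - fls_const x) = 0" using assms by simp
  hence "\<exists>x\<in>set xs. s = fls_const x" by (induction xs) auto
  thus ?thesis by blast
qed

text \<open>
  At a root \<open>r\<close> of \<open>h(y\<^sup>2 + x)\<close> the value \<open>r\<^sup>2 + x\<close> is a constant, namely a root of \<open>h\<close>.
\<close>
lemma resultant_parabola_const:
  fixes h k :: "'a::{alg_closed_field, field_char_0} poly"
  assumes ss: "sep_split N (pcompose (map_poly (\<lambda>c. [:c:]) h) parabola)"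
  shows "degree (resultant (pcompose (map_poly (\<lambda>c. [:c:]) h) parabola) (pcompose (map_poly (\<lambda>c. [:c:]) k) parabola)) = 0"
proof -
  let ?F = "pcompose (map_poly (\<lambda>c. [:c:]) h) parabola" and ?K = "pcompose (map_poly (\<lambda>c. [:c:]) k) parabola"
  have N: "N > 0" and F0: "?F \<noteq> 0" using ss by (auto simp: sep_split_def)
  interpret e: inj_comm_ring_hom "emb N :: 'a poly \<Rightarrow> 'a fls" by (rule emb_inj_hom[OF N])
  interpret c: inj_comm_ring_hom "fls_const :: 'a \<Rightarrow> 'a fls" by standard (simp_all add: fls_plus_const fls_const_mult_const)
  have h0: "h \<noteq> 0" using F0 by auto
  have "\<exists>a. lpoly N ?K r = fls_const a" if "r \<in> lroots N ?F" for r
  proof -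
    have "poly (map_poly fls_const h) (lpoly N parabola r) = 0"
      using that by (simp add: lroots_def lpoly_pcompose[OF N] emb_cmap)
    then obtain a where a: "lpoly N parabola r = fls_const a" using root_of_const_poly[OF h0] by blast
    have "lpoly N ?K r = fls_const (poly k a)" unfolding lpoly_pcompose[OF N] a emb_cmap by simp
    thus ?thesis by blast
  qed
  then obtain a where a: "\<And>r. r \<in> lroots N ?F \<Longrightarrow> lpoly N ?K r = fls_const (a r)" by metis
  have "\<exists>b. lead_coeff ?F = [:b:]"
    by (subst lead_coeff_comp) (auto simp: poly_const_pow)
  then obtain b where b: "lead_coeff ?F = [:b:]" by blast
  have "emb N (resultant ?F ?K) = fls_const b ^ degree ?K * (\<Prod>r\<in>lroots N ?F. fls_const (a r))"
    unfolding emb_resultant[OF N ss] b using a by (simp only: emb_const cong: prod.cong)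
  also have "\<dots> = emb N [:b ^ degree ?K * (\<Prod>r\<in>lroots N ?F. a r):]"
    by (simp only: emb_const c.hom_mult c.hom_power c.hom_prod)
  finally have "resultant ?F ?K = [:b ^ degree ?K * (\<Prod>r\<in>lroots N ?F. a r):]" by (simp only: e.eq_iff)
  thus ?thesis by simp
qed

text \<open>
  The derivative of \<open>h(y\<^sup>2 + x)\<close> is \<open>2 y h'(y\<^sup>2 + x)\<close>.  The second factor contributes a constant to the
  resultant, and the first one contributes \<open>h(x)\<close>.
\<close>
lemma discdeg_parabola:
  fixes h :: "'a::{alg_closed_field, field_char_0} poly"
  assumes ss: "sep_split N (pcompose (map_poly (\<lambda>c. [:c:]) h) parabola)" and h: "degree h > 0"
  shows "discdeg (pcompose (map_poly (\<lambda>c. [:c:]) h) parabola) = int (degree h)"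
proof -
  let ?F = "pcompose (map_poly (\<lambda>c. [:c:]) h) parabola" and ?K = "pcompose (map_poly (\<lambda>c. [:c:]) (pderiv h)) parabola"
  have N: "N > 0" and F0: "?F \<noteq> 0" using ss by (auto simp: sep_split_def)
  interpret e: inj_comm_ring_hom "emb N :: 'a poly \<Rightarrow> 'a fls" by (rule emb_inj_hom[OF N])
  have dF: "degree ?F = 2 * degree h" by (simp add: degree_pcompose)
  have "pderiv (map_poly (\<lambda>c. [:c:]) h) = map_poly (\<lambda>c. [:c:]) (pderiv h)"
    by (rule poly_eqI) (simp add: coeff_pderiv of_nat_poly)
  moreover have "pderiv (parabola :: 'a poly poly) = [:0, 2:]"
    by (rule poly_eqI) (auto simp: coeff_pderiv coeff_pCons numeral_eq_Suc split: nat.split)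
  ultimately have d: "pderiv ?F = ?K * [:0, 2:]" by (simp add: pderiv_pcompose)
  have "pderiv ?F \<noteq> 0" using dF h by (simp add: pderiv_eq_0_iff)
  hence K0: "?K \<noteq> 0" using d by auto
  have R: "resultant ?F (pderiv ?F) = resultant ?F ?K * resultant ?F [:0, 2:]"
    unfolding d by (rule resultant_mult_right[OF N ss K0]) simp
  have "emb N (resultant [:0, 2:] ?F) = emb N (2 ^ degree ?F * coeff ?F 0)"
    using emb_resultant_linear[OF N, of 2 0 ?F] by (simp add: e.hom_mult e.hom_power e.hom_numeral poly_0_coeff_0)
  hence r2: "resultant [:0, 2:] ?F = 2 ^ degree ?F * coeff ?F 0" by (simp only: e.eq_iff)
  have "coeff ?F 0 = poly (map_poly (\<lambda>c. [:c:]) h) [:0, 1:]"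
    by (simp add: poly_0_coeff_0[symmetric] poly_pcompose)
  also have "\<dots> = h" by (induction h) (simp_all add: map_poly_pCons)
  finally have c0: "coeff ?F 0 = h" .
  have "degree (resultant ?F [:0, 2:]) = degree (resultant [:0, 2:] ?F)" by (rule degree_resultant_sym)
  also have "\<dots> = degree h" unfolding r2 c0 using h by (subst degree_mult_eq) (auto simp: degree_power_eq numeral_poly poly_const_pow)
  finally have "degree (resultant ?F [:0, 2:]) = degree h" .
  moreover have "resultant ?F (pderiv ?F) \<noteq> 0" by (rule resultant_pderiv_nonzero[OF ss])
  ultimately have "degree (resultant ?F (pderiv ?F)) = degree h"
    using resultant_parabola_const[OF ss, of "pderiv h"] unfolding R by (simp add: degree_mult_eq)
  moreover have "degree (lead_coeff ?F) = 0"
    by (subst lead_coeff_comp) (auto simp: poly_const_pow)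
  ultimately show ?thesis by (simp add: discdeg_def)
qed

lemma discdeg_parabolic_form:
  fixes f :: "'a::{alg_closed_field, field_char_0} poly poly"
  assumes ss: "sep_split N f" "degree f = 2 * n + r" "n > 0" "r \<le> 1" and f: "parabolic_form r n f"
  shows "discdeg f = int n"
proof -
  obtain p q h where b: "basis p q" and h: "degree h \<le> n"
    "f = q ^ r * hsub (2 * n) (pcompose (map_poly (\<lambda>c. [:c:]) h) parabola) p q"
    using f by (auto simp: parabolic_form_def)
  let ?F = "pcompose (map_poly (\<lambda>c. [:c:]) h) parabola"
  have dF: "degree ?F = 2 * degree h" by (simp add: degree_pcompose)
  have dF': "degree ?F \<le> 2 * n" using dF h by simp
  have fF: "f = hsub (2 * n + r) ?F p q"
    using h(2) hsub_Suc[OF dF', of p q] ss(4) by (cases r) auto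
  have "2 * n + r \<le> Suc (2 * degree h)" using hsub_degree_lower_bound[OF ss(1,2) b fF] dF by simp
  hence dh: "degree h = n" using h(1) by simp
  have l: "degree (lead_coeff ?F) = 0" by (subst lead_coeff_comp) (auto simp: poly_const_pow)
  have "sep_split N ?F \<and> discdeg f = discdeg ?F"
    by (rule discdeg_hsub_general[OF ss(1,2) _ b fF _ l]) (use dF dh ss(3) in auto)
  thus ?thesis using discdeg_parabola[of N h] dh ss(3) by simp
qed

section \<open>The action on binary forms\<close>

lemma Const_hom: "comm_ring_hom (Const :: 'r::comm_ring_1 \<Rightarrow> 'r binary_poly)"
  by standard (simp_all add: Const_def)

lemma homogenize_gsub: "homogenize f = gsub Const (degree f) f Y0 Y1"
  by (simp add: homogenize_def gsub_def)

lemma Const_mult_monomial: "Const c * Y0 ^ k * Y1 ^ n = monom (monom c n) k"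
proof -
  have "Y0 ^ k = (monom 1 k :: 'a poly poly)" by (simp add: Y0_def monom_altdef)
  moreover have "Y1 ^ n = ([:monom 1 n:] :: 'a poly poly)" unfolding Y1_def poly_const_pow by (simp add: monom_altdef)
  ultimately show ?thesis by (simp add: Const_def smult_monom mult_monom)
qed

lemma coeff_gsub_Const: "coeff (coeff (gsub Const m g Y0 Y1) i) j = (if i + j = m then coeff g i else 0)"
proof -
  have "coeff (coeff (gsub Const m g Y0 Y1) i) j = (\<Sum>k\<le>m. coeff (coeff (monom (monom (coeff g k) (m - k)) k) i) j)"
    by (simp only: gsub_def Const_mult_monomial coeff_sum)
  also have "\<dots> = (\<Sum>k\<le>m. if k = i then (if i + j = m then coeff g i else 0) else 0)"
    by (rule sum.cong[OF refl]) auto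
  also have "\<dots> = (if i + j = m then coeff g i else 0)" by simp
  finally show ?thesis .
qed

text \<open>
  Forms of degree \<open>n\<close> correspond to polynomials of degree at most \<open>n\<close> in one variable.
\<close>
lemma homogeneous_iff: "homogeneous n H \<longleftrightarrow> (\<exists>h. degree h \<le> n \<and> H = gsub Const n h Y0 Y1)"
proof
  assume H: "homogeneous n H"
  define h where "h = (\<Sum>k\<le>n. monom (coeff (coeff H k) (n - k)) k)"
  have c: "coeff h i = (if i \<le> n then coeff (coeff H i) (n - i) else 0)" for i
    by (simp add: h_def coeff_sum)
  have "coeff (coeff H i) j = coeff (coeff (gsub Const n h Y0 Y1) i) j" for i j
  proof (cases "i + j = n")
    case True
    hence "i \<le> n" "n - i = j" by auto
    thus ?thesis using True by (simp add: coeff_gsub_Const c)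
  next
    case False
    hence "coeff (coeff H i) j = 0" using H unfolding homogeneous_def by blast
    thus ?thesis using False by (simp add: coeff_gsub_Const)
  qed
  hence "H = gsub Const n h Y0 Y1" by (simp add: poly_eq_iff)
  moreover have "degree h \<le> n" by (rule degree_le) (simp add: c)
  ultimately show "\<exists>h. degree h \<le> n \<and> H = gsub Const n h Y0 Y1" by blast
next
  assume "\<exists>h. degree h \<le> n \<and> H = gsub Const n h Y0 Y1"
  thus "homogeneous n H" by (auto simp: homogeneous_def coeff_gsub_Const split: if_splits)
qed

lemma lift_form_gsub: "lift_form (gsub Const n h Y0 Y1) = gsub Const n (map_poly (\<lambda>c. [:c:]) h) Y0 Y1"
proof -
  have "coeff (coeff (lift_form (gsub Const n h Y0 Y1)) i) j = coeff (coeff (gsub Const n (map_poly (\<lambda>c. [:c:]) h) Y0 Y1) i) j" for i j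
    by (simp add: lift_form_def coeff_map_poly coeff_gsub_Const)
  thus ?thesis by (simp add: poly_eq_iff)
qed

lemma subst2_gsub:
  fixes F :: "'r::comm_ring_1 poly"
  shows "subst2 (gsub Const m F Y0 Y1) P Q = gsub Const m F P Q"
proof -
  interpret C: comm_ring_hom "Const :: 'r \<Rightarrow> 'r binary_poly" by (rule Const_hom)
  let ?G = "gsub Const m F Y0 Y1"
  have d: "degree ?G \<le> m"
    by (rule degree_le) (auto simp: poly_eq_iff coeff_gsub_Const)
  have "subst2 ?G P Q = (\<Sum>i\<le>degree ?G. Const (coeff F i) * P ^ i * Q ^ (m - i))"
    unfolding subst2_def
  proof (rule sum.cong[OF refl])
    fix i assume i: "i \<in> {..degree ?G}"
    have ci: "coeff ?G i = monom (coeff F i) (m - i)"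
      using i d by (auto simp: poly_eq_iff coeff_gsub_Const)
    show "(\<Sum>j\<le>degree (coeff ?G i). Const (coeff (coeff ?G i) j) * P ^ i * Q ^ j) = Const (coeff F i) * P ^ i * Q ^ (m - i)"
    proof (cases "coeff F i = 0")
      case True thus ?thesis unfolding ci by simp
    next
      case False
      have "(\<Sum>j\<le>m - i. Const (coeff (monom (coeff F i) (m - i)) j) * P ^ i * Q ^ j) =
        (\<Sum>j\<le>m - i. if j = m - i then Const (coeff F i) * P ^ i * Q ^ (m - i) else 0)"
        by (intro sum.cong) auto
      thus ?thesis unfolding ci using False by (simp add: degree_monom_eq)
    qed
  qed
  also have "\<dots> = (\<Sum>i\<le>m. Const (coeff F i) * P ^ i * Q ^ (m - i))"
  proof (rule sum.mono_neutral_left)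
    show "\<forall>i\<in>{..m} - {..degree ?G}. Const (coeff F i) * P ^ i * Q ^ (m - i) = 0"
    proof
      fix i assume i: "i \<in> {..m} - {..degree ?G}"
      hence "coeff ?G i = 0" by (intro coeff_eq_0) auto
      hence "coeff (coeff ?G i) (m - i) = 0" by simp
      hence "coeff F i = 0" using i by (simp add: coeff_gsub_Const split: if_splits)
      thus "Const (coeff F i) * P ^ i * Q ^ (m - i) = 0" by simp
    qed
  qed (use d in auto)
  finally show ?thesis by (simp add: gsub_def)
qed

lemma mult_mat_2x2:
  fixes A B :: "'r::comm_ring_1 mat"
  assumes "A \<in> carrier_mat 2 2" "B \<in> carrier_mat 2 2" "i < 2" "j < 2"
  shows "(A * B) $$ (i, j) = A $$ (i, 0) * B $$ (0, j) + A $$ (i, 1) * B $$ (1, j)"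
proof -
  have "(A * B) $$ (i, j) = (\<Sum>k\<in>{0..<2}. A $$ (i, k) * B $$ (k, j))"
    using assms by (simp add: scalar_prod_def)
  thus ?thesis by (simp add: numeral_2_eq_2)
qed

lemma GL2_det:
  fixes A :: "'a::field poly mat"
  assumes "A \<in> GL2"
  shows "\<exists>e. e \<noteq> 0 \<and> A $$ (0, 0) * A $$ (1, 1) - A $$ (0, 1) * A $$ (1, 0) = [:e:]"
proof -
  have A: "A \<in> carrier_mat 2 2" and "invertible_mat A" using assms by (auto simp: GL2_def)
  then obtain B where AB: "A * B = 1\<^sub>m 2" "B * A = 1\<^sub>m (dim_row B)"
    by (auto simp: invertible_mat_def inverts_mat_def)
  have "dim_col B = 2" using arg_cong[OF AB(1), of dim_col] by simp
  moreover have "dim_row B = 2" using arg_cong[OF AB(2), of dim_col] A by simp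
  ultimately have B: "B \<in> carrier_mat 2 2" by auto
  define a b c d where "a = A $$ (0, 0)" "b = A $$ (0, 1)" "c = A $$ (1, 0)" "d = A $$ (1, 1)"
  define a' b' c' d' where "a' = B $$ (0, 0)" "b' = B $$ (0, 1)" "c' = B $$ (1, 0)" "d' = B $$ (1, 1)"
  note m = mult_mat_2x2[OF A B, folded a_b_c_d_def a'_b'_c'_d'_def, unfolded AB(1)]
  have e: "a * a' + b * c' = 1" "a * b' + b * d' = 0" "c * a' + d * c' = 0" "c * b' + d * d' = 1"
    using m[of 0 0] m[of 0 1] m[of 1 0] m[of 1 1] by (simp_all add: a_b_c_d_def a'_b'_c'_d'_def)
  have "(a * d - b * c) * (a' * d' - b' * c') = (a * a' + b * c') * (c * b' + d * d') - (a * b' + b * d') * (c * a' + d * c')"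
    by (simp add: algebra_simps)
  hence "(a * d - b * c) * (a' * d' - b' * c') = 1" unfolding e by simp
  hence "a * d - b * c dvd 1" by (metis dvd_triv_left)
  hence "a * d - b * c \<noteq> 0" "degree (a * d - b * c) = 0" by (auto simp: is_unit_iff_degree)
  thus ?thesis unfolding a_b_c_d_def[symmetric] by (metis degree_eq_zeroE pCons_0_0)
qed

lemma eq_mat_2x2:
  assumes "A \<in> carrier_mat 2 2" "B \<in> carrier_mat 2 2" "A $$ (0, 0) = B $$ (0, 0)" "A $$ (0, 1) = B $$ (0, 1)"
    "A $$ (1, 0) = B $$ (1, 0)" "A $$ (1, 1) = B $$ (1, 1)"
  shows "A = B"
proof (rule eq_matI)
  fix i j assume "i < dim_row B" "j < dim_col B"
  hence "(i = 0 \<or> i = 1) \<and> (j = 0 \<or> j = 1)" using assms(2) by auto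
  thus "A $$ (i, j) = B $$ (i, j)" using assms by auto
qed (use assms in auto)

lemma mat_2x2_exists:
  "\<exists>A \<in> carrier_mat 2 2. A $$ (0, 0) = a \<and> A $$ (0, 1) = b \<and> A $$ (1, 0) = c \<and> A $$ (1, 1) = d"
  by (rule bexI[of _ "mat 2 2 (\<lambda>(i, j). if i = 0 then (if j = 0 then a else b) else (if j = 0 then c else d))"]) simp_all

lemma GL2_exists:
  fixes a b c d :: "'a::field poly"
  assumes "a * d - b * c = [:e:]" "e \<noteq> 0"
  shows "\<exists>A\<in>GL2. A $$ (0, 0) = a \<and> A $$ (0, 1) = b \<and> A $$ (1, 0) = c \<and> A $$ (1, 1) = d"
proof -
  \<comment> \<open>the inverse is the adjugate matrix divided by the constant determinant\<close>
  define k where "k = [:1 / e:]"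
  have k: "k * (a * d - b * c) = 1" using assms by (simp add: k_def one_pCons[symmetric])
  obtain A where A: "A \<in> carrier_mat 2 2" "A $$ (0, 0) = a" "A $$ (0, 1) = b" "A $$ (1, 0) = c" "A $$ (1, 1) = d"
    using mat_2x2_exists by metis
  obtain B where B: "B \<in> carrier_mat 2 2" "B $$ (0, 0) = k * d" "B $$ (0, 1) = - k * b" "B $$ (1, 0) = - k * c" "B $$ (1, 1) = k * a"
    using mat_2x2_exists by metis
  have "a * (k * d) + b * (- k * c) = 1" "c * (- k * b) + d * (k * a) = 1" "a * (- k * b) + b * (k * a) = 0" "c * (k * d) + d * (- k * c) = 0"
    "k * d * a + - k * b * c = 1" "- k * c * b + k * a * d = 1" "k * d * b + - k * b * d = 0" "- k * c * a + k * a * c = 0"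
    using k by (simp_all add: algebra_simps)
  note e = this
  have "A * B = 1\<^sub>m 2" by (rule eq_mat_2x2) (simp_all only: mult_carrier_mat[OF A(1) B(1)] mult_mat_2x2[OF A(1) B(1)] A B e, simp_all)
  moreover have "B * A = 1\<^sub>m 2" by (rule eq_mat_2x2) (simp_all only: mult_carrier_mat[OF B(1) A(1)] mult_mat_2x2[OF B(1) A(1)] A B e, simp_all)
  ultimately have "invertible_mat A" using A(1) B(1) unfolding invertible_mat_def inverts_mat_def by (intro conjI exI[of _ B]) auto
  hence "A \<in> GL2" using A by (simp add: GL2_def)
  thus ?thesis using A by blast
qed

text \<open>
  Acting with a matrix on a form evaluates it at the linear forms given by the rows; dehomogenising gives \<open>hsub\<close>.
  The degree condition says that the homogenisation of \<open>f\<close> has the degree of the form.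
\<close>
lemma GL2_equiv_homogenize_iff:
  fixes f F :: "'a::field poly poly"
  assumes f: "f \<noteq> 0"
  shows "GL2_equiv (homogenize f) (gsub Const m F Y0 Y1) \<longleftrightarrow> (\<exists>p q. basis p q \<and> f = hsub m F p q \<and> degree f = m)"
proof -
  interpret C: comm_ring_hom "Const :: 'a poly \<Rightarrow> 'a poly binary_poly" by (rule Const_hom)
  have act: "GL2_act A (gsub Const m F Y0 Y1) = gsub Const m (hsub m F [:A $$ (0, 1), A $$ (0, 0):] [:A $$ (1, 1), A $$ (1, 0):]) Y0 Y1" for A
    unfolding GL2_act_def subst2_gsub by (subst C.gsub_hsub) (simp_all only: C.gsub_linear, simp_all)
  show ?thesis
  proof
    assume "GL2_equiv (homogenize f) (gsub Const m F Y0 Y1)"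
    then obtain A where A: "A \<in> GL2" "homogenize f = GL2_act A (gsub Const m F Y0 Y1)" by (auto simp: GL2_equiv_def)
    define p q where "p = [:A $$ (0, 1), A $$ (0, 0):]" "q = [:A $$ (1, 1), A $$ (1, 0):]"
    define g where "g = hsub m F p q"
    have dpq: "degree p \<le> 1" "degree q \<le> 1" by (simp_all add: p_q_def)
    have dg: "degree g \<le> m" unfolding g_def by (rule degree_hsub_le[OF dpq])
    have "gsub Const (degree f) f Y0 Y1 = gsub Const m g Y0 Y1"
      using A(2) by (simp only: homogenize_gsub act g_def p_q_def)
    hence eq: "(if i + j = degree f then coeff f i else 0) = (if i + j = m then coeff g i else 0)" for i j
      using coeff_gsub_Const[of "degree f" f i j] coeff_gsub_Const[of m g i j] by simp
    have dm: "degree f = m" using eq[of "degree f" 0] f by (simp split: if_splits)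
    have "coeff f i = coeff g i" for i
    proof (cases "i \<le> m")
      case True thus ?thesis using eq[of i "m - i"] dm by simp
    next
      case False thus ?thesis using dm dg by (simp add: coeff_eq_0)
    qed
    hence "f = g" by (simp add: poly_eq_iff)
    moreover have "basis p q" using GL2_det[OF A(1)] dpq by (simp add: basis_def pdet_def p_q_def)
    ultimately show "\<exists>p q. basis p q \<and> f = hsub m F p q \<and> degree f = m" using dm g_def by blast
  next
    assume "\<exists>p q. basis p q \<and> f = hsub m F p q \<and> degree f = m"
    then obtain p q where pq: "basis p q" "f = hsub m F p q" "degree f = m" by blast
    obtain e where e: "degree p \<le> 1" "degree q \<le> 1" "pdet p q = [:e:]" "e \<noteq> 0" using pq(1) by (elim basisE)
    obtain A where A: "A \<in> GL2" "A $$ (0, 0) = coeff p 1" "A $$ (0, 1) = coeff p 0" "A $$ (1, 0) = coeff q 1" "A $$ (1, 1) = coeff q 0"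
      using GL2_exists[OF e(3)[unfolded pdet_def] e(4)] by blast
    have "GL2_act A (gsub Const m F Y0 Y1) = gsub Const m (hsub m F p q) Y0 Y1"
      unfolding act A deg1_form[OF e(1), symmetric] deg1_form[OF e(2), symmetric] ..
    also have "\<dots> = homogenize f" unfolding homogenize_gsub using pq by simp
    finally show "GL2_equiv (homogenize f) (gsub Const m F Y0 Y1)" unfolding GL2_equiv_def using A(1) by metis
  qed
qed

text \<open>
  The homogeneous version of composing with a quadratic polynomial; the constant \<open>1\<close> becomes \<open>Q\<^sup>2\<close>.
\<close>
lemma (in comm_ring_hom) gsub_pcompose:
  assumes "degree G \<le> n" "degree g \<le> 2"
  shows "gsub hom (2 * n) (pcompose G g) P Q = gsub hom n G (gsub hom 2 g P Q) (Q\<^sup>2)"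
  using assms(1)
proof (induction G arbitrary: n)
  case 0 thus ?case by (simp add: gsub_0)
next
  case (pCons a G)
  have c: "gsub hom (2 * n) [:a:] P Q = hom a * (Q\<^sup>2) ^ n"
    unfolding power_mult[symmetric] using gsub_add_exp[of "[:a:]" 0 "2 * n" P Q] by (simp add: gsub_0_exp mult.commute)
  show ?case
  proof (cases n)
    case 0
    hence "G = 0" using pCons.prems by (auto split: if_splits)
    thus ?thesis by (simp add: 0 gsub_0_exp pcompose_pCons)
  next
    case (Suc m)
    hence G: "degree G \<le> m" using pCons.prems by (cases "G = 0") auto
    have "degree (pcompose G g) \<le> 2 * m"
      using degree_pcompose_le[of G g] mult_mono[OF G assms(2)] by (simp add: mult.commute)
    hence "gsub hom (2 + 2 * m) (g * pcompose G g) P Q = gsub hom 2 g P Q * gsub hom (2 * m) (pcompose G g) P Q"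
      by (rule gsub_mult[OF assms(2)])
    thus ?thesis using c pCons.IH[OF G] by (simp add: Suc pcompose_pCons gsub_add gsub_pCons)
  qed
qed

lemma ex_homogeneous_iff:
  assumes "\<And>h. degree h \<le> n \<Longrightarrow> T (gsub Const n h Y0 Y1) = T' h"
  shows "(\<exists>H. homogeneous n H \<and> P (T H)) \<longleftrightarrow> (\<exists>h. degree h \<le> n \<and> P (T' h))"
  unfolding homogeneous_iff using assms by (metis (no_types, lifting))

lemma ex_form_iff:
  assumes "\<And>n h. degree h \<le> n \<Longrightarrow> T (gsub Const n h Y0 Y1) = T' n h"
  shows "(\<exists>H. is_form H \<and> P (T H)) \<longleftrightarrow> (\<exists>n h. degree h \<le> n \<and> P (T' n h))"
  unfolding is_form_def homogeneous_iff using assms by (metis (no_types, lifting))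

lemma const_form_iff:
  fixes f :: "'a::field poly poly"
  assumes f: "f \<noteq> 0"
  shows "(\<exists>H :: 'a binary_poly. is_form H \<and> GL2_equiv (homogenize f) (lift_form H)) \<longleftrightarrow> const_form (degree f) f"
proof
  assume "\<exists>H :: 'a binary_poly. is_form H \<and> GL2_equiv (homogenize f) (lift_form H)"
  then obtain n and h :: "'a poly" where "degree h \<le> n" "GL2_equiv (homogenize f) (gsub Const n (map_poly (\<lambda>c. [:c:]) h) Y0 Y1)"
    by (auto simp: is_form_def homogeneous_iff lift_form_gsub)
  then obtain p q where "basis p q" "f = hsub n (map_poly (\<lambda>c. [:c:]) h) p q" "degree f = n"
    unfolding GL2_equiv_homogenize_iff[OF f] by blast
  thus "const_form (degree f) f" unfolding const_form_def using \<open>degree h \<le> n\<close> by (intro exI[of _ p] exI[of _ q] exI[of _ h]) simp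
next
  assume "const_form (degree f) f"
  then obtain p q h where "basis p q" "degree h \<le> degree f" "f = hsub (degree f) (map_poly (\<lambda>c. [:c:]) h) p q"
    by (auto simp: const_form_def)
  hence "GL2_equiv (homogenize f) (gsub Const (degree f) (map_poly (\<lambda>c. [:c:]) h) Y0 Y1)"
    unfolding GL2_equiv_homogenize_iff[OF f] by blast
  moreover have "is_form (gsub Const (degree f) h Y0 Y1)"
    using \<open>degree h \<le> degree f\<close> unfolding is_form_def homogeneous_iff by blast
  ultimately show "\<exists>H :: 'a binary_poly. is_form H \<and> GL2_equiv (homogenize f) (lift_form H)"
    by (metis lift_form_gsub)
qed

lemma biquadratic_form_iff:
  fixes f :: "'a::field poly poly"
  assumes f: "f \<noteq> 0"
  shows "(\<exists>\<mu> \<nu> :: 'a. \<mu> \<noteq> 0 \<and> GL2_equiv (homogenize f)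
        (Y0 * Y1 * (Y0\<^sup>2 + (Const [:\<mu>:] * Const [:0, 1:] + Const [:\<nu>:]) * Y0 * Y1 + Y1\<^sup>2))) \<longleftrightarrow>
    degree f = 4 \<and> biquadratic_form f"
proof -
  interpret C: comm_ring_hom "Const :: 'a poly \<Rightarrow> 'a poly binary_poly" by (rule Const_hom)
  have "Y0 * Y1 * (Y0\<^sup>2 + (Const [:\<mu>:] * Const [:0, 1:] + Const [:\<nu>:]) * Y0 * Y1 + Y1\<^sup>2) = gsub Const 4 [:0, 1, [:\<nu>, \<mu>:], 1:] Y0 Y1" for \<mu> \<nu> :: 'a
  proof -
    have "Const [:\<mu>:] * Const [:0, 1:] + Const [:\<nu>:] = Const [:\<nu>, \<mu>:]"
      by (simp only: C.hom_mult[symmetric] C.hom_add[symmetric]) simp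
    thus ?thesis by (simp add: gsub_def numeral_eq_Suc algebra_simps)
  qed
  thus ?thesis unfolding biquadratic_form_def by (simp only: GL2_equiv_homogenize_iff[OF f]) blast
qed

lemma cubic_form_iff:
  fixes f :: "'a::field poly poly"
  assumes f: "f \<noteq> 0"
  shows "(\<exists>H :: 'a binary_poly. homogeneous 3 H \<and> GL2_equiv (homogenize f) (Y1 * (lift_form H + Const [:0, 1:] * Y1 ^ 3))) \<longleftrightarrow>
    degree f = 4 \<and> cubic_form f"
proof -
  interpret C: comm_ring_hom "Const :: 'a poly \<Rightarrow> 'a poly binary_poly" by (rule Const_hom)
  have d: "degree (map_poly (\<lambda>c. [:c:]) h + [:[:0, 1:]:]) \<le> 3" if "degree h \<le> 3" for h :: "'a poly"
    using that by (intro degree_add_le) auto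
  have x: "Const [:0, 1 :: 'a:] * Y1 ^ 3 = gsub Const 3 [:[:0, 1:]:] Y0 Y1" by (simp add: gsub_def numeral_eq_Suc)
  have e: "Y1 * (lift_form (gsub Const 3 h Y0 Y1) + Const [:0, 1:] * Y1 ^ 3) = gsub Const (Suc 3) (map_poly (\<lambda>c. [:c:]) h + [:[:0, 1:]:]) Y0 Y1"
    if "degree h \<le> 3" for h :: "'a poly"
    unfolding lift_form_gsub x C.gsub_add[symmetric] C.gsub_Suc[OF d[OF that]] ..
  have "(\<exists>H :: 'a binary_poly. homogeneous 3 H \<and> GL2_equiv (homogenize f) (Y1 * (lift_form H + Const [:0, 1:] * Y1 ^ 3))) \<longleftrightarrow>
    (\<exists>h :: 'a poly. degree h \<le> 3 \<and> GL2_equiv (homogenize f) (gsub Const (Suc 3) (map_poly (\<lambda>c. [:c:]) h + [:[:0, 1:]:]) Y0 Y1))"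
    by (rule ex_homogeneous_iff[where P = "GL2_equiv (homogenize f)" and T = "\<lambda>H. Y1 * (lift_form H + Const [:0, 1:] * Y1 ^ 3)"]) (rule e)
  also have "\<dots> \<longleftrightarrow> (\<exists>h :: 'a poly. degree h \<le> 3 \<and> (\<exists>p q. basis p q \<and> f = q * hsub 3 (map_poly (\<lambda>c. [:c:]) h + [:[:0, 1:]:]) p q \<and> degree f = Suc 3))"
    unfolding GL2_equiv_homogenize_iff[OF f] by (intro ex_cong1 conj_cong refl) (simp only: hsub_Suc[OF d])
  finally show ?thesis unfolding cubic_form_def by auto
qed

lemma parabolic_form_iff:
  fixes f :: "'a::field poly poly"
  assumes f: "f \<noteq> 0" and r: "r \<le> 1"
  shows "(\<exists>H :: 'a binary_poly. is_form H \<and> GL2_equiv (homogenize f) (Y1 ^ r * subst2 (lift_form H) (Y0\<^sup>2 + Const [:0, 1:] * Y1\<^sup>2) (Y1\<^sup>2))) \<longleftrightarrow>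
    (\<exists>n. degree f = 2 * n + r \<and> parabolic_form r n f)"
proof -
  interpret C: comm_ring_hom "Const :: 'a poly \<Rightarrow> 'a poly binary_poly" by (rule Const_hom)
  have P: "Y0\<^sup>2 + Const [:0, 1:] * Y1\<^sup>2 = gsub Const 2 (parabola :: 'a poly poly) Y0 Y1"
    by (simp add: gsub_def numeral_2_eq_2 add.commute)
  have d: "degree (pcompose (map_poly (\<lambda>c. [:c:]) h) parabola) \<le> 2 * n" if "degree h \<le> n" for h :: "'a poly" and n
    using that by (simp add: degree_pcompose)
  have e: "Y1 ^ r * subst2 (lift_form (gsub Const n h Y0 Y1)) (Y0\<^sup>2 + Const [:0, 1:] * Y1\<^sup>2) (Y1\<^sup>2) =
      gsub Const (2 * n + r) (pcompose (map_poly (\<lambda>c. [:c:]) h) parabola) Y0 Y1" if h: "degree h \<le> n" for h :: "'a poly" and n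
  proof -
    have "subst2 (lift_form (gsub Const n h Y0 Y1)) (Y0\<^sup>2 + Const [:0, 1:] * Y1\<^sup>2) (Y1\<^sup>2) =
      gsub Const (2 * n) (pcompose (map_poly (\<lambda>c. [:c:]) h) parabola) Y0 Y1"
      unfolding lift_form_gsub subst2_gsub P by (rule C.gsub_pcompose[symmetric]) (use h in simp_all)
    thus ?thesis using C.gsub_add_exp[OF d[OF h], of r Y0 Y1] by (simp add: add.commute)
  qed
  have h': "hsub (2 * n + r) (pcompose (map_poly (\<lambda>c. [:c:]) h) parabola) p q =
      q ^ r * hsub (2 * n) (pcompose (map_poly (\<lambda>c. [:c:]) h) parabola) p q" if "degree h \<le> n" for h :: "'a poly" and n p q
    using hsub_Suc[OF d[OF that]] r by (cases r) auto
  have "(\<exists>H :: 'a binary_poly. is_form H \<and> GL2_equiv (homogenize f) (Y1 ^ r * subst2 (lift_form H) (Y0\<^sup>2 + Const [:0, 1:] * Y1\<^sup>2) (Y1\<^sup>2))) \<longleftrightarrow>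
    (\<exists>n. \<exists>h :: 'a poly. degree h \<le> n \<and> GL2_equiv (homogenize f) (gsub Const (2 * n + r) (pcompose (map_poly (\<lambda>c. [:c:]) h) parabola) Y0 Y1))"
    by (rule ex_form_iff[where P = "GL2_equiv (homogenize f)" and
          T = "\<lambda>H. Y1 ^ r * subst2 (lift_form H) (Y0\<^sup>2 + Const [:0, 1:] * Y1\<^sup>2) (Y1\<^sup>2)"]) (rule e)
  also have "\<dots> \<longleftrightarrow> (\<exists>n. \<exists>h :: 'a poly. degree h \<le> n \<and> (\<exists>p q. basis p q \<and>
      f = q ^ r * hsub (2 * n) (pcompose (map_poly (\<lambda>c. [:c:]) h) parabola) p q \<and> degree f = 2 * n + r))"
    unfolding GL2_equiv_homogenize_iff[OF f] by (intro ex_cong1 conj_cong refl) (simp only: h')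
  finally show ?thesis unfolding parabolic_form_def by blast
qed

section \<open>The degree of the discriminant\<close>

text \<open>
  The theorem for polynomials of positive degree, in terms of normal forms.  Since \<open>2 * D \<ge> d - 1\<close>, the condition
  \<open>2 * D \<le> d\<close> says that \<open>D\<close> is the rounded-up half of \<open>d - 1\<close>.
\<close>
lemma discriminant_bound:
  fixes f :: "'a::{alg_closed_field, field_char_0} poly poly"
  assumes prim: "primitive_in_y f" and sqf: "squarefree f" and d: "degree f = d" "d > 0"
  defines "D \<equiv> int (degree (discriminant f))"
  shows "D = 0 \<longleftrightarrow> const_form d f"
    and "D \<noteq> 0 \<Longrightarrow> 2 * D \<ge> int d - 1"
    and "D \<noteq> 0 \<Longrightarrow> 2 * D \<le> int d \<longleftrightarrow> (d = 4 \<and> biquadratic_form f) \<or> (d = 4 \<and> cubic_form f) \<or>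
      (\<exists>n. d = 2 * n + 1 \<and> parabolic_form 1 n f) \<or> (\<exists>n. d = 2 * n \<and> parabolic_form 0 n f)"
proof -
  have f0: "f \<noteq> 0" using d by auto
  obtain N where sf: "sep_split N f" using sep_split_exists[OF f0 sqf] by blast
  obtain S where S: "finite S" "f = \<Prod>S" "\<And>g. g \<in> S \<Longrightarrow> prim_irr g"
    using prim_irr_factorization[OF prim sqf] d by auto
  interpret factors N S by unfold_locales (use S sf in auto)
  have Sne: "S \<noteq> {}" using S(2) d by auto
  have Df: "discdeg f = T" using discdeg_prod_eq S(2) by simp
  note cl = classification[OF Sne, folded S(2)]
  have "T \<ge> 0" using cl by auto
  hence D: "D = T" "D = discdeg f" unfolding D_def using degree_discriminant[of f] Df d by simp_all
  show c: "D = 0 \<longleftrightarrow> const_form d f"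
  proof
    assume "D = 0"
    hence "S = L" "clique L" using cl D by auto
    thus "const_form d f" using const_form_of_clique[OF Sne] S(2) d by simp
  next
    assume "const_form d f" thus "D = 0" using discdeg_const_form[OF sf d] D by simp
  qed
  show "2 * D \<ge> int d - 1" if "D \<noteq> 0" using cl D d that by auto
  assume D0: "D \<noteq> 0"
  show "2 * D \<le> int d \<longleftrightarrow> (d = 4 \<and> biquadratic_form f) \<or> (d = 4 \<and> cubic_form f) \<or>
      (\<exists>n. d = 2 * n + 1 \<and> parabolic_form 1 n f) \<or> (\<exists>n. d = 2 * n \<and> parabolic_form 0 n f)" (is "_ \<longleftrightarrow> ?R")
  proof
    assume "2 * D \<le> int d"
    hence "extremal" "T > 0" using cl D d D0 by auto
    thus ?R using extremal_normal_form S(2) d by simp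
  next
    assume ?R
    moreover have "discdeg f = int n" if n: "d = 2 * n + r" "parabolic_form r n f" "r \<le> 1" for n r
    proof -
      have "n > 0"
      proof (rule ccontr)
        assume "\<not> n > 0"
        hence "degree f = 1" using d n by auto
        thus False using discdeg_linear[of f] D D0 by simp
      qed
      thus ?thesis using discdeg_parabolic_form[OF sf _ _ n(3,2)] d n by simp
    qed
    from this[of _ 1] this[of _ 0] have "(\<exists>n. d = 2 * n + 1 \<and> parabolic_form 1 n f) \<or> (\<exists>n. d = 2 * n \<and> parabolic_form 0 n f) \<Longrightarrow> 2 * D \<le> int d"
      unfolding D(2) by auto
    ultimately show "2 * D \<le> int d"
      using discdeg_biquadratic_form[OF sf] discdeg_cubic_form[OF sf] d D(2) by auto
  qed
qed

theorem theorem1p7: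
  fixes f :: "'a::{alg_closed_field, field_char_0} poly poly"
  assumes "primitive_in_y f"
    and "squarefree f"
  defines "x \<equiv> Const [:0, 1:] :: 'a poly binary_poly"
    and "d \<equiv> degree f"
    and "F \<equiv> homogenize f"
    and "\<Delta> \<equiv> discriminant f"
  shows "(degree \<Delta> = 0 \<longleftrightarrow> (\<exists>H :: 'a binary_poly. is_form H \<and> GL2_equiv F (lift_form H))) \<and>
    (degree \<Delta> \<noteq> 0 \<longrightarrow>
       int (degree \<Delta>) \<ge> \<lceil>(real d - 1) / 2\<rceil> \<and>
       (int (degree \<Delta>) = \<lceil>(real d - 1) / 2\<rceil> \<longleftrightarrow>
          (d = 4 \<and>
             (\<exists>\<mu> \<nu> :: 'a. \<mu> \<noteq> 0 \<and>
                GL2_equiv F (Y0 * Y1 * (Y0\<^sup>2 + (Const [:\<mu>:] * x + Const [:\<nu>:]) * Y0 * Y1 + Y1\<^sup>2)))) \<or>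
          (d = 4 \<and>
             (\<exists>H :: 'a binary_poly. homogeneous 3 H \<and>
                GL2_equiv F (Y1 * (lift_form H + x * Y1 ^ 3)))) \<or>
          (odd d \<and>
             (\<exists>H :: 'a binary_poly. is_form H \<and>
                GL2_equiv F (Y1 * subst2 (lift_form H) (Y0\<^sup>2 + x * Y1\<^sup>2) (Y1\<^sup>2)))) \<or>
          (even d \<and>
             (\<exists>H :: 'a binary_poly. is_form H \<and>
                GL2_equiv F (subst2 (lift_form H) (Y0\<^sup>2 + x * Y1\<^sup>2) (Y1\<^sup>2))))))"
proof -
  have f0: "f \<noteq> 0"
  proof
    assume "f = 0"
    hence "degree [:0, 1 :: 'a:] = 0" using assms(1) unfolding primitive_in_y_def by blast
    thus False by simp
  qed
  have zero: "degree \<Delta> = 0 \<longleftrightarrow> (\<exists>H :: 'a binary_poly. is_form H \<and> GL2_equiv F (lift_form H))"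
  proof (cases "d = 0")
    case True
    then obtain c where c: "f = [:c:]" unfolding d_def by (elim degree_eq_zeroE)
    hence "degree c = 0" using assms(1) unfolding primitive_in_y_def by (metis dvd_refl)
    then obtain k where k: "c = [:k:]" by (elim degree_eq_zeroE)
    have "f = hsub 0 (map_poly (\<lambda>c. [:c:]) [:k:]) [:0, 1:] [:1:]" by (simp add: c k hsub_altdef)
    hence "const_form (degree f) f" unfolding const_form_def using True basis_std d_def
      by (intro exI[of _ "[:0, 1:]"] exI[of _ "[:1:]"] exI[of _ "[:k:]"]) simp
    moreover have "degree \<Delta> = 0" using True by (simp add: \<Delta>_def discriminant_def d_def)
    ultimately show ?thesis using const_form_iff[OF f0] by (simp add: F_def)
  next
    case False
    thus ?thesis using discriminant_bound(1)[OF assms(1,2) refl] const_form_iff[OF f0] by (simp add: F_def d_def \<Delta>_def)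
  qed
  define T where "T = int (degree \<Delta>)"
  have forms: "(\<exists>\<mu> \<nu> :: 'a. \<mu> \<noteq> 0 \<and> GL2_equiv F (Y0 * Y1 * (Y0\<^sup>2 + (Const [:\<mu>:] * x + Const [:\<nu>:]) * Y0 * Y1 + Y1\<^sup>2)))
      \<longleftrightarrow> d = 4 \<and> biquadratic_form f"
    "(\<exists>H :: 'a binary_poly. homogeneous 3 H \<and> GL2_equiv F (Y1 * (lift_form H + x * Y1 ^ 3))) \<longleftrightarrow> d = 4 \<and> cubic_form f"
    "(\<exists>H :: 'a binary_poly. is_form H \<and> GL2_equiv F (Y1 * subst2 (lift_form H) (Y0\<^sup>2 + x * Y1\<^sup>2) (Y1\<^sup>2)))
      \<longleftrightarrow> (\<exists>n. d = 2 * n + 1 \<and> parabolic_form 1 n f)"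
    "(\<exists>H :: 'a binary_poly. is_form H \<and> GL2_equiv F (subst2 (lift_form H) (Y0\<^sup>2 + x * Y1\<^sup>2) (Y1\<^sup>2)))
      \<longleftrightarrow> (\<exists>n. d = 2 * n \<and> parabolic_form 0 n f)"
    unfolding F_def x_def d_def
    using biquadratic_form_iff[OF f0] cubic_form_iff[OF f0] parabolic_form_iff[OF f0, of 1] parabolic_form_iff[OF f0, of 0]
    by simp_all
  have ceil: "\<lceil>(real d - 1) / 2\<rceil> = (int d) div 2" 
  proof -
    define k where "k = d div 2"
    have "2 * k \<le> d" "d \<le> 2 * k + 1" by (auto simp: k_def)
    hence "2 * real k \<le> real d" "real d \<le> 2 * real k + 1" by linarith+
    hence "\<lceil>(real d - 1) / 2\<rceil> = int k" by (intro ceiling_unique) (simp_all add: field_simps)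
    thus ?thesis by (simp add: k_def zdiv_int)
  qed
  have "\<lceil>(real d - 1) / 2\<rceil> \<le> T \<and> (T = \<lceil>(real d - 1) / 2\<rceil> \<longleftrightarrow>
      (d = 4 \<and> biquadratic_form f) \<or> (d = 4 \<and> cubic_form f) \<or>
      (\<exists>n. d = 2 * n + 1 \<and> parabolic_form 1 n f) \<or> (\<exists>n. d = 2 * n \<and> parabolic_form 0 n f))" if "degree \<Delta> \<noteq> 0"
  proof -
    have d0: "degree f > 0" using that by (cases "degree f = 0") (auto simp: \<Delta>_def discriminant_def)
    have T0: "T \<noteq> 0" using that by (simp add: T_def)
    note B = discriminant_bound[OF assms(1,2) refl d0, folded \<Delta>_def d_def, folded T_def]
    have "T \<ge> int d div 2" using B(2)[OF T0] by linarith
    moreover have "T = int d div 2 \<longleftrightarrow> 2 * T \<le> int d" using B(2)[OF T0] by linarith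
    ultimately show ?thesis unfolding ceil B(3)[OF T0, symmetric] by blast
  qed
  thus ?thesis unfolding zero forms T_def[symmetric] by auto
qed

end
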